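(* Let $R$ be a commutative noetherian ring, $\mathfrak{a}$ an ideal of $R$, and $K$ the Koszul complex on a finite sequence of $n$ generators of $\mathfrak{a}$. For every complex $M$ of $R$-modules (no boundedness or finiteness conditions), the following three elements of $\mathbb{Z}\cup\{\pm\infty\}$ are equal: (1) $n-\sup\{\ell\in\mathbb{Z}\mid \mathrm{H}_\ell(K\otimes_R M)\neq 0\}$; (2) $\inf\{\ell\in\mathbb{Z}\mid \operatorname{Ext}^\ell_R(R/\mathfrak{a},M)\neq 0\}$; (3) $\inf\{\ell\in\mathbb{Z}\mid \mathrm{H}^\ell_{\mathfrak{a}}(M)\neq 0\}$.
   Context: Complexes are graded homologically, $\cdots\to M_{\ell+1}\to M_\ell\to M_{\ell-1}\to\cdots$, and may be unbounded in both directions. Conventions: $\sup\emptyset=-\infty$, $\inf\emptyset=\infty$. For $x\in R$, $K(x)$ is the complex $0\to R\xrightarrow{x}R\to 0$ in degrees $1,0$; the Koszul complex on $x_1,\dots,x_n$ is $K(x_1)\otimes_R\cdots\otimes_R K(x_n)$. $\operatorname{Ext}^\ell_R(X,M)=\mathrm{H}_{-\ell}(\mathbf{R}\mathrm{Hom}_R(X,M))$, where $\mathbf{R}\mathrm{Hom}$ is the derived functor on the unbounded derived category of $R$-modules (computed with K-projective or K-injective resolutions). $\Gamma_{\mathfrak a}(M)=\{m\in M\mid \mathfrak a^n m=0\text{ for some }n\}$ for a module $M$, extended degreewise to complexes; $\mathbf{R}\Gamma_{\mathfrak a}$ is its right derived functor, i.e. $\mathbf{R}\Gamma_{\mathfrak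 a}(M)=\Gamma_{\mathfrak a}(I)$ for a K-injective resolution $I$ of $M$ by injective modules, and $\mathrm{H}^\ell_{\mathfrak a}(M)=\mathrm{H}_{-\ell}(\mathbf{R}\Gamma_{\mathfrak a}(M))$ is local cohomology. *)

theory Defs
  imports "HOL-Library.Extended_Real" "HOL-Algebra.Ring_Divisibility" "HOL-Algebra.Ideal_Product"
begin

text \<open>
  A \<open>module\<close> record extends a \<open>ring\<close> record, but the locale \<^locale>\<open>module\<close> ignores its
  multiplicative fields \<open>mult\<close> and \<open>one\<close>.  They are left unspecified here.
\<close>

definition mk_module ::
  "'m set \<Rightarrow> 'm \<Rightarrow> ('m \<Rightarrow> 'm \<Rightarrow> 'm) \<Rightarrow> ('r \<Rightarrow> 'm \<Rightarrow> 'm) \<Rightarrow> ('r, 'm) module" where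
  "mk_module A z p s =
    \<lparr>carrier = A, mult = undefined, one = undefined, zero = z, add = p, smult = s\<rparr>"

definition module_hom :: "'r ring \<Rightarrow> ('r, 'a) module \<Rightarrow> ('r, 'b) module \<Rightarrow> ('a \<Rightarrow> 'b) set" where
  "module_hom R M N = {f \<in> carrier M \<rightarrow> carrier N.
     (\<forall>x\<in>carrier M. \<forall>y\<in>carrier M. f (x \<oplus>\<^bsub>M\<^esub> y) = f x \<oplus>\<^bsub>N\<^esub> f y) \<and>
     (\<forall>r\<in>carrier R. \<forall>x\<in>carrier M. f (r \<odot>\<^bsub>M\<^esub> x) = r \<odot>\<^bsub>N\<^esub> f x)}"

definition nonzero_module :: "('r, 'm) module \<Rightarrow> bool" where
  "nonzero_module M \<longleftrightarrow> carrier M \<noteq> {\<zero>\<^bsub>M\<^esub>}"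

definition zero_submodule :: "('r, 'm) module \<Rightarrow> ('r, 'm) module" where
  "zero_submodule M = M\<lparr>carrier := {\<zero>\<^bsub>M\<^esub>}\<rparr>"

definition regular_module :: "'r ring \<Rightarrow> ('r, 'r) module" where
  "regular_module R = mk_module (carrier R) \<zero>\<^bsub>R\<^esub> (add R) (mult R)"

definition quot_module :: "('r, 'm) module \<Rightarrow> 'm set \<Rightarrow> ('r, 'm set) module" where
  "quot_module M N =
    mk_module (a_rcosets\<^bsub>M\<^esub> N) N (set_add M) (\<lambda>r X. \<Union>x\<in>X. N +>\<^bsub>M\<^esub> (r \<odot>\<^bsub>M\<^esub> x))"

definition submodule_span :: "'r ring \<Rightarrow> ('r, 'm) module \<Rightarrow> 'm set \<Rightarrow> 'm set" where
  "submodule_span R M S = \<Inter>{N. submodule N R M \<and> S \<subseteq> N}"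

definition prod_module :: "(int \<Rightarrow> ('r, 'm) module) \<Rightarrow> ('r, int \<Rightarrow> 'm) module" where
  "prod_module F = mk_module {z. \<forall>i. z i \<in> carrier (F i)} (\<lambda>i. \<zero>\<^bsub>F i\<^esub>)
     (\<lambda>y z i. y i \<oplus>\<^bsub>F i\<^esub> z i) (\<lambda>r z i. r \<odot>\<^bsub>F i\<^esub> z i)"

definition direct_sum_module :: "(int \<Rightarrow> ('r, 'm) module) \<Rightarrow> ('r, int \<Rightarrow> 'm) module" where
  "direct_sum_module F = (prod_module F)
     \<lparr>carrier := {z. (\<forall>i. z i \<in> carrier (F i)) \<and> finite {i. z i \<noteq> \<zero>\<^bsub>F i\<^esub>}}\<rparr>"

text \<open>Homomorphisms are made extensional, so that equal maps are equal elements.\<close>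

definition hom_module :: "'r ring \<Rightarrow> ('r, 'a) module \<Rightarrow> ('r, 'b) module \<Rightarrow> ('r, 'a \<Rightarrow> 'b) module" where
  "hom_module R M N = mk_module (module_hom R M N \<inter> extensional (carrier M))
     (\<lambda>x\<in>carrier M. \<zero>\<^bsub>N\<^esub>)
     (\<lambda>f g. \<lambda>x\<in>carrier M. f x \<oplus>\<^bsub>N\<^esub> g x)
     (\<lambda>r f. \<lambda>x\<in>carrier M. r \<odot>\<^bsub>N\<^esub> f x)"

definition free_module :: "'r ring \<Rightarrow> 'a set \<Rightarrow> ('r, 'a \<Rightarrow> 'r) module" where
  "free_module R S = mk_module
     {u. (\<forall>a. u a \<in> carrier R) \<and> (\<forall>a. a \<notin> S \<longrightarrow> u a = \<zero>\<^bsub>R\<^esub>) \<and> finite {a. u a \<noteq> \<zero>\<^bsub>R\<^esub>}}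
     (\<lambda>a. \<zero>\<^bsub>R\<^esub>) (\<lambda>u v a. u a \<oplus>\<^bsub>R\<^esub> v a) (\<lambda>r u a. r \<otimes>\<^bsub>R\<^esub> u a)"

definition free_gen :: "'r ring \<Rightarrow> 'a \<Rightarrow> 'a \<Rightarrow> 'r" where
  "free_gen R a = (\<lambda>b. if b = a then \<one>\<^bsub>R\<^esub> else \<zero>\<^bsub>R\<^esub>)"

definition tensor_rels :: "'r ring \<Rightarrow> ('r, 'a) module \<Rightarrow> ('r, 'b) module \<Rightarrow> ('a \<times> 'b \<Rightarrow> 'r) set" where
  "tensor_rels R M N =
    (let F = free_module R (carrier M \<times> carrier N); e = free_gen R in
      {e (m \<oplus>\<^bsub>M\<^esub> m', n) \<ominus>\<^bsub>F\<^esub> (e (m, n) \<oplus>\<^bsub>F\<^esub> e (m', n)) | m m' n.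
          m \<in> carrier M \<and> m' \<in> carrier M \<and> n \<in> carrier N} \<union>
      {e (m, n \<oplus>\<^bsub>N\<^esub> n') \<ominus>\<^bsub>F\<^esub> (e (m, n) \<oplus>\<^bsub>F\<^esub> e (m, n')) | m n n'.
          m \<in> carrier M \<and> n \<in> carrier N \<and> n' \<in> carrier N} \<union>
      {e (r \<odot>\<^bsub>M\<^esub> m, n) \<ominus>\<^bsub>F\<^esub> r \<odot>\<^bsub>F\<^esub> e (m, n) | r m n.
          r \<in> carrier R \<and> m \<in> carrier M \<and> n \<in> carrier N} \<union>
      {e (m, r \<odot>\<^bsub>N\<^esub> n) \<ominus>\<^bsub>F\<^esub> r \<odot>\<^bsub>F\<^esub> e (m, n) | r m n.
          r \<in> carrier R \<and> m \<in> carrier M \<and> n \<in> carrier N})"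

definition tensor_kernel :: "'r ring \<Rightarrow> ('r, 'a) module \<Rightarrow> ('r, 'b) module \<Rightarrow> ('a \<times> 'b \<Rightarrow> 'r) set" where
  "tensor_kernel R M N =
    submodule_span R (free_module R (carrier M \<times> carrier N)) (tensor_rels R M N)"

definition tensor_module ::
  "'r ring \<Rightarrow> ('r, 'a) module \<Rightarrow> ('r, 'b) module \<Rightarrow> ('r, ('a \<times> 'b \<Rightarrow> 'r) set) module" where
  "tensor_module R M N =
    quot_module (free_module R (carrier M \<times> carrier N)) (tensor_kernel R M N)"

definition pure_tensor ::
  "'r ring \<Rightarrow> ('r, 'a) module \<Rightarrow> ('r, 'b) module \<Rightarrow> 'a \<Rightarrow> 'b \<Rightarrow> ('a \<times> 'b \<Rightarrow> 'r) set" where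
  "pure_tensor R M N m n =
    tensor_kernel R M N +>\<^bsub>free_module R (carrier M \<times> carrier N)\<^esub> free_gen R (m, n)"

definition tensor_map ::
  "'r ring \<Rightarrow> ('r, 'a) module \<Rightarrow> ('r, 'b) module \<Rightarrow> ('r, 'c) module \<Rightarrow> ('r, 'd) module \<Rightarrow>
   ('a \<Rightarrow> 'c) \<Rightarrow> ('b \<Rightarrow> 'd) \<Rightarrow> ('a \<times> 'b \<Rightarrow> 'r) set \<Rightarrow> ('c \<times> 'd \<Rightarrow> 'r) set" where
  "tensor_map R M N M' N' f g =
    (THE h. h \<in> module_hom R (tensor_module R M N) (tensor_module R M' N') \<and>
       h \<in> extensional (carrier (tensor_module R M N)) \<and>
       (\<forall>m\<in>carrier M. \<forall>n\<in>carrier N.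
          h (pure_tensor R M N m n) = pure_tensor R M' N' (f m) (g n)))"

text \<open>The differential \<open>diff C l\<close> maps \<open>obj C l\<close> to \<open>obj C (l - 1)\<close>.\<close>

record ('r, 'm) chain_complex =
  obj :: "int \<Rightarrow> ('r, 'm) module"
  diff :: "int \<Rightarrow> 'm \<Rightarrow> 'm"

definition is_complex :: "'r ring \<Rightarrow> ('r, 'm) chain_complex \<Rightarrow> bool" where
  "is_complex R C \<longleftrightarrow>
    (\<forall>l. module R (obj C l)) \<and>
    (\<forall>l. diff C l \<in> module_hom R (obj C l) (obj C (l - 1))) \<and>
    (\<forall>l. \<forall>x\<in>carrier (obj C l). diff C (l - 1) (diff C l x) = \<zero>\<^bsub>obj C (l - 1 - 1)\<^esub>)"

definition cycles :: "('r, 'm) chain_complex \<Rightarrow> int \<Rightarrow> 'm set" where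
  "cycles C l = {x \<in> carrier (obj C l). diff C l x = \<zero>\<^bsub>obj C (l - 1)\<^esub>}"

definition boundaries :: "('r, 'm) chain_complex \<Rightarrow> int \<Rightarrow> 'm set" where
  "boundaries C l = diff C (l + 1) ` carrier (obj C (l + 1))"

definition homology :: "('r, 'm) chain_complex \<Rightarrow> int \<Rightarrow> ('r, 'm set) module" where
  "homology C l = quot_module ((obj C l)\<lparr>carrier := cycles C l\<rparr>) (boundaries C l)"

definition acyclic_complex :: "('r, 'm) chain_complex \<Rightarrow> bool" where
  "acyclic_complex C \<longleftrightarrow> (\<forall>l. \<not> nonzero_module (homology C l))"

definition chain_map ::
  "'r ring \<Rightarrow> ('r, 'a) chain_complex \<Rightarrow> ('r, 'b) chain_complex \<Rightarrow> (int \<Rightarrow> 'a \<Rightarrow> 'b) \<Rightarrow> bool" where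
  "chain_map R C D f \<longleftrightarrow>
    is_complex R C \<and> is_complex R D \<and>
    (\<forall>l. f l \<in> module_hom R (obj C l) (obj D l)) \<and>
    (\<forall>l. \<forall>x\<in>carrier (obj C l). diff D l (f l x) = f (l - 1) (diff C l x))"

definition isomorphic_complexes ::
  "'r ring \<Rightarrow> ('r, 'a) chain_complex \<Rightarrow> ('r, 'b) chain_complex \<Rightarrow> bool" where
  "isomorphic_complexes R C D \<longleftrightarrow>
    (\<exists>f. chain_map R C D f \<and> (\<forall>l. bij_betw (f l) (carrier (obj C l)) (carrier (obj D l))))"

definition homology_map ::
  "('r, 'b) chain_complex \<Rightarrow> (int \<Rightarrow> 'a \<Rightarrow> 'b) \<Rightarrow> int \<Rightarrow> 'a set \<Rightarrow> 'b set" where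
  "homology_map D f l X = (\<Union>x\<in>X. boundaries D l +>\<^bsub>obj D l\<^esub> f l x)"

definition quasi_isomorphism ::
  "'r ring \<Rightarrow> ('r, 'a) chain_complex \<Rightarrow> ('r, 'b) chain_complex \<Rightarrow> (int \<Rightarrow> 'a \<Rightarrow> 'b) \<Rightarrow> bool" where
  "quasi_isomorphism R C D f \<longleftrightarrow>
    chain_map R C D f \<and>
    (\<forall>l. bij_betw (homology_map D f l) (carrier (homology C l)) (carrier (homology D l)))"

definition stalk_complex :: "('r, 'm) module \<Rightarrow> ('r, 'm) chain_complex" where
  "stalk_complex N =
    \<lparr>obj = (\<lambda>l. if l = 0 then N else zero_submodule N), diff = (\<lambda>l x. \<zero>\<^bsub>N\<^esub>)\<rparr>"

definition parity_sign :: "('r, 'm) module \<Rightarrow> int \<Rightarrow> 'm \<Rightarrow> 'm" where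
  "parity_sign M i x = (if even i then x else \<ominus>\<^bsub>M\<^esub> x)"

text \<open>
  The component of index \<open>p\<close> of an element of degree \<open>l\<close> of the tensor product \<open>C \<otimes> D\<close> lies in
  \<open>C\<^sub>p \<otimes> D\<^sub>l\<^sub>-\<^sub>p\<close>, and the differential is \<open>d (c \<otimes> d') = d c \<otimes> d' + (-1)\<^sup>p c \<otimes> d d'\<close>.
\<close>

definition tensor_complex ::
  "'r ring \<Rightarrow> ('r, 'a) chain_complex \<Rightarrow> ('r, 'b) chain_complex \<Rightarrow>
   ('r, int \<Rightarrow> ('a \<times> 'b \<Rightarrow> 'r) set) chain_complex" where
  "tensor_complex R C D =
    \<lparr>obj = (\<lambda>l. direct_sum_module (\<lambda>p. tensor_module R (obj C p) (obj D (l - p)))),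
     diff = (\<lambda>l z p.
       (let T = tensor_module R (obj C p) (obj D (l - 1 - p)) in
         tensor_map R (obj C (p + 1)) (obj D (l - 1 - p)) (obj C p) (obj D (l - 1 - p))
             (diff C (p + 1)) (\<lambda>y. y) (z (p + 1))
         \<oplus>\<^bsub>T\<^esub> parity_sign T p
           (tensor_map R (obj C p) (obj D (l - p)) (obj C p) (obj D (l - 1 - p))
             (\<lambda>x. x) (diff D (l - p)) (z p))))\<rparr>"

text \<open>
  An element of degree \<open>l\<close> of the Hom complex is a family of maps \<open>f p : X\<^sub>p \<rightarrow> Y\<^sub>p\<^sub>+\<^sub>l\<close>, and its
  differential is \<open>d \<circ> f - (-1)\<^sup>l f \<circ> d\<close>.
\<close>

definition hom_complex ::
  "'r ring \<Rightarrow> ('r, 'a) chain_complex \<Rightarrow> ('r, 'b) chain_complex \<Rightarrow>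
   ('r, int \<Rightarrow> 'a \<Rightarrow> 'b) chain_complex" where
  "hom_complex R X Y =
    \<lparr>obj = (\<lambda>l. prod_module (\<lambda>p. hom_module R (obj X p) (obj Y (p + l)))),
     diff = (\<lambda>l f p. \<lambda>x\<in>carrier (obj X p).
       diff Y (p + l) (f p x)
       \<ominus>\<^bsub>obj Y (p + l - 1)\<^esub> parity_sign (obj Y (p + l - 1)) l (f (p - 1) (diff X p x)))\<rparr>"

definition koszul1 :: "'r ring \<Rightarrow> 'r \<Rightarrow> ('r, 'r) chain_complex" where
  "koszul1 R x =
    \<lparr>obj = (\<lambda>l. if l = 0 \<or> l = 1 then regular_module R else zero_submodule (regular_module R)),
     diff = (\<lambda>l r. if l = 1 then x \<otimes>\<^bsub>R\<^esub> r else \<zero>\<^bsub>R\<^esub>)\<rparr>"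

text \<open>
  \<open>is_koszul R [x\<^sub>1, \<dots>, x\<^sub>n] K\<close> states that \<open>K\<close> is isomorphic to \<open>K(x\<^sub>1) \<otimes> (\<dots> \<otimes> K(x\<^sub>n))\<close>, where the
  empty tensor product is \<open>R\<close> in degree 0.  This is a predicate and not a function because the
  element type of an iterated tensor product depends on the number of factors.
\<close>

primrec is_koszul :: "'r ring \<Rightarrow> 'r list \<Rightarrow> ('r, 'k) chain_complex \<Rightarrow> bool" where
  "is_koszul R [] K \<longleftrightarrow> isomorphic_complexes R K (stalk_complex (regular_module R))"
| "is_koszul R (x # xs) K \<longleftrightarrow>
    (\<exists>K' :: ('r, 'k) chain_complex. is_koszul R xs K' \<and>
       isomorphic_complexes R K (tensor_complex R (koszul1 R x) K'))"

text \<open>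
  A definition cannot quantify over types, so the test objects below have elements in the type
  \<open>'e + 'r list\<close>, which is at least as large as \<open>R\<close>, the natural numbers and the object tested.
  In particular it has room for all ideals of \<open>R\<close>, which suffice to test injectivity of a module
  by Baer's criterion, and for all acyclic complexes of cardinality at most
  \<open>max(\<bar>R\<bar>, \<aleph>\<^sub>0)\<close>, which suffice to test K-injectivity of a complex of injective modules,
  since every acyclic complex is a transfinite extension of such complexes (Eklof's lemma).
  In general a restriction on the test objects only makes these conditions weaker, hence a
  theorem that assumes them stronger.
\<close>

definition injective_module :: "'r ring \<Rightarrow> ('r, 'e) module \<Rightarrow> bool" where
  "injective_module R E \<longleftrightarrow> module R E \<and>
    (\<forall>(A :: ('r, 'e + 'r list) module) (B :: ('r, 'e + 'r list) module) g h.
       module R A \<and> module R B \<and> g \<in> module_hom R A B \<and> inj_on g (carrier A) \<and>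
       h \<in> module_hom R A E \<longrightarrow>
       (\<exists>k \<in> module_hom R B E. \<forall>x\<in>carrier A. k (g x) = h x))"

definition K_injective :: "'r ring \<Rightarrow> ('r, 'e) chain_complex \<Rightarrow> bool" where
  "K_injective R I \<longleftrightarrow> is_complex R I \<and>
    (\<forall>X :: ('r, 'e + 'r list) chain_complex.
       is_complex R X \<and> acyclic_complex X \<longrightarrow> acyclic_complex (hom_complex R X I))"

definition K_injective_resolution ::
  "'r ring \<Rightarrow> ('r, 'm) chain_complex \<Rightarrow> ('r, 'e) chain_complex \<Rightarrow> bool" where
  "K_injective_resolution R M I \<longleftrightarrow> K_injective R I \<and> (\<exists>f. quasi_isomorphism R M I f)"

text \<open>
  The argument \<open>I\<close> is a K-injective resolution of \<open>M\<close>, and \<open>Ext_module R l X I\<close> is then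
  \<open>Ext\<^sup>l(X, M)\<close> for a module \<open>X\<close>.
\<close>

definition Ext_module ::
  "'r ring \<Rightarrow> int \<Rightarrow> ('r, 'x) module \<Rightarrow> ('r, 'e) chain_complex \<Rightarrow> ('r, (int \<Rightarrow> 'x \<Rightarrow> 'e) set) module" where
  "Ext_module R l X I = homology (hom_complex R (stalk_complex X) I) (- l)"

definition torsion_submodule :: "'r ring \<Rightarrow> 'r set \<Rightarrow> ('r, 'm) module \<Rightarrow> ('r, 'm) module" where
  "torsion_submodule R \<aa> M = M\<lparr>carrier :=
    {m \<in> carrier M. \<exists>n::nat. \<forall>r \<in> \<aa> [^]\<^bsub>ideals_set R\<^esub> n. r \<odot>\<^bsub>M\<^esub> m = \<zero>\<^bsub>M\<^esub>}\<rparr>"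

definition torsion_complex :: "'r ring \<Rightarrow> 'r set \<Rightarrow> ('r, 'm) chain_complex \<Rightarrow> ('r, 'm) chain_complex" where
  "torsion_complex R \<aa> C = C\<lparr>obj := (\<lambda>l. torsion_submodule R \<aa> (obj C l))\<rparr>"

text \<open>
  The argument \<open>J\<close> is a K-injective resolution of \<open>M\<close> by injective modules, and
  \<open>local_cohomology R \<aa> l J\<close> is then \<open>H\<^sup>l\<^sub>\<aa>(M)\<close>.
\<close>

definition local_cohomology ::
  "'r ring \<Rightarrow> 'r set \<Rightarrow> int \<Rightarrow> ('r, 'e) chain_complex \<Rightarrow> ('r, 'e set) module" where
  "local_cohomology R \<aa> l J = homology (torsion_complex R \<aa> J) (- l)"

end

theory Submission
  imports Defs
begin

text \<open>
  It suffices to show for every \<open>t\<close> that \<open>K \<otimes> M\<close> is exact above \<open>t +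
      n\<close> iff \<open>Ext\<^sup>-\<^sup>l(R/\<aa>, M) = 0\<close> for all \<open>l > t\<close>
  iff \<open>H\<^sup>-\<^sup>l\<^sub>\<aa>(M) = 0\<close> for all \<open>l > t\<close>.  The resolutions
      \<open>I\<close> and \<open>J\<close> are compared only through \<open>K \<otimes> M\<close>, which is
  an iterated cone \<open>K(x\<^sub>1) \<otimes> (\<dots> \<otimes> (K(x\<^sub>n) \<otimes> M))\<close>: cones
      preserve quasi-isomorphisms, so \<open>M\<close> may be replaced
  by \<open>I\<close> or \<open>J\<close>.

  Local cohomology: on a complex with \<open>x\<close>-torsion terms the cone of \<open>x\<close> shifts the
      supremum by one, so
  \<open>sup (K \<otimes> \<Gamma>(J)) = n + sup \<Gamma>(J)\<close>.  For an injective module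
      \<open>E\<close>, multiplication by \<open>x\<^sub>i\<close> is bijective on the
  quotient of the \<open>(x\<^sub>1, \<dots>, x\<^sub>i\<^sub>-\<^sub>1)\<close>-torsion of \<open>E\<close> by
      its \<open>(x\<^sub>1, \<dots>, x\<^sub>i)\<close>-torsion, and a complex on which \<open>x\<^sub>i\<close>
  is bijective has an acyclic cone.  Hence \<open>K \<otimes> \<Gamma>(J) \<rightarrow> K \<otimes> J\<close>
      is a quasi-isomorphism.

  Ext: if a K-injective complex \<open>I\<close>, or its subcomplex of elements killed by \<open>\<aa>\<close>,
      is exact above \<open>t\<close>, then
  the truncation above \<open>t\<close> is an acyclic test complex, so its inclusion into \<open>I\<close> is
      null-homotopic.  This
  splits the differential linearly, and \<open>Hom(N, I)\<close> is exact above \<open>t\<close> for all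
      modules \<open>N\<close>, respectively all
  \<open>N\<close> killed by \<open>\<aa>\<close>.  Testing K-injectivity on the exact sequence
  \<open>0 \<rightarrow> (0 : x) \<rightarrow> N \<rightarrow> N \<rightarrow> N/xN \<rightarrow> 0\<close>,
      given by multiplication by \<open>x\<close>, passes from \<open>I\<close> and the modules
  killed by \<open>x, y\<^sub>1, \<dots>, y\<^sub>m\<close> to the cone of \<open>x\<close> on \<open>I\<close>
      and the modules killed by \<open>y\<^sub>1, \<dots>, y\<^sub>m\<close>.  After all
  the \<open>x\<^sub>i\<close> one reaches \<open>N = R\<close> and \<open>K \<otimes> I\<close>.
\<close>

section \<open>Modules and complexes\<close>

text \<open>K-injectivity is tested on complexes with elements in one fixed type, so arbitrary test
  objects are not at hand. The test complexes that are used are cut out of the data: truncations of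
  \<open>I\<close> and of its iterated cones, and a four-term sequence of subquotients of
  \<open>R\<close>. Each of them has to be embedded in the test type. For the same reason the
  modules N of the Ext argument are the quotients \<open>A/B\<close> of ideals
  \<open>B <= A\<close>. This class contains \<open>R/\<aa>\<close> and \<open>R\<close>, is closed
  under passing to (0 : x) and to N/xN, and its members are no larger than \<open>R\<close>. The
  closure matters because the passage to the cone of \<open>x\<close> uses both ends of the
  four-term sequence, so \<open>R/\<aa>\<close> alone would not carry the induction.

  Multiplication by \<open>x\<close> on an injective module is surjective only up to elements killed
  by a power of \<open>x\<close>; the noetherian hypothesis enters here, since the annihilators of
  the multiples of an element by powers of \<open>x\<close> have to stabilise. This is why torsion
  is divided out one generator at a time.

  Comparing the three quantities through all integer bounds \<open>t\<close> treats infinite values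
  like finite ones.\<close>

lemma mk_module_sel [simp]:
  "carrier (mk_module A z p s) = A" "zero (mk_module A z p s) = z"
  "add (mk_module A z p s) = p" "smult (mk_module A z p s) = s"
  by (simp_all add: mk_module_def)

lemma (in abelian_group) neg_zero [simp]: "\<ominus> \<zero> = \<zero>"
  by (rule minus_equality) auto

lemma module_homI:
  assumes "\<And>x. x \<in> carrier M \<Longrightarrow> f x \<in> carrier N"
    and "\<And>x y. x \<in> carrier M \<Longrightarrow> y \<in> carrier M \<Longrightarrow> f (x
        \<oplus>\<^bsub>M\<^esub> y) = f x \<oplus>\<^bsub>N\<^esub> f y"
    and "\<And>r x. r \<in> carrier R \<Longrightarrow> x \<in> carrier M \<Longrightarrow> f (r
        \<odot>\<^bsub>M\<^esub> x) = r \<odot>\<^bsub>N\<^esub> f x"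
  shows "f \<in> module_hom R M N"
  using assms by (auto simp: module_hom_def)

lemma module_homD:
  assumes "f \<in> module_hom R M N"
  shows "\<And>x. x \<in> carrier M \<Longrightarrow> f x \<in> carrier N"
    and "\<And>x y. x \<in> carrier M \<Longrightarrow> y \<in> carrier M \<Longrightarrow> f (x
        \<oplus>\<^bsub>M\<^esub> y) = f x \<oplus>\<^bsub>N\<^esub> f y"
    and "\<And>r x. r \<in> carrier R \<Longrightarrow> x \<in> carrier M \<Longrightarrow> f (r
        \<odot>\<^bsub>M\<^esub> x) = r \<odot>\<^bsub>N\<^esub> f x"
  using assms by (auto simp: module_hom_def)

lemma module_hom_zero:
  assumes "module R M" "module R N" "f \<in> module_hom R M N"
  shows "f \<zero>\<^bsub>M\<^esub> = \<zero>\<^bsub>N\<^esub>"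
proof -
  interpret M: module R M by fact
  interpret N: module R N by fact
  have "f (\<zero>\<^bsub>R\<^esub> \<odot>\<^bsub>M\<^esub> \<zero>\<^bsub>M\<^esub>) =
      \<zero>\<^bsub>R\<^esub> \<odot>\<^bsub>N\<^esub> f \<zero>\<^bsub>M\<^esub>"
    by (rule module_homD(3)[OF assms(3)]) auto
  then show ?thesis using module_homD(1)[OF assms(3)] by simp
qed

lemma module_hom_neg:
  assumes "module R M" "module R N" "f \<in> module_hom R M N" "x \<in> carrier M"
  shows "f (\<ominus>\<^bsub>M\<^esub> x) = \<ominus>\<^bsub>N\<^esub> f x"
proof -
  interpret M: module R M by fact
  interpret N: module R N by fact
  have "f (\<ominus>\<^bsub>M\<^esub> x) \<oplus>\<^bsub>N\<^esub> f x = f (\<ominus>\<^bsub>M\<^esub> x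
      \<oplus>\<^bsub>M\<^esub> x)"
    using assms by (simp add: module_homD(2)[OF assms(3)])
  also have "\<dots> = \<zero>\<^bsub>N\<^esub>" using assms by (simp add: M.M.l_neg module_hom_zero)
  finally show ?thesis
    using N.M.minus_equality assms module_homD(1)[OF assms(3)] by fastforce
qed

lemma module_hom_comp:
  assumes "f \<in> module_hom R M N" "g \<in> module_hom R N P"
  shows "(\<lambda>x. g (f x)) \<in> module_hom R M P"
  using assms by (auto simp: module_hom_def Pi_iff)

lemma module_hom_add:
  assumes "module R M" and "f \<in> module_hom R N M" "g \<in> module_hom R N M"
  shows "(\<lambda>x. f x \<oplus>\<^bsub>M\<^esub> g x) \<in> module_hom R N M"
proof -
  interpret module R M by fact
  show ?thesis
    by (rule module_homI)
      (simp_all add: module_homD[OF assms(2)] module_homD[OF assms(3)] smult_r_distr M.a_ac)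
qed

lemma module_hom_smult:
  assumes "module R M" and "f \<in> module_hom R N M" "r \<in> carrier R"
  shows "(\<lambda>x. r \<odot>\<^bsub>M\<^esub> f x) \<in> module_hom R N M"
proof -
  interpret module R M by fact
  show ?thesis
    by (rule module_homI)
      (simp_all add: module_homD[OF assms(2)] smult_r_distr assms(3) smult_assoc1[symmetric] R.m_comm)
qed

lemma module_hom_uminus:
  assumes "module R M" and "f \<in> module_hom R N M"
  shows "(\<lambda>x. \<ominus>\<^bsub>M\<^esub> f x) \<in> module_hom R N M"
proof -
  interpret module R M by fact
  show ?thesis
    by (rule module_homI)
      (simp_all add: module_homD[OF assms(2)] M.minus_add smult_r_minus)
qed

locale cplx =
  fixes R :: "'r ring" (structure) and C :: "('r, 'm) chain_complex"
  assumes is_complex: "is_complex R C"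
begin

lemma module_obj: "module R (obj C l)"
  using is_complex by (simp add: is_complex_def)

lemma cring: "cring R"
  by (rule module.axioms(1)[OF module_obj])

lemma diff_hom: "diff C l \<in> module_hom R (obj C l) (obj C (l - 1))"
  using is_complex by (simp add: is_complex_def)

end

sublocale cplx \<subseteq> obj: module R "obj C l" for l
  by (rule module_obj)

context cplx
begin

lemmas diff_add = module_homD(2)[OF diff_hom]
lemmas diff_smult = module_homD(3)[OF diff_hom]
lemmas diff_zero [simp] = module_hom_zero[OF module_obj module_obj diff_hom]
lemmas diff_neg = module_hom_neg[OF module_obj module_obj diff_hom]

lemma diff_closed [simp]: "x \<in> carrier (obj C l) \<Longrightarrow> diff C l x \<in> carrier (obj C (l - 1))"
  by (rule module_homD(1)[OF diff_hom])

lemma diff_closed_Suc [simp]: "x \<in> carrier (obj C (l + 1)) \<Longrightarrow> diff C (l + 1) x \<in> carrier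
    (obj C l)"
  using diff_closed[of x "l + 1"] by simp

lemma diff_closed_pred [simp]: "x \<in> carrier (obj C (l - 1)) \<Longrightarrow> diff C (l - 1) x \<in>
    carrier (obj C (l - 2))"
  using diff_closed[of x "l - 1"] by simp

lemma diff_diff [simp]: "x \<in> carrier (obj C l) \<Longrightarrow> diff C (l - 1) (diff C l x) =
    \<zero>\<^bsub>obj C (l - 1 - 1)\<^esub>"
  using is_complex by (simp add: is_complex_def)

lemma diff_diff_pred [simp]: "x \<in> carrier (obj C (l - 1)) \<Longrightarrow> diff C (l - 2) (diff C (l - 1)
    x) = \<zero>\<^bsub>obj C (l - 3)\<^esub>"
  using diff_diff[of x "l - 1"] by simp

lemma diff_diff_Suc [simp]: "x \<in> carrier (obj C (l + 1)) \<Longrightarrow> diff C l (diff C (l + 1) x) =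
    \<zero>\<^bsub>obj C (l - 1)\<^esub>"
  using diff_diff[of x "l + 1"] by simp

end

section \<open>Vanishing of homology as exactness\<close>

definition exact_at :: "('r, 'm) chain_complex \<Rightarrow> int \<Rightarrow> bool" where
  "exact_at C l \<longleftrightarrow> (\<forall>z\<in>carrier (obj C l). diff C l z = \<zero>\<^bsub>obj C (l -
      1)\<^esub> \<longrightarrow>
     (\<exists>w\<in>carrier (obj C (l + 1)). diff C (l + 1) w = z))"

lemma exact_atD:
  assumes "exact_at C l" "z \<in> carrier (obj C l)" "diff C l z = \<zero>\<^bsub>obj C (l - 1)\<^esub>"
  shows "\<exists>w\<in>carrier (obj C (l + 1)). diff C (l + 1) w = z"
  using assms by (auto simp: exact_at_def)

text \<open>The hypotheses concern two neighbouring terms, so that the lemma also covers the Hom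
  complex, of which only the linearity of the differential is established below. The class of a
  cycle is zero exactly when the cycle itself is a boundary.\<close>

lemma nonzero_homology_iff:
  assumes "module R (obj C l)" "module R (obj C (l + 1))"
    and d: "diff C (l + 1) \<in> module_hom R (obj C (l + 1)) (obj C l)"
    and z: "diff C l \<zero>\<^bsub>obj C l\<^esub> = \<zero>\<^bsub>obj C (l - 1)\<^esub>"
  shows "nonzero_module (homology C l) \<longleftrightarrow> \<not> exact_at C l"
proof -
  interpret A: module R "obj C l" by fact
  interpret B: module R "obj C (l + 1)" by fact
  let ?B = "boundaries C l" and ?M = "(obj C l)\<lparr>carrier := cycles C l\<rparr>"
  have Bsub: "?B \<subseteq> carrier (obj C l)"
    using module_homD(1)[OF d] by (auto simp: boundaries_def)
  have zB: "\<zero>\<^bsub>obj C l\<^esub> \<in> ?B"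
    using module_hom_zero[OF assms(2,1) d] B.M.zero_closed unfolding boundaries_def by (metis image_eqI)
  have zC: "\<zero>\<^bsub>obj C l\<^esub> \<in> cycles C l" using z by (simp add: cycles_def)
  have addB: "x \<oplus>\<^bsub>obj C l\<^esub> y \<in> ?B" if "x \<in> ?B" "y \<in> ?B" for x y
    using that module_homD(2)[OF d] unfolding boundaries_def by (auto simp flip: module_homD(2)[OF d])
  have negB: "\<ominus>\<^bsub>obj C l\<^esub> x \<in> ?B" if "x \<in> ?B" for x
    using that unfolding boundaries_def
    by (auto simp flip: module_hom_neg[OF assms(2,1) d])
  have coset: "?B +>\<^bsub>?M\<^esub> x = (\<lambda>b. b \<oplus>\<^bsub>obj C l\<^esub> x) ` ?B" for x
    by (auto simp: a_r_coset_def r_coset_def)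
  have triv: "?B +>\<^bsub>?M\<^esub> x = ?B" if x: "x \<in> ?B" for x
  proof -
    have "y \<in> (\<lambda>b. b \<oplus>\<^bsub>obj C l\<^esub> x) ` ?B" if y: "y \<in> ?B" for y
    proof (rule image_eqI[of _ _ "y \<oplus>\<^bsub>obj C l\<^esub> \<ominus>\<^bsub>obj C l\<^esub> x"])
      show "y = y \<oplus>\<^bsub>obj C l\<^esub> \<ominus>\<^bsub>obj C l\<^esub> x \<oplus>\<^bsub>obj C
          l\<^esub> x"
        using y x Bsub by (auto simp: A.M.a_assoc A.M.l_neg subset_iff)
    qed (use addB negB x y in simp)
    then show ?thesis using x addB coset by auto
  qed
  have self: "x \<in> ?B +>\<^bsub>?M\<^esub> x" if "x \<in> carrier (obj C l)" for x
    using zB that unfolding coset by (metis A.M.l_zero image_eqI)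
  have car: "carrier (homology C l) = {?B +>\<^bsub>?M\<^esub> x | x. x \<in> cycles C l}"
    by (auto simp: homology_def quot_module_def A_RCOSETS_def RCOSETS_def a_r_coset_def)
  have zero: "\<zero>\<^bsub>homology C l\<^esub> = ?B" by (simp add: homology_def quot_module_def)
  have "nonzero_module (homology C l) \<longleftrightarrow> (\<exists>x\<in>cycles C l. ?B +>\<^bsub>?M\<^esub>
      x \<noteq> ?B)"
    unfolding nonzero_module_def car zero using zC triv[OF zB] by auto
  also have "\<dots> \<longleftrightarrow> (\<exists>x\<in>cycles C l. x \<notin> ?B)"
    using triv self by (metis (no_types, lifting) cycles_def mem_Collect_eq)
  also have "\<dots> \<longleftrightarrow> \<not> exact_at C l"
    unfolding exact_at_def cycles_def boundaries_def by (auto simp: image_iff; metis)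
  finally show ?thesis .
qed

lemma (in cplx) nonzero_homology_iff: "nonzero_module (homology C l) \<longleftrightarrow> \<not> exact_at C l"
  by (rule nonzero_homology_iff[OF module_obj module_obj]) (use diff_hom[of "l + 1"] in auto)

section \<open>Quasi-isomorphisms and cones\<close>

lemma (in abelian_group) transpose_sum:
  assumes "u \<oplus> a \<oplus> b = p \<oplus> q" "u \<in> carrier G" "a \<in> carrier G" "b \<in> carrier G"
    "p \<in> carrier G" "q \<in> carrier G"
  shows "u = (p \<oplus> \<ominus> b) \<oplus> (q \<oplus> \<ominus> a)"
proof -
  have "u \<oplus> (a \<oplus> b) = p \<oplus> q" using assms by (simp add: a_assoc)
  then have "u = (p \<oplus> q) \<oplus> \<ominus> (a \<oplus> b)" using assms by (simp add: add.inv_solve_right)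
  then show ?thesis using assms by (simp add: minus_add a_ac)
qed

lemma (in abelian_group) eq_neg_of_sum_zero:
  assumes "a \<oplus> b = \<zero>" "a \<in> carrier G" "b \<in> carrier G"
  shows "a = \<ominus> b" "b = \<ominus> a"
  using assms minus_equality a_comm by metis+

text \<open>Bijectivity on homology in terms of representatives: the second clause is injectivity,
  the third is surjectivity. In this form diagram chases do not pass through cosets.\<close>

definition qis ::
  "'r ring \<Rightarrow> ('r, 'a) chain_complex \<Rightarrow> ('r, 'b) chain_complex \<Rightarrow> (int
      \<Rightarrow> 'a \<Rightarrow> 'b) \<Rightarrow> bool" where
  "qis R C D f \<longleftrightarrow> chain_map R C D f \<and>
    (\<forall>l. \<forall>z\<in>cycles C l. f l z \<in> boundaries D l \<longrightarrow> z \<in> boundaries C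
        l) \<and>
    (\<forall>l. \<forall>w\<in>cycles D l. \<exists>z\<in>cycles C l. \<exists>c\<in>carrier (obj D (l + 1)).
       w = f l z \<oplus>\<^bsub>obj D l\<^esub> diff D (l + 1) c)"

lemma chain_mapD:
  assumes "chain_map R C D f"
  shows "cplx R C" "cplx R D"
    "\<And>l. f l \<in> module_hom R (obj C l) (obj D l)"
    "\<And>l x. x \<in> carrier (obj C l) \<Longrightarrow> f l x \<in> carrier (obj D l)"
    "\<And>l x y. x \<in> carrier (obj C l) \<Longrightarrow> y \<in> carrier (obj C l) \<Longrightarrow>
       f l (x \<oplus>\<^bsub>obj C l\<^esub> y) = f l x \<oplus>\<^bsub>obj D l\<^esub> f l y"
    "\<And>l r x. r \<in> carrier R \<Longrightarrow> x \<in> carrier (obj C l) \<Longrightarrow> f l (r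
        \<odot>\<^bsub>obj C l\<^esub> x) = r \<odot>\<^bsub>obj D l\<^esub> f l x"
    "\<And>l. f l \<zero>\<^bsub>obj C l\<^esub> = \<zero>\<^bsub>obj D l\<^esub>"
    "\<And>l x. x \<in> carrier (obj C l) \<Longrightarrow> f l (\<ominus>\<^bsub>obj C l\<^esub> x) =
        \<ominus>\<^bsub>obj D l\<^esub> f l x"
    "\<And>l x. x \<in> carrier (obj C l) \<Longrightarrow> diff D l (f l x) = f (l - 1) (diff C l x)"
proof -
  show C: "cplx R C" and D: "cplx R D" using assms by (simp_all add: chain_map_def cplx_def)
  show hom: "\<And>l. f l \<in> module_hom R (obj C l) (obj D l)" using assms by (simp add: chain_map_def)
  interpret C: cplx R C by fact
  interpret D: cplx R D by fact
  show "\<And>l x. x \<in> carrier (obj C l) \<Longrightarrow> f l x \<in> carrier (obj D l)"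
    "\<And>l x y. x \<in> carrier (obj C l) \<Longrightarrow> y \<in> carrier (obj C l) \<Longrightarrow>
       f l (x \<oplus>\<^bsub>obj C l\<^esub> y) = f l x \<oplus>\<^bsub>obj D l\<^esub> f l y"
    "\<And>l r x. r \<in> carrier R \<Longrightarrow> x \<in> carrier (obj C l) \<Longrightarrow> f l (r
        \<odot>\<^bsub>obj C l\<^esub> x) = r \<odot>\<^bsub>obj D l\<^esub> f l x"
    by (rule module_homD[OF hom]; assumption)+
  show "\<And>l. f l \<zero>\<^bsub>obj C l\<^esub> = \<zero>\<^bsub>obj D l\<^esub>"
    by (rule module_hom_zero[OF C.module_obj D.module_obj hom])
  show "\<And>l x. x \<in> carrier (obj C l) \<Longrightarrow> f l (\<ominus>\<^bsub>obj C l\<^esub> x) =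
      \<ominus>\<^bsub>obj D l\<^esub> f l x"
    by (rule module_hom_neg[OF C.module_obj D.module_obj hom])
  show "\<And>l x. x \<in> carrier (obj C l) \<Longrightarrow> diff D l (f l x) = f (l - 1) (diff C l x)"
    using assms by (simp add: chain_map_def)
qed

lemma qis_exact_at_iff:
  assumes "qis R C D f"
  shows "exact_at C l \<longleftrightarrow> exact_at D l"
proof -
  have f: "chain_map R C D f" using assms by (simp add: qis_def)
  interpret C: cplx R C by (rule chain_mapD[OF f])
  interpret D: cplx R D by (rule chain_mapD[OF f])
  note fD = chain_mapD(4-)[OF f]
  show ?thesis
  proof
    assume ex: "exact_at C l"
    show "exact_at D l"
      unfolding exact_at_def
    proof (intro ballI impI)
      fix w assume w: "w \<in> carrier (obj D l)" "diff D l w = \<zero>\<^bsub>obj D (l - 1)\<^esub>"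
      then obtain z c where z: "z \<in> cycles C l" and c: "c \<in> carrier (obj D (l + 1))"
        and weq: "w = f l z \<oplus>\<^bsub>obj D l\<^esub> diff D (l + 1) c"
        using assms unfolding qis_def cycles_def by blast
      obtain y where y: "y \<in> carrier (obj C (l + 1))" "diff C (l + 1) y = z"
        using ex z unfolding exact_at_def cycles_def by blast
      have "w = diff D (l + 1) (f (l + 1) y \<oplus>\<^bsub>obj D (l + 1)\<^esub> c)"
        using y c by (simp add: weq D.diff_add fD)
      then show "\<exists>v\<in>carrier (obj D (l + 1)). diff D (l + 1) v = w"
        using y c fD(1) by blast
    qed
  next
    assume ex: "exact_at D l"
    show "exact_at C l"
      unfolding exact_at_def
    proof (intro ballI impI)
      fix z assume z: "z \<in> carrier (obj C l)" "diff C l z = \<zero>\<^bsub>obj C (l - 1)\<^esub>"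
      have "f l z \<in> boundaries D l"
        using ex z fD unfolding exact_at_def boundaries_def by (simp add: image_iff) metis
      then have "z \<in> boundaries C l"
        using assms z unfolding qis_def cycles_def by blast
      then show "\<exists>v\<in>carrier (obj C (l + 1)). diff C (l + 1) v = z"
        by (auto simp: boundaries_def)
    qed
  qed
qed

section \<open>Cones of multiplication by a ring element\<close>

text \<open>
  The elements of a cone are pairs.  Trees serve as a common element type for all iterated cones.
\<close>

datatype 'm tree = Leaf (leaf_val: 'm) | Node (lft: "'m tree") (rgt: "'m tree")

text \<open>This is K(x) tensored with \<open>C\<close>: in \<open>Node u v\<close> the component
  \<open>u\<close> belongs to degree 0 of K(x) and \<open>v\<close> to degree 1. Hence
  \<open>v\<close> has degree \<open>l - 1\<close> in \<open>C\<close>, the differential of K(x)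
  contributes \<open>x v\<close> to the first component, and the Koszul sign of degree 1 negates the
  differential of \<open>v\<close>.\<close>

definition cone :: "'r ring \<Rightarrow> 'r \<Rightarrow> ('r, 'm tree) chain_complex \<Rightarrow> ('r, 'm
    tree) chain_complex" where
  "cone R x C =
    \<lparr>obj = (\<lambda>l. mk_module {Node u v | u v. u \<in> carrier (obj C l) \<and> v \<in> carrier (obj
        C (l - 1))}
       (Node \<zero>\<^bsub>obj C l\<^esub> \<zero>\<^bsub>obj C (l - 1)\<^esub>)
       (\<lambda>a b. Node (lft a \<oplus>\<^bsub>obj C l\<^esub> lft b) (rgt a \<oplus>\<^bsub>obj C (l -
           1)\<^esub> rgt b))
       (\<lambda>r a. Node (r \<odot>\<^bsub>obj C l\<^esub> lft a) (r \<odot>\<^bsub>obj C (l - 1)\<^esub> rgt a))),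
     diff = (\<lambda>l a. Node (diff C l (lft a) \<oplus>\<^bsub>obj C (l - 1)\<^esub> x \<odot>\<^bsub>obj C
         (l - 1)\<^esub> rgt a)
       (\<ominus>\<^bsub>obj C (l - 1 - 1)\<^esub> diff C (l - 1) (rgt a)))\<rparr>"

lemma cone_sel [simp]:
  "carrier (obj (cone R x C) l) =
    {Node u v | u v. u \<in> carrier (obj C l) \<and> v \<in> carrier (obj C (l - 1))}"
  "\<zero>\<^bsub>obj (cone R x C) l\<^esub> = Node \<zero>\<^bsub>obj C l\<^esub> \<zero>\<^bsub>obj C (l -
      1)\<^esub>"
  "Node u v \<oplus>\<^bsub>obj (cone R x C) l\<^esub> Node u' v' =
    Node (u \<oplus>\<^bsub>obj C l\<^esub> u') (v \<oplus>\<^bsub>obj C (l - 1)\<^esub> v')"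
  "r \<odot>\<^bsub>obj (cone R x C) l\<^esub> Node u v = Node (r \<odot>\<^bsub>obj C l\<^esub> u) (r
      \<odot>\<^bsub>obj C (l - 1)\<^esub> v)"
  "diff (cone R x C) l (Node u v) =
    Node (diff C l u \<oplus>\<^bsub>obj C (l - 1)\<^esub> x \<odot>\<^bsub>obj C (l - 1)\<^esub> v)
      (\<ominus>\<^bsub>obj C (l - 1 - 1)\<^esub> diff C (l - 1) v)"
  by (simp_all add: cone_def)

locale tree_cplx = cplx R C for R :: "'r ring" (structure) and C :: "('r, 'm tree) chain_complex"

lemma (in tree_cplx) cone_cplx:
  fixes x
  assumes x: "x \<in> carrier R"
  shows "cplx R (cone R x C)"
proof
  have mod: "module R (obj (cone R x C) l)" for l
  proof (rule moduleI)
    show "abelian_group (obj (cone R x C) l)"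
    proof (rule abelian_groupI)
      fix a assume "a \<in> carrier (obj (cone R x C) l)"
      then obtain u v where a: "a = Node u v" "u \<in> carrier (obj C l)" "v \<in> carrier (obj C (l - 1))"
        by auto
      show "\<exists>y\<in>carrier (obj (cone R x C) l). y \<oplus>\<^bsub>obj (cone R x C) l\<^esub> a =
          \<zero>\<^bsub>obj (cone R x C) l\<^esub>"
        using a by (intro bexI[of _ "Node (\<ominus>\<^bsub>obj C l\<^esub> u) (\<ominus>\<^bsub>obj C (l -
            1)\<^esub> v)"])
          (auto simp: obj.M.l_neg)
    qed (auto simp: obj.M.a_ac)
  qed (auto simp: obj.smult_l_distr obj.smult_r_distr obj.smult_assoc1 cring)
  show "is_complex R (cone R x C)"
    unfolding is_complex_def
  proof (intro conjI allI ballI)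
    fix l
    show "module R (obj (cone R x C) l)" by (rule mod)
    show "diff (cone R x C) l \<in> module_hom R (obj (cone R x C) l) (obj (cone R x C) (l - 1))"
      using x by (intro module_homI)
        (auto simp: diff_add diff_smult obj.smult_r_distr obj.M.minus_add obj.smult_r_minus
          obj.M.a_ac obj.smult_assoc1[symmetric] obj.R.m_comm)
    fix a assume "a \<in> carrier (obj (cone R x C) l)"
    then show "diff (cone R x C) (l - 1) (diff (cone R x C) l a) = \<zero>\<^bsub>obj (cone R x C) (l - 1 -
        1)\<^esub>"
      using x by (auto simp: diff_add diff_smult diff_neg obj.smult_r_minus obj.M.r_neg)
  qed
qed

lemma (in tree_cplx) exact_at_cone_iff:
  "exact_at (cone R x C) l \<longleftrightarrow>
    (\<forall>u\<in>carrier (obj C l). \<forall>v\<in>carrier (obj C (l - 1)).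
      diff C l u \<oplus>\<^bsub>obj C (l - 1)\<^esub> x \<odot>\<^bsub>obj C (l - 1)\<^esub> v =
          \<zero>\<^bsub>obj C (l - 1)\<^esub> \<longrightarrow>
      diff C (l - 1) v = \<zero>\<^bsub>obj C (l - 1 - 1)\<^esub> \<longrightarrow>
      (\<exists>a\<in>carrier (obj C (l + 1)). \<exists>b\<in>carrier (obj C l).
         diff C (l + 1) a \<oplus>\<^bsub>obj C l\<^esub> x \<odot>\<^bsub>obj C l\<^esub> b = u \<and>
             \<ominus>\<^bsub>obj C (l - 1)\<^esub> diff C l b = v))"
proof -
  have neg: "\<ominus>\<^bsub>obj C (l - 1 - 1)\<^esub> diff C (l - 1) v = \<zero>\<^bsub>obj C (l - 1 -
      1)\<^esub> \<longleftrightarrow>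
      diff C (l - 1) v = \<zero>\<^bsub>obj C (l - 1 - 1)\<^esub>" if "v \<in> carrier (obj C (l - 1))" for v
    using that by (simp add: obj.M.add.inv_eq_1_iff)
  have ball: "(\<forall>z\<in>carrier (obj (cone R x C) l). P z) \<longleftrightarrow>
      (\<forall>u\<in>carrier (obj C l). \<forall>v\<in>carrier (obj C (l - 1)). P (Node u v))" for P
    by auto
  have bex: "(\<exists>z\<in>carrier (obj (cone R x C) (l + 1)). P z) \<longleftrightarrow>
      (\<exists>a\<in>carrier (obj C (l + 1)). \<exists>b\<in>carrier (obj C l). P (Node a b))" for P
    by auto
  show ?thesis
    unfolding exact_at_def ball bex by (simp add: neg imp_conjL)
qed

definition cone_map :: "(int \<Rightarrow> 'a tree \<Rightarrow> 'b tree) \<Rightarrow> int \<Rightarrow> 'a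
    tree \<Rightarrow> 'b tree" where
  "cone_map f l a = Node (f l (lft a)) (f (l - 1) (rgt a))"

lemma cone_map_Node [simp]: "cone_map f l (Node u v) = Node (f l u) (f (l - 1) v)"
  by (simp add: cone_map_def)

lemma chain_map_cone:
  assumes f: "chain_map R C D f" and x: "x \<in> carrier R"
  shows "chain_map R (cone R x C) (cone R x D) (cone_map f)"
proof -
  interpret C: tree_cplx R C unfolding tree_cplx_def by (rule chain_mapD[OF f])
  interpret D: tree_cplx R D unfolding tree_cplx_def by (rule chain_mapD[OF f])
  note fD = chain_mapD(4-)[OF f]
  show ?thesis
    unfolding chain_map_def
  proof (intro conjI allI ballI)
    show "is_complex R (cone R x C)" "is_complex R (cone R x D)"
      using C.cone_cplx D.cone_cplx x by (simp_all add: cplx_def)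
    fix l
    show "cone_map f l \<in> module_hom R (obj (cone R x C) l) (obj (cone R x D) l)"
      by (rule module_homI) (auto simp: fD)
    show "diff (cone R x D) l (cone_map f l a) = cone_map f (l - 1) (diff (cone R x C) l a)"
      if "a \<in> carrier (obj (cone R x C) l)" for a
      using that x by (auto simp: fD)
  qed
qed

text \<open>The five lemma for the long exact sequences of the two cones, carried out on elements.
  The facts \<open>inj\<close> and \<open>surj\<close> are the hypothesis in the form that the chase
  uses, \<open>inj_cone\<close> and \<open>surj_cone\<close> are its two halves.\<close>

lemma qis_cone:
  assumes q: "qis R C D f" and x: "x \<in> carrier R"
  shows "qis R (cone R x C) (cone R x D) (cone_map f)"
proof -
  have f: "chain_map R C D f" using q by (simp add: qis_def)
  interpret C: tree_cplx R C unfolding tree_cplx_def by (rule chain_mapD[OF f])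
  interpret D: tree_cplx R D unfolding tree_cplx_def by (rule chain_mapD[OF f])
  note fD = chain_mapD(4-)[OF f]
  have inj: "\<exists>y\<in>carrier (obj C (l + 1)). diff C (l + 1) y = z"
    if "z \<in> carrier (obj C l)" "diff C l z = \<zero>\<^bsub>obj C (l - 1)\<^esub>"
      "c \<in> carrier (obj D (l + 1))" "f l z = diff D (l + 1) c" for l z c
  proof -
    have "z \<in> boundaries C l"
      using q that unfolding qis_def cycles_def boundaries_def by blast
    then show ?thesis by (auto simp: boundaries_def)
  qed
  have surj: "\<exists>z\<in>carrier (obj C l). diff C l z = \<zero>\<^bsub>obj C (l - 1)\<^esub> \<and>
      (\<exists>c\<in>carrier (obj D (l + 1)). w = f l z \<oplus>\<^bsub>obj D l\<^esub> diff D (l + 1) c)"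
    if "w \<in> carrier (obj D l)" "diff D l w = \<zero>\<^bsub>obj D (l - 1)\<^esub>" for l w
    using q that unfolding qis_def cycles_def by blast
  have inj_cone: "\<exists>a'\<in>carrier (obj C (l + 1)). \<exists>b'\<in>carrier (obj C l).
      u = diff C (l + 1) a' \<oplus>\<^bsub>obj C l\<^esub> x \<odot>\<^bsub>obj C l\<^esub> b' \<and> v =
          \<ominus>\<^bsub>obj C (l - 1)\<^esub> diff C l b'"
    if u: "u \<in> carrier (obj C l)" and v: "v \<in> carrier (obj C (l - 1))"
      and uv: "diff C l u \<oplus>\<^bsub>obj C (l - 1)\<^esub> x \<odot>\<^bsub>obj C (l - 1)\<^esub> v =
          \<zero>\<^bsub>obj C (l - 1)\<^esub>"
      and dv: "diff C (l - 1) v = \<zero>\<^bsub>obj C (l - 1 - 1)\<^esub>"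
      and a: "a \<in> carrier (obj D (l + 1))" and b: "b \<in> carrier (obj D l)"
      and fu: "f l u = diff D (l + 1) a \<oplus>\<^bsub>obj D l\<^esub> x \<odot>\<^bsub>obj D l\<^esub> b"
      and fv: "f (l - 1) v = \<ominus>\<^bsub>obj D (l - 1)\<^esub> diff D l b" for l u v a b
  proof -
    obtain b0 where b0: "b0 \<in> carrier (obj C l)" "diff C l b0 = v"
      using inj[of v "l - 1" "\<ominus>\<^bsub>obj D l\<^esub> b"] v dv b fv by (auto simp: D.diff_neg)
    have "diff D l (f l b0 \<oplus>\<^bsub>obj D l\<^esub> b) = \<zero>\<^bsub>obj D (l - 1)\<^esub>"
      using b0 b fv by (simp add: D.diff_add fD D.obj.M.l_neg)
    then obtain z c where z: "z \<in> carrier (obj C l)" "diff C l z = \<zero>\<^bsub>obj C (l - 1)\<^esub>"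
      and c: "c \<in> carrier (obj D (l + 1))"
      and zc: "f l b0 \<oplus>\<^bsub>obj D l\<^esub> b = f l z \<oplus>\<^bsub>obj D l\<^esub> diff D (l + 1) c"
      using surj[of "f l b0 \<oplus>\<^bsub>obj D l\<^esub> b" l] b0 b fD by auto
    \<comment> \<open>The cycle \<open>z\<close> measures how far \<open>f b0\<close> is from
      \<open>-b\<close> up to boundaries. Removing it leaves the boundary \<open>v\<close> of
      \<open>b0\<close> unchanged and yields \<open>b + f b1 = d c\<close>. Then
      \<open>u + x b1\<close> is a boundary \<open>d a1\<close>, and \<open>(a1, -b1)\<close> is the
      required preimage of \<open>(u, v)\<close>.\<close>
    define b1 where "b1 = b0 \<oplus>\<^bsub>obj C l\<^esub> \<ominus>\<^bsub>obj C l\<^esub> z"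
    have b1: "b1 \<in> carrier (obj C l)" "diff C l b1 = v"
      using b0 z v by (simp_all add: b1_def C.diff_add C.diff_neg)
    have fb1: "b \<oplus>\<^bsub>obj D l\<^esub> f l b1 = diff D (l + 1) c"
    proof -
      have "b \<oplus>\<^bsub>obj D l\<^esub> f l b1 = (f l b0 \<oplus>\<^bsub>obj D l\<^esub> b)
          \<oplus>\<^bsub>obj D l\<^esub> \<ominus>\<^bsub>obj D l\<^esub> f l z"
        using b0 z b by (simp add: b1_def fD D.obj.M.a_ac)
      then show ?thesis
        using z c zc by (simp add: fD D.obj.M.a_comm[of "f l z"] D.obj.M.a_assoc D.obj.M.r_neg)
    qed
    have "f l (u \<oplus>\<^bsub>obj C l\<^esub> x \<odot>\<^bsub>obj C l\<^esub> b1) =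
        diff D (l + 1) a \<oplus>\<^bsub>obj D l\<^esub> x \<odot>\<^bsub>obj D l\<^esub> (b
            \<oplus>\<^bsub>obj D l\<^esub> f l b1)"
      using u b1 x a b by (simp add: fD fu D.obj.smult_r_distr D.obj.M.a_assoc)
    also have "\<dots> = diff D (l + 1) (a \<oplus>\<^bsub>obj D (l + 1)\<^esub> x \<odot>\<^bsub>obj D (l +
        1)\<^esub> c)"
      using a c x by (simp add: fb1 D.diff_add D.diff_smult)
    finally have "f l (u \<oplus>\<^bsub>obj C l\<^esub> x \<odot>\<^bsub>obj C l\<^esub> b1) = \<dots>" .
    moreover have "diff C l (u \<oplus>\<^bsub>obj C l\<^esub> x \<odot>\<^bsub>obj C l\<^esub> b1) =
        \<zero>\<^bsub>obj C (l - 1)\<^esub>"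
      using u b1 x uv by (simp add: C.diff_add C.diff_smult)
    ultimately obtain a1 where a1: "a1 \<in> carrier (obj C (l + 1))"
      "diff C (l + 1) a1 = u \<oplus>\<^bsub>obj C l\<^esub> x \<odot>\<^bsub>obj C l\<^esub> b1"
      using inj[of "u \<oplus>\<^bsub>obj C l\<^esub> x \<odot>\<^bsub>obj C l\<^esub> b1" l "a
          \<oplus>\<^bsub>obj D (l + 1)\<^esub> x \<odot>\<^bsub>obj D (l + 1)\<^esub> c"]
        u b1 x a c by auto
    show ?thesis
      using a1 b1 u x by (intro bexI[of _ a1] bexI[of _ "\<ominus>\<^bsub>obj C l\<^esub> b1"])
        (auto simp: C.diff_neg C.obj.smult_r_minus C.obj.M.a_assoc C.obj.M.r_neg)
  qed
  have surj_cone: "\<exists>z\<in>cycles (cone R x C) l. \<exists>c\<in>carrier (obj (cone R x D) (l + 1)).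
      Node u v = cone_map f l z \<oplus>\<^bsub>obj (cone R x D) l\<^esub> diff (cone R x D) (l + 1) c"
    if u: "u \<in> carrier (obj D l)" and v: "v \<in> carrier (obj D (l - 1))"
      and uv: "diff D l u \<oplus>\<^bsub>obj D (l - 1)\<^esub> x \<odot>\<^bsub>obj D (l - 1)\<^esub> v =
          \<zero>\<^bsub>obj D (l - 1)\<^esub>"
      and dv: "diff D (l - 1) v = \<zero>\<^bsub>obj D (l - 1 - 1)\<^esub>" for l u v
  proof -
    obtain z c where z: "z \<in> carrier (obj C (l - 1))" "diff C (l - 1) z = \<zero>\<^bsub>obj C (l - 1 -
        1)\<^esub>"
      and c: "c \<in> carrier (obj D l)"
      and vzc: "v = f (l - 1) z \<oplus>\<^bsub>obj D (l - 1)\<^esub> diff D l c"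
      using surj[of v "l - 1"] v dv by auto
    \<comment> \<open>Subtracting the differential of \<open>(0, -c)\<close> from
      \<open>(u, v)\<close> leaves \<open>(s, f z)\<close>. The cycle condition makes
      \<open>f (x z)\<close> a boundary, so \<open>x z\<close> is itself the boundary of some
      \<open>w\<close>, and \<open>(-w, z)\<close> is a cycle of the cone over \<open>C\<close>. The
      remaining \<open>s + f w\<close> is a cycle of \<open>D\<close>, to which surjectivity
      applies.\<close>
    let ?s = "u \<oplus>\<^bsub>obj D l\<^esub> x \<odot>\<^bsub>obj D l\<^esub> c"
    have s: "?s \<in> carrier (obj D l)" using u c x by simp
    have ds: "diff D l ?s \<oplus>\<^bsub>obj D (l - 1)\<^esub> x \<odot>\<^bsub>obj D (l - 1)\<^esub> f (l -
        1) z = \<zero>\<^bsub>obj D (l - 1)\<^esub>"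
      using uv u c x z by (simp add: vzc D.diff_add D.diff_smult D.obj.smult_r_distr fD D.obj.M.a_ac)
    have fxz: "f (l - 1) (x \<odot>\<^bsub>obj C (l - 1)\<^esub> z) = diff D l (\<ominus>\<^bsub>obj D l\<^esub> ?s)"
      using D.obj.M.eq_neg_of_sum_zero[OF ds] s x z fD by (simp add: D.diff_neg)
    have "diff C (l - 1) (x \<odot>\<^bsub>obj C (l - 1)\<^esub> z) = \<zero>\<^bsub>obj C (l - 1 - 1)\<^esub>"
      using z x by (simp add: C.diff_smult)
    then obtain w where w: "w \<in> carrier (obj C l)" "diff C l w = x \<odot>\<^bsub>obj C (l - 1)\<^esub> z"
      using inj[of "x \<odot>\<^bsub>obj C (l - 1)\<^esub> z" "l - 1" "\<ominus>\<^bsub>obj D l\<^esub> ?s"]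
          fxz s x z by auto
    have "diff D l (?s \<oplus>\<^bsub>obj D l\<^esub> f l w) = \<zero>\<^bsub>obj D (l - 1)\<^esub>"
      using ds s w x z by (simp add: D.diff_add[of ?s] fD)
    then obtain z' e where z': "z' \<in> carrier (obj C l)" "diff C l z' = \<zero>\<^bsub>obj C (l - 1)\<^esub>"
      and e: "e \<in> carrier (obj D (l + 1))"
      and ze: "?s \<oplus>\<^bsub>obj D l\<^esub> f l w = f l z' \<oplus>\<^bsub>obj D l\<^esub> diff D (l + 1) e"
      using surj[of "?s \<oplus>\<^bsub>obj D l\<^esub> f l w" l] s w fD by auto
    have ueq: "u = (f l z' \<oplus>\<^bsub>obj D l\<^esub> \<ominus>\<^bsub>obj D l\<^esub> f l w)
        \<oplus>\<^bsub>obj D l\<^esub>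
        (diff D (l + 1) e \<oplus>\<^bsub>obj D l\<^esub> \<ominus>\<^bsub>obj D l\<^esub> (x
            \<odot>\<^bsub>obj D l\<^esub> c))"
      using ze u c x w z' e by (intro D.obj.M.transpose_sum) (auto simp: fD)
    let ?z = "Node (z' \<oplus>\<^bsub>obj C l\<^esub> \<ominus>\<^bsub>obj C l\<^esub> w) z"
    have "?z \<in> cycles (cone R x C) l"
      using z z' w x by (simp add: cycles_def C.diff_add C.diff_neg C.obj.M.l_neg)
    moreover have "Node e (\<ominus>\<^bsub>obj D l\<^esub> c) \<in> carrier (obj (cone R x D) (l + 1))"
      using e c by simp
    moreover have "Node u v = cone_map f l ?z \<oplus>\<^bsub>obj (cone R x D) l\<^esub>
        diff (cone R x D) (l + 1) (Node e (\<ominus>\<^bsub>obj D l\<^esub> c))"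
      using ueq vzc z' w c x by (simp add: fD D.diff_neg D.obj.smult_r_minus)
    ultimately show ?thesis by blast
  qed
  show ?thesis
    unfolding qis_def
  proof (intro conjI allI ballI impI)
    show "chain_map R (cone R x C) (cone R x D) (cone_map f)" by (rule chain_map_cone[OF f x])
    fix l
    show "z \<in> boundaries (cone R x C) l"
      if zc: "z \<in> cycles (cone R x C) l" and fb: "cone_map f l z \<in> boundaries (cone R x D) l" for z
    proof -
      obtain u v where z: "z = Node u v" "u \<in> carrier (obj C l)" "v \<in> carrier (obj C (l - 1))"
        using zc by (auto simp: cycles_def)
      have dv: "diff C (l - 1) v = \<zero>\<^bsub>obj C (l - 1 - 1)\<^esub>"
        using zc z by (simp add: cycles_def C.obj.M.add.inv_eq_1_iff)
      obtain a b where ab: "a \<in> carrier (obj D (l + 1))" "b \<in> carrier (obj D l)"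
        "f l u = diff D (l + 1) a \<oplus>\<^bsub>obj D l\<^esub> x \<odot>\<^bsub>obj D l\<^esub> b"
        "f (l - 1) v = \<ominus>\<^bsub>obj D (l - 1)\<^esub> diff D l b"
        using fb z by (auto simp: boundaries_def)
      obtain a' b' where "a' \<in> carrier (obj C (l + 1))" "b' \<in> carrier (obj C l)"
        "u = diff C (l + 1) a' \<oplus>\<^bsub>obj C l\<^esub> x \<odot>\<^bsub>obj C l\<^esub> b'" "v =
            \<ominus>\<^bsub>obj C (l - 1)\<^esub> diff C l b'"
        using inj_cone[OF z(2,3) _ dv ab] zc z(1) by (auto simp: cycles_def)
      then have "z = diff (cone R x C) (l + 1) (Node a' b')" "Node a' b' \<in> carrier (obj (cone R x C) (l + 1))"
        using z by simp_all
      then show ?thesis unfolding boundaries_def by blast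
    qed
    show "\<exists>z\<in>cycles (cone R x C) l. \<exists>c\<in>carrier (obj (cone R x D) (l + 1)).
        w = cone_map f l z \<oplus>\<^bsub>obj (cone R x D) l\<^esub> diff (cone R x D) (l + 1) c"
      if wc: "w \<in> cycles (cone R x D) l" for w
    proof -
      obtain u v where w: "w = Node u v" "u \<in> carrier (obj D l)" "v \<in> carrier (obj D (l - 1))"
        using wc by (auto simp: cycles_def)
      have "diff D (l - 1) v = \<zero>\<^bsub>obj D (l - 1 - 1)\<^esub>"
        using wc w by (simp add: cycles_def D.obj.M.add.inv_eq_1_iff)
      then show ?thesis using surj_cone[of u l v] wc w by (simp add: cycles_def)
    qed
  qed
qed

section \<open>Quotient modules and homology classes\<close>

locale quotient_mod =
  fixes R :: "'r ring" (structure) and M :: "('r, 'm) module" and N :: "'m set"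
  assumes module: "module R M" and submodule: "submodule N R M"

sublocale quotient_mod \<subseteq> M: module R M
  by (rule module)

sublocale quotient_mod \<subseteq> N: abelian_subgroup N M
  by (rule abelian_subgroupI2[OF M.M.a_comm_group submodule.axioms(1)[OF submodule]])

context quotient_mod
begin

lemma sub_carrier: "x \<in> N \<Longrightarrow> x \<in> carrier M"
  using M.submoduleE(1)[OF submodule] by blast

lemma smult_sub: "r \<in> carrier R \<Longrightarrow> x \<in> N \<Longrightarrow> r \<odot>\<^bsub>M\<^esub> x
    \<in> N"
  using M.submoduleE(4)[OF submodule] .

lemma coset_eq_iff:
  assumes "x \<in> carrier M" "y \<in> carrier M"
  shows "N +>\<^bsub>M\<^esub> x = N +>\<^bsub>M\<^esub> y \<longleftrightarrow> x \<oplus>\<^bsub>M\<^esub>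
      \<ominus>\<^bsub>M\<^esub> y \<in> N"
proof
  assume "N +>\<^bsub>M\<^esub> x = N +>\<^bsub>M\<^esub> y"
  then have "N +>\<^bsub>M\<^esub> (x \<oplus>\<^bsub>M\<^esub> \<ominus>\<^bsub>M\<^esub> y) = N"
    by (rule M.M.a_coset_add_inv2) (use assms sub_carrier in auto)
  then show "x \<oplus>\<^bsub>M\<^esub> \<ominus>\<^bsub>M\<^esub> y \<in> N"
    by (rule M.M.a_coset_join1) (use assms N.a_subgroup in auto)
next
  assume "x \<oplus>\<^bsub>M\<^esub> \<ominus>\<^bsub>M\<^esub> y \<in> N"
  then have "N +>\<^bsub>M\<^esub> (x \<oplus>\<^bsub>M\<^esub> \<ominus>\<^bsub>M\<^esub> y) = N"
    by (intro M.M.a_coset_join2) (use assms N.a_subgroup in auto)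
  then show "N +>\<^bsub>M\<^esub> x = N +>\<^bsub>M\<^esub> y"
    by (rule M.M.a_coset_add_inv1) (use assms sub_carrier in auto)
qed

lemma coset_eq_sub_iff: "x \<in> carrier M \<Longrightarrow> N +>\<^bsub>M\<^esub> x = N \<longleftrightarrow>
    x \<in> N"
  using coset_eq_iff[of x "\<zero>\<^bsub>M\<^esub>"] N.a_subset by simp

lemma carrier_quot: "carrier (quot_module M N) = (\<lambda>x. N +>\<^bsub>M\<^esub> x) ` carrier M"
  by (auto simp: quot_module_def A_RCOSETS_def RCOSETS_def a_r_coset_def)

lemma zero_quot: "\<zero>\<^bsub>quot_module M N\<^esub> = N"
  by (simp add: quot_module_def)

lemma add_quot:
  "x \<in> carrier M \<Longrightarrow> y \<in> carrier M \<Longrightarrow>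
    (N +>\<^bsub>M\<^esub> x) \<oplus>\<^bsub>quot_module M N\<^esub> (N +>\<^bsub>M\<^esub> y) = N
        +>\<^bsub>M\<^esub> (x \<oplus>\<^bsub>M\<^esub> y)"
  by (simp add: quot_module_def N.a_rcos_sum)

text \<open>\<open>quot_module\<close> defines a scalar multiple as a union over all
  representatives. All members of this union are the same coset.\<close>

lemma smult_quot:
  assumes r: "r \<in> carrier R" and x: "x \<in> carrier M"
  shows "r \<odot>\<^bsub>quot_module M N\<^esub> (N +>\<^bsub>M\<^esub> x) = N +>\<^bsub>M\<^esub> (r
      \<odot>\<^bsub>M\<^esub> x)"
proof -
  have "N +>\<^bsub>M\<^esub> (r \<odot>\<^bsub>M\<^esub> y) = N +>\<^bsub>M\<^esub> (r
      \<odot>\<^bsub>M\<^esub> x)" if y: "y \<in> N +>\<^bsub>M\<^esub> x" for y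
  proof -
    obtain n where n: "n \<in> N" "y = n \<oplus>\<^bsub>M\<^esub> x"
      using y by (auto simp: a_r_coset_def r_coset_def)
    have "r \<odot>\<^bsub>M\<^esub> y \<oplus>\<^bsub>M\<^esub> \<ominus>\<^bsub>M\<^esub> (r
        \<odot>\<^bsub>M\<^esub> x) = r \<odot>\<^bsub>M\<^esub> n"
      using n r x sub_carrier by (simp add: M.smult_r_distr M.M.a_assoc M.M.r_neg)
    then show ?thesis using n r x sub_carrier smult_sub by (subst coset_eq_iff) auto
  qed
  note eq = this
  show ?thesis
    unfolding quot_module_def mk_module_sel
    by (rule SUP_eq_const[OF _ eq]) (use N.a_rcos_self[OF x] in blast)
qed

lemma module_quot: "module R (quot_module M N)"
proof (rule moduleI)
  show "cring R" by (rule module.axioms(1)[OF module])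
  have zero: "\<zero>\<^bsub>quot_module M N\<^esub> = N +>\<^bsub>M\<^esub> \<zero>\<^bsub>M\<^esub>"
    using coset_eq_sub_iff[of "\<zero>\<^bsub>M\<^esub>"] zero_quot by simp
  show "abelian_group (quot_module M N)"
  proof (rule abelian_groupI)
    fix a assume "a \<in> carrier (quot_module M N)"
    then obtain x where x: "a = N +>\<^bsub>M\<^esub> x" "x \<in> carrier M" by (auto simp: carrier_quot)
    show "\<exists>y\<in>carrier (quot_module M N). y \<oplus>\<^bsub>quot_module M N\<^esub> a =
        \<zero>\<^bsub>quot_module M N\<^esub>"
      unfolding zero using x
      by (intro bexI[of _ "N +>\<^bsub>M\<^esub> (\<ominus>\<^bsub>M\<^esub> x)"]) (auto simp: add_quot
          carrier_quot M.M.l_neg)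
  qed (auto simp: carrier_quot add_quot zero M.M.a_ac)
qed (auto simp: carrier_quot add_quot smult_quot M.smult_l_distr M.smult_r_distr M.smult_assoc1)

lemma proj_hom: "(\<lambda>x. N +>\<^bsub>M\<^esub> x) \<in> module_hom R M (quot_module M N)"
  by (rule module_homI) (auto simp: carrier_quot add_quot smult_quot)

lemma quot_lift:
  assumes P: "module R P" and f: "f \<in> module_hom R M P" and fN: "\<And>x. x \<in> N \<Longrightarrow> f x =
      \<zero>\<^bsub>P\<^esub>"
  obtains h where "h \<in> module_hom R (quot_module M N) P"
    "\<And>x. x \<in> carrier M \<Longrightarrow> h (N +>\<^bsub>M\<^esub> x) = f x"
proof -
  interpret P: module R P by fact
  define h where "h = (\<lambda>X. f (SOME x. x \<in> carrier M \<and> X = N +>\<^bsub>M\<^esub> x))"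
  have h: "h (N +>\<^bsub>M\<^esub> x) = f x" if x: "x \<in> carrier M" for x
  proof -
    define y where "y = (SOME y. y \<in> carrier M \<and> N +>\<^bsub>M\<^esub> x = N +>\<^bsub>M\<^esub> y)"
    have y: "y \<in> carrier M \<and> N +>\<^bsub>M\<^esub> x = N +>\<^bsub>M\<^esub> y"
      unfolding y_def by (rule someI[of _ x]) (simp add: x)
    then have "f (x \<oplus>\<^bsub>M\<^esub> \<ominus>\<^bsub>M\<^esub> y) = \<zero>\<^bsub>P\<^esub>" using x
        coset_eq_iff by (intro fN) blast
    then have eq: "f x \<oplus>\<^bsub>P\<^esub> \<ominus>\<^bsub>P\<^esub> f y = \<zero>\<^bsub>P\<^esub>"
      using x y by (simp add: module_homD[OF f] module_hom_neg[OF module P f])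
    have "f x = f y"
      using P.M.eq_neg_of_sum_zero(1)[OF eq] x y by (simp add: module_homD[OF f])
    then show ?thesis by (simp add: h_def y_def)
  qed
  show ?thesis
  proof
    show "h \<in> module_hom R (quot_module M N) P"
      by (rule module_homI) (auto simp: carrier_quot add_quot smult_quot h module_homD[OF f])
  qed (rule h)
qed

end

context cplx
begin

lemma boundaries_submodule: "submodule (boundaries C l) R (obj C l)"
proof (rule obj.submoduleI)
  show "\<zero>\<^bsub>obj C l\<^esub> \<in> boundaries C l"
    unfolding boundaries_def using diff_zero[of "l + 1"] obj.M.zero_closed[of "l + 1"]
    by (intro image_eqI[of _ _ "\<zero>\<^bsub>obj C (l + 1)\<^esub>"]) (simp_all del: diff_zero)
next
  fix a b assume "a \<in> boundaries C l" "b \<in> boundaries C l"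
  then show "a \<oplus>\<^bsub>obj C l\<^esub> b \<in> boundaries C l"
    using diff_add[of _ "l + 1"] unfolding boundaries_def by (auto simp flip: diff_add[of _ "l + 1", simplified])
next
  fix a assume "a \<in> boundaries C l"
  then show "\<ominus>\<^bsub>obj C l\<^esub> a \<in> boundaries C l"
    unfolding boundaries_def by (auto simp flip: diff_neg[of _ "l + 1", simplified])
next
  fix r a assume "r \<in> carrier R" "a \<in> boundaries C l"
  then show "r \<odot>\<^bsub>obj C l\<^esub> a \<in> boundaries C l"
    unfolding boundaries_def by (auto simp flip: diff_smult[of _ _ "l + 1", simplified])
qed (auto simp: boundaries_def)

lemma quotient_boundaries: "quotient_mod R (obj C l) (boundaries C l)"
  by (intro quotient_mod.intro module_obj boundaries_submodule)

lemma carrier_homology: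
  "carrier (homology C l) = (\<lambda>z. boundaries C l +>\<^bsub>obj C l\<^esub> z) ` cycles C l"
  by (auto simp: homology_def quot_module_def A_RCOSETS_def RCOSETS_def a_r_coset_def r_coset_def)

end

text \<open>\<open>homology_map\<close> is a union over representatives, too. As soon as it is known
  to send the class of \<open>z\<close> to the class of \<open>f l z\<close>, both clauses of
  \<open>qis\<close> can be read off from bijectivity.\<close>

lemma quasi_isomorphism_qis:
  assumes q: "quasi_isomorphism R C D f"
  shows "qis R C D f"
proof -
  have f: "chain_map R C D f" using q by (simp add: quasi_isomorphism_def)
  interpret C: cplx R C by (rule chain_mapD[OF f])
  interpret D: cplx R D by (rule chain_mapD[OF f])
  interpret QC: quotient_mod R "obj C l" "boundaries C l" for l by (rule C.quotient_boundaries)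
  interpret QD: quotient_mod R "obj D l" "boundaries D l" for l by (rule D.quotient_boundaries)
  note fD = chain_mapD(4-)[OF f]
  have bij: "bij_betw (homology_map D f l) (carrier (homology C l)) (carrier (homology D l))" for l
    using q by (simp add: quasi_isomorphism_def)
  have hm: "homology_map D f l (boundaries C l +>\<^bsub>obj C l\<^esub> z) = boundaries D l +>\<^bsub>obj D
      l\<^esub> f l z"
    if z: "z \<in> carrier (obj C l)" for l z
  proof -
    have "boundaries D l +>\<^bsub>obj D l\<^esub> f l y = boundaries D l +>\<^bsub>obj D l\<^esub> f l z"
      if y: "y \<in> boundaries C l +>\<^bsub>obj C l\<^esub> z" for y
    proof -
      obtain c where c: "c \<in> carrier (obj C (l + 1))" "y = diff C (l + 1) c \<oplus>\<^bsub>obj C l\<^esub> z"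
        using y by (auto simp: a_r_coset_def r_coset_def boundaries_def)
      have "f l y \<oplus>\<^bsub>obj D l\<^esub> \<ominus>\<^bsub>obj D l\<^esub> f l z = diff D (l + 1) (f (l
          + 1) c)"
        using c z by (simp add: fD D.obj.M.a_assoc D.obj.M.r_neg)
      then have "f l y \<oplus>\<^bsub>obj D l\<^esub> \<ominus>\<^bsub>obj D l\<^esub> f l z \<in> boundaries D l"
        using c fD(1) by (auto simp: boundaries_def)
      then show ?thesis using c z fD(1) by (subst QD.coset_eq_iff) auto
    qed
    note eq = this
    show ?thesis
      unfolding homology_map_def by (rule SUP_eq_const[OF _ eq]) (use QC.N.a_rcos_self[OF z] in blast)
  qed
  show ?thesis
    unfolding qis_def
  proof (intro conjI allI ballI impI)
    fix l
    show "z \<in> boundaries C l" if z: "z \<in> cycles C l" and fz: "f l z \<in> boundaries D l" for z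
    proof -
      have zc: "z \<in> carrier (obj C l)" and zero: "\<zero>\<^bsub>obj C l\<^esub> \<in> cycles C l" using z
          by (auto simp: cycles_def)
      have "homology_map D f l (boundaries C l +>\<^bsub>obj C l\<^esub> z) =
          homology_map D f l (boundaries C l +>\<^bsub>obj C l\<^esub> \<zero>\<^bsub>obj C l\<^esub>)"
        using zc fz fD QD.N.a_subset by (simp add: hm QD.coset_eq_sub_iff)
      then have "boundaries C l +>\<^bsub>obj C l\<^esub> z = boundaries C l +>\<^bsub>obj C l\<^esub>
          \<zero>\<^bsub>obj C l\<^esub>"
        using bij[of l] z zero unfolding bij_betw_def C.carrier_homology by (auto dest: inj_onD)
      then show ?thesis using zc QC.coset_eq_sub_iff QC.N.a_subset by simp
    qed
    show "\<exists>z\<in>cycles C l. \<exists>c\<in>carrier (obj D (l + 1)). w = f l z \<oplus>\<^bsub>obj D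
        l\<^esub> diff D (l + 1) c"
      if w: "w \<in> cycles D l" for w
    proof -
      have wc: "w \<in> carrier (obj D l)" using w by (simp add: cycles_def)
      have "boundaries D l +>\<^bsub>obj D l\<^esub> w \<in> homology_map D f l ` carrier (homology C l)"
        using bij[of l] w unfolding bij_betw_def D.carrier_homology by blast
      then obtain z where z: "z \<in> cycles C l"
        and "boundaries D l +>\<^bsub>obj D l\<^esub> w = homology_map D f l (boundaries C l +>\<^bsub>obj C
            l\<^esub> z)"
        unfolding C.carrier_homology by blast
      then have "w \<in> boundaries D l +>\<^bsub>obj D l\<^esub> f l z"
        using hm[of z l] QD.N.a_rcos_self[OF wc] by (simp add: cycles_def)
      then obtain c where "c \<in> carrier (obj D (l + 1))" "w = diff D (l + 1) c \<oplus>\<^bsub>obj D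
          l\<^esub> f l z"
        by (auto simp: a_r_coset_def r_coset_def boundaries_def)
      then show ?thesis using z fD(1) D.obj.M.a_comm by (force simp: cycles_def)
    qed
  qed (rule f)
qed

section \<open>Transport of structure to another element type\<close>

definition transport_module :: "('a \<Rightarrow> 'b) \<Rightarrow> ('b \<Rightarrow> 'a) \<Rightarrow> ('r,
    'a) module \<Rightarrow> ('r, 'b) module" where
  "transport_module e e' M = mk_module (e ` carrier M) (e \<zero>\<^bsub>M\<^esub>)
    (\<lambda>a b. e (e' a \<oplus>\<^bsub>M\<^esub> e' b)) (\<lambda>r a. e (r \<odot>\<^bsub>M\<^esub> e' a))"

text \<open>The map \<open>e\<close> is the same in all degrees, while its left inverse depends on
  the degree: \<open>e\<close> is injective on each term separately, and terms of different degrees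
  may share their images.\<close>

definition transport_complex ::
  "('a \<Rightarrow> 'b) \<Rightarrow> (int \<Rightarrow> 'b \<Rightarrow> 'a) \<Rightarrow> ('r, 'a)
      chain_complex \<Rightarrow> ('r, 'b) chain_complex" where
  "transport_complex e e' C =
    \<lparr>obj = (\<lambda>l. transport_module e (e' l) (obj C l)), diff = (\<lambda>l a. e (diff C l (e' l
        a)))\<rparr>"

lemma transport_module_sel [simp]:
  "carrier (transport_module e e' M) = e ` carrier M"
  "\<zero>\<^bsub>transport_module e e' M\<^esub> = e \<zero>\<^bsub>M\<^esub>"
  "a \<oplus>\<^bsub>transport_module e e' M\<^esub> b = e (e' a \<oplus>\<^bsub>M\<^esub> e' b)"
  "r \<odot>\<^bsub>transport_module e e' M\<^esub> a = e (r \<odot>\<^bsub>M\<^esub> e' a)"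
  by (simp_all add: transport_module_def)

lemma transport_complex_sel [simp]:
  "obj (transport_complex e e' C) l = transport_module e (e' l) (obj C l)"
  "diff (transport_complex e e' C) l a = e (diff C l (e' l a))"
  by (simp_all add: transport_complex_def)

lemma module_transport:
  assumes "module R M" and inv: "\<And>x. x \<in> carrier M \<Longrightarrow> e' (e x) = x"
  shows "module R (transport_module e e' M)"
proof -
  interpret M: module R M by fact
  show ?thesis
  proof (rule moduleI)
    show "cring R" by (rule module.axioms(1)[OF assms(1)])
    show "abelian_group (transport_module e e' M)"
    proof (rule abelian_groupI)
      fix a assume "a \<in> carrier (transport_module e e' M)"
      then obtain x where "x \<in> carrier M" "a = e x" by auto
      then show "\<exists>y\<in>carrier (transport_module e e' M).
          y \<oplus>\<^bsub>transport_module e e' M\<^esub> a = \<zero>\<^bsub>transport_module e e' M\<^esub>"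
        by (intro bexI[of _ "e (\<ominus>\<^bsub>M\<^esub> x)"]) (auto simp: inv M.M.l_neg)
    qed (auto simp: inv M.M.a_ac)
  qed (auto simp: inv M.smult_l_distr M.smult_r_distr M.smult_assoc1)
qed

lemma transport_hom:
  assumes "module R M" "\<And>x. x \<in> carrier M \<Longrightarrow> e' (e x) = x"
  shows "e \<in> module_hom R M (transport_module e e' M)"
    and "e' \<in> module_hom R (transport_module e e' M) M"
proof -
  interpret M: module R M by fact
  show "e \<in> module_hom R M (transport_module e e' M)"
    "e' \<in> module_hom R (transport_module e e' M) M"
    by (auto intro!: module_homI simp: assms(2))
qed

lemma (in cplx) transport_cplx:
  assumes inv: "\<And>l x. x \<in> carrier (obj C l) \<Longrightarrow> e' l (e x) = x"
  shows "cplx R (transport_complex e e' C)"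
  by unfold_locales
    (auto simp: is_complex_def inv diff_add diff_smult intro!: module_homI module_transport[OF module_obj])

lemma (in cplx) exact_at_transport:
  assumes inv: "\<And>l x. x \<in> carrier (obj C l) \<Longrightarrow> e' l (e x) = x"
  shows "exact_at (transport_complex e e' C) l \<longleftrightarrow> exact_at C l"
proof -
  have inj: "e x = e y \<longleftrightarrow> x = y" if "x \<in> carrier (obj C l)" "y \<in> carrier (obj C l)"
      for l x y
    using that inv by metis
  show ?thesis by (simp add: exact_at_def inv inj[of _ "l - 1"] inj[of _ l])
qed

section \<open>Iterated cones and comparison of complexes after Koszul construction\<close>

abbreviation leaf_complex :: "('r, 'm) chain_complex \<Rightarrow> ('r, 'm tree) chain_complex" where
  "leaf_complex \<equiv> transport_complex Leaf (\<lambda>_. leaf_val)"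

text \<open>Each cone being a tensor product with K(x), this is a model of the Koszul complex
  tensored with \<open>C\<close> whose element type does not depend on the number of generators. The
  identification is \<open>tensor_koszul_isomorphic\<close>.\<close>

primrec kos :: "'r ring \<Rightarrow> 'r list \<Rightarrow> ('r, 'm) chain_complex \<Rightarrow> ('r, 'm tree)
    chain_complex" where
  "kos R [] C = leaf_complex C"
| "kos R (x # xs) C = cone R x (kos R xs C)"

lemma (in cplx) kos_cplx: "set xs \<subseteq> carrier R \<Longrightarrow> cplx R (kos R xs C)"
proof (induction xs)
  case Nil
  then show ?case by (simp add: transport_cplx)
next
  case (Cons x xs)
  then show ?case by (auto intro: tree_cplx.cone_cplx simp: tree_cplx_def)
qed

lemma qis_leaf:
  assumes q: "qis R C D f"
  shows "qis R (leaf_complex C) (leaf_complex D) (\<lambda>l a. Leaf (f l (leaf_val a)))"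
proof -
  have f: "chain_map R C D f" using q by (simp add: qis_def)
  interpret C: cplx R C by (rule chain_mapD[OF f])
  interpret D: cplx R D by (rule chain_mapD[OF f])
  note fD = chain_mapD(4-)[OF f]
  have "chain_map R (leaf_complex C) (leaf_complex D) (\<lambda>l a. Leaf (f l (leaf_val a)))"
    unfolding chain_map_def
    using C.transport_cplx[of "\<lambda>_. leaf_val" Leaf] D.transport_cplx[of "\<lambda>_. leaf_val" Leaf]
    by (auto simp: cplx_def fD intro!: module_homI)
  moreover have bd: "boundaries (leaf_complex E) l = Leaf ` boundaries E l"
    for E :: "('r, 'c) chain_complex" and l by (auto simp: boundaries_def image_iff)
  moreover have bd': "boundaries (leaf_complex D) l = Leaf ` boundaries D l" for l
    by (auto simp: boundaries_def image_iff)
  moreover have bd'': "boundaries (leaf_complex C) l = Leaf ` boundaries C l" for l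
    by (auto simp: boundaries_def image_iff)
  moreover have cy: "cycles (leaf_complex C) l = Leaf ` cycles C l" for l
    by (auto simp: cycles_def image_iff)
  moreover have cy': "cycles (leaf_complex D) l = Leaf ` cycles D l" for l
    by (auto simp: cycles_def image_iff)
  ultimately show ?thesis
    using q unfolding qis_def by (fastforce simp: image_iff)
qed

lemma qis_kos:
  assumes "qis R C D f" "set xs \<subseteq> carrier R"
  shows "\<exists>g. qis R (kos R xs C) (kos R xs D) g"
  using assms(2)
proof (induction xs)
  case Nil
  then show ?case using qis_leaf[OF assms(1)] by auto
next
  case (Cons x xs)
  then obtain g where "qis R (kos R xs C) (kos R xs D) g" by auto
  then show ?case using qis_cone[of R _ _ g x] Cons.prems by auto
qed

text \<open>The complex \<open>A\<close> is a subcomplex of \<open>B\<close>, and \<open>y\<close>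
  acts bijectively on each term of the quotient \<open>B/A\<close>: the second clause is injectivity
  there, the third is surjectivity.\<close>

definition bijective_inclusion ::
  "'r ring \<Rightarrow> 'r \<Rightarrow> ('r, 'm) chain_complex \<Rightarrow> ('r, 'm) chain_complex
      \<Rightarrow> bool" where
  "bijective_inclusion R y A B \<longleftrightarrow> chain_map R A B (\<lambda>_ a. a) \<and>
    (\<forall>l. \<forall>b\<in>carrier (obj B l). y \<odot>\<^bsub>obj B l\<^esub> b \<in> carrier (obj A l)
        \<longrightarrow> b \<in> carrier (obj A l)) \<and>
    (\<forall>l. \<forall>b\<in>carrier (obj B l). \<exists>b'\<in>carrier (obj B l). \<exists>a\<in>carrier
        (obj A l).
       b = y \<odot>\<^bsub>obj B l\<^esub> b' \<oplus>\<^bsub>obj B l\<^esub> a)"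

lemma chain_map_cong:
  assumes f: "chain_map R C D f" and eq: "\<And>l x. x \<in> carrier (obj C l) \<Longrightarrow> f l x = g l x"
  shows "chain_map R C D g"
proof -
  interpret C: cplx R C by (rule chain_mapD[OF f])
  show ?thesis
    using f unfolding chain_map_def module_hom_def by (auto simp: eq[symmetric] Pi_iff)
qed

lemma bijective_inclusion_leaf:
  assumes q: "bijective_inclusion R y A B"
  shows "bijective_inclusion R y (leaf_complex A) (leaf_complex B)"
proof -
  have f: "chain_map R A B (\<lambda>_ x. x)" using q by (simp add: bijective_inclusion_def)
  interpret A: cplx R A by (rule chain_mapD[OF f])
  interpret B: cplx R B by (rule chain_mapD[OF f])
  note fD = chain_mapD(4-)[OF f]
  have "chain_map R (leaf_complex A) (leaf_complex B) (\<lambda>_ x. x)"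
    unfolding chain_map_def
    using A.transport_cplx[of "\<lambda>_. leaf_val" Leaf] B.transport_cplx[of "\<lambda>_. leaf_val" Leaf]
    by (auto simp: cplx_def fD intro!: module_homI)
  then show ?thesis using q unfolding bijective_inclusion_def by (fastforce simp: image_iff)
qed

text \<open>A term of the quotient of the two cones is a sum of two terms of \<open>B/A\<close>, so
  \<open>y\<close> stays bijective on it.\<close>

lemma bijective_inclusion_cone:
  assumes q: "bijective_inclusion R y A B" and x: "x \<in> carrier R"
  shows "bijective_inclusion R y (cone R x A) (cone R x B)"
proof -
  have f: "chain_map R A B (\<lambda>_ x. x)" using q by (simp add: bijective_inclusion_def)
  have "chain_map R (cone R x A) (cone R x B) (cone_map (\<lambda>_ x. x))"
    by (rule chain_map_cone[OF f x])
  then have "chain_map R (cone R x A) (cone R x B) (\<lambda>_ x. x)"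
    by (rule chain_map_cong) (auto simp: cone_map_def)
  moreover have "\<exists>b'\<in>carrier (obj (cone R x B) l). \<exists>a\<in>carrier (obj (cone R x A) l).
      b = y \<odot>\<^bsub>obj (cone R x B) l\<^esub> b' \<oplus>\<^bsub>obj (cone R x B) l\<^esub> a"
    if b: "b \<in> carrier (obj (cone R x B) l)" for l b
  proof -
    obtain u v where uv: "b = Node u v" "u \<in> carrier (obj B l)" "v \<in> carrier (obj B (l - 1))"
      using b by auto
    obtain u' u0 where "u' \<in> carrier (obj B l)" "u0 \<in> carrier (obj A l)"
      "u = y \<odot>\<^bsub>obj B l\<^esub> u' \<oplus>\<^bsub>obj B l\<^esub> u0"
      using q uv unfolding bijective_inclusion_def by blast
    moreover obtain v' v0 where "v' \<in> carrier (obj B (l - 1))" "v0 \<in> carrier (obj A (l - 1))"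
      "v = y \<odot>\<^bsub>obj B (l - 1)\<^esub> v' \<oplus>\<^bsub>obj B (l - 1)\<^esub> v0"
      using q uv unfolding bijective_inclusion_def by blast
    ultimately show ?thesis
      using uv by (intro bexI[of _ "Node u' v'"] bexI[of _ "Node u0 v0"]) auto
  qed
  ultimately show ?thesis using q unfolding bijective_inclusion_def by auto
qed

text \<open>The quotient of the two cones is the cone of \<open>x\<close> on \<open>B/A\<close>,
  which is acyclic because \<open>x\<close> is bijective there. On elements, a pair over
  \<open>B\<close> is moved into \<open>A\<close> by subtracting the differential of a pair whose
  first component is zero.\<close>

lemma bijective_inclusion_qis:
  assumes q: "bijective_inclusion R x A B" and x: "x \<in> carrier R"
  shows "qis R (cone R x A) (cone R x B) (\<lambda>_ z. z)"
proof -
  have f: "chain_map R A B (\<lambda>_ x. x)" using q by (simp add: bijective_inclusion_def)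
  interpret A: tree_cplx R A unfolding tree_cplx_def by (rule chain_mapD[OF f])
  interpret B: tree_cplx R B unfolding tree_cplx_def by (rule chain_mapD[OF f])
  note fD = chain_mapD(4-)[OF f]
  have sub: "a \<in> carrier (obj A l) \<Longrightarrow> a \<in> carrier (obj B l)" for a l by (rule fD(1))
  have zero: "\<zero>\<^bsub>obj A l\<^esub> = \<zero>\<^bsub>obj B l\<^esub>" for l by (rule fD(4))
  have add: "a \<oplus>\<^bsub>obj A l\<^esub> b = a \<oplus>\<^bsub>obj B l\<^esub> b"
    if "a \<in> carrier (obj A l)" "b \<in> carrier (obj A l)" for a b l by (rule fD(2)[OF that])
  have smult: "x \<odot>\<^bsub>obj A l\<^esub> b = x \<odot>\<^bsub>obj B l\<^esub> b" if "b \<in> carrier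
      (obj A l)" for b l
    by (rule fD(3)[OF x that])
  have neg: "\<ominus>\<^bsub>obj A l\<^esub> b = \<ominus>\<^bsub>obj B l\<^esub> b" if "b \<in> carrier (obj
      A l)" for b l
    by (rule fD(5)[OF that])
  have diff: "diff A l b = diff B l b" if "b \<in> carrier (obj A l)" for b l
    by (rule fD(6)[OF that, symmetric])
  have addA: "a \<oplus>\<^bsub>obj B l\<^esub> b \<in> carrier (obj A l)"
    if "a \<in> carrier (obj A l)" "b \<in> carrier (obj A l)" for a b l
    using that A.obj.M.a_closed add by metis
  have negA: "\<ominus>\<^bsub>obj B l\<^esub> b \<in> carrier (obj A l)" if "b \<in> carrier (obj A l)" for b l
    using that A.obj.M.a_inv_closed neg by metis
  have smultA: "x \<odot>\<^bsub>obj B l\<^esub> b \<in> carrier (obj A l)" if "b \<in> carrier (obj A l)" for b l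
    using that A.obj.smult_closed x smult by metis
  have diffA: "diff B l b \<in> carrier (obj A (l - 1))" if "b \<in> carrier (obj A l)" for b l
    using that A.diff_closed diff by metis
  have inA: "b \<in> carrier (obj A l)"
    if "b \<in> carrier (obj B l)" "x \<odot>\<^bsub>obj B l\<^esub> b \<in> carrier (obj A l)" for b l
    using q that unfolding bijective_inclusion_def by blast
  have decomp: "\<exists>b'\<in>carrier (obj B l). \<exists>a\<in>carrier (obj A l). b = x \<odot>\<^bsub>obj B
      l\<^esub> b' \<oplus>\<^bsub>obj B l\<^esub> a"
    if "b \<in> carrier (obj B l)" for b l
    using q that unfolding bijective_inclusion_def by blast
  show ?thesis
    unfolding qis_def
  proof (intro conjI allI ballI impI)
    have "chain_map R (cone R x A) (cone R x B) (cone_map (\<lambda>_ x. x))"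
      by (rule chain_map_cone[OF f x])
    then show "chain_map R (cone R x A) (cone R x B) (\<lambda>_ x. x)"
      by (rule chain_map_cong) (auto simp: cone_map_def)
    fix l
    show "z \<in> boundaries (cone R x A) l"
      if zc: "z \<in> cycles (cone R x A) l" and zb: "z \<in> boundaries (cone R x B) l" for z
    proof -
      obtain u v where z: "z = Node u v" "u \<in> carrier (obj A l)" "v \<in> carrier (obj A (l - 1))"
        using zc by (auto simp: cycles_def)
      obtain a b where a: "a \<in> carrier (obj B (l + 1))" and b: "b \<in> carrier (obj B l)"
        and u: "u = diff B (l + 1) a \<oplus>\<^bsub>obj B l\<^esub> x \<odot>\<^bsub>obj B l\<^esub> b"
        and v: "v = \<ominus>\<^bsub>obj B (l - 1)\<^esub> diff B l b"
        using zb z(1) by (auto simp: boundaries_def)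
      obtain a2 a0 where a2: "a2 \<in> carrier (obj B (l + 1))" and a0: "a0 \<in> carrier (obj A (l + 1))"
        and aeq: "a = x \<odot>\<^bsub>obj B (l + 1)\<^esub> a2 \<oplus>\<^bsub>obj B (l + 1)\<^esub> a0"
        using decomp[OF a] by blast
      \<comment> \<open>\<open>(a0, b')\<close> is \<open>(a, b)\<close> minus the differential of
        \<open>(0, a2)\<close> and so has the same differential \<open>(u, v)\<close>. Since
        \<open>u\<close> and \<open>a0\<close> belong to \<open>A\<close>, so does
        \<open>x b'\<close>, and injectivity of \<open>x\<close> on \<open>B/A\<close> puts
        \<open>b'\<close> into \<open>A\<close>.\<close>
      define b' where "b' = b \<oplus>\<^bsub>obj B l\<^esub> diff B (l + 1) a2"
      have b': "b' \<in> carrier (obj B l)" using b a2 by (simp add: b'_def)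
      have u': "u = diff B (l + 1) a0 \<oplus>\<^bsub>obj B l\<^esub> x \<odot>\<^bsub>obj B l\<^esub> b'"
        using a2 a0 b x
        by (simp add: u aeq b'_def B.diff_add B.diff_smult sub B.obj.smult_r_distr B.obj.M.a_ac)
      have "x \<odot>\<^bsub>obj B l\<^esub> b' = \<ominus>\<^bsub>obj B l\<^esub> diff B (l + 1) a0
          \<oplus>\<^bsub>obj B l\<^esub> u"
        using b' a0 x by (simp add: u' sub B.obj.M.a_assoc[symmetric] B.obj.M.l_neg)
      then have b'A: "b' \<in> carrier (obj A l)"
        using b' z a0 diffA[OF a0] by (intro inA[OF b']) (simp_all add: addA negA)
      have v': "v = \<ominus>\<^bsub>obj B (l - 1)\<^esub> diff B l b'"
        using a2 b by (simp add: v b'_def B.diff_add)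
      have "z = diff (cone R x A) (l + 1) (Node a0 b')"
        unfolding z using a0 b'A diffA[OF a0] diffA[OF b'A] x
        by (simp only: cone_sel add_diff_cancel_right' diff add smult neg smultA u'[symmetric] v'[symmetric])
      then show ?thesis using a0 b'A unfolding boundaries_def by (intro image_eqI) auto
    qed
    show "\<exists>z\<in>cycles (cone R x A) l. \<exists>c\<in>carrier (obj (cone R x B) (l + 1)).
        w = z \<oplus>\<^bsub>obj (cone R x B) l\<^esub> diff (cone R x B) (l + 1) c"
      if wc: "w \<in> cycles (cone R x B) l" for w
    proof -
      obtain u v where w: "w = Node u v" and uc: "u \<in> carrier (obj B l)"
        and vc: "v \<in> carrier (obj B (l - 1))"
        using wc by (auto simp: cycles_def)
      have uv: "diff B l u \<oplus>\<^bsub>obj B (l - 1)\<^esub> x \<odot>\<^bsub>obj B (l - 1)\<^esub> v =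
          \<zero>\<^bsub>obj B (l - 1)\<^esub>"
        and dv: "diff B (l - 1) v = \<zero>\<^bsub>obj B (l - 2)\<^esub>"
        using wc vc unfolding w by (simp_all add: cycles_def B.obj.M.add.inv_eq_1_iff)
      obtain e u0 where e: "e \<in> carrier (obj B l)" and u0: "u0 \<in> carrier (obj A l)"
        and u: "u = x \<odot>\<^bsub>obj B l\<^esub> e \<oplus>\<^bsub>obj B l\<^esub> u0"
        using decomp[OF uc] by blast
      \<comment> \<open>The same move: \<open>(u0, v')\<close> is the cycle \<open>(u, v)\<close>
        minus the differential of \<open>(0, e)\<close>. The first component of the cycle condition
        forces \<open>x v'\<close> into \<open>A\<close>.\<close>
      define v' where "v' = v \<oplus>\<^bsub>obj B (l - 1)\<^esub> diff B l e"
      have v': "v' \<in> carrier (obj B (l - 1))" using vc e by (simp add: v'_def)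
      have s: "x \<odot>\<^bsub>obj B (l - 1)\<^esub> v' \<oplus>\<^bsub>obj B (l - 1)\<^esub> diff B l u0 =
          \<zero>\<^bsub>obj B (l - 1)\<^esub>"
        using uv e u0 vc x
        by (simp add: u v'_def B.diff_add B.diff_smult sub B.obj.smult_r_distr B.obj.M.a_ac)
      then have "x \<odot>\<^bsub>obj B (l - 1)\<^esub> v' = \<ominus>\<^bsub>obj B (l - 1)\<^esub> diff B l u0"
        using v' x u0 by (intro B.obj.M.eq_neg_of_sum_zero(1)) (simp_all add: sub)
      then have v'A: "v' \<in> carrier (obj A (l - 1))"
        using u0 by (intro inA[OF v']) (simp_all add: negA diffA)
      have "Node u0 v' \<in> cycles (cone R x A) l"
        using u0 v'A s e dv vc x sub[OF u0]
        by (simp add: cycles_def add smult neg diff diffA smultA zero B.obj.M.a_comm v'_def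
            B.diff_add A.obj.M.neg_zero[unfolded zero]) 
      moreover have "w = Node u0 v' \<oplus>\<^bsub>obj (cone R x B) l\<^esub>
          diff (cone R x B) (l + 1) (Node \<zero>\<^bsub>obj B (l + 1)\<^esub> e)"
        using e u0 vc x by (simp add: w u v'_def sub B.obj.M.a_ac B.obj.M.r_neg)
      moreover have "Node \<zero>\<^bsub>obj B (l + 1)\<^esub> e \<in> carrier (obj (cone R x B) (l + 1))"
          using e by simp
      ultimately show ?thesis by blast
    qed
  qed
qed

lemma bijective_inclusion_kos:
  assumes q: "bijective_inclusion R y A B" and xs: "set xs \<subseteq> carrier R"
  shows "bijective_inclusion R y (kos R xs A) (kos R xs B)"
  using xs by (induction xs) (auto intro: bijective_inclusion_leaf[OF q] bijective_inclusion_cone)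

text \<open>Bijectivity is used at the innermost cone over \<open>y\<close>. Cones inside it
  preserve the bijective inclusion, and cones outside it preserve the quasi-isomorphism obtained
  there.\<close>

lemma bijective_inclusion_kos_qis:
  assumes q: "bijective_inclusion R y A B" and "set xs \<subseteq> carrier R" "y \<in> set xs"
  shows "\<exists>g. qis R (kos R xs A) (kos R xs B) g"
  using assms(2,3)
proof (induction xs)
  case (Cons x xs)
  show ?case
  proof (cases "y \<in> set xs")
    case True
    then obtain g where "qis R (kos R xs A) (kos R xs B) g" using Cons by auto
    then show ?thesis using qis_cone[of R _ _ g x] Cons.prems by auto
  next
    case False
    then have "y = x" using Cons.prems by simp
    then show ?thesis
      using bijective_inclusion_qis[OF bijective_inclusion_kos[OF q]] Cons.prems by auto
  qed
qed simp

text \<open>By the long exact sequence, exactness of the cone in degree \<open>l + 1\<close> makes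
  \<open>x\<close> injective on H_l. As every homology class is killed by a power of
  \<open>x\<close>, injectivity forces H_l to vanish. Conversely the cone is exact in degree
  \<open>l\<close> if H_l and H_(l-1) vanish.\<close>

lemma exact_above_cone_iff:
  assumes "tree_cplx R C" and x: "x \<in> carrier R"
    and tors: "\<And>l u. u \<in> carrier (obj C l) \<Longrightarrow> \<exists>k::nat. (x [^]\<^bsub>R\<^esub>
        k) \<odot>\<^bsub>obj C l\<^esub> u = \<zero>\<^bsub>obj C l\<^esub>"
  shows "(\<forall>l>t. exact_at C l) \<longleftrightarrow> (\<forall>l>t + 1. exact_at (cone R x C) l)"
proof -
  interpret C: tree_cplx R C by fact
  show ?thesis
  proof (intro iffI allI impI)
    fix l assume ex: "\<forall>l>t. exact_at C l" and l: "t + 1 < l"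
    show "exact_at (cone R x C) l"
      unfolding C.exact_at_cone_iff
    proof (intro ballI impI)
      fix u v assume u: "u \<in> carrier (obj C l)" and v: "v \<in> carrier (obj C (l - 1))"
        and uv: "diff C l u \<oplus>\<^bsub>obj C (l - 1)\<^esub> x \<odot>\<^bsub>obj C (l - 1)\<^esub> v =
            \<zero>\<^bsub>obj C (l - 1)\<^esub>"
        and dv: "diff C (l - 1) v = \<zero>\<^bsub>obj C (l - 1 - 1)\<^esub>"
      have "exact_at C (l - 1)" "exact_at C l" using ex l by auto
      then obtain b where b: "b \<in> carrier (obj C l)" "diff C l b = v"
        using exact_atD[of C "l - 1" v] v dv by auto
      have "diff C l (u \<oplus>\<^bsub>obj C l\<^esub> x \<odot>\<^bsub>obj C l\<^esub> b) =
          \<zero>\<^bsub>obj C (l - 1)\<^esub>"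
        using u b x uv by (simp add: C.diff_add C.diff_smult)
      then obtain a where a: "a \<in> carrier (obj C (l + 1))"
        "diff C (l + 1) a = u \<oplus>\<^bsub>obj C l\<^esub> x \<odot>\<^bsub>obj C l\<^esub> b"
        using exact_atD[OF \<open>exact_at C l\<close>] u b x by (meson C.obj.M.a_closed C.obj.smult_closed)
      then show "\<exists>a\<in>carrier (obj C (l + 1)). \<exists>b\<in>carrier (obj C l).
          diff C (l + 1) a \<oplus>\<^bsub>obj C l\<^esub> x \<odot>\<^bsub>obj C l\<^esub> b = u \<and>
              \<ominus>\<^bsub>obj C (l - 1)\<^esub> diff C l b = v"
        using u b x by (intro bexI[of _ a] bexI[of _ "\<ominus>\<^bsub>obj C l\<^esub> b"])
          (auto simp: C.diff_neg C.obj.smult_r_minus C.obj.M.a_assoc C.obj.M.r_neg)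
    qed
  next
    fix l assume ex: "\<forall>l>t + 1. exact_at (cone R x C) l" and l: "t < l"
    \<comment> \<open>Induction on the exponent \<open>k\<close> that kills \<open>z\<close>: the
      element \<open>x z\<close> is killed by a smaller power, hence is the boundary of some
      \<open>w\<close>, and \<open>(-w, z)\<close> is a cycle of the cone in degree
      \<open>l + 1\<close>. The second component of a preimage exhibits \<open>z\<close> as a
      boundary.\<close>
    have "\<exists>w\<in>carrier (obj C (l + 1)). diff C (l + 1) w = z"
      if "(x [^]\<^bsub>R\<^esub> (k::nat)) \<odot>\<^bsub>obj C l\<^esub> z = \<zero>\<^bsub>obj C l\<^esub>"
          "z \<in> carrier (obj C l)"
        "diff C l z = \<zero>\<^bsub>obj C (l - 1)\<^esub>" for k z
      using that
    proof (induction k arbitrary: z)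
      case 0
      then have "diff C (l + 1) \<zero>\<^bsub>obj C (l + 1)\<^esub> = z" by simp
      then show ?case by blast
    next
      case (Suc k)
      have "(x [^]\<^bsub>R\<^esub> k) \<odot>\<^bsub>obj C l\<^esub> (x \<odot>\<^bsub>obj C l\<^esub> z) =
          \<zero>\<^bsub>obj C l\<^esub>"
        using Suc.prems x by (simp add: C.obj.smult_assoc1)
      then obtain w where w: "w \<in> carrier (obj C (l + 1))" "diff C (l + 1) w = x \<odot>\<^bsub>obj C l\<^esub> z"
        using Suc.IH[of "x \<odot>\<^bsub>obj C l\<^esub> z"] Suc.prems x by (auto simp: C.diff_smult)
      have "exact_at (cone R x C) (l + 1)" using ex l by simp
      moreover have "diff C (l + 1) (\<ominus>\<^bsub>obj C (l + 1)\<^esub> w) \<oplus>\<^bsub>obj C l\<^esub>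
          x \<odot>\<^bsub>obj C l\<^esub> z = \<zero>\<^bsub>obj C l\<^esub>"
        using w Suc.prems x by (simp add: C.diff_neg C.obj.M.l_neg)
      ultimately obtain b where "b \<in> carrier (obj C (l + 1))" "\<ominus>\<^bsub>obj C l\<^esub> diff C (l +
          1) b = z"
        using w Suc.prems unfolding C.exact_at_cone_iff by fastforce
      then show ?case by (intro bexI[of _ "\<ominus>\<^bsub>obj C (l + 1)\<^esub> b"]) (auto simp: C.diff_neg)
    qed
    then show "exact_at C l" unfolding exact_at_def using tors by blast
  qed
qed

text \<open>Cones inherit the torsion hypothesis, because the sum of the two exponents kills both
  components of a pair. So each cone raises the bound by one.\<close>

lemma exact_above_kos_iff:
  assumes C: "cplx R C" and "set xs \<subseteq> carrier R"
    and "\<And>x l u. x \<in> set xs \<Longrightarrow> u \<in> carrier (obj C l) \<Longrightarrow>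
      \<exists>k::nat. (x [^]\<^bsub>R\<^esub> k) \<odot>\<^bsub>obj C l\<^esub> u = \<zero>\<^bsub>obj C l\<^esub>"
  shows "(\<forall>l>t. exact_at C l) \<longleftrightarrow> (\<forall>l>t + int (length xs). exact_at (kos R xs C) l)"
proof -
  interpret C: cplx R C by fact
  have tors: "\<exists>k::nat. (x [^]\<^bsub>R\<^esub> k) \<odot>\<^bsub>obj (kos R ys C) l\<^esub> u =
      \<zero>\<^bsub>obj (kos R ys C) l\<^esub>"
    if "set ys \<subseteq> carrier R" "x \<in> set xs" "u \<in> carrier (obj (kos R ys C) l)" for x l u ys
    using that
  proof (induction ys arbitrary: l u)
    case Nil
    then show ?case using assms(3) by fastforce
  next
    case (Cons y ys)
    interpret K: cplx R "kos R ys C" using Cons.prems by (intro C.kos_cplx) auto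
    have x: "x \<in> carrier R" using Cons.prems assms(2) by auto
    obtain v w where u: "u = Node v w" "v \<in> carrier (obj (kos R ys C) l)"
      "w \<in> carrier (obj (kos R ys C) (l - 1))" using Cons.prems by auto
    obtain i j :: nat where i: "(x [^]\<^bsub>R\<^esub> i) \<odot>\<^bsub>obj (kos R ys C) l\<^esub> v =
        \<zero>\<^bsub>obj (kos R ys C) l\<^esub>"
      and j: "(x [^]\<^bsub>R\<^esub> j) \<odot>\<^bsub>obj (kos R ys C) (l - 1)\<^esub> w = \<zero>\<^bsub>obj
          (kos R ys C) (l - 1)\<^esub>"
      using Cons.IH[of v l] Cons.IH[of w "l - 1"] Cons.prems u by auto
    have "x [^]\<^bsub>R\<^esub> (i + j) = (x [^]\<^bsub>R\<^esub> j) \<otimes>\<^bsub>R\<^esub> (x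
        [^]\<^bsub>R\<^esub> i)"
      "x [^]\<^bsub>R\<^esub> (i + j) = (x [^]\<^bsub>R\<^esub> i) \<otimes>\<^bsub>R\<^esub> (x
          [^]\<^bsub>R\<^esub> j)"
      using x by (simp_all add: C.obj.R.nat_pow_mult add.commute)
    then have "(x [^]\<^bsub>R\<^esub> (i + j)) \<odot>\<^bsub>obj (kos R ys C) l\<^esub> v =
        \<zero>\<^bsub>obj (kos R ys C) l\<^esub>"
      "(x [^]\<^bsub>R\<^esub> (i + j)) \<odot>\<^bsub>obj (kos R ys C) (l - 1)\<^esub> w = \<zero>\<^bsub>obj
          (kos R ys C) (l - 1)\<^esub>"
      using u x i j by (metis K.obj.smult_assoc1 C.obj.R.nat_pow_closed K.obj.smult_r_null)+
    then show ?case using u by auto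
  qed
  have "(\<forall>l>t. exact_at C l) \<longleftrightarrow> (\<forall>l>t + int (length ys). exact_at (kos R ys C) l)"
    if "set ys \<subseteq> set xs" for ys
    using that
  proof (induction ys)
    case Nil
    then show ?case by (simp add: C.exact_at_transport)
  next
    case (Cons y ys)
    have "set ys \<subseteq> carrier R" "y \<in> carrier R" using Cons.prems assms(2) by auto
    then have "(\<forall>l>t + int (length ys). exact_at (kos R ys C) l) \<longleftrightarrow>
        (\<forall>l>t + int (length ys) + 1. exact_at (cone R y (kos R ys C)) l)"
      using Cons.prems C.kos_cplx[of ys] tors[of ys y]
      by (intro exact_above_cone_iff) (auto simp: tree_cplx_def)
    then show ?case using Cons by (simp add: add.assoc add.commute[of 1])
  qed
  then show ?thesis by blast
qed

section \<open>Torsion and local cohomology\<close>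

lemma module_regular:
  assumes "cring R"
  shows "module R (regular_module R)"
proof -
  interpret R: cring R by fact
  show ?thesis
  proof (rule moduleI)
    show "abelian_group (regular_module R)"
      by (rule abelian_groupI)
        (auto simp: regular_module_def R.a_ac intro: R.l_neg bexI[of _ "\<ominus>\<^bsub>R\<^esub> x" for x])
  qed (auto simp: regular_module_def R.l_distr R.r_distr R.m_assoc assms)
qed

lemma regular_module_sel [simp]:
  "carrier (regular_module R) = carrier R" "\<zero>\<^bsub>regular_module R\<^esub> = \<zero>\<^bsub>R\<^esub>"
  "a \<oplus>\<^bsub>regular_module R\<^esub> b = a \<oplus>\<^bsub>R\<^esub> b" "a
      \<odot>\<^bsub>regular_module R\<^esub> b = a \<otimes>\<^bsub>R\<^esub> b"
  by (simp_all add: regular_module_def)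

section \<open>Subcomplexes and torsion subcomplexes\<close>

definition subcomplex :: "('r, 'm) chain_complex \<Rightarrow> (int \<Rightarrow> 'm set) \<Rightarrow> ('r,
    'm) chain_complex" where
  "subcomplex C c = C\<lparr>obj := (\<lambda>l. (obj C l)\<lparr>carrier := c l\<rparr>)\<rparr>"

lemma subcomplex_sel [simp]:
  "carrier (obj (subcomplex C c) l) = c l"
  "zero (obj (subcomplex C c) l) = zero (obj C l)"
  "add (obj (subcomplex C c) l) = add (obj C l)"
  "smult (obj (subcomplex C c) l) = smult (obj C l)"
  "diff (subcomplex C c) = diff C"
  by (simp_all add: subcomplex_def)

lemma (in cplx) subcomplex_cplx:
  assumes "\<And>l. submodule (c l) R (obj C l)" and d: "\<And>l x. x \<in> c l \<Longrightarrow> diff C l x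
      \<in> c (l - 1)"
  shows "cplx R (subcomplex C c)"
proof
  have sub: "x \<in> carrier (obj C l)" if "x \<in> c l" for x l
    using obj.submoduleE(1)[OF assms(1)] that by blast
  have "module R (obj (subcomplex C c) l)" for l
    using submodule.submodule_is_module[OF assms(1) module_obj] by (simp add: subcomplex_def)
  then show "is_complex R (subcomplex C c)"
    unfolding is_complex_def by (auto intro!: module_homI simp: d diff_add diff_smult sub)
qed

text \<open>Torsion is measured by the powers of single elements, so that generators can be imposed
  one at a time. For a finite set of generators it agrees with the torsion of the ideal, see
  \<open>torsion_complex_eq\<close>.\<close>

definition tors_complex :: "'r ring \<Rightarrow> 'r set \<Rightarrow> ('r, 'm) chain_complex \<Rightarrow>
    ('r, 'm) chain_complex" where
  "tors_complex R S C = subcomplex C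
     (\<lambda>l. {m \<in> carrier (obj C l). \<forall>x\<in>S. \<exists>k::nat. (x [^]\<^bsub>R\<^esub> k)
         \<odot>\<^bsub>obj C l\<^esub> m = \<zero>\<^bsub>obj C l\<^esub>})"

lemma tors_complex_sel [simp]:
  "carrier (obj (tors_complex R S C) l) =
     {m \<in> carrier (obj C l). \<forall>x\<in>S. \<exists>k::nat. (x [^]\<^bsub>R\<^esub> k)
         \<odot>\<^bsub>obj C l\<^esub> m = \<zero>\<^bsub>obj C l\<^esub>}"
  "zero (obj (tors_complex R S C) l) = zero (obj C l)"
  "add (obj (tors_complex R S C) l) = add (obj C l)"
  "smult (obj (tors_complex R S C) l) = smult (obj C l)"
  "diff (tors_complex R S C) = diff C"
  by (simp_all add: tors_complex_def)

lemma (in cplx) tors_cplx: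
  assumes S: "S \<subseteq> carrier R"
  shows "cplx R (tors_complex R S C)"
  unfolding tors_complex_def
proof (rule subcomplex_cplx)
  let ?T = "\<lambda>l. {m \<in> carrier (obj C l). \<forall>x\<in>S. \<exists>k::nat. (x [^] k)
      \<odot>\<^bsub>obj C l\<^esub> m = \<zero>\<^bsub>obj C l\<^esub>}"
  have swap: "(x [^] k) \<odot>\<^bsub>obj C l\<^esub> (r \<odot>\<^bsub>obj C l\<^esub> m) = r
      \<odot>\<^bsub>obj C l\<^esub> ((x [^] k) \<odot>\<^bsub>obj C l\<^esub> m)"
    if "x \<in> carrier R" "r \<in> carrier R" "m \<in> carrier (obj C l)" for x r m l and k :: nat
    using that by (simp add: obj.smult_assoc1[symmetric] obj.R.m_comm)
  show "submodule (?T l) R (obj C l)" for l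
  proof (rule obj.submoduleI)
    fix a b assume a: "a \<in> ?T l" and b: "b \<in> ?T l"
    have "\<exists>k::nat. (x [^] k) \<odot>\<^bsub>obj C l\<^esub> (a \<oplus>\<^bsub>obj C l\<^esub> b) =
        \<zero>\<^bsub>obj C l\<^esub>" if x: "x \<in> S" for x
    proof -
      obtain i j :: nat where i: "(x [^] i) \<odot>\<^bsub>obj C l\<^esub> a = \<zero>\<^bsub>obj C l\<^esub>"
        and j: "(x [^] j) \<odot>\<^bsub>obj C l\<^esub> b = \<zero>\<^bsub>obj C l\<^esub>" using a b x by blast
      have xR: "x \<in> carrier R" using x S by blast
      have "(x [^] (j + i)) \<odot>\<^bsub>obj C l\<^esub> a = \<zero>\<^bsub>obj C l\<^esub>"
        using a i xR by (simp add: obj.R.nat_pow_mult[symmetric] obj.smult_assoc1)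
      moreover have "(x [^] (i + j)) \<odot>\<^bsub>obj C l\<^esub> b = \<zero>\<^bsub>obj C l\<^esub>"
        using b j xR by (simp add: obj.R.nat_pow_mult[symmetric] obj.smult_assoc1)
      ultimately show ?thesis
        using a b xR by (intro exI[of _ "i + j"]) (simp add: obj.smult_r_distr add.commute[of j])
    qed
    then show "a \<oplus>\<^bsub>obj C l\<^esub> b \<in> ?T l" using a b by simp
  next
    fix a assume a: "a \<in> ?T l"
    have "\<exists>k::nat. (x [^] k) \<odot>\<^bsub>obj C l\<^esub> (\<ominus>\<^bsub>obj C l\<^esub> a) =
        \<zero>\<^bsub>obj C l\<^esub>" if x: "x \<in> S" for x
    proof -
      obtain k :: nat where "(x [^] k) \<odot>\<^bsub>obj C l\<^esub> a = \<zero>\<^bsub>obj C l\<^esub>" using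
          a x by blast
      moreover have "x \<in> carrier R" using x S by blast
      ultimately show ?thesis using a by (intro exI[of _ k]) (simp add: obj.smult_r_minus)
    qed
    then show "\<ominus>\<^bsub>obj C l\<^esub> a \<in> ?T l" using a by simp
  next
    fix r a assume "r \<in> carrier R" "a \<in> ?T l"
    moreover have "\<exists>k::nat. (x [^] k) \<odot>\<^bsub>obj C l\<^esub> (r \<odot>\<^bsub>obj C l\<^esub>
        a) = \<zero>\<^bsub>obj C l\<^esub>" if x: "x \<in> S" for x
    proof -
      obtain k :: nat where "(x [^] k) \<odot>\<^bsub>obj C l\<^esub> a = \<zero>\<^bsub>obj C l\<^esub>"
        using \<open>a \<in> ?T l\<close> x by blast
      moreover have "x \<in> carrier R" using x S by blast
      ultimately show ?thesis
        using \<open>r \<in> carrier R\<close> \<open>a \<in> ?T l\<close> by (intro exI[of _ k]) (simp add: swap)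
    qed
    ultimately show "r \<odot>\<^bsub>obj C l\<^esub> a \<in> ?T l" by simp
  qed (use S in auto)
  fix l a assume a: "a \<in> ?T l"
  have "\<exists>k::nat. (x [^] k) \<odot>\<^bsub>obj C (l - 1)\<^esub> diff C l a = \<zero>\<^bsub>obj C (l -
      1)\<^esub>" if x: "x \<in> S" for x
  proof -
    obtain k :: nat where "(x [^] k) \<odot>\<^bsub>obj C l\<^esub> a = \<zero>\<^bsub>obj C l\<^esub>" using a
        x by auto
    then have "(x [^] k) \<odot>\<^bsub>obj C (l - 1)\<^esub> diff C l a = \<zero>\<^bsub>obj C (l - 1)\<^esub>"
      using diff_smult[of "x [^] k" a l] a x S by (auto simp: subset_iff)
    then show ?thesis by blast
  qed
  then show "diff C l a \<in> ?T (l - 1)" using a by simp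
qed

section \<open>Divisibility of injective modules up to torsion\<close>

text \<open>
  The ideals \<open>ann(x\<^sup>m e)\<close> stabilise at some \<open>m\<close>.  Then \<open>r
      x\<^sup>m\<^sup>+\<^sup>1 + c \<mapsto> r x\<^sup>m e\<close> is well defined on the ideal
  \<open>x\<^sup>m\<^sup>+\<^sup>1 R + ann(e)\<close>, and \<open>e'\<close> is the value at \<open>1\<close>
      of an extension to \<open>R\<close>.
\<close>

lemma injective_module_divisible:
  fixes R :: "'r ring" and E :: "('r, 'e) module"
  assumes R: "cring R" "noetherian_ring R" and E: "injective_module R E"
    and x: "x \<in> carrier R" and e: "e \<in> carrier E"
  obtains e' and m :: nat where "e' \<in> carrier E"
    "(x [^]\<^bsub>R\<^esub> m) \<odot>\<^bsub>E\<^esub> (e \<oplus>\<^bsub>E\<^esub>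
        \<ominus>\<^bsub>E\<^esub> (x \<odot>\<^bsub>E\<^esub> e')) = \<zero>\<^bsub>E\<^esub>"
    "\<And>r. r \<in> carrier R \<Longrightarrow> r \<odot>\<^bsub>E\<^esub> e = \<zero>\<^bsub>E\<^esub>
        \<Longrightarrow> r \<odot>\<^bsub>E\<^esub> e' = \<zero>\<^bsub>E\<^esub>"
proof -
  interpret R: cring R by fact
  interpret R: noetherian_ring R by fact
  interpret E: module R E using E by (simp add: injective_module_def)
  define ann where "ann m = {r \<in> carrier R. r \<odot>\<^bsub>E\<^esub> ((x [^]\<^bsub>R\<^esub> m)
      \<odot>\<^bsub>E\<^esub> e) = \<zero>\<^bsub>E\<^esub>}" for m :: nat
  have swap: "a \<odot>\<^bsub>E\<^esub> (b \<odot>\<^bsub>E\<^esub> y) = b \<odot>\<^bsub>E\<^esub> (a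
      \<odot>\<^bsub>E\<^esub> y)"
    if "a \<in> carrier R" "b \<in> carrier R" "y \<in> carrier E" for a b y
    using that by (simp add: E.smult_assoc1[symmetric] R.m_comm)
  have Suc: "(x [^]\<^bsub>R\<^esub> Suc m) \<odot>\<^bsub>E\<^esub> e = x \<odot>\<^bsub>E\<^esub> ((x
      [^]\<^bsub>R\<^esub> m) \<odot>\<^bsub>E\<^esub> e)" for m
    using x e by (simp add: E.smult_assoc1 swap)
  have ideal: "ideal (ann m) R" for m
  proof (rule idealI)
    show "subgroup (ann m) (add_monoid R)"
      using x e by (intro R.add.subgroupI)
        (auto simp: ann_def E.smult_l_distr E.smult_l_minus intro!: exI[of _ "\<zero>\<^bsub>R\<^esub>"])
  next
    fix a b assume a: "a \<in> ann m" and b: "b \<in> carrier R"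
    then have "a \<odot>\<^bsub>E\<^esub> (b \<odot>\<^bsub>E\<^esub> ((x [^]\<^bsub>R\<^esub> m)
        \<odot>\<^bsub>E\<^esub> e)) = \<zero>\<^bsub>E\<^esub>"
      using x e by (simp add: ann_def swap[of a b])
    then show "a \<otimes>\<^bsub>R\<^esub> b \<in> ann m" using a b x e by (simp add: ann_def E.smult_assoc1)
    then show "b \<otimes>\<^bsub>R\<^esub> a \<in> ann m" using a b by (simp add: ann_def R.m_comm)
  qed (rule R.ring_axioms)
  have step: "ann m \<subseteq> ann (Suc m)" for m
    using x e unfolding ann_def Suc by (auto simp: swap[of _ x])
  have mono: "ann i \<subseteq> ann j" if "i \<le> j" for i j
    using lift_Suc_mono_le[of ann, OF step that] .
  have "subset.chain {I. ideal I R} (range ann)"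
  proof -
    have "ann i \<subseteq> ann j \<or> ann j \<subseteq> ann i" for i j
      using mono[of i j] mono[of j i] by linarith
    then show ?thesis unfolding subset_chain_def using ideal by blast
  qed
  \<comment> \<open>In a noetherian ring the union of the chain is one of its members, so the chain
    is constant from there on.\<close>
  then have "\<Union>(range ann) \<in> range ann" by (intro R.ideal_chain_is_trivial) auto
  then obtain m where m: "ann (Suc m) \<subseteq> ann m" by blast
  define X where "X = x [^]\<^bsub>R\<^esub> Suc m"
  define y where "y = (x [^]\<^bsub>R\<^esub> m) \<odot>\<^bsub>E\<^esub> e"
  have X: "X \<in> carrier R" and y: "y \<in> carrier E" using x e by (simp_all add: X_def y_def)
  \<comment> \<open>Such decompositions are not unique. The map \<open>hh\<close> selects one; that
    the choice does not matter rests on the inclusion of \<open>ann (Suc m)\<close> in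
    \<open>ann m\<close>.\<close>
  define rep where "rep a r c \<longleftrightarrow> r \<in> carrier R \<and> c \<in> carrier R \<and> c
      \<odot>\<^bsub>E\<^esub> e = \<zero>\<^bsub>E\<^esub> \<and> a = r \<otimes>\<^bsub>R\<^esub> X
      \<oplus>\<^bsub>R\<^esub> c"
    for a r c
  define I where "I = {a. \<exists>r c. rep a r c}"
  define hh where "hh a = (SOME r. \<exists>c. rep a r c) \<odot>\<^bsub>E\<^esub> y" for a
  have rep_act: "a \<odot>\<^bsub>E\<^esub> e = r \<odot>\<^bsub>E\<^esub> (X \<odot>\<^bsub>E\<^esub> e)" if
      "rep a r c" for a r c
    using that X e by (auto simp: rep_def E.smult_l_distr E.smult_assoc1)
  have hh: "hh a = r \<odot>\<^bsub>E\<^esub> y" if ar: "rep a r c" for a r c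
  proof -
    define s where "s = (SOME r. \<exists>c. rep a r c)"
    have "\<exists>c. rep a s c" unfolding s_def by (rule someI[of _ r]) (use ar in blast)
    then obtain d where d: "rep a s d" by blast
    have rs: "r \<in> carrier R" "s \<in> carrier R" using ar d by (auto simp: rep_def)
    have "(r \<oplus>\<^bsub>R\<^esub> \<ominus>\<^bsub>R\<^esub> s) \<odot>\<^bsub>E\<^esub> (X
        \<odot>\<^bsub>E\<^esub> e) = \<zero>\<^bsub>E\<^esub>"
      using rep_act[OF ar] rep_act[OF d] rs X e by (simp add: E.smult_l_distr E.smult_l_minus E.M.r_neg)
    then have "r \<oplus>\<^bsub>R\<^esub> \<ominus>\<^bsub>R\<^esub> s \<in> ann (Suc m)" using rs unfolding
        ann_def X_def by blast
    then have "r \<oplus>\<^bsub>R\<^esub> \<ominus>\<^bsub>R\<^esub> s \<in> ann m" using m by blast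
    then have "r \<odot>\<^bsub>E\<^esub> y \<oplus>\<^bsub>E\<^esub> \<ominus>\<^bsub>E\<^esub> (s
        \<odot>\<^bsub>E\<^esub> y) = \<zero>\<^bsub>E\<^esub>"
      using rs y by (simp add: ann_def y_def[symmetric] E.smult_l_distr E.smult_l_minus)
    then have "r \<odot>\<^bsub>E\<^esub> y = s \<odot>\<^bsub>E\<^esub> y"
      using E.M.eq_neg_of_sum_zero(1) rs y by force
    then show ?thesis by (simp add: hh_def s_def)
  qed
  have IR: "I \<subseteq> carrier R" using X by (auto simp: I_def rep_def)
  have rep_add: "rep (a \<oplus>\<^bsub>R\<^esub> b) (r \<oplus>\<^bsub>R\<^esub> s) (c
      \<oplus>\<^bsub>R\<^esub> d)" if "rep a r c" "rep b s d" for a b r s c d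
    using that X e by (auto simp: rep_def E.smult_l_distr R.l_distr R.a_ac)
  have rep_smult: "rep (t \<otimes>\<^bsub>R\<^esub> a) (t \<otimes>\<^bsub>R\<^esub> r) (t
      \<otimes>\<^bsub>R\<^esub> c)" if "rep a r c" "t \<in> carrier R" for a r c t
    using that X e by (auto simp: rep_def E.smult_assoc1 R.r_distr R.m_assoc)
  interpret N: module R "regular_module R" by (rule module_regular) fact
  have sub: "submodule I R (regular_module R)"
  proof (rule N.submoduleI)
    show "\<zero>\<^bsub>regular_module R\<^esub> \<in> I"
      using X e unfolding I_def by (intro CollectI exI[of _ "\<zero>\<^bsub>R\<^esub>"]) (auto simp: rep_def)
    fix a assume a: "a \<in> I"
    have "\<ominus>\<^bsub>R\<^esub> \<one>\<^bsub>R\<^esub> \<otimes>\<^bsub>R\<^esub> a =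
        \<ominus>\<^bsub>regular_module R\<^esub> a"
      using a IR N.smult_l_minus[of "\<one>\<^bsub>R\<^esub>" a] by (auto simp: subset_iff)
    moreover have "\<ominus>\<^bsub>R\<^esub> \<one>\<^bsub>R\<^esub> \<otimes>\<^bsub>R\<^esub> a \<in> I"
      using a rep_smult[of a _ _ "\<ominus>\<^bsub>R\<^esub> \<one>\<^bsub>R\<^esub>"] by (auto simp: I_def)
    ultimately show "\<ominus>\<^bsub>regular_module R\<^esub> a \<in> I" by simp
  qed (use IR rep_add rep_smult in \<open>auto simp: I_def; blast\<close>)+
  \<comment> \<open>The ideal and the ring are copied into the test type as lists of length
    one.\<close>
  let ?emb = "\<lambda>r. Inr [r] :: 'e + 'r list" and ?un = "\<lambda>z :: 'e + 'r list. hd (projr z)"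
  let ?A = "transport_module ?emb ?un ((regular_module R)\<lparr>carrier := I\<rparr>)"
  let ?B = "transport_module ?emb ?un (regular_module R)"
  have "module R ?A" "module R ?B"
    using submodule.submodule_is_module[OF sub N.module_axioms] N.module_axioms
    by (auto intro: module_transport)
  moreover have "(\<lambda>z. z) \<in> module_hom R ?A ?B"
    using IR by (intro module_homI) (auto simp: subset_iff)
  moreover have "(\<lambda>z. hh (?un z)) \<in> module_hom R ?A E"
  proof (rule module_homI)
    fix z assume "z \<in> carrier ?A"
    then obtain a r c where a: "rep a r c" "z = ?emb a" by (auto simp: I_def)
    show "hh (?un z) \<in> carrier E" using a hh[OF a(1)] y by (simp add: rep_def)
    show "hh (?un (t \<odot>\<^bsub>?A\<^esub> z)) = t \<odot>\<^bsub>E\<^esub> hh (?un z)" if t: "t \<in>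
        carrier R" for t
      using a hh[OF a(1)] hh[OF rep_smult[OF a(1) t]] y t by (simp add: rep_def E.smult_assoc1)
    fix w assume "w \<in> carrier ?A"
    then obtain b s d where b: "rep b s d" "w = ?emb b" by (auto simp: I_def)
    show "hh (?un (z \<oplus>\<^bsub>?A\<^esub> w)) = hh (?un z) \<oplus>\<^bsub>E\<^esub> hh (?un w)"
      using a b hh[OF a(1)] hh[OF b(1)] hh[OF rep_add[OF a(1) b(1)]] y
      by (simp add: rep_def E.smult_l_distr)
  qed
  ultimately obtain k where k: "k \<in> module_hom R ?B E" and kh: "\<forall>z\<in>carrier ?A. k z = hh (?un z)"
    using E[unfolded injective_module_def, THEN conjunct2, rule_format, of ?A ?B "\<lambda>z. z" "\<lambda>z.
        hh (?un z)"]
    by (simp only: inj_on_id2) blast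
  define e' where "e' = k (?emb \<one>\<^bsub>R\<^esub>)"
  have e': "e' \<in> carrier E" unfolding e'_def by (rule module_homD(1)[OF k]) simp
  have act: "a \<odot>\<^bsub>E\<^esub> e' = r \<odot>\<^bsub>E\<^esub> y" if a: "rep a r c" for a r c
  proof -
    have "a \<in> I" using a by (auto simp: I_def)
    then have aR: "a \<in> carrier R" using IR by blast
    have "a \<odot>\<^bsub>E\<^esub> e' = k (a \<odot>\<^bsub>?B\<^esub> ?emb \<one>\<^bsub>R\<^esub>)"
      unfolding e'_def by (rule module_homD(3)[OF k aR, symmetric]) simp
    also have "\<dots> = hh a" using kh \<open>a \<in> I\<close> aR by simp
    finally show ?thesis using hh[OF a] by simp
  qed
  have "rep X \<one>\<^bsub>R\<^esub> \<zero>\<^bsub>R\<^esub>" using X e by (simp add: rep_def)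
  then have Xe': "X \<odot>\<^bsub>E\<^esub> e' = y" using act y by force
  have "(x [^]\<^bsub>R\<^esub> m) \<odot>\<^bsub>E\<^esub> (e \<oplus>\<^bsub>E\<^esub>
      \<ominus>\<^bsub>E\<^esub> (x \<odot>\<^bsub>E\<^esub> e')) = y \<oplus>\<^bsub>E\<^esub>
      \<ominus>\<^bsub>E\<^esub> (X \<odot>\<^bsub>E\<^esub> e')"
    using x e e' by (simp add: E.smult_r_distr E.smult_r_minus X_def y_def E.smult_assoc1)
  then have "(x [^]\<^bsub>R\<^esub> m) \<odot>\<^bsub>E\<^esub> (e \<oplus>\<^bsub>E\<^esub>
      \<ominus>\<^bsub>E\<^esub> (x \<odot>\<^bsub>E\<^esub> e')) = \<zero>\<^bsub>E\<^esub>"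
    using y by (simp add: Xe' E.M.r_neg)
  \<comment> \<open>This is why the ideal contains the annihilator of \<open>e\<close>: the map
    vanishes there, so whatever kills \<open>e\<close> also kills \<open>e'\<close>. Consequently
    \<open>e'\<close> stays in every torsion submodule that contains \<open>e\<close>.\<close>
  moreover have "r \<odot>\<^bsub>E\<^esub> e' = \<zero>\<^bsub>E\<^esub>" if "r \<in> carrier R" "r
      \<odot>\<^bsub>E\<^esub> e = \<zero>\<^bsub>E\<^esub>" for r
  proof -
    have "rep r \<zero>\<^bsub>R\<^esub> r" using that X by (simp add: rep_def)
    then show ?thesis using act y by simp
  qed
  ultimately show ?thesis using that e' by blast
qed

text \<open>On the quotient of the two torsion submodules \<open>x\<close> is injective, because a
  power of \<open>x\<close> that kills \<open>x b\<close> yields one that kills \<open>b\<close>.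
  Surjectivity is \<open>injective_module_divisible\<close>: in \<open>b = x e' + (b - x e')\<close>
  the condition on annihilators keeps \<open>e'\<close> in the \<open>S\<close>-torsion, and the
  remainder is killed by a power of \<open>x\<close>.\<close>

lemma bijective_inclusion_tors:
  fixes J :: "('r, 'j) chain_complex"
  assumes R: "cring R" "noetherian_ring R" and J: "cplx R J" "\<forall>l. injective_module R (obj J l)"
    and S: "S \<subseteq> carrier R" and x: "x \<in> carrier R"
  shows "bijective_inclusion R x (tors_complex R (insert x S) J) (tors_complex R S J)"
proof -
  interpret J: cplx R J by fact
  interpret A: cplx R "tors_complex R (insert x S) J" using S x by (intro J.tors_cplx) auto
  interpret B: cplx R "tors_complex R S J" using S by (intro J.tors_cplx)
  have "chain_map R (tors_complex R (insert x S) J) (tors_complex R S J) (\<lambda>_ a. a)"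
    unfolding chain_map_def using A.is_complex B.is_complex by (auto intro!: module_homI)
  moreover have "\<exists>k::nat. (x [^]\<^bsub>R\<^esub> k) \<odot>\<^bsub>obj J l\<^esub> b =
      \<zero>\<^bsub>obj J l\<^esub>"
    if "(x [^]\<^bsub>R\<^esub> k) \<odot>\<^bsub>obj J l\<^esub> (x \<odot>\<^bsub>obj J l\<^esub> b) =
        \<zero>\<^bsub>obj J l\<^esub>" "b \<in> carrier (obj J l)" for l b and k :: nat
    using that x by (intro exI[of _ "Suc k"]) (simp add: J.obj.smult_assoc1)
  moreover have "\<exists>b'\<in>carrier (obj (tors_complex R S J) l). \<exists>a\<in>carrier (obj
      (tors_complex R (insert x S) J) l).
       b = x \<odot>\<^bsub>obj (tors_complex R S J) l\<^esub> b' \<oplus>\<^bsub>obj (tors_complex R S J)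
           l\<^esub> a"
    if b: "b \<in> carrier (obj (tors_complex R S J) l)" for l b
  proof -
    have bJ: "b \<in> carrier (obj J l)" using b by simp
    obtain e' and m :: nat where e': "e' \<in> carrier (obj J l)"
      and m: "(x [^]\<^bsub>R\<^esub> m) \<odot>\<^bsub>obj J l\<^esub> (b \<oplus>\<^bsub>obj J l\<^esub>
          \<ominus>\<^bsub>obj J l\<^esub> (x \<odot>\<^bsub>obj J l\<^esub> e')) = \<zero>\<^bsub>obj J l\<^esub>"
      and ann: "\<And>r. r \<in> carrier R \<Longrightarrow> r \<odot>\<^bsub>obj J l\<^esub> b =
          \<zero>\<^bsub>obj J l\<^esub> \<Longrightarrow> r \<odot>\<^bsub>obj J l\<^esub> e' =
          \<zero>\<^bsub>obj J l\<^esub>"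
      using injective_module_divisible[OF R J(2)[rule_format] x bJ] by blast
    have e'T: "e' \<in> carrier (obj (tors_complex R S J) l)"
      using b e' ann S J.obj.R.nat_pow_closed by (simp add: subset_iff) blast
    have "\<ominus>\<^bsub>obj J l\<^esub> (x \<odot>\<^bsub>obj J l\<^esub> e') = (\<ominus>\<^bsub>R\<^esub>
        x) \<odot>\<^bsub>obj (tors_complex R S J) l\<^esub> e'"
      using e' x by (simp add: J.obj.smult_l_minus)
    then have "\<ominus>\<^bsub>obj J l\<^esub> (x \<odot>\<^bsub>obj J l\<^esub> e') \<in> carrier (obj
        (tors_complex R S J) l)"
      using e'T x B.obj.smult_closed[of "\<ominus>\<^bsub>R\<^esub> x" e' l] J.obj.R.a_inv_closed by simp
    from B.obj.M.a_closed[OF b this]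
    have "b \<oplus>\<^bsub>obj J l\<^esub> \<ominus>\<^bsub>obj J l\<^esub> (x \<odot>\<^bsub>obj J l\<^esub>
        e') \<in> carrier (obj (tors_complex R (insert x S) J) l)"
      using m by auto
    moreover have "b = x \<odot>\<^bsub>obj J l\<^esub> e' \<oplus>\<^bsub>obj J l\<^esub> (b
        \<oplus>\<^bsub>obj J l\<^esub> \<ominus>\<^bsub>obj J l\<^esub> (x \<odot>\<^bsub>obj J l\<^esub> e'))"
      using bJ e' x by (simp add: J.obj.M.a_lcomm J.obj.M.r_neg)
    ultimately show ?thesis using e'T by (metis tors_complex_sel(3,4))
  qed
  ultimately show ?thesis unfolding bijective_inclusion_def by auto
qed

text \<open>The torsion conditions for the elements of \<open>xs\<close> are imposed one by one.
  Each of them changes the iterated cone by a quasi-isomorphism, because a cone over that very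
  element occurs in it.\<close>

lemma exact_at_kos_tors:
  fixes J :: "('r, 'j) chain_complex"
  assumes R: "cring R" "noetherian_ring R" and J: "cplx R J" "\<forall>l. injective_module R (obj J l)"
    and xs: "set xs \<subseteq> carrier R"
  shows "exact_at (kos R xs (tors_complex R (set xs) J)) l \<longleftrightarrow> exact_at (kos R xs J) l"
proof -
  have "exact_at (kos R xs (tors_complex R S J)) l \<longleftrightarrow> exact_at (kos R xs J) l"
    if "finite S" "S \<subseteq> set xs" for S
    using that
  proof (induction S)
    case empty
    have "tors_complex R {} J = J" by (simp add: tors_complex_def subcomplex_def)
    then show ?case by simp
  next
    case (insert x S)
    have "x \<in> carrier R" "S \<subseteq> carrier R" "x \<in> set xs" using insert.prems xs by auto
    then obtain g where
      "qis R (kos R xs (tors_complex R (insert x S) J)) (kos R xs (tors_complex R S J)) g"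
      using bijective_inclusion_kos_qis[OF bijective_inclusion_tors[OF R J] xs] by blast
    then show ?case using qis_exact_at_iff insert by fastforce
  qed
  then show ?thesis by simp
qed

text \<open>Powers of generators lie in the powers of the ideal, which gives one direction. For the
  other, let the powers with exponents \<open>k x\<close> kill \<open>m\<close>: multiplying
  \<open>m\<close> by a generator lowers the sum of the exponents by one, so induction on this sum
  bounds the power of the ideal that is needed.\<close>

lemma torsion_submodule_eq:
  assumes "module R M" and xs: "set xs \<subseteq> carrier R" and m: "m \<in> carrier M"
  shows "(\<exists>n::nat. \<forall>r\<in>(Idl\<^bsub>R\<^esub> (set xs)) [^]\<^bsub>ideals_set R\<^esub> n. r
      \<odot>\<^bsub>M\<^esub> m = \<zero>\<^bsub>M\<^esub>) \<longleftrightarrow>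
    (\<forall>x\<in>set xs. \<exists>k::nat. (x [^]\<^bsub>R\<^esub> k) \<odot>\<^bsub>M\<^esub> m =
        \<zero>\<^bsub>M\<^esub>)"
proof -
  interpret M: module R M by fact
  let ?a = "Idl\<^bsub>R\<^esub> (set xs)"
  define pw where "pw n = ?a [^]\<^bsub>ideals_set R\<^esub> n" for n :: nat
  have pw0: "pw 0 = carrier R" by (simp add: pw_def nat_pow_def ideals_set_def)
  have pwS: "pw (Suc n) = ideal_prod R (pw n) ?a" for n
    by (simp add: pw_def nat_pow_def ideals_set_def)
  have idl: "ideal ?a R" by (rule M.R.genideal_ideal[OF xs])
  have pwi: "ideal (pw n) R" for n
    by (induction n) (simp_all add: pw0 pwS M.R.oneideal M.R.ideal_prod_is_ideal idl)
  have pwR: "r \<in> carrier R" if "r \<in> pw n" for r n using pwi ideal.Icarr that by metis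
  have gen: "x \<in> ?a" if "x \<in> set xs" for x using that M.R.genideal_self[OF xs] by blast
  have power: "x [^]\<^bsub>R\<^esub> n \<in> pw n" if "x \<in> set xs" for x and n :: nat
    by (induction n) (auto simp: pw0 pwS gen[OF that] intro: ideal_prod.prod)
  define K where "K n m \<longleftrightarrow> (\<forall>r\<in>pw n. r \<odot>\<^bsub>M\<^esub> m =
      \<zero>\<^bsub>M\<^esub>)" for n m
  \<comment> \<open>The elements \<open>j\<close> for which the \<open>n\<close>-th power of the
    ideal kills \<open>j m\<close> form an ideal. It contains the generators and therefore all of
    \<open>?a\<close>.\<close>
  have K_Suc: "K (Suc n) m" if m: "m \<in> carrier M" and K: "\<And>x. x \<in> set xs \<Longrightarrow> K n (x
      \<odot>\<^bsub>M\<^esub> m)" for n m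
  proof -
    let ?T = "{j \<in> carrier R. \<forall>i\<in>pw n. i \<odot>\<^bsub>M\<^esub> (j \<odot>\<^bsub>M\<^esub>
        m) = \<zero>\<^bsub>M\<^esub>}"
    have swap: "i \<odot>\<^bsub>M\<^esub> ((r \<otimes>\<^bsub>R\<^esub> j) \<odot>\<^bsub>M\<^esub> m) = r
        \<odot>\<^bsub>M\<^esub> (i \<odot>\<^bsub>M\<^esub> (j \<odot>\<^bsub>M\<^esub> m))"
      if "i \<in> carrier R" "r \<in> carrier R" "j \<in> carrier R" for i r j
      using that m by (simp add: M.smult_assoc1[symmetric] M.R.m_ac)
    have "ideal ?T R"
    proof (rule idealI)
      show "ring R" by (rule M.R.ring_axioms)
      show "subgroup ?T (add_monoid R)"
        using m pwR by (intro M.R.add.subgroupI)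
          (auto simp: M.smult_l_distr M.smult_r_distr M.smult_l_minus M.smult_r_minus intro!: exI[of _
              "\<zero>\<^bsub>R\<^esub>"])
    next
      fix a x assume a: "a \<in> ?T" and x: "x \<in> carrier R"
      show xa: "x \<otimes>\<^bsub>R\<^esub> a \<in> ?T"
        using a x pwR by (auto simp: swap)
      then show "a \<otimes>\<^bsub>R\<^esub> x \<in> ?T" using a x by (simp add: M.R.m_comm)
    qed
    moreover have "set xs \<subseteq> ?T" using K xs by (auto simp: K_def)
    ultimately have T: "?a \<subseteq> ?T" by (rule M.R.genideal_minimal)
    have "r \<in> carrier R \<and> r \<odot>\<^bsub>M\<^esub> m = \<zero>\<^bsub>M\<^esub>" if "r \<in>
        ideal_prod R (pw n) ?a" for r
      using that
    proof induction
      case (prod i j)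
      then show ?case using T pwR m by (auto simp: M.smult_assoc1 subset_iff)
    next
      case (sum s1 s2)
      then show ?case using m by (simp add: M.smult_l_distr)
    qed
    then show ?thesis by (simp add: K_def pwS)
  qed
  \<comment> \<open>The bound is \<open>Suc N\<close> rather than \<open>N\<close> because of the
    empty list: its sum is 0, the zeroth power is the whole ring, and it takes the first power, the
    zero ideal, to kill every \<open>m\<close>.\<close>
  have main: "K (Suc N) m"
    if "m \<in> carrier M" "\<And>x. x \<in> set xs \<Longrightarrow> (x [^]\<^bsub>R\<^esub> k x)
        \<odot>\<^bsub>M\<^esub> m = \<zero>\<^bsub>M\<^esub>" "(\<Sum>x\<in>set xs. k x) = N"
    for N m and k :: "_ \<Rightarrow> nat"
    using that
  proof (induction N arbitrary: k m)
    case 0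
    then have "m = \<zero>\<^bsub>M\<^esub>" if "x \<in> set xs" for x using that by force
    then show ?case using 0 pwR xs by (intro K_Suc) (auto simp: K_def)
  next
    case (Suc N)
    show ?case
    proof (rule K_Suc[OF Suc.prems(1)])
      fix x assume x: "x \<in> set xs"
      have xR: "x \<in> carrier R" using x xs by blast
      show "K (Suc N) (x \<odot>\<^bsub>M\<^esub> m)"
      proof (cases "k x")
        case 0
        then have "m = \<zero>\<^bsub>M\<^esub>" using Suc.prems(1) Suc.prems(2)[OF x] by simp
        then show ?thesis using xR pwR by (auto simp: K_def)
      next
        case (Suc j)
        show ?thesis
        proof (rule Suc.IH[of _ "k(x := j)"])
          show "x \<odot>\<^bsub>M\<^esub> m \<in> carrier M" using xR Suc.prems by simp
          show "(\<Sum>y\<in>set xs. (k(x := j)) y) = N"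
          proof -
            have "(\<Sum>y\<in>set xs - {x}. (k(x := j)) y) = (\<Sum>y\<in>set xs - {x}. k y)"
              by (rule sum.cong) auto
            then show ?thesis using Suc.prems(3) x Suc by (simp add: sum.remove[of "set xs" x])
          qed
          fix y assume y: "y \<in> set xs"
          then have yR: "y \<in> carrier R" using xs by blast
          show "(y [^]\<^bsub>R\<^esub> (k(x := j)) y) \<odot>\<^bsub>M\<^esub> (x \<odot>\<^bsub>M\<^esub> m)
              = \<zero>\<^bsub>M\<^esub>"
          proof (cases "y = x")
            case True
            then show ?thesis
              using Suc.prems(1) Suc.prems(2)[OF x] Suc xR by (simp add: M.smult_assoc1)
          next
            case False
            have "(y [^]\<^bsub>R\<^esub> k y) \<odot>\<^bsub>M\<^esub> (x \<odot>\<^bsub>M\<^esub> m) = x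
                \<odot>\<^bsub>M\<^esub> ((y [^]\<^bsub>R\<^esub> k y) \<odot>\<^bsub>M\<^esub> m)"
              using Suc.prems(1) xR yR by (simp add: M.smult_assoc1[symmetric] M.R.m_comm)
            then show ?thesis using False Suc.prems(2)[OF y] xR by simp
          qed
        qed
      qed
    qed
  qed
  show ?thesis
  proof
    assume "\<exists>n::nat. \<forall>r\<in>?a [^]\<^bsub>ideals_set R\<^esub> n. r \<odot>\<^bsub>M\<^esub> m
        = \<zero>\<^bsub>M\<^esub>"
    then show "\<forall>x\<in>set xs. \<exists>k::nat. (x [^]\<^bsub>R\<^esub> k) \<odot>\<^bsub>M\<^esub> m =
        \<zero>\<^bsub>M\<^esub>"
      using power unfolding pw_def by blast
  next
    assume "\<forall>x\<in>set xs. \<exists>k::nat. (x [^]\<^bsub>R\<^esub> k) \<odot>\<^bsub>M\<^esub> m =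
        \<zero>\<^bsub>M\<^esub>"
    then obtain k :: "_ \<Rightarrow> nat" where "\<And>x. x \<in> set xs \<Longrightarrow> (x
        [^]\<^bsub>R\<^esub> k x) \<odot>\<^bsub>M\<^esub> m = \<zero>\<^bsub>M\<^esub>" by metis
    then have "K (Suc (\<Sum>x\<in>set xs. k x)) m" using main[OF m] by blast
    then show "\<exists>n::nat. \<forall>r\<in>?a [^]\<^bsub>ideals_set R\<^esub> n. r \<odot>\<^bsub>M\<^esub>
        m = \<zero>\<^bsub>M\<^esub>"
      unfolding K_def pw_def by blast
  qed
qed

lemma torsion_complex_eq:
  assumes "cplx R C" "set xs \<subseteq> carrier R"
  shows "torsion_complex R (Idl\<^bsub>R\<^esub> (set xs)) C = tors_complex R (set xs) C"
proof -
  interpret cplx R C by fact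
  have "torsion_submodule R (Idl\<^bsub>R\<^esub> (set xs)) (obj C l) = (obj C l)
     \<lparr>carrier := {m \<in> carrier (obj C l). \<forall>x\<in>set xs. \<exists>k::nat. (x
         [^]\<^bsub>R\<^esub> k) \<odot>\<^bsub>obj C l\<^esub> m = \<zero>\<^bsub>obj C l\<^esub>}\<rparr>" for l
    proof -
    have "{m \<in> carrier (obj C l). \<exists>n::nat. \<forall>r\<in>(Idl\<^bsub>R\<^esub> (set xs))
        [^]\<^bsub>ideals_set R\<^esub> n. r \<odot>\<^bsub>obj C l\<^esub> m = \<zero>\<^bsub>obj C l\<^esub>} =
        {m \<in> carrier (obj C l). \<forall>x\<in>set xs. \<exists>k::nat. (x [^]\<^bsub>R\<^esub> k)
            \<odot>\<^bsub>obj C l\<^esub> m = \<zero>\<^bsub>obj C l\<^esub>}"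
      by (rule Collect_cong) (rule conj_cong[OF refl torsion_submodule_eq[OF module_obj assms(2)]])
    then show ?thesis by (simp only: torsion_submodule_def)
  qed
  then show ?thesis by (simp add: torsion_complex_def tors_complex_def subcomplex_def)
qed

theorem local_cohomology_vanishing_iff:
  fixes J :: "('r, 'j) chain_complex"
  assumes R: "cring R" "noetherian_ring R" and J: "cplx R J" "\<forall>l. injective_module R (obj J l)"
    and xs: "set xs \<subseteq> carrier R"
  shows "(\<forall>l>t. \<not> nonzero_module (local_cohomology R (Idl\<^bsub>R\<^esub> (set xs)) (- l) J))
      \<longleftrightarrow>
    (\<forall>l>t + int (length xs). exact_at (kos R xs J) l)"
proof -
  interpret J: cplx R J by fact
  interpret T: cplx R "tors_complex R (set xs) J" by (rule J.tors_cplx[OF xs])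
  have "(\<forall>l>t. exact_at (tors_complex R (set xs) J) l) \<longleftrightarrow>
      (\<forall>l>t + int (length xs). exact_at (kos R xs (tors_complex R (set xs) J)) l)"
    by (rule exact_above_kos_iff[OF T.cplx_axioms xs]) auto
  then show ?thesis
    by (simp add: local_cohomology_def torsion_complex_eq[OF J(1) xs] T.nonzero_homology_iff
        exact_at_kos_tors[OF R J xs])
qed

section \<open>K-injective complexes and Ext\<close>

definition null_homotopic ::
  "'r ring \<Rightarrow> ('r, 'a) chain_complex \<Rightarrow> ('r, 'b) chain_complex \<Rightarrow> (int
      \<Rightarrow> 'a \<Rightarrow> 'b) \<Rightarrow> bool" where
  "null_homotopic R X Y f \<longleftrightarrow>
    (\<exists>h. (\<forall>l. h l \<in> module_hom R (obj X l) (obj Y (l + 1))) \<and>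
      (\<forall>l. \<forall>x\<in>carrier (obj X l).
         f l x = diff Y (l + 1) (h l x) \<oplus>\<^bsub>obj Y l\<^esub> h (l - 1) (diff X l x)))"

text \<open>
  The element type \<open>'t\<close> of the test complexes is independent of that of \<open>I\<close>, so that
      the property can be
  stated for the iterated cones of \<open>I\<close> with the test complexes of \<open>I\<close> itself.
\<close>

definition K_inj_wrt :: "'t itself \<Rightarrow> 'r ring \<Rightarrow> ('r, 'e) chain_complex \<Rightarrow>
    bool" where
  "K_inj_wrt T R I \<longleftrightarrow> (\<forall>(X :: ('r, 't) chain_complex) f.
     chain_map R X I f \<and> (\<forall>l. exact_at X l) \<longrightarrow> null_homotopic R X I f)"

section \<open>Hom complexes and K-injectivity as null-homotopy\<close>

lemma module_prod:
  assumes "cring R" "\<And>i. module R (F i)"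
  shows "module R (prod_module F)"
proof -
  interpret F: module R "F i" for i by fact
  show ?thesis
  proof (rule moduleI)
    show "abelian_group (prod_module F)"
    proof (rule abelian_groupI)
      fix z assume "z \<in> carrier (prod_module F)"
      then show "\<exists>y\<in>carrier (prod_module F). y \<oplus>\<^bsub>prod_module F\<^esub> z =
          \<zero>\<^bsub>prod_module F\<^esub>"
        by (intro bexI[of _ "\<lambda>i. \<ominus>\<^bsub>F i\<^esub> z i"]) (auto simp: prod_module_def F.M.l_neg)
    qed (auto simp: prod_module_def F.M.a_ac)
  qed (auto simp: prod_module_def F.smult_l_distr F.smult_r_distr F.smult_assoc1 assms(1))
qed

lemma module_hom_restrict:
  assumes "module R M" "f \<in> module_hom R M N"
  shows "restrict f (carrier M) \<in> module_hom R M N"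
proof -
  interpret M: module R M by fact
  show ?thesis by (rule module_homI) (auto simp: module_homD[OF assms(2)])
qed

lemma module_hom_const_zero:
  assumes "module R N"
  shows "(\<lambda>_. \<zero>\<^bsub>N\<^esub>) \<in> module_hom R M N"
proof -
  interpret N: module R N by fact
  show ?thesis by (rule module_homI) auto
qed

lemma module_hom_module:
  assumes "module R M" "module R N"
  shows "module R (hom_module R M N)"
proof -
  interpret M: module R M by fact
  interpret N: module R N by fact
  let ?H = "hom_module R M N"
  have restr: "restrict f (carrier M) \<in> carrier ?H" if "f \<in> module_hom R M N" for f
    using module_hom_restrict[OF assms(1) that] by (auto simp: hom_module_def)
  have homD: "f \<in> module_hom R M N" "f \<in> extensional (carrier M)" if "f \<in> carrier ?H" for f
    using that by (auto simp: hom_module_def)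
  have closed: "f x \<in> carrier N" if "f \<in> carrier ?H" "x \<in> carrier M" for f x
    using module_homD(1)[OF homD(1)] that .
  show ?thesis
  proof (rule moduleI)
    show "cring R" by (rule module.axioms(1)[OF assms(1)])
    show "abelian_group ?H"
    proof (rule abelian_groupI)
      fix f g assume f: "f \<in> carrier ?H" and g: "g \<in> carrier ?H"
      show "f \<oplus>\<^bsub>?H\<^esub> g \<in> carrier ?H"
        using restr[OF module_hom_add[OF assms(2) homD(1)[OF f] homD(1)[OF g]]] by (simp add: hom_module_def)
      show "f \<oplus>\<^bsub>?H\<^esub> g = g \<oplus>\<^bsub>?H\<^esub> f"
        using closed[OF f] closed[OF g] by (auto simp: hom_module_def N.M.a_comm)
    next
      show "\<zero>\<^bsub>?H\<^esub> \<in> carrier ?H"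
        using restr[OF module_hom_const_zero[OF assms(2)]] by (simp add: hom_module_def)
    next
      fix f assume f: "f \<in> carrier ?H"
      show "\<zero>\<^bsub>?H\<^esub> \<oplus>\<^bsub>?H\<^esub> f = f"
        using closed[OF f] homD(2)[OF f] by (auto simp: hom_module_def extensional_def)
      show "\<exists>g\<in>carrier ?H. g \<oplus>\<^bsub>?H\<^esub> f = \<zero>\<^bsub>?H\<^esub>"
        using restr[OF module_hom_uminus[OF assms(2) homD(1)[OF f]]] closed[OF f]
        by (intro bexI[of _ "\<lambda>x\<in>carrier M. \<ominus>\<^bsub>N\<^esub> f x"]) (auto simp:
            hom_module_def N.M.l_neg)
      fix g h assume g: "g \<in> carrier ?H" and h: "h \<in> carrier ?H"
      show "f \<oplus>\<^bsub>?H\<^esub> g \<oplus>\<^bsub>?H\<^esub> h = f \<oplus>\<^bsub>?H\<^esub> (g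
          \<oplus>\<^bsub>?H\<^esub> h)"
        using closed[OF f] closed[OF g] closed[OF h] by (auto simp: hom_module_def N.M.a_assoc)
    qed
  next
    fix r f assume r: "r \<in> carrier R" and f: "f \<in> carrier ?H"
    show "r \<odot>\<^bsub>?H\<^esub> f \<in> carrier ?H"
      using restr[OF module_hom_smult[OF assms(2) homD(1)[OF f] r]] by (simp add: hom_module_def)
    fix g assume g: "g \<in> carrier ?H"
    show "r \<odot>\<^bsub>?H\<^esub> (f \<oplus>\<^bsub>?H\<^esub> g) = r \<odot>\<^bsub>?H\<^esub> f
        \<oplus>\<^bsub>?H\<^esub> r \<odot>\<^bsub>?H\<^esub> g"
      using r closed[OF f] closed[OF g] by (auto simp: hom_module_def N.smult_r_distr)
  next
    fix r s f assume r: "r \<in> carrier R" and s: "s \<in> carrier R" and f: "f \<in> carrier ?H"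
    show "(r \<oplus>\<^bsub>R\<^esub> s) \<odot>\<^bsub>?H\<^esub> f = r \<odot>\<^bsub>?H\<^esub> f
        \<oplus>\<^bsub>?H\<^esub> s \<odot>\<^bsub>?H\<^esub> f"
      "(r \<otimes>\<^bsub>R\<^esub> s) \<odot>\<^bsub>?H\<^esub> f = r \<odot>\<^bsub>?H\<^esub> (s
          \<odot>\<^bsub>?H\<^esub> f)"
      using r s closed[OF f] by (auto simp: hom_module_def N.smult_l_distr N.smult_assoc1)
  next
    fix f assume f: "f \<in> carrier ?H"
    show "\<one>\<^bsub>R\<^esub> \<odot>\<^bsub>?H\<^esub> f = f"
      using closed[OF f] homD(2)[OF f] by (auto simp: hom_module_def extensional_def)
  qed
qed

locale cplx_pair = X: cplx R X + Y: cplx R Y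
  for R :: "'r ring" and X :: "('r, 'a) chain_complex" and Y :: "('r, 'b) chain_complex"
begin

lemma hom_complex_sel:
  "carrier (obj (hom_complex R X Y) l) =
    {f. \<forall>p. f p \<in> module_hom R (obj X p) (obj Y (p + l)) \<and> f p \<in> extensional (carrier (obj
        X p))}"
  "\<zero>\<^bsub>obj (hom_complex R X Y) l\<^esub> = (\<lambda>p. \<lambda>x\<in>carrier (obj X p).
      \<zero>\<^bsub>obj Y (p + l)\<^esub>)"
  "(f \<oplus>\<^bsub>obj (hom_complex R X Y) l\<^esub> g) = (\<lambda>p. \<lambda>x\<in>carrier (obj X p). f p
      x \<oplus>\<^bsub>obj Y (p + l)\<^esub> g p x)"
  "(r \<odot>\<^bsub>obj (hom_complex R X Y) l\<^esub> f) = (\<lambda>p. \<lambda>x\<in>carrier (obj X p). r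
      \<odot>\<^bsub>obj Y (p + l)\<^esub> f p x)"
  "diff (hom_complex R X Y) l f = (\<lambda>p. \<lambda>x\<in>carrier (obj X p). diff Y (p + l) (f p x)
      \<ominus>\<^bsub>obj Y (p + l - 1)\<^esub> parity_sign (obj Y (p + l - 1)) l (f (p - 1) (diff X p x)))"
  by (auto simp: hom_complex_def prod_module_def hom_module_def)

lemma module_hom_complex: "module R (obj (hom_complex R X Y) l)"
  by (simp add: hom_complex_def module_prod[OF X.cring] module_hom_module X.module_obj Y.module_obj)

lemma diff_hom_complex_hom:
  "diff (hom_complex R X Y) l \<in> module_hom R (obj (hom_complex R X Y) l) (obj (hom_complex R X Y) (l - 1))"
proof -
  have idx: "p + (l - 1) = p + l - 1" "p - 1 + l = p + l - 1" for p :: int by simp_all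
  have comp1: "f p x \<in> carrier (obj Y (p + l))"
    if f: "f \<in> carrier (obj (hom_complex R X Y) l)" and x: "x \<in> carrier (obj X p)" for f p x
  proof -
    have "f p \<in> module_hom R (obj X p) (obj Y (p + l))" using f unfolding hom_complex_sel by blast
    then show ?thesis using x by (rule module_homD(1))
  qed
  have comp2: "f (p - 1) y \<in> carrier (obj Y (p + l - 1))"
    if f: "f \<in> carrier (obj (hom_complex R X Y) l)" and y: "y \<in> carrier (obj X (p - 1))" for f p y
    using comp1[OF f y] by (simp only: idx)
  note comp = comp1 comp2
  show ?thesis
  proof (rule module_homI)
    fix f assume f: "f \<in> carrier (obj (hom_complex R X Y) l)"
    have "(\<lambda>x. diff Y (p + l) (f p x)) \<in> module_hom R (obj X p) (obj Y (p + l - 1))" for p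
    proof -
      have "f p \<in> module_hom R (obj X p) (obj Y (p + l))" using f unfolding hom_complex_sel by blast
      then show ?thesis by (rule module_hom_comp[OF _ Y.diff_hom])
    qed
    moreover have "(\<lambda>x. f (p - 1) (diff X p x)) \<in> module_hom R (obj X p) (obj Y (p + l - 1))" for p
    proof -
      have "f (p - 1) \<in> module_hom R (obj X (p - 1)) (obj Y (p - 1 + l))"
        using f unfolding hom_complex_sel by blast
      then show ?thesis unfolding idx(2) by (rule module_hom_comp[OF X.diff_hom])
    qed
    ultimately have "(\<lambda>x. diff Y (p + l) (f p x) \<ominus>\<^bsub>obj Y (p + l - 1)\<^esub>
        parity_sign (obj Y (p + l - 1)) l (f (p - 1) (diff X p x)))
        \<in> module_hom R (obj X p) (obj Y (p + l - 1))" for p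
      unfolding a_minus_def parity_sign_def
      by (cases "even l") (simp_all add: module_hom_add module_hom_uminus Y.module_obj)
    note restr = module_hom_restrict[OF X.module_obj this]
    show "diff (hom_complex R X Y) l f \<in> carrier (obj (hom_complex R X Y) (l - 1))"
      by (simp add: hom_complex_sel idx(1) restr)
    show "diff (hom_complex R X Y) l (r \<odot>\<^bsub>obj (hom_complex R X Y) l\<^esub> f) =
        r \<odot>\<^bsub>obj (hom_complex R X Y) (l - 1)\<^esub> diff (hom_complex R X Y) l f" if r: "r \<in>
            carrier R" for r
      using comp[OF f] r by (auto simp: hom_complex_sel(4,5) idx parity_sign_def a_minus_def fun_eq_iff Y.diff_smult
          Y.obj.smult_r_distr Y.obj.smult_r_minus)
    fix g assume g: "g \<in> carrier (obj (hom_complex R X Y) l)"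
    show "diff (hom_complex R X Y) l (f \<oplus>\<^bsub>obj (hom_complex R X Y) l\<^esub> g) =
        diff (hom_complex R X Y) l f \<oplus>\<^bsub>obj (hom_complex R X Y) (l - 1)\<^esub> diff (hom_complex
            R X Y) l g"
      using comp[OF f] comp[OF g]
      by (auto simp: hom_complex_sel(3,5) idx parity_sign_def a_minus_def fun_eq_iff Y.diff_add
          Y.obj.M.minus_add Y.obj.M.a_ac)
  qed
qed

lemma nonzero_homology_hom_complex:
  "nonzero_module (homology (hom_complex R X Y) l) \<longleftrightarrow> \<not> exact_at (hom_complex R X Y) l"
  using diff_hom_complex_hom[of "l + 1"] module_hom_zero[OF module_hom_complex module_hom_complex
      diff_hom_complex_hom]
  by (intro nonzero_homology_iff[OF module_hom_complex module_hom_complex]) simp_all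

end

text \<open>A chain map, restricted to the carriers, is a cycle of degree 0 in the Hom complex. A
  preimage in degree 1 is a homotopy: in this degree the sign in the differential turns the
  difference \<open>d h - (-1) h d\<close> into the sum that a homotopy requires.\<close>

lemma K_injective_K_inj_wrt:
  fixes I :: "('r, 'e) chain_complex"
  assumes "K_injective R I"
  shows "K_inj_wrt TYPE('e + 'r list) R I"
  unfolding K_inj_wrt_def
proof (intro allI impI, elim conjE)
  fix X :: "('r, 'e + 'r list) chain_complex" and f
  assume f: "chain_map R X I f" and ex: "\<forall>l. exact_at X l"
  interpret cplx_pair R X I
    unfolding cplx_pair_def using chain_mapD(1,2)[OF f] by simp
  note fD = chain_mapD(4-)[OF f]
  have "acyclic_complex X" using ex by (simp add: acyclic_complex_def X.nonzero_homology_iff)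
  then have "acyclic_complex (hom_complex R X I)"
    using assms X.is_complex unfolding K_injective_def by blast
  then have "exact_at (hom_complex R X I) 0"
    unfolding acyclic_complex_def by (simp add: nonzero_homology_hom_complex)
  moreover define F where "F p = restrict (f p) (carrier (obj X p))" for p
  have "F \<in> carrier (obj (hom_complex R X I) 0)"
    using module_hom_restrict[OF X.module_obj chain_mapD(3)[OF f]] by (simp add: hom_complex_sel F_def)
  moreover have "diff (hom_complex R X I) 0 F = \<zero>\<^bsub>obj (hom_complex R X I) (0 - 1)\<^esub>"
    by (auto simp: hom_complex_sel F_def fun_eq_iff fD parity_sign_def a_minus_def Y.obj.M.r_neg)
  ultimately obtain h where h: "h \<in> carrier (obj (hom_complex R X I) 1)"
    and hF: "diff (hom_complex R X I) 1 h = F"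
    using exact_atD[of "hom_complex R X I" 0 F] by auto
  have "f l x = diff I (l + 1) (h l x) \<oplus>\<^bsub>obj I l\<^esub> h (l - 1) (diff X l x)" if x: "x \<in>
      carrier (obj X l)" for l x
  proof -
    have "h (l - 1) \<in> module_hom R (obj X (l - 1)) (obj I (l - 1 + 1))"
      using h unfolding hom_complex_sel by blast
    then have "h (l - 1) (diff X l x) \<in> carrier (obj I l)"
      using module_homD(1)[of "h (l - 1)"] x by force
    then show ?thesis
      using fun_cong[OF fun_cong[OF hF, of l], of x] x
      by (simp add: hom_complex_sel F_def parity_sign_def a_minus_def)
  qed
  then show "null_homotopic R X I f"
    unfolding null_homotopic_def using h by (auto simp: hom_complex_sel)
qed

text \<open>Transport along \<open>e\<close> turns \<open>X\<close> into a test complex of the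
  prescribed element type, and the homotopy is pulled back along \<open>e\<close>. It is enough that
  \<open>e\<close> is injective on each term, so different terms may overlap after
  transport.\<close>

lemma K_inj_wrt_null_homotopic:
  fixes e :: "'x \<Rightarrow> 't"
  assumes K: "K_inj_wrt TYPE('t) R I" and f: "chain_map R X I f" and ex: "\<And>l. exact_at X l"
    and e: "\<And>l. inj_on e (carrier (obj X l))"
  shows "null_homotopic R X I f"
proof -
  interpret X: cplx R X by (rule chain_mapD[OF f])
  interpret I: cplx R I by (rule chain_mapD[OF f])
  define e' where "e' l = inv_into (carrier (obj X l)) e" for l
  have inv: "e' l (e x) = x" if "x \<in> carrier (obj X l)" for l x
    using that e by (simp add: e'_def)
  let ?X = "transport_complex e e' X"
  interpret T: cplx R ?X by (rule X.transport_cplx[of e' e, OF inv])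
  have "chain_map R ?X I (\<lambda>l y. f l (e' l y))"
    unfolding chain_map_def
  proof (intro conjI allI ballI)
    fix l
    show "(\<lambda>y. f l (e' l y)) \<in> module_hom R (obj ?X l) (obj I l)"
      using transport_hom(2)[of R "obj X l" "e' l" e, OF X.module_obj inv] chain_mapD(3)[OF f] by (auto intro:
          module_hom_comp)
    show "diff I l (f l (e' l y)) = f (l - 1) (e' (l - 1) (diff ?X l y))" if "y \<in> carrier (obj ?X l)" for y
      using that by (auto simp: inv chain_mapD(9)[OF f])
  qed (use T.is_complex I.is_complex in auto)
  moreover have "exact_at ?X l" for l using ex X.exact_at_transport[of e' e, OF inv] by simp
  ultimately have "null_homotopic R ?X I (\<lambda>l y. f l (e' l y))"
    using K unfolding K_inj_wrt_def by blast
  then obtain h where h: "\<And>l. h l \<in> module_hom R (obj ?X l) (obj I (l + 1))"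
    and hf: "\<And>l y. y \<in> carrier (obj ?X l) \<Longrightarrow>
      f l (e' l y) = diff I (l + 1) (h l y) \<oplus>\<^bsub>obj I l\<^esub> h (l - 1) (diff ?X l y)"
    unfolding null_homotopic_def by blast
  show ?thesis
    unfolding null_homotopic_def
  proof (intro exI[of _ "\<lambda>l x. h l (e x)"] conjI allI ballI)
    fix l
    show "(\<lambda>x. h l (e x)) \<in> module_hom R (obj X l) (obj I (l + 1))"
      using transport_hom(1)[of R "obj X l" "e' l" e, OF X.module_obj inv] h by (auto intro: module_hom_comp)
    show "f l x = diff I (l + 1) (h l (e x)) \<oplus>\<^bsub>obj I l\<^esub> h (l - 1) (e (diff X l x))"
      if "x \<in> carrier (obj X l)" for x
      using hf[of "e x" l] that by (simp add: inv)
  qed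
qed

lemma K_inj_wrt_leaf:
  assumes K: "K_inj_wrt TYPE('t) R I" and I: "cplx R I"
  shows "K_inj_wrt TYPE('t) R (leaf_complex I)"
  unfolding K_inj_wrt_def
proof (intro allI impI, elim conjE)
  fix X :: "('a, 't) chain_complex" and f
  assume f: "chain_map R X (leaf_complex I) f" and ex: "\<forall>l. exact_at X l"
  interpret X: cplx R X by (rule chain_mapD[OF f])
  interpret I: cplx R I by fact
  have leaf: "Leaf (leaf_val (f l x)) = f l x" "leaf_val (f l x) \<in> carrier (obj I l)"
    if "x \<in> carrier (obj X l)" for l x
    using chain_mapD(4)[OF f that] by auto
  have "chain_map R X I (\<lambda>l x. leaf_val (f l x))"
    unfolding chain_map_def
  proof (intro conjI allI ballI)
    fix l
    show "(\<lambda>x. leaf_val (f l x)) \<in> module_hom R (obj X l) (obj I l)"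
      using transport_hom(2)[of R "obj I l" leaf_val Leaf] I.module_obj chain_mapD(3)[OF f]
      by (auto intro: module_hom_comp)
    show "diff I l (leaf_val (f l x)) = leaf_val (f (l - 1) (diff X l x))" if "x \<in> carrier (obj X l)" for x
      using chain_mapD(9)[OF f that, symmetric] by simp
  qed (use X.is_complex I.is_complex in auto)
  then obtain h where h: "\<And>l. h l \<in> module_hom R (obj X l) (obj I (l + 1))"
    and hf: "\<And>l x. x \<in> carrier (obj X l) \<Longrightarrow>
      leaf_val (f l x) = diff I (l + 1) (h l x) \<oplus>\<^bsub>obj I l\<^esub> h (l - 1) (diff X l x)"
    using K ex unfolding K_inj_wrt_def null_homotopic_def by blast
  show "null_homotopic R X (leaf_complex I) f"
    unfolding null_homotopic_def
  proof (intro exI[of _ "\<lambda>l x. Leaf (h l x)"] conjI allI ballI)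
    fix l
    show "(\<lambda>x. Leaf (h l x)) \<in> module_hom R (obj X l) (obj (leaf_complex I) (l + 1))"
      using transport_hom(1)[of R "obj I (l + 1)" leaf_val Leaf] I.module_obj h
      by (auto intro: module_hom_comp)
    show "f l x = diff (leaf_complex I) (l + 1) (Leaf (h l x)) \<oplus>\<^bsub>obj (leaf_complex I) l\<^esub>
        Leaf (h (l - 1) (diff X l x))" if "x \<in> carrier (obj X l)" for x
      using hf[OF that] leaf(1)[OF that, symmetric] by simp
  qed
qed

text \<open>The cone is an extension of a shift of \<open>C\<close> by \<open>C\<close>. So a map
  into it is contracted in two steps: first its component \<open>v\<close> in the shift, by a
  homotopy \<open>b\<close>, and then its component in \<open>C\<close>, corrected by means of
  \<open>b\<close>.\<close>

lemma K_inj_wrt_cone: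
  assumes K: "K_inj_wrt TYPE('t) R C" and C: "tree_cplx R C" and x: "x \<in> carrier R"
  shows "K_inj_wrt TYPE('t) R (cone R x C)"
  unfolding K_inj_wrt_def
proof (intro allI impI, elim conjE)
  fix X :: "('a, 't) chain_complex" and f
  assume f: "chain_map R X (cone R x C) f" and ex: "\<forall>l. exact_at X l"
  interpret X: cplx R X by (rule chain_mapD[OF f])
  interpret C: tree_cplx R C by fact
  define u where "u l y = lft (f l y)" for l y
  define v where "v l y = rgt (f l y)" for l y
  have fuv: "f l y = Node (u l y) (v l y)" if "y \<in> carrier (obj X l)" for l y
    using chain_mapD(4)[OF f that] by (auto simp: u_def v_def)
  have uC: "u l y \<in> carrier (obj C l)" and vC: "v l y \<in> carrier (obj C (l - 1))"
    if "y \<in> carrier (obj X l)" for l y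
    using chain_mapD(4)[OF f that] by (auto simp: u_def v_def)
  have u: "u l \<in> module_hom R (obj X l) (obj C l)" and v: "v l \<in> module_hom R (obj X l) (obj C (l - 1))" for l
    using uC vC chain_mapD(5,6)[OF f] by (auto intro!: module_homI simp: fuv)
  have du: "diff C l (u l y) \<oplus>\<^bsub>obj C (l - 1)\<^esub> x \<odot>\<^bsub>obj C (l - 1)\<^esub> v l y
      = u (l - 1) (diff X l y)"
    and dv: "\<ominus>\<^bsub>obj C (l - 1 - 1)\<^esub> diff C (l - 1) (v l y) = v (l - 1) (diff X l y)"
    if "y \<in> carrier (obj X l)" for l y
    using chain_mapD(9)[OF f that] that by (simp_all add: fuv)
  \<comment> \<open>\<open>v\<close> lowers the degree by one and anticommutes with the
    differentials. On the shift of \<open>X\<close> with negated differential it becomes a chain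
    map.\<close>
  define X' where "X' = \<lparr>obj = (\<lambda>l. obj X (l + 1)), diff = (\<lambda>l y. \<ominus>\<^bsub>obj X
      l\<^esub> diff X (l + 1) y)\<rparr>"
  have X': "is_complex R X'"
    unfolding is_complex_def X'_def using X.diff_hom[of "l + 1" for l]
    by (auto intro!: X.module_obj module_hom_uminus simp: X.diff_neg)
  have "chain_map R X' C (\<lambda>l. v (l + 1))"
    unfolding chain_map_def
  proof (intro conjI allI ballI)
    fix l
    show "v (l + 1) \<in> module_hom R (obj X' l) (obj C l)" using v[of "l + 1"] by (simp add: X'_def)
    show "diff C l (v (l + 1) y) = v (l - 1 + 1) (diff X' l y)" if "y \<in> carrier (obj X' l)" for y
    proof -
      have y: "y \<in> carrier (obj X (l + 1))" using that by (simp add: X'_def)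
      have "v l (diff X (l + 1) y) = \<ominus>\<^bsub>obj C (l - 1)\<^esub> diff C l (v (l + 1) y)"
        using dv[OF y] by simp
      then show ?thesis
        using y vC[OF y] module_hom_neg[OF X.module_obj C.module_obj v, of _ l] by (simp add: X'_def)
    qed
  qed (use X' C.is_complex in auto)
  moreover have "exact_at X' l" for l
  proof -
    have "\<exists>w\<in>carrier (obj X (l + 1 + 1)). \<ominus>\<^bsub>obj X (l + 1)\<^esub> diff X (l + 1 + 1) w = y"
      if y: "y \<in> carrier (obj X (l + 1))" and dy: "\<ominus>\<^bsub>obj X l\<^esub> diff X (l + 1) y =
          \<zero>\<^bsub>obj X l\<^esub>" for y
    proof -
      have "diff X (l + 1) y = \<zero>\<^bsub>obj X (l + 1 - 1)\<^esub>"
        using dy y by (simp add: X.obj.M.add.inv_eq_1_iff)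
      then obtain w where w: "w \<in> carrier (obj X (l + 1 + 1))" "diff X (l + 1 + 1) w = y"
        using exact_atD[OF ex[rule_format] y] by blast
      have "diff X (l + 1 + 1) (\<ominus>\<^bsub>obj X (l + 1 + 1)\<^esub> w) = \<ominus>\<^bsub>obj X (l +
          1)\<^esub> y"
        using X.diff_neg[OF w(1)] unfolding w(2) add_diff_cancel_right' .
      then show ?thesis
        using w y by (intro bexI[of _ "\<ominus>\<^bsub>obj X (l + 1 + 1)\<^esub> w"]) (simp_all del: add.assoc)
    qed
    then show ?thesis unfolding exact_at_def X'_def by simp
  qed
  ultimately obtain b' where b': "\<And>l. b' l \<in> module_hom R (obj X' l) (obj C (l + 1))"
    and b'v: "\<And>l y. y \<in> carrier (obj X' l) \<Longrightarrow>
      v (l + 1) y = diff C (l + 1) (b' l y) \<oplus>\<^bsub>obj C l\<^esub> b' (l - 1) (diff X' l y)"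
    using K unfolding K_inj_wrt_def null_homotopic_def by blast
  define b where "b l = b' (l - 1)" for l
  have b: "b l \<in> module_hom R (obj X l) (obj C l)" for l
    using b'[of "l - 1"] by (simp add: b_def X'_def)
  note bC = module_homD(1)[OF b]
  have bv: "v l y = diff C l (b l y) \<oplus>\<^bsub>obj C (l - 1)\<^esub> \<ominus>\<^bsub>obj C (l -
      1)\<^esub> b (l - 1) (diff X l y)"
    if "y \<in> carrier (obj X l)" for l y
    using b'v[of y "l - 1"] that module_hom_neg[OF X.module_obj C.module_obj b, of "diff X l y" "l - 1"]
    by (simp add: b_def X'_def)
  \<comment> \<open>\<open>u\<close> fails to be a chain map by the term \<open>x v\<close>. Since
    \<open>b\<close> is a homotopy for \<open>v\<close>, adding \<open>x b\<close> repairs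
    this.\<close>
  define w where "w l y = u l y \<oplus>\<^bsub>obj C l\<^esub> x \<odot>\<^bsub>obj C l\<^esub> b l y" for l y
  have "chain_map R X C w"
    unfolding chain_map_def
  proof (intro conjI allI ballI)
    fix l
    show "w l \<in> module_hom R (obj X l) (obj C l)"
      unfolding w_def by (intro module_hom_add module_hom_smult C.module_obj u b x)
    fix y assume y: "y \<in> carrier (obj X l)"
    have "diff C l (u l y) \<oplus>\<^bsub>obj C (l - 1)\<^esub> x \<odot>\<^bsub>obj C (l - 1)\<^esub> diff C
        l (b l y) =
        (diff C l (u l y) \<oplus>\<^bsub>obj C (l - 1)\<^esub> x \<odot>\<^bsub>obj C (l - 1)\<^esub> v l y)
            \<oplus>\<^bsub>obj C (l - 1)\<^esub>
        x \<odot>\<^bsub>obj C (l - 1)\<^esub> b (l - 1) (diff X l y)"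
      using y uC bC x by (simp add: bv C.obj.smult_r_distr C.obj.smult_r_minus C.obj.M.a_assoc C.obj.M.l_neg)
    then show "diff C l (w l y) = w (l - 1) (diff X l y)"
      using y uC bC x by (simp add: w_def C.diff_add C.diff_smult du)
  qed (use X.is_complex C.is_complex in auto)
  then obtain a where a: "\<And>l. a l \<in> module_hom R (obj X l) (obj C (l + 1))"
    and aw: "\<And>l y. y \<in> carrier (obj X l) \<Longrightarrow>
      w l y = diff C (l + 1) (a l y) \<oplus>\<^bsub>obj C l\<^esub> a (l - 1) (diff X l y)"
    using K ex unfolding K_inj_wrt_def null_homotopic_def by blast
  note aC = module_homD(1)[OF a]
  have aC': "a (l - 1) y \<in> carrier (obj C l)" if "y \<in> carrier (obj X (l - 1))" for l y
    using aC[OF that] by simp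
  show "null_homotopic R X (cone R x C) f"
    unfolding null_homotopic_def
  proof (intro exI[of _ "\<lambda>l y. Node (a l y) (\<ominus>\<^bsub>obj C l\<^esub> b l y)"] conjI allI ballI)
    fix l
    show "(\<lambda>y. Node (a l y) (\<ominus>\<^bsub>obj C l\<^esub> b l y)) \<in> module_hom R (obj X l) (obj
        (cone R x C) (l + 1))"
      using module_homD[OF a] module_homD[OF module_hom_uminus[OF C.module_obj b]]
      by (intro module_homI) auto
    fix y assume y: "y \<in> carrier (obj X l)"
    have "u l y = w l y \<oplus>\<^bsub>obj C l\<^esub> \<ominus>\<^bsub>obj C l\<^esub> (x \<odot>\<^bsub>obj
        C l\<^esub> b l y)"
      using y uC bC x by (simp add: w_def C.obj.M.a_assoc C.obj.M.r_neg)
    then show "f l y = diff (cone R x C) (l + 1) (Node (a l y) (\<ominus>\<^bsub>obj C l\<^esub> b l y))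
        \<oplus>\<^bsub>obj (cone R x C) l\<^esub>
        Node (a (l - 1) (diff X l y)) (\<ominus>\<^bsub>obj C (l - 1)\<^esub> b (l - 1) (diff X l y))"
      using y aC aC' bC x
      by (simp add: fuv aw bv C.diff_neg C.obj.smult_r_minus C.obj.M.a_ac)
  qed
qed

lemma K_inj_wrt_kos:
  assumes K: "K_inj_wrt TYPE('t) R I" and I: "cplx R I" and xs: "set xs \<subseteq> carrier R"
  shows "K_inj_wrt TYPE('t) R (kos R xs I)"
  using xs
proof (induction xs)
  case (Cons x xs)
  then show ?case
    using cplx.kos_cplx[OF I, of xs] by (auto intro!: K_inj_wrt_cone simp: tree_cplx_def)
qed (simp add: K_inj_wrt_leaf[OF K I])

section \<open>Homomorphisms from subquotients of the ring\<close>

text \<open>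
  For ideals \<open>B \<subseteq> A\<close>, a map out of the module \<open>A/B\<close> is represented by a map
      on \<open>A\<close> that vanishes on \<open>B\<close>.
  The condition says that \<open>Hom(A/B, C)\<close> has no homology in degree \<open>l\<close>.
\<close>

definition hom_exact :: "'r ring \<Rightarrow> 'r set \<Rightarrow> 'r set \<Rightarrow> ('r, 'm) chain_complex
    \<Rightarrow> int \<Rightarrow> bool" where
  "hom_exact R A B C l \<longleftrightarrow>
    (\<forall>f\<in>module_hom R ((regular_module R)\<lparr>carrier := A\<rparr>) (obj C l).
       (\<forall>b\<in>B. f b = \<zero>\<^bsub>obj C l\<^esub>) \<longrightarrow> (\<forall>a\<in>A. diff C l
           (f a) = \<zero>\<^bsub>obj C (l - 1)\<^esub>) \<longrightarrow>
       (\<exists>g\<in>module_hom R ((regular_module R)\<lparr>carrier := A\<rparr>) (obj C (l + 1)).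
          (\<forall>b\<in>B. g b = \<zero>\<^bsub>obj C (l + 1)\<^esub>) \<and> (\<forall>a\<in>A. diff C (l +
              1) (g a) = f a)))"

lemma hom_exactD:
  assumes "hom_exact R A B C l"
    and "f \<in> module_hom R ((regular_module R)\<lparr>carrier := A\<rparr>) (obj C l)"
    and "\<And>b. b \<in> B \<Longrightarrow> f b = \<zero>\<^bsub>obj C l\<^esub>" "\<And>a. a \<in> A
        \<Longrightarrow> diff C l (f a) = \<zero>\<^bsub>obj C (l - 1)\<^esub>"
  shows "\<exists>g\<in>module_hom R ((regular_module R)\<lparr>carrier := A\<rparr>) (obj C (l + 1)).
    (\<forall>b\<in>B. g b = \<zero>\<^bsub>obj C (l + 1)\<^esub>) \<and> (\<forall>a\<in>A. diff C (l + 1) (g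
        a) = f a)"
  using assms unfolding hom_exact_def by blast

text \<open>For an ideal \<open>S\<close> this is the complex of homomorphisms from
  \<open>R/S\<close> to \<open>C\<close>, a homomorphism being identified with its value at 1. For
  \<open>S = {}\<close> it is \<open>C\<close> itself.\<close>

definition annihilated :: "'r set \<Rightarrow> ('r, 'm) chain_complex \<Rightarrow> ('r, 'm) chain_complex" where
  "annihilated S C = subcomplex C (\<lambda>l. {z \<in> carrier (obj C l). \<forall>r\<in>S. r
      \<odot>\<^bsub>obj C l\<^esub> z = \<zero>\<^bsub>obj C l\<^esub>})"

lemma annihilated_sel [simp]:
  "carrier (obj (annihilated S C) l) = {z \<in> carrier (obj C l). \<forall>r\<in>S. r \<odot>\<^bsub>obj C
      l\<^esub> z = \<zero>\<^bsub>obj C l\<^esub>}"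
  "zero (obj (annihilated S C) l) = zero (obj C l)"
  "add (obj (annihilated S C) l) = add (obj C l)"
  "smult (obj (annihilated S C) l) = smult (obj C l)"
  "diff (annihilated S C) = diff C"
  by (simp_all add: annihilated_def)

lemma (in cplx) submodule_annihilated:
  assumes S: "S \<subseteq> carrier R"
  shows "submodule {z \<in> carrier (obj C l). \<forall>r\<in>S. r \<odot>\<^bsub>obj C l\<^esub> z =
      \<zero>\<^bsub>obj C l\<^esub>} R (obj C l)"
proof (rule obj.submoduleI)
  fix r a assume r: "r \<in> carrier R"
    and a: "a \<in> {z \<in> carrier (obj C l). \<forall>r\<in>S. r \<odot>\<^bsub>obj C l\<^esub> z =
        \<zero>\<^bsub>obj C l\<^esub>}"
  have "s \<odot>\<^bsub>obj C l\<^esub> (r \<odot>\<^bsub>obj C l\<^esub> a) = r \<odot>\<^bsub>obj C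
      l\<^esub> (s \<odot>\<^bsub>obj C l\<^esub> a)" if "s \<in> S" for s
  proof -
    have "s \<in> carrier R" "a \<in> carrier (obj C l)" using that S a by auto
    then show ?thesis using r by (metis obj.smult_assoc1 obj.R.m_comm)
  qed
  then show "r \<odot>\<^bsub>obj C l\<^esub> a \<in> {z \<in> carrier (obj C l). \<forall>r\<in>S. r
      \<odot>\<^bsub>obj C l\<^esub> z = \<zero>\<^bsub>obj C l\<^esub>}"
    using r a by simp
qed (use S in \<open>auto simp: obj.smult_r_distr obj.smult_r_minus subset_iff\<close>)

text \<open>The two uses are an ideal \<open>S\<close>, and \<open>S = {}\<close> for a complex that
  is itself exact above \<open>t\<close>. The condition that \<open>S\<close> moves \<open>A\<close>
  into \<open>B\<close> makes homomorphisms on \<open>A/B\<close> take values in the elements killed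
  by \<open>S\<close>. There a null-homotopy provides a linear section of the differential, and
  composition with it lifts the homomorphism.\<close>

lemma hom_exact_above:
  fixes e :: "'e \<Rightarrow> 't"
  assumes K: "K_inj_wrt TYPE('t) R I" and I: "cplx R I" and S: "S \<subseteq> carrier R"
    and e: "\<And>l. inj_on e (carrier (obj I l))"
    and ex: "\<And>l. t < l \<Longrightarrow> exact_at (annihilated S I) l"
    and AB: "A \<subseteq> carrier R" "B \<subseteq> A" "\<And>s a. s \<in> S \<Longrightarrow> a \<in> A
        \<Longrightarrow> s \<otimes>\<^bsub>R\<^esub> a \<in> B"
    and l: "t < l"
  shows "hom_exact R A B I l"
proof -
  interpret I: cplx R I by fact
  let ?S = "\<lambda>i. {z \<in> carrier (obj I i). \<forall>r\<in>S. r \<odot>\<^bsub>obj I i\<^esub> z =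
      \<zero>\<^bsub>obj I i\<^esub>}"
  have dS: "diff I i z \<in> ?S (i - 1)" if "z \<in> ?S i" for i z
    using that S by (auto simp: subset_iff simp flip: I.diff_smult)
  \<comment> \<open>The truncation of the annihilated subcomplex: everything above degree
    \<open>l\<close>, the cycles in degree \<open>l\<close>, zero below. It is acyclic in degree
    \<open>l\<close> as well, since \<open>l > t\<close> makes the differential from degree
    \<open>l + 1\<close> onto these cycles.\<close>
  define c where "c i = (if i < l then {\<zero>\<^bsub>obj I i\<^esub>} else
    if i = l then {z \<in> ?S l. diff I l z = \<zero>\<^bsub>obj I (l - 1)\<^esub>} else ?S i)" for i
  have cS: "z \<in> ?S i" if "z \<in> c i" for z i
    using that S by (auto simp: c_def subset_iff split: if_splits)
  have "submodule {\<zero>\<^bsub>obj I i\<^esub>} R (obj I i)" for i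
    by (rule I.obj.submoduleI) auto
  moreover have "submodule {z \<in> ?S l. diff I l z = \<zero>\<^bsub>obj I (l - 1)\<^esub>} R (obj I l)"
    using I.obj.submoduleE[OF I.submodule_annihilated[OF S]]
    by (intro I.obj.submoduleI) (use S in \<open>auto simp: I.diff_add I.diff_neg I.diff_smult subset_iff\<close>)
  ultimately have "submodule (c i) R (obj I i)" for i
    using I.submodule_annihilated[OF S] by (simp add: c_def)
  moreover have "diff I i z \<in> c (i - 1)" if "z \<in> c i" for i z
    using that dS[of z i] cS[OF that] by (auto simp: c_def split: if_splits)
  ultimately interpret X: cplx R "subcomplex I c" by (rule I.subcomplex_cplx)
  have Xex: "exact_at (subcomplex I c) i" for i
    unfolding exact_at_def
  proof (intro ballI impI)
    fix z assume z: "z \<in> carrier (obj (subcomplex I c) i)"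
      and dz: "diff (subcomplex I c) i z = \<zero>\<^bsub>obj (subcomplex I c) (i - 1)\<^esub>"
    show "\<exists>w\<in>carrier (obj (subcomplex I c) (i + 1)). diff (subcomplex I c) (i + 1) w = z"
    proof (cases "i < l")
      case True
      then have "z = \<zero>\<^bsub>obj I i\<^esub>" using z by (simp add: c_def)
      then show ?thesis
        using X.obj.M.zero_closed[of "i + 1"] by (intro bexI[of _ "\<zero>\<^bsub>obj I (i + 1)\<^esub>"]) simp_all
    next
      case False
      then show ?thesis
        using exact_atD[OF ex[of i], of z] cS[of z i] z dz l by (simp add: c_def[of "i + 1"])
    qed
  qed
  have "chain_map R (subcomplex I c) I (\<lambda>_ z. z)"
    unfolding chain_map_def using X.is_complex I.is_complex cS by (auto intro!: module_homI)
  from K_inj_wrt_null_homotopic[OF K this Xex, of e]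
  have "null_homotopic R (subcomplex I c) I (\<lambda>_ z. z)"
    using e cS by (simp add: inj_on_def) blast
  then obtain h where h: "\<And>i. h i \<in> module_hom R (obj (subcomplex I c) i) (obj I (i + 1))"
    and hz: "\<And>i z. z \<in> c i \<Longrightarrow> z = diff I (i + 1) (h i z) \<oplus>\<^bsub>obj I
        i\<^esub> h (i - 1) (diff I i z)"
    unfolding null_homotopic_def by auto
  \<comment> \<open>On cycles the second term of the homotopy is the value of a linear map at zero.
    What remains says that \<open>h l\<close> is a linear section of the differential.\<close>
  have split: "diff I (l + 1) (h l z) = z" if z: "z \<in> c l" for z
  proof -
    have "h (l - 1) \<zero>\<^bsub>obj I (l - 1)\<^esub> = \<zero>\<^bsub>obj I l\<^esub>"
      using module_hom_zero[OF X.module_obj I.module_obj h, of "l - 1"] by simp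
    moreover have "diff I l z = \<zero>\<^bsub>obj I (l - 1)\<^esub>" using z by (simp add: c_def)
    moreover have "h l z \<in> carrier (obj I (l + 1))" using module_homD(1)[OF h, of z l] z by simp
    ultimately show ?thesis using hz[OF z] by simp
  qed
  show ?thesis
    unfolding hom_exact_def
  proof (intro ballI impI)
    fix f assume f: "f \<in> module_hom R ((regular_module R)\<lparr>carrier := A\<rparr>) (obj I l)"
      and fB: "\<forall>b\<in>B. f b = \<zero>\<^bsub>obj I l\<^esub>" and df: "\<forall>a\<in>A. diff I l (f
          a) = \<zero>\<^bsub>obj I (l - 1)\<^esub>"
    have fc: "f a \<in> c l" if "a \<in> A" for a
    proof -
      have "s \<odot>\<^bsub>obj I l\<^esub> f a = \<zero>\<^bsub>obj I l\<^esub>" if "s \<in> S" for s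
        using module_homD(3)[OF f, of s a] fB AB(3)[OF that \<open>a \<in> A\<close>] S that \<open>a \<in>
            A\<close> by (auto simp: subset_iff)
      then show ?thesis using that df module_homD(1)[OF f, of a] by (simp add: c_def)
    qed
    have "f \<in> module_hom R ((regular_module R)\<lparr>carrier := A\<rparr>) (obj (subcomplex I c) l)"
      using f fc unfolding module_hom_def by auto
    then have "(\<lambda>a. h l (f a)) \<in> module_hom R ((regular_module R)\<lparr>carrier := A\<rparr>) (obj
        I (l + 1))"
      by (rule module_hom_comp[OF _ h])
    moreover have "h l (f b) = \<zero>\<^bsub>obj I (l + 1)\<^esub>" if "b \<in> B" for b
      using fB that module_hom_zero[OF X.module_obj I.module_obj h, of l] by simp
    ultimately show "\<exists>g\<in>module_hom R ((regular_module R)\<lparr>carrier := A\<rparr>) (obj I (l + 1)).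
        (\<forall>b\<in>B. g b = \<zero>\<^bsub>obj I (l + 1)\<^esub>) \<and> (\<forall>a\<in>A. diff I (l + 1)
            (g a) = f a)"
      using split fc by (intro bexI[of _ "\<lambda>a. h l (f a)"]) simp_all
  qed
qed

text \<open>A cycle \<open>z\<close> killed by \<open>B\<close> corresponds to the map sending
  \<open>r\<close> to \<open>r z\<close> on \<open>R/B\<close>. A lift of this map, evaluated at 1,
  is a preimage of \<open>z\<close>.\<close>

lemma (in cplx) exact_at_annihilated_of_hom_exact:
  assumes h: "hom_exact R (carrier R) B C l" and B: "B \<subseteq> carrier R"
  shows "exact_at (annihilated B C) l"
  unfolding exact_at_def
proof (intro ballI impI)
  fix z assume z: "z \<in> carrier (obj (annihilated B C) l)"
    and dz: "diff (annihilated B C) l z = \<zero>\<^bsub>obj (annihilated B C) (l - 1)\<^esub>"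
  let ?f = "\<lambda>r. r \<odot>\<^bsub>obj C l\<^esub> z"
  have F: "?f \<in> module_hom R ((regular_module R)\<lparr>carrier := carrier R\<rparr>) (obj C l)"
    using z by (intro module_homI) (auto simp: obj.smult_l_distr obj.smult_assoc1)
  have FB: "?f b = \<zero>\<^bsub>obj C l\<^esub>" if "b \<in> B" for b using that z by simp
  have dF: "diff C l (?f a) = \<zero>\<^bsub>obj C (l - 1)\<^esub>" if "a \<in> carrier R" for a
    using that z dz by (simp add: diff_smult)
  from hom_exactD[OF h F FB dF] obtain g where g: "g \<in> module_hom R ((regular_module R)\<lparr>carrier :=
      carrier R\<rparr>) (obj C (l + 1))"
    and gB: "\<And>b. b \<in> B \<Longrightarrow> g b = \<zero>\<^bsub>obj C (l + 1)\<^esub>"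
    and dg: "\<And>a. a \<in> carrier R \<Longrightarrow> diff C (l + 1) (g a) = ?f a"
    by blast
  have "b \<odot>\<^bsub>obj C (l + 1)\<^esub> g \<one>\<^bsub>R\<^esub> = \<zero>\<^bsub>obj C (l +
      1)\<^esub>" if "b \<in> B" for b
    using module_homD(3)[OF g, of b "\<one>\<^bsub>R\<^esub>"] gB[OF that] B that by (auto simp: subset_iff)
  moreover have "g \<one>\<^bsub>R\<^esub> \<in> carrier (obj C (l + 1))" using module_homD(1)[OF g] by simp
  moreover have "diff C (l + 1) (g \<one>\<^bsub>R\<^esub>) = z" using dg z by simp
  ultimately show "\<exists>w\<in>carrier (obj (annihilated B C) (l + 1)). diff (annihilated B C) (l + 1) w = z"
    by auto
qed

text \<open>As \<open>x\<close> kills \<open>A/B\<close>, a homomorphism \<open>f\<close> into the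
  cycles of \<open>C\<close> gives the homomorphism \<open>(0, f)\<close> into the cycles of the
  cone. The second component of a lift, with its sign changed, lifts \<open>f\<close>.\<close>

lemma (in tree_cplx) hom_exact_of_cone:
  assumes x: "x \<in> carrier R" and h: "hom_exact R A B (cone R x C) l"
    and xA: "\<And>a. a \<in> A \<Longrightarrow> x \<otimes> a \<in> B"
  shows "hom_exact R A B C (l - 1)"
  unfolding hom_exact_def
proof (intro ballI impI)
  fix f assume f: "f \<in> module_hom R ((regular_module R)\<lparr>carrier := A\<rparr>) (obj C (l - 1))"
    and fB: "\<forall>b\<in>B. f b = \<zero>\<^bsub>obj C (l - 1)\<^esub>" and df: "\<forall>a\<in>A. diff C (l
        - 1) (f a) = \<zero>\<^bsub>obj C (l - 1 - 1)\<^esub>"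
  note fD = module_homD[OF f, simplified]
  have xf: "x \<odot>\<^bsub>obj C (l - 1)\<^esub> f a = \<zero>\<^bsub>obj C (l - 1)\<^esub>" if "a \<in> A" for a
    using fD(3)[OF x that] fB xA[OF that] by simp
  let ?F = "\<lambda>a. Node \<zero>\<^bsub>obj C l\<^esub> (f a)"
  have F: "?F \<in> module_hom R ((regular_module R)\<lparr>carrier := A\<rparr>) (obj (cone R x C) l)"
    by (intro module_homI) (auto simp: fD)
  have FB: "?F b = \<zero>\<^bsub>obj (cone R x C) l\<^esub>" if "b \<in> B" for b using that fB by simp
  have dF: "diff (cone R x C) l (?F a) = \<zero>\<^bsub>obj (cone R x C) (l - 1)\<^esub>" if "a \<in> A" for a
    using that df xf by simp
  from hom_exactD[OF h F FB dF] obtain G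
    where G: "G \<in> module_hom R ((regular_module R)\<lparr>carrier := A\<rparr>) (obj (cone R x C) (l + 1))"
    and GB: "\<And>b. b \<in> B \<Longrightarrow> G b = \<zero>\<^bsub>obj (cone R x C) (l + 1)\<^esub>"
    and dG: "\<And>a. a \<in> A \<Longrightarrow> diff (cone R x C) (l + 1) (G a) = ?F a"
    by blast
  note GD = module_homD[OF G, simplified]
  have GN: "\<exists>u v. G a = Node u v \<and> u \<in> carrier (obj C (l + 1)) \<and> v \<in> carrier (obj C
      l)" if "a \<in> A" for a
    using GD(1)[OF that] .
  have "(\<lambda>a. rgt (G a)) \<in> module_hom R ((regular_module R)\<lparr>carrier := A\<rparr>) (obj C l)"
  proof (rule module_homI)
    fix a assume "a \<in> carrier ((regular_module R)\<lparr>carrier := A\<rparr>)"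
    then have a: "a \<in> A" by simp
    from GN[OF a] obtain u v where uv: "G a = Node u v" "v \<in> carrier (obj C l)" by auto
    then show "rgt (G a) \<in> carrier (obj C l)" by simp
    show "rgt (G (r \<odot>\<^bsub>(regular_module R)\<lparr>carrier := A\<rparr>\<^esub> a)) = r
        \<odot>\<^bsub>obj C l\<^esub> rgt (G a)"
      if "r \<in> carrier R" for r using GD(3)[OF that a] uv by simp
    fix b assume "b \<in> carrier ((regular_module R)\<lparr>carrier := A\<rparr>)"
    then have b: "b \<in> A" by simp
    from GN[OF b] obtain u' v' where "G b = Node u' v'" by auto
    then show "rgt (G (a \<oplus>\<^bsub>(regular_module R)\<lparr>carrier := A\<rparr>\<^esub> b)) = rgt (G a)
        \<oplus>\<^bsub>obj C l\<^esub> rgt (G b)"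
      using GD(2)[OF a b] uv by simp
  qed
  then have "(\<lambda>a. \<ominus>\<^bsub>obj C l\<^esub> rgt (G a)) \<in> module_hom R ((regular_module
      R)\<lparr>carrier := A\<rparr>) (obj C l)"
    by (rule module_hom_uminus[OF module_obj])
  moreover have "\<ominus>\<^bsub>obj C l\<^esub> rgt (G b) = \<zero>\<^bsub>obj C l\<^esub>" if "b \<in> B" for b
    using GB[OF that] by simp
  moreover have "diff C l (\<ominus>\<^bsub>obj C l\<^esub> rgt (G a)) = f a" if a: "a \<in> A" for a
  proof -
    from GN[OF a] obtain u v where uv: "G a = Node u v" "v \<in> carrier (obj C l)" by auto
    then show ?thesis using dG[OF a] by (simp add: diff_neg)
  qed
  ultimately show "\<exists>g\<in>module_hom R ((regular_module R)\<lparr>carrier := A\<rparr>) (obj C (l - 1 + 1)).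
      (\<forall>b\<in>B. g b = \<zero>\<^bsub>obj C (l - 1 + 1)\<^esub>) \<and> (\<forall>a\<in>A. diff C (l -
          1 + 1) (g a) = f a)"
    by (intro bexI[of _ "\<lambda>a. \<ominus>\<^bsub>obj C l\<^esub> rgt (G a)"]) simp_all
qed

section \<open>The four-term test complex\<close>

lemma zero_submodule_sel [simp]:
  "carrier (zero_submodule M) = {\<zero>\<^bsub>M\<^esub>}" "zero (zero_submodule M) = zero M"
  "add (zero_submodule M) = add M" "smult (zero_submodule M) = smult M"
  by (simp_all add: zero_submodule_def)

lemma module_zero_submodule:
  assumes "module R M"
  shows "module R (zero_submodule M)"
proof -
  interpret M: module R M by fact
  have "submodule {\<zero>\<^bsub>M\<^esub>} R M" by (rule M.submoduleI) auto
  then show ?thesis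
    using submodule.submodule_is_module assms by (fastforce simp: zero_submodule_def)
qed

text \<open>The exact sequence, placed in degrees \<open>l + 1\<close> to \<open>l - 2\<close>, is
  an acyclic test complex. The maps \<open>f3\<close>, \<open>f2\<close>, \<open>f1\<close> and zero
  on \<open>M0\<close> form a chain map into \<open>I\<close>; the conclusion records those parts of
  its null-homotopy that serve in \<open>hom_exact_cone\<close>.\<close>

lemma four_term_homotopy:
  fixes e :: "'x \<Rightarrow> 't"
  assumes K: "K_inj_wrt TYPE('t) R I" and I: "cplx R I"
    and M: "module R M3" "module R M2" "module R M1" "module R M0"
    and d: "d3 \<in> module_hom R M3 M2" "d2 \<in> module_hom R M2 M1" "d1 \<in> module_hom R M1 M0"
    and ex3: "\<And>z. z \<in> carrier M3 \<Longrightarrow> d3 z = \<zero>\<^bsub>M2\<^esub> \<Longrightarrow>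
        z = \<zero>\<^bsub>M3\<^esub>"
    and ex2: "\<And>z. z \<in> carrier M2 \<Longrightarrow> d2 z = \<zero>\<^bsub>M1\<^esub>
        \<longleftrightarrow> z \<in> d3 ` carrier M3"
    and ex1: "\<And>z. z \<in> carrier M1 \<Longrightarrow> d1 z = \<zero>\<^bsub>M0\<^esub>
        \<longleftrightarrow> z \<in> d2 ` carrier M2"
    and ex0: "carrier M0 \<subseteq> d1 ` carrier M1"
    and e: "inj_on e (carrier M3)" "inj_on e (carrier M2)" "inj_on e (carrier M1)" "inj_on e (carrier M0)"
    and f: "f3 \<in> module_hom R M3 (obj I (l + 1))" "f2 \<in> module_hom R M2 (obj I l)"
      "f1 \<in> module_hom R M1 (obj I (l - 1))"
    and comm: "\<And>z. z \<in> carrier M3 \<Longrightarrow> diff I (l + 1) (f3 z) = f2 (d3 z)"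
      "\<And>z. z \<in> carrier M2 \<Longrightarrow> diff I l (f2 z) = f1 (d2 z)"
      "\<And>z. z \<in> carrier M1 \<Longrightarrow> diff I (l - 1) (f1 z) = \<zero>\<^bsub>obj I (l - 1 - 1)\<^esub>"
  obtains h2 h1 h0 where "h2 \<in> module_hom R M2 (obj I (l + 1))" "h1 \<in> module_hom R M1 (obj I l)"
    "h0 \<in> module_hom R M0 (obj I (l - 1))"
    "\<And>z. z \<in> carrier M2 \<Longrightarrow> f2 z = diff I (l + 1) (h2 z) \<oplus>\<^bsub>obj I l\<^esub>
        h1 (d2 z)"
    "\<And>z. z \<in> carrier M1 \<Longrightarrow> f1 z = diff I l (h1 z) \<oplus>\<^bsub>obj I (l - 1)\<^esub>
        h0 (d1 z)"
    "\<And>z. z \<in> carrier M0 \<Longrightarrow> diff I (l - 1) (h0 z) = \<zero>\<^bsub>obj I (l - 1 - 1)\<^esub>"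
proof -
  interpret I: cplx R I by fact
  interpret M3: module R M3 by fact
  interpret M2: module R M2 by fact
  interpret M1: module R M1 by fact
  interpret M0: module R M0 by fact
  define F where "F i = (if i = l + 1 then M3 else if i = l then M2 else if i = l - 1 then M1
    else if i = l - 2 then M0 else zero_submodule M0)" for i
  define D where "D i = (if i = l + 1 then d3 else if i = l then d2 else if i = l - 1 then d1
    else (\<lambda>_. \<zero>\<^bsub>F (i - 1)\<^esub>))" for i
  define \<phi> where "\<phi> i = (if i = l + 1 then f3 else if i = l then f2 else if i = l - 1 then f1
    else (\<lambda>_. \<zero>\<^bsub>obj I i\<^esub>))" for i
  let ?X = "\<lparr>obj = F, diff = D\<rparr>"
  have F: "F (l + 1) = M3" "F l = M2" "F (l - 1) = M1" "F (l - 2) = M0"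
    and D: "D (l + 1) = d3" "D l = d2" "D (l - 1) = d1"
    and \<phi>: "\<phi> (l + 1) = f3" "\<phi> l = f2" "\<phi> (l - 1) = f1" by (simp_all add: F_def D_def \<phi>_def)
  have cases: "i = l + 1 \<or> i = l \<or> i = l - 1 \<or> i = l - 2 \<or> i \<notin> {l + 1, l, l - 1, l - 2}"
      for i by auto
  have Fother: "F i = zero_submodule M0" if "i \<notin> {l + 1, l, l - 1, l - 2}" for i
    using that by (simp add: F_def)
  have Dother: "D i = (\<lambda>_. \<zero>\<^bsub>F (i - 1)\<^esub>)" if "i \<notin> {l + 1, l, l - 1}" for i
    using that by (simp add: D_def)
  have \<phi>other: "\<phi> i = (\<lambda>_. \<zero>\<^bsub>obj I i\<^esub>)" if "i \<notin> {l + 1, l, l - 1}" for i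
    using that by (simp add: \<phi>_def)
  have Fmod: "module R (F i)" for i
    using M module_zero_submodule[OF M(4)] by (simp add: F_def)
  have Dhom: "D i \<in> module_hom R (F i) (F (i - 1))" for i
  proof (cases "i \<in> {l + 1, l, l - 1}")
    case True
    then show ?thesis using d F D by auto
  next
    case False
    then show ?thesis using Dother[OF False] module_hom_const_zero[OF Fmod] by simp
  qed
  have D0: "D i \<zero>\<^bsub>F i\<^esub> = \<zero>\<^bsub>F (i - 1)\<^esub>" for i by (rule
      module_hom_zero[OF Fmod Fmod Dhom])
  have DD: "D (i - 1) (D i z) = \<zero>\<^bsub>F (i - 1 - 1)\<^esub>" if z: "z \<in> carrier (F i)" for i z
  proof -
    consider "i = l + 1" | "i = l" | "i \<notin> {l + 1, l, l - 1}" | "i = l - 1" by auto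
    then show ?thesis
    proof cases
      case 1
      then show ?thesis using z ex2[of "d3 z"] module_homD(1)[OF d(1)] F D by auto
    next
      case 2
      then show ?thesis using z ex1[of "d2 z"] module_homD(1)[OF d(2)] F D by auto
    next
      case 3
      then show ?thesis using Dother[OF 3] D0 by simp
    next
      case 4
      then have "i - 1 \<notin> {l + 1, l, l - 1}" by simp
      then show ?thesis using Dother by simp
    qed
  qed
  have cplx: "is_complex R ?X" unfolding is_complex_def using Fmod Dhom DD by simp
  interpret X: cplx R ?X by unfold_locales (rule cplx)
  have Xex: "exact_at ?X i" for i
    unfolding exact_at_def
  proof (intro ballI impI)
    fix z assume z: "z \<in> carrier (obj ?X i)" and dz: "diff ?X i z = \<zero>\<^bsub>obj ?X (i - 1)\<^esub>"
    show "\<exists>w\<in>carrier (obj ?X (i + 1)). diff ?X (i + 1) w = z"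
      using cases[of i]
    proof (elim disjE)
      assume i: "i = l + 1"
      then have "z = \<zero>\<^bsub>F i\<^esub>" using z dz F D ex3 by simp
      then show ?thesis using X.diff_zero[of "i + 1"] X.obj.M.zero_closed[of "i + 1"] by auto
    next
      assume i: "i = l"
      then show ?thesis using z dz F D ex2 by auto
    next
      assume i: "i = l - 1"
      then show ?thesis using z dz F D ex1 by auto
    next
      assume i: "i = l - 2"
      then have "i + 1 = l - 1" by simp
      then show ?thesis using z F D ex0 i by auto
    next
      assume i: "i \<notin> {l + 1, l, l - 1, l - 2}"
      then have "z = \<zero>\<^bsub>F i\<^esub>" using z Fother[OF i] by simp
      then show ?thesis using X.diff_zero[of "i + 1"] X.obj.M.zero_closed[of "i + 1"] by auto
    qed
  qed
  have \<phi>hom: "\<phi> i \<in> module_hom R (F i) (obj I i)" for i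
  proof (cases "i \<in> {l + 1, l, l - 1}")
    case True
    then show ?thesis using f F \<phi> by auto
  next
    case False
    then show ?thesis using \<phi>other[OF False] module_hom_const_zero[OF I.module_obj] by simp
  qed
  have \<phi>0: "\<phi> i \<zero>\<^bsub>F i\<^esub> = \<zero>\<^bsub>obj I i\<^esub>" for i by (rule
      module_hom_zero[OF Fmod I.module_obj \<phi>hom])
  have "diff I i (\<phi> i z) = \<phi> (i - 1) (D i z)" if z: "z \<in> carrier (F i)" for i z
  proof -
    consider "i = l + 1" | "i = l" | "i = l - 1" | "i \<notin> {l + 1, l, l - 1}" by auto
    then show ?thesis
    proof cases
      case 3
      then have "i - 1 \<notin> {l + 1, l, l - 1}" by simp
      then show ?thesis using \<phi>other[of "i - 1"] comm(3) z F \<phi> 3 by simp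
    next
      case 4
      then show ?thesis using \<phi>other[OF 4] Dother[OF 4] \<phi>0 by simp
    qed (use comm z F D \<phi> in auto)
  qed
  then have "chain_map R ?X I \<phi>"
    unfolding chain_map_def using cplx I.is_complex \<phi>hom by simp
  moreover have "inj_on e (carrier (obj ?X i))" for i using e by (simp add: F_def)
  ultimately have "null_homotopic R ?X I \<phi>" using K_inj_wrt_null_homotopic[OF K] Xex by blast
  then obtain h where h: "\<And>i. h i \<in> module_hom R (F i) (obj I (i + 1))"
    and hz: "\<And>i z. z \<in> carrier (F i) \<Longrightarrow> \<phi> i z = diff I (i + 1) (h i z)
        \<oplus>\<^bsub>obj I i\<^esub> h (i - 1) (D i z)"
    unfolding null_homotopic_def by auto
  show ?thesis
  proof
    show "h l \<in> module_hom R M2 (obj I (l + 1))" "h (l - 1) \<in> module_hom R M1 (obj I l)"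
      "h (l - 2) \<in> module_hom R M0 (obj I (l - 1))"
      using h[of l] h[of "l - 1"] h[of "l - 2"] F by simp_all
    show "f2 z = diff I (l + 1) (h l z) \<oplus>\<^bsub>obj I l\<^esub> h (l - 1) (d2 z)" if "z \<in> carrier
        M2" for z
      using hz[of z l] that F D \<phi> by simp
    show "f1 z = diff I l (h (l - 1) z) \<oplus>\<^bsub>obj I (l - 1)\<^esub> h (l - 2) (d1 z)" if "z \<in>
        carrier M1" for z
      using hz[of z "l - 1"] that F D \<phi> by simp
    \<comment> \<open>In degree \<open>l - 2\<close> both the chain map and the differential out of
      \<open>M0\<close> are zero, so that the homotopy identity reduces to the vanishing of the
      differential of \<open>h (l - 2) z\<close>.\<close>
    show "diff I (l - 1) (h (l - 2) z) = \<zero>\<^bsub>obj I (l - 1 - 1)\<^esub>" if z: "z \<in> carrier M0" for z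
    proof -
      have o: "l - 2 \<notin> {l + 1, l, l - 1}" by simp
      have "h (l - 2 - 1) \<zero>\<^bsub>F (l - 2 - 1)\<^esub> = \<zero>\<^bsub>obj I (l - 2 - 1 + 1)\<^esub>"
        by (rule module_hom_zero[OF Fmod I.module_obj h])
      moreover have "h (l - 2) z \<in> carrier (obj I (l - 2 + 1))"
        using module_homD(1)[OF h, of z "l - 2"] z F by simp
      then have "diff I (l - 1) (h (l - 2) z) \<in> carrier (obj I (l - 2))" using I.diff_closed_pred[of _ l] by simp
      ultimately show ?thesis using hz[of z "l - 2"] z F \<phi>other[OF o] Dother[OF o] by simp
    qed
  qed
qed

text \<open>A coset is a set of elements. Choosing a representative embeds the quotient into the
  element type of \<open>M\<close>, so that quotients of ideals fit into any test type that has room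
  for \<open>R\<close>.\<close>

lemma (in quotient_mod) inj_on_representative:
  "inj_on (\<lambda>X. SOME x. x \<in> X) (carrier (quot_module M N))"
proof (rule inj_onI)
  have repr: "X = N +>\<^bsub>M\<^esub> (SOME x. x \<in> X)" if X: "X \<in> carrier (quot_module M N)" for X
  proof -
    obtain m where m: "X = N +>\<^bsub>M\<^esub> m" "m \<in> carrier M" using X by (auto simp: carrier_quot)
    then have "(SOME x. x \<in> X) \<in> N +>\<^bsub>M\<^esub> m" using N.a_rcos_self by (metis someI)
    then show ?thesis using m M.M.a_repr_independence N.a_subgroup by simp
  qed
  fix X Y assume "X \<in> carrier (quot_module M N)" "Y \<in> carrier (quot_module M N)"
    and "(SOME x. x \<in> X) = (SOME x. x \<in> Y)"
  then show "X = Y" using repr by metis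
qed

section \<open>Ideals as submodules of the regular module\<close>

lemma quotient_mod_ideal:
  fixes R :: "'r ring"
  assumes R: "cring R" and A: "submodule A R (regular_module R)" and B: "submodule B R (regular_module R)" "B
      \<subseteq> A"
  shows "quotient_mod R ((regular_module R)\<lparr>carrier := A\<rparr>) B"
proof (rule quotient_mod.intro)
  interpret N: module R "regular_module R" by (rule module_regular[OF R])
  let ?A = "(regular_module R)\<lparr>carrier := A\<rparr>"
  show "module R ?A" by (rule submodule.submodule_is_module[OF A N.module_axioms])
  then interpret A: module R ?A .
  note E = N.submoduleE[OF B(1)]
  have "\<zero>\<^bsub>R\<^esub> \<in> B" using submodule.axioms(1)[OF B(1)] subgroup.one_closed by fastforce
  then show "submodule B R ?A"
  proof (intro A.submoduleI)
    fix a assume a: "a \<in> B"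
    \<comment> \<open>The additive inverse is defined relative to the carrier, which has changed.
      Multiplication by -1 is the same in both modules and transfers closure under negation.\<close>
    have "\<ominus>\<^bsub>?A\<^esub> a = (\<ominus>\<^bsub>R\<^esub> \<one>\<^bsub>R\<^esub>)
        \<odot>\<^bsub>?A\<^esub> a"
      using A.smult_l_minus[of "\<one>\<^bsub>R\<^esub>" a] A.smult_one[of a] a B(2) by (auto simp: subset_iff)
    then show "\<ominus>\<^bsub>?A\<^esub> a \<in> B" using E(4)[of "\<ominus>\<^bsub>R\<^esub>
        \<one>\<^bsub>R\<^esub>" a] a by simp
  qed (use E B(2) in auto)
qed

lemma submodule_regularI:
  fixes R :: "'r ring"
  assumes R: "cring R" and "A \<subseteq> carrier R" "\<zero>\<^bsub>R\<^esub> \<in> A"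
    and "\<And>a b. a \<in> A \<Longrightarrow> b \<in> A \<Longrightarrow> a \<oplus>\<^bsub>R\<^esub> b \<in> A"
    and smult: "\<And>r a. r \<in> carrier R \<Longrightarrow> a \<in> A \<Longrightarrow> r
        \<otimes>\<^bsub>R\<^esub> a \<in> A"
  shows "submodule A R (regular_module R)"
proof -
  interpret N: module R "regular_module R" by (rule module_regular[OF R])
  show ?thesis
  proof (rule N.submoduleI)
    fix a assume a: "a \<in> A"
    have "\<ominus>\<^bsub>regular_module R\<^esub> a = (\<ominus>\<^bsub>R\<^esub> \<one>\<^bsub>R\<^esub>)
        \<odot>\<^bsub>regular_module R\<^esub> a"
      using N.smult_l_minus[of "\<one>\<^bsub>R\<^esub>" a] N.smult_one[of a] a assms(2) by (auto simp: subset_iff)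
    then show "\<ominus>\<^bsub>regular_module R\<^esub> a \<in> A" using smult[of "\<ominus>\<^bsub>R\<^esub>
        \<one>\<^bsub>R\<^esub>" a] a by simp
  qed (use assms in auto)
qed

lemma submodule_regularD:
  fixes R :: "'r ring"
  assumes R: "cring R" and A: "submodule A R (regular_module R)"
  shows "A \<subseteq> carrier R" "\<zero>\<^bsub>R\<^esub> \<in> A" "\<And>a b. a \<in> A \<Longrightarrow> b
      \<in> A \<Longrightarrow> a \<oplus>\<^bsub>R\<^esub> b \<in> A"
    "\<And>r a. r \<in> carrier R \<Longrightarrow> a \<in> A \<Longrightarrow> r \<otimes>\<^bsub>R\<^esub> a
        \<in> A"
proof -
  interpret N: module R "regular_module R" by (rule module_regular[OF R])
  note E = N.submoduleE[OF A, simplified]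
  show "A \<subseteq> carrier R" "\<And>a b. a \<in> A \<Longrightarrow> b \<in> A \<Longrightarrow> a
      \<oplus>\<^bsub>R\<^esub> b \<in> A"
    "\<And>r a. r \<in> carrier R \<Longrightarrow> a \<in> A \<Longrightarrow> r \<otimes>\<^bsub>R\<^esub> a
        \<in> A" using E by auto
  show "\<zero>\<^bsub>R\<^esub> \<in> A" using submodule.axioms(1)[OF A] subgroup.one_closed by fastforce
qed

text \<open>
  With \<open>N = A/B\<close>, the submodule \<open>(0 : x)\<close> of \<open>N\<close> is \<open>A'/B\<close>
      and \<open>N/xN\<close> is \<open>A/Q\<close> in the proof below.
\<close>

lemma hom_exact_cone:
  fixes R :: "'r ring" and \<epsilon> :: "'r \<Rightarrow> 't"
  assumes K: "K_inj_wrt TYPE('t) R C" and C: "tree_cplx R C" and x: "x \<in> carrier R" and \<epsilon>: "inj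
      \<epsilon>"
    and hyp: "\<And>A B l. submodule A R (regular_module R) \<Longrightarrow> submodule B R (regular_module R)
        \<Longrightarrow> B \<subseteq> A \<Longrightarrow>
      (\<And>y a. y \<in> insert x Y \<Longrightarrow> a \<in> A \<Longrightarrow> y \<otimes>\<^bsub>R\<^esub>
          a \<in> B) \<Longrightarrow> t < l \<Longrightarrow> hom_exact R A B C l"
    and A: "submodule A R (regular_module R)" and B: "submodule B R (regular_module R)" "B \<subseteq> A"
    and YA: "\<And>y a. y \<in> Y \<Longrightarrow> a \<in> A \<Longrightarrow> y \<otimes>\<^bsub>R\<^esub> a
        \<in> B" and l: "t + 1 < l"
  shows "hom_exact R A B (cone R x C) l"
  unfolding hom_exact_def
proof (intro ballI impI)
  interpret R: cring R using C by (simp add: tree_cplx_def cplx.cring)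
  interpret C: tree_cplx R C by fact
  note AD = submodule_regularD[OF C.cring A] and BD = submodule_regularD[OF C.cring B(1)]
  let ?M = "\<lambda>A. (regular_module R)\<lparr>carrier := A\<rparr>"
  fix f assume f: "f \<in> module_hom R (?M A) (obj (cone R x C) l)"
    and fB: "\<forall>b\<in>B. f b = \<zero>\<^bsub>obj (cone R x C) l\<^esub>"
    and df: "\<forall>a\<in>A. diff (cone R x C) l (f a) = \<zero>\<^bsub>obj (cone R x C) (l - 1)\<^esub>"
  note fD = module_homD[OF f, simplified]
  define p where "p a = lft (f a)" for a
  define q where "q a = rgt (f a)" for a
  have fpq: "f a = Node (p a) (q a)" and pC: "p a \<in> carrier (obj C l)" and qC: "q a \<in> carrier (obj C (l - 1))"
    if "a \<in> A" for a
    using fD(1)[OF that] by (auto simp: p_def q_def)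
  have p: "p \<in> module_hom R (?M A) (obj C l)" and q: "q \<in> module_hom R (?M A) (obj C (l - 1))"
  proof -
    have "p (a \<oplus>\<^bsub>R\<^esub> b) = p a \<oplus>\<^bsub>obj C l\<^esub> p b" "q (a
        \<oplus>\<^bsub>R\<^esub> b) = q a \<oplus>\<^bsub>obj C (l - 1)\<^esub> q b"
      if "a \<in> A" "b \<in> A" for a b
      using fD(2)[OF that] that by (simp_all add: fpq AD(3))
    moreover have "p (r \<otimes>\<^bsub>R\<^esub> a) = r \<odot>\<^bsub>obj C l\<^esub> p a" "q (r
        \<otimes>\<^bsub>R\<^esub> a) = r \<odot>\<^bsub>obj C (l - 1)\<^esub> q a"
      if "r \<in> carrier R" "a \<in> A" for r a
      using fD(3)[OF that] that by (simp_all add: fpq AD(4))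
    ultimately show "p \<in> module_hom R (?M A) (obj C l)" "q \<in> module_hom R (?M A) (obj C (l - 1))"
      using pC qC by (auto intro!: module_homI)
  qed
  note pD = module_homD[OF p, simplified] and qD = module_homD[OF q, simplified]
  have pB: "p b = \<zero>\<^bsub>obj C l\<^esub>" and qB: "q b = \<zero>\<^bsub>obj C (l - 1)\<^esub>" if "b
      \<in> B" for b
    using fB that by (auto simp: p_def q_def)
  have dp: "diff C l (p a) = \<ominus>\<^bsub>obj C (l - 1)\<^esub> (x \<odot>\<^bsub>obj C (l - 1)\<^esub> q a)"
    and dq: "diff C (l - 1) (q a) = \<zero>\<^bsub>obj C (l - 1 - 1)\<^esub>" if a: "a \<in> A" for a
  proof -
    have s: "diff C l (p a) \<oplus>\<^bsub>obj C (l - 1)\<^esub> x \<odot>\<^bsub>obj C (l - 1)\<^esub> q a =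
        \<zero>\<^bsub>obj C (l - 1)\<^esub>"
      and "\<ominus>\<^bsub>obj C (l - 1 - 1)\<^esub> diff C (l - 1) (q a) = \<zero>\<^bsub>obj C (l - 1 - 1)\<^esub>"
      using df a fpq by auto
    then show "diff C (l - 1) (q a) = \<zero>\<^bsub>obj C (l - 1 - 1)\<^esub>"
      using qC[OF a] by (simp add: C.obj.M.add.inv_eq_1_iff)
    show "diff C l (p a) = \<ominus>\<^bsub>obj C (l - 1)\<^esub> (x \<odot>\<^bsub>obj C (l - 1)\<^esub> q a)"
      using pC[OF a] qC[OF a] x by (intro C.obj.M.eq_neg_of_sum_zero(1)[OF s]) auto
  qed
  define A' where "A' = {a \<in> A. x \<otimes>\<^bsub>R\<^esub> a \<in> B}"
  define Q where "Q = {x \<otimes>\<^bsub>R\<^esub> a \<oplus>\<^bsub>R\<^esub> b | a b. a \<in> A \<and> b \<in> B}"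
  have AR: "a \<in> carrier R" if "a \<in> A" for a using AD(1) that by blast
  have BR: "a \<in> carrier R" if "a \<in> B" for a using BD(1) that by blast
  have QI: "x \<otimes>\<^bsub>R\<^esub> a \<oplus>\<^bsub>R\<^esub> b \<in> Q" if "a \<in> A" "b \<in> B" for
      a b using that by (auto simp: Q_def)
  have A': "submodule A' R (regular_module R)" "B \<subseteq> A'" "A' \<subseteq> A"
  proof -
    show "submodule A' R (regular_module R)"
    proof (rule submodule_regularI[OF C.cring])
      fix r a assume r: "r \<in> carrier R" and a: "a \<in> A'"
      then have "x \<otimes>\<^bsub>R\<^esub> (r \<otimes>\<^bsub>R\<^esub> a) = r \<otimes>\<^bsub>R\<^esub>
          (x \<otimes>\<^bsub>R\<^esub> a)" using x AR by (simp add: A'_def R.m_lcomm)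
      then show "r \<otimes>\<^bsub>R\<^esub> a \<in> A'" using r a AD BD by (simp add: A'_def)
    qed (use AD BD x AR in \<open>auto simp: A'_def R.r_distr\<close>)
    show "B \<subseteq> A'" using B(2) BD x by (auto simp: A'_def)
  qed (auto simp: A'_def)
  have Q: "submodule Q R (regular_module R)" "B \<subseteq> Q" "Q \<subseteq> A"
  proof -
    show "submodule Q R (regular_module R)"
    proof (rule submodule_regularI[OF C.cring])
      show "\<zero>\<^bsub>R\<^esub> \<in> Q" using QI[OF AD(2) BD(2)] x by simp
      fix c assume "c \<in> Q"
      then obtain a b where c: "c = x \<otimes>\<^bsub>R\<^esub> a \<oplus>\<^bsub>R\<^esub> b" "a \<in> A" "b
          \<in> B" by (auto simp: Q_def)
      show "r \<otimes>\<^bsub>R\<^esub> c \<in> Q" if r: "r \<in> carrier R" for r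
      proof -
        have "r \<otimes>\<^bsub>R\<^esub> c = x \<otimes>\<^bsub>R\<^esub> (r \<otimes>\<^bsub>R\<^esub> a)
            \<oplus>\<^bsub>R\<^esub> r \<otimes>\<^bsub>R\<^esub> b"
          using r c x AR BR by (simp add: R.r_distr R.m_lcomm)
        then show ?thesis using QI AD BD r c by simp
      qed
      fix c' assume "c' \<in> Q"
      then obtain a' b' where c': "c' = x \<otimes>\<^bsub>R\<^esub> a' \<oplus>\<^bsub>R\<^esub> b'" "a' \<in>
          A" "b' \<in> B" by (auto simp: Q_def)
      have "c \<oplus>\<^bsub>R\<^esub> c' = x \<otimes>\<^bsub>R\<^esub> (a \<oplus>\<^bsub>R\<^esub> a')
          \<oplus>\<^bsub>R\<^esub> (b \<oplus>\<^bsub>R\<^esub> b')"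
        using c c' x AR BR by (simp add: R.r_distr R.a_ac)
      then show "c \<oplus>\<^bsub>R\<^esub> c' \<in> Q" using QI AD BD c c' by simp
    qed (use x AR BR in \<open>auto simp: Q_def\<close>)
    show "B \<subseteq> Q"
    proof
      fix b assume "b \<in> B"
      then show "b \<in> Q" using QI[OF AD(2), of b] x BR by simp
    qed
    show "Q \<subseteq> A" using AD B(2) x by (auto simp: Q_def)
  qed
  interpret QA: quotient_mod R "?M A" B by (rule quotient_mod_ideal[OF C.cring A B])
  interpret QA': quotient_mod R "?M A'" B by (rule quotient_mod_ideal[OF C.cring A'(1) B(1) A'(2)])
  interpret QQ: quotient_mod R "?M A" Q by (rule quotient_mod_ideal[OF C.cring A Q(1,3)])
  have xQ: "x \<otimes>\<^bsub>R\<^esub> a \<in> Q" if "a \<in> A" for a using QI[OF that BD(2)] x AR[OF that] by simp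
  have neg: "\<ominus>\<^bsub>?M A\<^esub> a = \<ominus>\<^bsub>R\<^esub> a" if "a \<in> A" for a
    using that AR[OF that] AD(4)[of "\<ominus>\<^bsub>R\<^esub> \<one>\<^bsub>R\<^esub>" a]
    by (intro QA.M.M.minus_equality) (auto simp: R.l_neg R.l_minus)
  \<comment> \<open>On \<open>A'\<close> the values of \<open>p\<close> are cycles: there
    \<open>x q(a) = q(x a)\<close> vanishes because \<open>x a\<close> lies in \<open>B\<close>. The
    lift \<open>w\<close> of \<open>p\<close> becomes the component on \<open>A'/B\<close> of a
    chain map into \<open>C\<close>, whose other components are \<open>p\<close> and
    \<open>q\<close>.\<close>
  have "hom_exact R A' B C l"
    using A' B YA l by (intro hyp) (auto simp: A'_def)
  moreover have "p \<in> module_hom R (?M A') (obj C l)" using p A'(3) by (auto simp: module_hom_def subset_iff)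
  moreover have "diff C l (p a) = \<zero>\<^bsub>obj C (l - 1)\<^esub>" if a: "a \<in> A'" for a
  proof -
    have "x \<odot>\<^bsub>obj C (l - 1)\<^esub> q a = \<zero>\<^bsub>obj C (l - 1)\<^esub>"
      using qD(3)[OF x, of a] qB[of "x \<otimes>\<^bsub>R\<^esub> a"] a by (simp add: A'_def)
    then show ?thesis using dp a by (simp add: A'_def)
  qed
  ultimately obtain w where w: "w \<in> module_hom R (?M A') (obj C (l + 1))"
    and wB: "\<And>b. b \<in> B \<Longrightarrow> w b = \<zero>\<^bsub>obj C (l + 1)\<^esub>"
    and dw: "\<And>a. a \<in> A' \<Longrightarrow> diff C (l + 1) (w a) = p a"
    using hom_exactD[of R A' B C l p] pB by blast
  let ?N3 = "quot_module (?M A') B" and ?N2 = "quot_module (?M A) B" and ?N0 = "quot_module (?M A) Q"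
  have prB: "(\<lambda>a. B +>\<^bsub>?M A\<^esub> a) \<in> module_hom R (?M A') ?N2"
    using QA.proj_hom A'(3) by (auto simp: module_hom_def subset_iff)
  have zB: "B +>\<^bsub>?M A\<^esub> b = \<zero>\<^bsub>?N2\<^esub>" and zQ: "Q +>\<^bsub>?M A\<^esub> b =
      \<zero>\<^bsub>?N0\<^esub>" if "b \<in> B" for b
    using that B(2) Q(2) QA.coset_eq_sub_iff[of b] QQ.coset_eq_sub_iff[of b] QA.zero_quot QQ.zero_quot by auto
  obtain d3 where d3: "d3 \<in> module_hom R ?N3 ?N2"
    and d3v: "\<And>a. a \<in> A' \<Longrightarrow> d3 (B +>\<^bsub>?M A'\<^esub> a) = B +>\<^bsub>?M A\<^esub> a"
    using QA'.quot_lift[OF QA.module_quot prB zB] by auto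
  obtain d1 where d1: "d1 \<in> module_hom R ?N2 ?N0"
    and d1v: "\<And>a. a \<in> A \<Longrightarrow> d1 (B +>\<^bsub>?M A\<^esub> a) = Q +>\<^bsub>?M A\<^esub> a"
    using QA.quot_lift[OF QQ.module_quot QQ.proj_hom zQ] by auto
  \<comment> \<open>The middle map is multiplication by \<open>-x\<close>, to match the sign in
    \<open>d p = - x q\<close>.\<close>
  define d2 where "d2 X = (\<ominus>\<^bsub>R\<^esub> x) \<odot>\<^bsub>?N2\<^esub> X" for X
  interpret M2: module R ?N2 by (rule QA.module_quot)
  have d2: "d2 \<in> module_hom R ?N2 ?N2"
    using x unfolding d2_def
    by (intro module_hom_smult QA.module_quot) (auto intro: module_homI)
  have d2v: "d2 (B +>\<^bsub>?M A\<^esub> a) = B +>\<^bsub>?M A\<^esub> ((\<ominus>\<^bsub>R\<^esub> x)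
      \<otimes>\<^bsub>R\<^esub> a)" if "a \<in> A" for a
    using that x QA.smult_quot[of "\<ominus>\<^bsub>R\<^esub> x" a] by (simp add: d2_def)
  obtain f3 where f3: "f3 \<in> module_hom R ?N3 (obj C (l + 1))"
    and f3v: "\<And>a. a \<in> A' \<Longrightarrow> f3 (B +>\<^bsub>?M A'\<^esub> a) = w a"
    using QA'.quot_lift[OF C.module_obj w wB] by auto
  obtain f2 where f2: "f2 \<in> module_hom R ?N2 (obj C l)"
    and f2v: "\<And>a. a \<in> A \<Longrightarrow> f2 (B +>\<^bsub>?M A\<^esub> a) = p a"
    using QA.quot_lift[OF C.module_obj p pB] by auto
  obtain f1 where f1: "f1 \<in> module_hom R ?N2 (obj C (l - 1))"
    and f1v: "\<And>a. a \<in> A \<Longrightarrow> f1 (B +>\<^bsub>?M A\<^esub> a) = q a"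
    using QA.quot_lift[OF C.module_obj q qB] by auto
  have ex: "z \<in> carrier ?N2 \<longleftrightarrow> (\<exists>a\<in>A. z = B +>\<^bsub>?M A\<^esub> a)" for z
      by (auto simp: QA.carrier_quot)
  have ex': "z \<in> carrier ?N3 \<longleftrightarrow> (\<exists>a\<in>A'. z = B +>\<^bsub>?M A'\<^esub> a)"
      for z by (auto simp: QA'.carrier_quot)
  have negx: "(\<ominus>\<^bsub>R\<^esub> x) \<otimes>\<^bsub>R\<^esub> a \<in> A" if "a \<in> A" for a using
      that x AD(4) by simp
  have diffB: "B +>\<^bsub>?M A\<^esub> a = B +>\<^bsub>?M A\<^esub> a' \<longleftrightarrow> a
      \<oplus>\<^bsub>R\<^esub> \<ominus>\<^bsub>R\<^esub> a' \<in> B" if "a \<in> A" "a' \<in> A" for a a'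
    using QA.coset_eq_iff[of a a'] that neg by simp
  have ex3: "z = \<zero>\<^bsub>?N3\<^esub>" if "z \<in> carrier ?N3" "d3 z = \<zero>\<^bsub>?N2\<^esub>" for z
    using that d3v QA.coset_eq_sub_iff QA'.coset_eq_sub_iff A'(3) unfolding ex' QA.zero_quot QA'.zero_quot by
        fastforce
  have ex2: "d2 z = \<zero>\<^bsub>?N2\<^esub> \<longleftrightarrow> z \<in> d3 ` carrier ?N3" if z: "z \<in>
      carrier ?N2" for z
  proof -
    obtain a where a: "a \<in> A" "z = B +>\<^bsub>?M A\<^esub> a" using z ex by blast
    have "d2 z = \<zero>\<^bsub>?N2\<^esub> \<longleftrightarrow> (\<ominus>\<^bsub>R\<^esub> x)
        \<otimes>\<^bsub>R\<^esub> a \<in> B"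
      using a d2v QA.coset_eq_sub_iff[of "(\<ominus>\<^bsub>R\<^esub> x) \<otimes>\<^bsub>R\<^esub> a"] negx by
          (simp add: QA.zero_quot)
    also have "\<dots> \<longleftrightarrow> x \<otimes>\<^bsub>R\<^esub> a \<in> B"
      using BD(4)[of "\<ominus>\<^bsub>R\<^esub> \<one>\<^bsub>R\<^esub>" "(\<ominus>\<^bsub>R\<^esub> x)
          \<otimes>\<^bsub>R\<^esub> a"] BD(4)[of "\<ominus>\<^bsub>R\<^esub> \<one>\<^bsub>R\<^esub>" "x
          \<otimes>\<^bsub>R\<^esub> a"] a x AR
      by (auto simp: R.l_minus)
    also have "\<dots> \<longleftrightarrow> a \<in> A'" using a by (simp add: A'_def)
    also have "\<dots> \<longleftrightarrow> z \<in> d3 ` carrier ?N3"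
    proof
      assume "a \<in> A'"
      then have "z = d3 (B +>\<^bsub>?M A'\<^esub> a)" "B +>\<^bsub>?M A'\<^esub> a \<in> carrier ?N3" using
          d3v a ex' by auto
      then show "z \<in> d3 ` carrier ?N3" by blast
    next
      assume "z \<in> d3 ` carrier ?N3"
      then obtain a' where a': "a' \<in> A'" "z = B +>\<^bsub>?M A\<^esub> a'" using ex' d3v by auto
      then have "a \<oplus>\<^bsub>R\<^esub> \<ominus>\<^bsub>R\<^esub> a' \<in> A'" using diffB[of a a'] a A' by auto
      then have "(a \<oplus>\<^bsub>R\<^esub> \<ominus>\<^bsub>R\<^esub> a') \<oplus>\<^bsub>R\<^esub> a' \<in>
          A'" using submodule_regularD(3)[OF C.cring A'(1)] a' by blast
      then show "a \<in> A'" using a a' A'(3) AR by (auto simp: R.a_assoc R.l_neg)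
    qed
    finally show ?thesis .
  qed
  have ex1: "d1 z = \<zero>\<^bsub>?N0\<^esub> \<longleftrightarrow> z \<in> d2 ` carrier ?N2" if z: "z \<in>
      carrier ?N2" for z
  proof -
    obtain a where a: "a \<in> A" "z = B +>\<^bsub>?M A\<^esub> a" using z ex by blast
    have "d1 z = \<zero>\<^bsub>?N0\<^esub> \<longleftrightarrow> a \<in> Q"
      using a d1v QQ.coset_eq_sub_iff[of a] by (simp add: QQ.zero_quot)
    also have "\<dots> \<longleftrightarrow> z \<in> d2 ` carrier ?N2"
    proof
      assume "a \<in> Q"
      then obtain a1 b where ab: "a = x \<otimes>\<^bsub>R\<^esub> a1 \<oplus>\<^bsub>R\<^esub> b" "a1 \<in> A"
          "b \<in> B" by (auto simp: Q_def)
      have n: "\<ominus>\<^bsub>R\<^esub> a1 \<in> A" using AD(4)[of "\<ominus>\<^bsub>R\<^esub>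
          \<one>\<^bsub>R\<^esub>" a1] ab AR by (simp add: R.l_minus)
      have "a \<oplus>\<^bsub>R\<^esub> \<ominus>\<^bsub>R\<^esub> ((\<ominus>\<^bsub>R\<^esub> x)
          \<otimes>\<^bsub>R\<^esub> (\<ominus>\<^bsub>R\<^esub> a1)) = b"
        using ab x AR BR by (simp add: R.l_minus R.r_minus R.a_comm[of _ b] R.a_assoc R.r_neg)
      then have "z = d2 (B +>\<^bsub>?M A\<^esub> (\<ominus>\<^bsub>R\<^esub> a1))"
        using diffB[OF a(1) negx[OF n]] d2v[OF n] a ab by simp
      then show "z \<in> d2 ` carrier ?N2" using ex n by blast
    next
      assume "z \<in> d2 ` carrier ?N2"
      then obtain a1 where a1: "a1 \<in> A" "z = B +>\<^bsub>?M A\<^esub> ((\<ominus>\<^bsub>R\<^esub> x)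
          \<otimes>\<^bsub>R\<^esub> a1)" using ex d2v by auto
      then have b: "a \<oplus>\<^bsub>R\<^esub> \<ominus>\<^bsub>R\<^esub> ((\<ominus>\<^bsub>R\<^esub> x)
          \<otimes>\<^bsub>R\<^esub> a1) \<in> B" using diffB a negx by simp
      have n: "\<ominus>\<^bsub>R\<^esub> a1 \<in> A" using AD(4)[of "\<ominus>\<^bsub>R\<^esub>
          \<one>\<^bsub>R\<^esub>" a1] a1 AR by (simp add: R.l_minus)
      have "a = x \<otimes>\<^bsub>R\<^esub> (\<ominus>\<^bsub>R\<^esub> a1) \<oplus>\<^bsub>R\<^esub> (a
          \<oplus>\<^bsub>R\<^esub> \<ominus>\<^bsub>R\<^esub> ((\<ominus>\<^bsub>R\<^esub> x)
          \<otimes>\<^bsub>R\<^esub> a1))"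
        using a a1 x AR by (simp add: R.l_minus R.r_minus R.a_lcomm R.l_neg)
      then show "a \<in> Q" using QI[OF n b] by simp
    qed
    finally show ?thesis .
  qed
  have ex0: "carrier ?N0 \<subseteq> d1 ` carrier ?N2"
    using d1v by (auto simp: QQ.carrier_quot QA.carrier_quot image_iff)
  \<comment> \<open>A single map serves all the quotients: a representative, viewed in the test
    type.\<close>
  define e where "e = (\<lambda>X. \<epsilon> (SOME r. r \<in> X))"
  have inj: "inj_on e (carrier ?N3)" "inj_on e (carrier ?N2)" "inj_on e (carrier ?N0)"
    using comp_inj_on[OF QA.inj_on_representative, of \<epsilon>] comp_inj_on[OF QA'.inj_on_representative, of
        \<epsilon>]
      comp_inj_on[OF QQ.inj_on_representative, of \<epsilon>] inj_on_subset[OF \<epsilon> subset_UNIV]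
    by (simp_all add: e_def comp_def)
  have c3: "diff C (l + 1) (f3 z) = f2 (d3 z)" if "z \<in> carrier ?N3" for z
    using that A'(3) dw d3v f3v f2v unfolding ex' by (auto simp: subset_iff)
  have c2: "diff C l (f2 z) = f1 (d2 z)" if "z \<in> carrier ?N2" for z
    using that dp d2v f2v f1v negx x qC qD(3)[of "\<ominus>\<^bsub>R\<^esub> x"] unfolding ex by (auto simp:
        C.obj.smult_l_minus)
  have c1: "diff C (l - 1) (f1 z) = \<zero>\<^bsub>obj C (l - 1 - 1)\<^esub>" if "z \<in> carrier ?N2" for z
    using that dq f1v unfolding ex by auto
  obtain h2 h1 h0 where h2: "h2 \<in> module_hom R ?N2 (obj C (l + 1))"
    and h1: "h1 \<in> module_hom R ?N2 (obj C l)" and h0: "h0 \<in> module_hom R ?N0 (obj C (l - 1))"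
    and f2h: "\<And>z. z \<in> carrier ?N2 \<Longrightarrow> f2 z = diff C (l + 1) (h2 z) \<oplus>\<^bsub>obj C
        l\<^esub> h1 (d2 z)"
    and f1h: "\<And>z. z \<in> carrier ?N2 \<Longrightarrow> f1 z = diff C l (h1 z) \<oplus>\<^bsub>obj C (l -
        1)\<^esub> h0 (d1 z)"
    and dh0: "\<And>z. z \<in> carrier ?N0 \<Longrightarrow> diff C (l - 1) (h0 z) = \<zero>\<^bsub>obj C (l -
        1 - 1)\<^esub>"
    using four_term_homotopy[OF K C.cplx_axioms QA'.module_quot QA.module_quot QA.module_quot QQ.module_quot
        d3 d2 d1 ex3 ex2 ex1 ex0 inj(1,2,2,3) f3 f2 f1 c3 c2 c1] by blast
  \<comment> \<open>The values of \<open>h0\<close> are cycles of degree \<open>l - 1\<close>, which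
    has to be above \<open>t\<close>; this is where the bound moves up by one. The module
    \<open>A/Q\<close> is killed by \<open>x\<close> and \<open>Y\<close>, so \<open>h0\<close>
    lifts to \<open>g\<close>.\<close>
  have "hom_exact R A Q C (l - 1)"
    using A Q YA l xQ by (intro hyp) auto
  moreover have "(\<lambda>a. h0 (Q +>\<^bsub>?M A\<^esub> a)) \<in> module_hom R (?M A) (obj C (l - 1))"
    by (rule module_hom_comp[OF QQ.proj_hom h0])
  moreover have "h0 (Q +>\<^bsub>?M A\<^esub> a) = \<zero>\<^bsub>obj C (l - 1)\<^esub>" if "a \<in> Q" for a
    using module_hom_zero[OF QQ.module_quot C.module_obj h0] QQ.coset_eq_sub_iff[of a] that Q(3)
    by (auto simp: QQ.zero_quot)
  moreover have "diff C (l - 1) (h0 (Q +>\<^bsub>?M A\<^esub> a)) = \<zero>\<^bsub>obj C (l - 1 - 1)\<^esub>"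
      if "a \<in> A" for a
    using dh0 that by (simp add: QQ.carrier_quot)
  ultimately obtain g where g: "g \<in> module_hom R (?M A) (obj C l)"
    and gQ: "\<And>a. a \<in> Q \<Longrightarrow> g a = \<zero>\<^bsub>obj C l\<^esub>" and dg: "\<And>a. a
        \<in> A \<Longrightarrow> diff C l (g a) = h0 (Q +>\<^bsub>?M A\<^esub> a)"
    using hom_exactD[of R A Q C "l - 1" "\<lambda>a. h0 (Q +>\<^bsub>?M A\<^esub> a)"] by auto
  note gD = module_homD[OF g, simplified]
  define H2 where "H2 a = h2 (B +>\<^bsub>?M A\<^esub> a)" for a
  define H1 where "H1 a = h1 (B +>\<^bsub>?M A\<^esub> a)" for a
  have H2: "H2 \<in> module_hom R (?M A) (obj C (l + 1))" and H1: "H1 \<in> module_hom R (?M A) (obj C l)"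
    unfolding H2_def H1_def by (rule module_hom_comp[OF QA.proj_hom h2] module_hom_comp[OF QA.proj_hom h1])+
  \<comment> \<open>The homotopy gives \<open>p = d H2 - x H1\<close> and
    \<open>q = d H1 + d g\<close>. So \<open>(H2, - H1 - g)\<close> lifts \<open>(p, q)\<close> as
    soon as \<open>x g = 0\<close>, and this holds because \<open>g\<close> vanishes on
    \<open>Q\<close>, which contains \<open>x A\<close>.\<close>
  define k where "k a = \<ominus>\<^bsub>obj C l\<^esub> (H1 a \<oplus>\<^bsub>obj C l\<^esub> g a)" for a
  have k: "k \<in> module_hom R (?M A) (obj C l)"
    unfolding k_def by (intro module_hom_uminus module_hom_add C.module_obj H1 g)
  note H2D = module_homD[OF H2, simplified] and H1D = module_homD[OF H1, simplified]
    and kD = module_homD[OF k, simplified]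
  show "\<exists>g\<in>module_hom R (?M A) (obj (cone R x C) (l + 1)).
      (\<forall>b\<in>B. g b = \<zero>\<^bsub>obj (cone R x C) (l + 1)\<^esub>) \<and> (\<forall>a\<in>A. diff
          (cone R x C) (l + 1) (g a) = f a)"
  proof (intro bexI[of _ "\<lambda>a. Node (H2 a) (k a)"] conjI ballI)
    show "(\<lambda>a. Node (H2 a) (k a)) \<in> module_hom R (?M A) (obj (cone R x C) (l + 1))"
      by (intro module_homI) (auto simp: H2D kD)
    fix b assume b: "b \<in> B"
    have "B +>\<^bsub>?M A\<^esub> b = \<zero>\<^bsub>?N2\<^esub>" using QA.coset_eq_sub_iff[of b] b B(2) by
        (auto simp: QA.zero_quot)
    then show "Node (H2 b) (k b) = \<zero>\<^bsub>obj (cone R x C) (l + 1)\<^esub>"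
      using module_hom_zero[OF QA.module_quot C.module_obj h2] module_hom_zero[OF QA.module_quot C.module_obj h1]
        gQ[of b] b Q(2) by (auto simp: H2_def H1_def k_def)
  next
    fix a assume a: "a \<in> A"
    then have z: "B +>\<^bsub>?M A\<^esub> a \<in> carrier ?N2" using ex by blast
    have pa: "p a = diff C (l + 1) (H2 a) \<oplus>\<^bsub>obj C l\<^esub> (\<ominus>\<^bsub>R\<^esub> x)
        \<odot>\<^bsub>obj C l\<^esub> H1 a"
      using f2h[OF z] f2v[OF a] module_homD(3)[OF h1 _ z, of "\<ominus>\<^bsub>R\<^esub> x"] x
      by (simp add: H2_def H1_def d2_def)
    have qa: "q a = diff C l (H1 a) \<oplus>\<^bsub>obj C (l - 1)\<^esub> diff C l (g a)"
      using f1h[OF z] f1v[OF a] d1v[OF a] dg[OF a] by (simp add: H1_def)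
    have xg: "x \<odot>\<^bsub>obj C l\<^esub> g a = \<zero>\<^bsub>obj C l\<^esub>"
      using gD(3)[OF x a] gQ[OF xQ[OF a]] by simp
    show "diff (cone R x C) (l + 1) (Node (H2 a) (k a)) = f a"
      using a x by (simp add: fpq pa qa k_def H2D(1) H1D(1) gD(1) C.obj.smult_r_minus C.obj.smult_r_distr xg
          C.obj.smult_l_minus C.diff_neg C.diff_add)
  qed
qed

text \<open>The test type is infinite, hence has an injective pairing, by which trees are coded
  recursively. The codes of a leaf and of a node may collide, but all elements of one iterated cone
  have the same shape, so the coding is injective on each term.\<close>

lemma kos_embedding:
  fixes C :: "('r, 'e) chain_complex"
  shows "\<exists>e :: 'e tree \<Rightarrow> 'e + 'r list. \<forall>l. inj_on e (carrier (obj (kos R xs C) l))"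
proof -
  have "infinite (UNIV :: 'r list set)" by (rule infinite_UNIV_listI)
  then have "infinite (range (Inr :: 'r list \<Rightarrow> 'e + 'r list))" by (simp add: finite_image_iff)
  then have inf: "infinite (UNIV :: ('e + 'r list) set)" by (rule infinite_super[rotated]) simp
  have "\<exists>f :: ('e + 'r list) \<times> ('e + 'r list) \<Rightarrow> 'e + 'r list. inj_on f (UNIV
      \<times> UNIV) \<and> f ` (UNIV \<times> UNIV) \<subseteq> UNIV"
    unfolding card_of_ordLeq by (rule ordIso_imp_ordLeq[OF card_of_Times_same_infinite[OF inf]])
  then obtain pair :: "('e + 'r list) \<times> ('e + 'r list) \<Rightarrow> 'e + 'r list" where pair: "inj
      pair" by auto
  define enc where "enc = rec_tree (\<lambda>a. Inl a) (\<lambda>_ _ u v. pair (u, v))"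
  have enc: "enc (Leaf a) = Inl a" "enc (Node s t) = pair (enc s, enc t)" for a s t
    by (simp_all add: enc_def)
  have "inj_on enc (carrier (obj (kos R xs C) l))" for l
  proof (induction xs arbitrary: l)
    case Nil
    show ?case by (auto simp: inj_on_def enc)
  next
    case (Cons x xs)
    show ?case
      using Cons[of l] Cons[of "l - 1"] by (auto simp: inj_on_def enc inj_eq[OF pair])
  qed
  then show ?thesis by blast
qed

section \<open>Passing between a complex and its iterated cones\<close>

lemma hom_exact_leaf:
  assumes "cplx R C"
  shows "hom_exact R A B (leaf_complex C) l \<longleftrightarrow> hom_exact R A B C l"
proof
  interpret C: cplx R C by fact
  let ?A = "(regular_module R)\<lparr>carrier := A\<rparr>"
  note tr = transport_hom[of R "obj C i" leaf_val Leaf for i, OF C.module_obj, simplified]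
  assume h: "hom_exact R A B (leaf_complex C) l"
  show "hom_exact R A B C l"
    unfolding hom_exact_def
  proof (intro ballI impI)
    fix f assume f: "f \<in> module_hom R ?A (obj C l)"
      and fB: "\<forall>b\<in>B. f b = \<zero>\<^bsub>obj C l\<^esub>" and df: "\<forall>a\<in>A. diff C l (f
          a) = \<zero>\<^bsub>obj C (l - 1)\<^esub>"
    have "(\<lambda>a. Leaf (f a)) \<in> module_hom R ?A (obj (leaf_complex C) l)"
      using module_hom_comp[OF f tr(1)] by simp
    from hom_exactD[OF h this] obtain g
      where g: "g \<in> module_hom R ?A (obj (leaf_complex C) (l + 1))"
      and gB: "\<forall>b\<in>B. g b = Leaf \<zero>\<^bsub>obj C (l + 1)\<^esub>" and dg: "\<forall>a\<in>A.
          Leaf (diff C (l + 1) (leaf_val (g a))) = Leaf (f a)"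
      using fB df by auto
    have "(\<lambda>a. leaf_val (g a)) \<in> module_hom R ?A (obj C (l + 1))"
      using module_hom_comp[OF g, of leaf_val] tr(2) by simp
    then show "\<exists>g\<in>module_hom R ?A (obj C (l + 1)).
        (\<forall>b\<in>B. g b = \<zero>\<^bsub>obj C (l + 1)\<^esub>) \<and> (\<forall>a\<in>A. diff C (l + 1)
            (g a) = f a)"
      using gB dg by (intro bexI[of _ "\<lambda>a. leaf_val (g a)"]) simp_all
  qed
next
  interpret C: cplx R C by fact
  let ?A = "(regular_module R)\<lparr>carrier := A\<rparr>"
  note tr = transport_hom[of R "obj C i" leaf_val Leaf for i, OF C.module_obj, simplified]
  assume h: "hom_exact R A B C l"
  show "hom_exact R A B (leaf_complex C) l"
    unfolding hom_exact_def
  proof (intro ballI impI)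
    fix f assume f: "f \<in> module_hom R ?A (obj (leaf_complex C) l)"
      and fB: "\<forall>b\<in>B. f b = \<zero>\<^bsub>obj (leaf_complex C) l\<^esub>"
      and df: "\<forall>a\<in>A. diff (leaf_complex C) l (f a) = \<zero>\<^bsub>obj (leaf_complex C) (l - 1)\<^esub>"
    have fl: "Leaf (leaf_val (f a)) = f a" if "a \<in> A" for a
      using module_homD(1)[OF f, of a] that by auto
    have "(\<lambda>a. leaf_val (f a)) \<in> module_hom R ?A (obj C l)"
      using module_hom_comp[OF f, of leaf_val] tr(2) by simp
    from hom_exactD[OF h this] obtain g
      where g: "g \<in> module_hom R ?A (obj C (l + 1))"
      and gB: "\<forall>b\<in>B. g b = \<zero>\<^bsub>obj C (l + 1)\<^esub>" and dg: "\<forall>a\<in>A. diff C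
          (l + 1) (g a) = leaf_val (f a)"
      using fB df by auto
    have "(\<lambda>a. Leaf (g a)) \<in> module_hom R ?A (obj (leaf_complex C) (l + 1))"
      using module_hom_comp[OF g tr(1)] by simp
    then show "\<exists>g\<in>module_hom R ?A (obj (leaf_complex C) (l + 1)).
        (\<forall>b\<in>B. g b = \<zero>\<^bsub>obj (leaf_complex C) (l + 1)\<^esub>) \<and>
        (\<forall>a\<in>A. diff (leaf_complex C) (l + 1) (g a) = f a)"
      using gB dg fl by (intro bexI[of _ "\<lambda>a. Leaf (g a)"]) simp_all
  qed
qed

text \<open>Peeling off the outermost cone, over \<open>x\<close>, trades modules killed by
  \<open>Y\<close> for modules killed by \<open>x\<close> and \<open>Y\<close>. When
  \<open>C\<close> is reached all of \<open>xs\<close> has been collected in \<open>Y\<close>, and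
  \<open>hyp\<close> applies. This is why the induction is stated for arbitrary
  \<open>Y\<close>.\<close>

lemma hom_exact_above_kos:
  fixes R :: "'r ring" and \<epsilon> :: "'r \<Rightarrow> 't"
  assumes K: "K_inj_wrt TYPE('t) R C" and C: "cplx R C" and xs: "set xs \<subseteq> carrier R" and \<epsilon>:
      "inj \<epsilon>"
    and hyp: "\<And>A B l. submodule A R (regular_module R) \<Longrightarrow> submodule B R (regular_module R)
        \<Longrightarrow> B \<subseteq> A \<Longrightarrow>
      (\<And>y a. y \<in> set xs \<union> Y \<Longrightarrow> a \<in> A \<Longrightarrow> y
          \<otimes>\<^bsub>R\<^esub> a \<in> B) \<Longrightarrow> t < l \<Longrightarrow> hom_exact R A B C l"
    and AB: "submodule A R (regular_module R)" "submodule B R (regular_module R)" "B \<subseteq> A"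
      "\<And>y a. y \<in> Y \<Longrightarrow> a \<in> A \<Longrightarrow> y \<otimes>\<^bsub>R\<^esub> a \<in> B"
    and l: "t + int (length xs) < l"
  shows "hom_exact R A B (kos R xs C) l"
  using xs hyp AB l
proof (induction xs arbitrary: Y A B l)
  case Nil
  then show ?case by (simp add: hom_exact_leaf[OF C])
next
  case (Cons x xs)
  have xs: "set xs \<subseteq> carrier R" and x: "x \<in> carrier R" using Cons.prems(1) by auto
  have "tree_cplx R (kos R xs C)" using cplx.kos_cplx[OF C xs] by (simp add: tree_cplx_def)
  then have "hom_exact R A B (cone R x (kos R xs C)) l"
  proof (rule hom_exact_cone[OF K_inj_wrt_kos[OF K C xs] _ x \<epsilon>, where t = "t + int (length xs)" and Y = Y])
    fix A B l
    assume AB: "submodule A R (regular_module R)" "submodule B R (regular_module R)" "B \<subseteq> A"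
      and Y: "\<And>y a. y \<in> insert x Y \<Longrightarrow> a \<in> A \<Longrightarrow> y
          \<otimes>\<^bsub>R\<^esub> a \<in> B" and l: "t + int (length xs) < l"
    show "hom_exact R A B (kos R xs C) l"
    proof (rule Cons.IH[OF xs _ AB Y l])
      fix A B l
      assume "submodule A R (regular_module R)" "submodule B R (regular_module R)" "B \<subseteq> A"
        "\<And>y a. y \<in> set xs \<union> insert x Y \<Longrightarrow> a \<in> A \<Longrightarrow> y
            \<otimes>\<^bsub>R\<^esub> a \<in> B" "t < l"
      then show "hom_exact R A B C l" by (intro Cons.prems(2)) auto
    qed
  qed (use Cons.prems in auto)
  then show ?case by simp
qed

text \<open>All of \<open>xs\<close> kills \<open>A/B\<close>, so every cone can be removed by
  \<open>hom_exact_of_cone\<close>; each removal lowers the degree by one.\<close>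

lemma hom_exact_of_kos:
  fixes R :: "'r ring"
  assumes C: "cplx R C" and xs: "set xs \<subseteq> carrier R"
    and h: "hom_exact R A B (kos R xs C) (l + int (length xs))"
    and A: "\<And>y a. y \<in> set xs \<Longrightarrow> a \<in> A \<Longrightarrow> y
        \<otimes>\<^bsub>R\<^esub> a \<in> B"
  shows "hom_exact R A B C l"
  using xs h A
proof (induction xs)
  case Nil
  then show ?case by (simp add: hom_exact_leaf[OF C])
next
  case (Cons x xs)
  have "tree_cplx R (kos R xs C)" using cplx.kos_cplx[OF C, of xs] Cons.prems by (simp add: tree_cplx_def)
  then have "hom_exact R A B (kos R xs C) (l + int (length (x # xs)) - 1)"
    by (rule tree_cplx.hom_exact_of_cone[of R _ x]) (use Cons.prems in auto)
  then show ?case using Cons by simp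
qed

section \<open>Ext of a cyclic module\<close>

lemma stalk_complex_sel [simp]:
  "carrier (obj (stalk_complex N) l) = (if l = 0 then carrier N else {\<zero>\<^bsub>N\<^esub>})"
  "zero (obj (stalk_complex N) l) = zero N" "add (obj (stalk_complex N) l) = add N"
  "smult (obj (stalk_complex N) l) = smult N" "diff (stalk_complex N) l = (\<lambda>_. \<zero>\<^bsub>N\<^esub>)"
  by (simp_all add: stalk_complex_def)

lemma stalk_complex_cplx:
  assumes "module R N"
  shows "cplx R (stalk_complex N)"
proof
  interpret N: module R N by fact
  have "module R (obj (stalk_complex N) l)" for l
    using assms module_zero_submodule[OF assms] by (simp add: stalk_complex_def)
  then show "is_complex R (stalk_complex N)"
    unfolding is_complex_def by (auto intro!: module_homI)
qed

lemma regular_module_carrier: "(regular_module R)\<lparr>carrier := carrier R\<rparr> = regular_module R"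
  by (simp add: regular_module_def mk_module_def)

text \<open>A stalk complex has at most one nonzero term. So an element of the Hom complex is given
  by its component at \<open>p = 0\<close>, a map on \<open>R/\<aa>\<close> or, equivalently, a map
  on \<open>R\<close> that vanishes on \<open>\<aa>\<close>. The facts \<open>ext\<close>,
  \<open>lift\<close> and \<open>descend\<close> make up this identification.\<close>

lemma exact_at_hom_stalk_iff:
  fixes R :: "'r ring" and I :: "('r, 'e) chain_complex"
  assumes I: "cplx R I" and a: "submodule \<aa> R (regular_module R)"
  shows "exact_at (hom_complex R (stalk_complex (quot_module (regular_module R) \<aa>)) I) l \<longleftrightarrow>
    hom_exact R (carrier R) \<aa> I l"
proof -
  interpret I: cplx R I by fact
  interpret Q: quotient_mod R "regular_module R" \<aa>
    using module_regular[OF I.cring] a by (rule quotient_mod.intro)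
  let ?Q = "quot_module (regular_module R) \<aa>"
  interpret P: cplx_pair R "stalk_complex ?Q" I
    using stalk_complex_cplx[OF Q.module_quot] I by (rule cplx_pair.intro)
  let ?H = "hom_complex R (stalk_complex ?Q) I"
  have Q0: "\<zero>\<^bsub>?Q\<^esub> \<in> carrier ?Q" using P.X.obj.M.zero_closed[of 0] by simp
  have zero: "f p \<zero>\<^bsub>?Q\<^esub> = \<zero>\<^bsub>obj I (p + l)\<^esub>" if "f \<in> carrier (obj ?H
      l)" for f p l
  proof -
    have "f p \<in> module_hom R (obj (stalk_complex ?Q) p) (obj I (p + l))"
      using that unfolding P.hom_complex_sel by blast
    from module_hom_zero[OF P.X.module_obj I.module_obj this] show ?thesis by simp
  qed
  \<comment> \<open>For \<open>p\<close> other than 0 the domain consists of zero alone. The value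
    \<open>undefined\<close> outside the carriers comes from extensionality.\<close>
  have dH: "diff ?H l f p x = (if p = 0 \<and> x \<in> carrier ?Q then diff I l (f 0 x) else
      if x = \<zero>\<^bsub>?Q\<^esub> then \<zero>\<^bsub>obj I (p + l - 1)\<^esub> else undefined)"
    if f: "f \<in> carrier (obj ?H l)" for f p x l
  proof -
    have idx: "p - 1 + l = p + l - 1" by simp
    have f1: "f (p - 1) \<zero>\<^bsub>?Q\<^esub> = \<zero>\<^bsub>obj I (p + l - 1)\<^esub>" using zero[OF f,
        of "p - 1"] by (simp only: idx)
    have ps: "parity_sign (obj I (p + l - 1)) l \<zero>\<^bsub>obj I (p + l - 1)\<^esub> = \<zero>\<^bsub>obj I
        (p + l - 1)\<^esub>"
      by (simp add: parity_sign_def)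
    have "f p x \<in> carrier (obj I (p + l))" if "x \<in> carrier (obj (stalk_complex ?Q) p)"
    proof -
      have "f p \<in> module_hom R (obj (stalk_complex ?Q) p) (obj I (p + l))"
        using f unfolding P.hom_complex_sel by blast
      then show ?thesis using that by (rule module_homD(1))
    qed
    then show ?thesis
      using zero[OF f, of p] Q0 unfolding P.hom_complex_sel(5)
      by (auto simp: f1 ps a_minus_def)
  qed
  have ext: "f = g" if f: "f \<in> carrier (obj ?H l)" and g: "g \<in> carrier (obj ?H l)"
    and eq: "\<And>x. x \<in> carrier ?Q \<Longrightarrow> f 0 x = g 0 x" for f g l
  proof (rule ext)
    fix p
    have fe: "f p \<in> extensional (carrier (obj (stalk_complex ?Q) p))"
      and ge: "g p \<in> extensional (carrier (obj (stalk_complex ?Q) p))"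
      using f g unfolding P.hom_complex_sel by blast+
    show "f p = g p"
      by (rule extensionalityI[OF fe ge]) (use eq zero[OF f] zero[OF g] in \<open>auto split: if_splits\<close>)
  qed
  have lift: "\<exists>f\<in>carrier (obj ?H l). \<forall>r\<in>carrier R. f 0 (\<aa> +>\<^bsub>regular_module
      R\<^esub> r) = F r"
    if F: "F \<in> module_hom R (regular_module R) (obj I l)" and Fa: "\<And>b. b \<in> \<aa> \<Longrightarrow>
        F b = \<zero>\<^bsub>obj I l\<^esub>" for F l
  proof -
    obtain f0 where f0: "f0 \<in> module_hom R ?Q (obj I l)"
      and f0v: "\<And>r. r \<in> carrier R \<Longrightarrow> f0 (\<aa> +>\<^bsub>regular_module R\<^esub> r) = F r"
      using Q.quot_lift[OF I.module_obj F Fa] by auto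
    define f where "f p = restrict (if p = 0 then f0 else (\<lambda>_. \<zero>\<^bsub>obj I (p + l)\<^esub>))
        (carrier (obj (stalk_complex ?Q) p))" for p
    have "(if p = 0 then f0 else (\<lambda>_. \<zero>\<^bsub>obj I (p + l)\<^esub>)) \<in> module_hom R (obj
        (stalk_complex ?Q) p) (obj I (p + l))" for p
      using f0 by (simp add: stalk_complex_def module_hom_const_zero[OF I.module_obj])
    then have "f \<in> carrier (obj ?H l)"
      unfolding P.hom_complex_sel f_def using module_hom_restrict[OF P.X.module_obj] by blast
    moreover have "f 0 (\<aa> +>\<^bsub>regular_module R\<^esub> r) = F r" if "r \<in> carrier R" for r
      using f0v that by (simp add: f_def Q.carrier_quot)
    ultimately show ?thesis by blast
  qed
  have descend: "(\<lambda>r. f 0 (\<aa> +>\<^bsub>regular_module R\<^esub> r)) \<in> module_hom R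
      (regular_module R) (obj I l)"
    "\<And>b. b \<in> \<aa> \<Longrightarrow> f 0 (\<aa> +>\<^bsub>regular_module R\<^esub> b) =
        \<zero>\<^bsub>obj I l\<^esub>" if f: "f \<in> carrier (obj ?H l)" for f l
  proof -
    have f0: "f 0 \<in> module_hom R (obj (stalk_complex ?Q) 0) (obj I (0 + l))"
      using f unfolding P.hom_complex_sel by blast
    then show "(\<lambda>r. f 0 (\<aa> +>\<^bsub>regular_module R\<^esub> r)) \<in> module_hom R
        (regular_module R) (obj I l)"
      using module_hom_comp[OF Q.proj_hom, of "f 0"] by (simp add: stalk_complex_def)
    show "f 0 (\<aa> +>\<^bsub>regular_module R\<^esub> b) = \<zero>\<^bsub>obj I l\<^esub>" if "b \<in> \<aa>" for b
      using zero[OF f, of 0] Q.coset_eq_sub_iff[of b] Q.sub_carrier[OF that] that by (simp add: Q.zero_quot)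
  qed
  note dHc = module_homD(1)[OF P.diff_hom_complex_hom]
  show ?thesis
  proof
    assume ex: "exact_at ?H l"
    show "hom_exact R (carrier R) \<aa> I l"
      unfolding hom_exact_def regular_module_carrier
    proof (intro ballI impI)
      fix F assume F: "F \<in> module_hom R (regular_module R) (obj I l)"
        and Fa: "\<forall>b\<in>\<aa>. F b = \<zero>\<^bsub>obj I l\<^esub>" and dF: "\<forall>r\<in>carrier R.
            diff I l (F r) = \<zero>\<^bsub>obj I (l - 1)\<^esub>"
      obtain f where f: "f \<in> carrier (obj ?H l)"
        and fF: "\<And>r. r \<in> carrier R \<Longrightarrow> f 0 (\<aa> +>\<^bsub>regular_module R\<^esub> r) = F r"
        using lift[OF F] Fa by blast
      have "diff ?H l f = \<zero>\<^bsub>obj ?H (l - 1)\<^esub>"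
        by (rule ext[OF dHc[OF f] P.module_hom_complex[THEN module.axioms(2), THEN abelian_group.axioms(1),
            THEN abelian_monoid.zero_closed]])
          (use fF dF in \<open>auto simp: dH[OF f] Q.carrier_quot P.hom_complex_sel(2)\<close>)
      then obtain g where g: "g \<in> carrier (obj ?H (l + 1))" and dg: "diff ?H (l + 1) g = f"
        using exact_atD[OF ex f] by blast
      have "diff I (l + 1) (g 0 (\<aa> +>\<^bsub>regular_module R\<^esub> r)) = F r" if "r \<in> carrier R" for r
        using dH[OF g, of 0 "\<aa> +>\<^bsub>regular_module R\<^esub> r"] fF[OF that] that by (simp add: dg
            Q.carrier_quot)
      then show "\<exists>G\<in>module_hom R (regular_module R) (obj I (l + 1)).
          (\<forall>b\<in>\<aa>. G b = \<zero>\<^bsub>obj I (l + 1)\<^esub>) \<and> (\<forall>r\<in>carrier R.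
              diff I (l + 1) (G r) = F r)"
        by (intro bexI[OF _ descend(1)[OF g]]) (simp add: descend(2)[OF g])
    qed
  next
    assume ex: "hom_exact R (carrier R) \<aa> I l"
    show "exact_at ?H l"
      unfolding exact_at_def
    proof (intro ballI impI)
      fix f assume f: "f \<in> carrier (obj ?H l)" and df: "diff ?H l f = \<zero>\<^bsub>obj ?H (l - 1)\<^esub>"
      let ?F = "\<lambda>r. f 0 (\<aa> +>\<^bsub>regular_module R\<^esub> r)"
      have dF: "diff I l (?F r) = \<zero>\<^bsub>obj I (l - 1)\<^esub>" if "r \<in> carrier R" for r
        using dH[OF f, of 0 "\<aa> +>\<^bsub>regular_module R\<^esub> r"] that by (simp add: df Q.carrier_quot
            P.hom_complex_sel(2))
      have F: "?F \<in> module_hom R ((regular_module R)\<lparr>carrier := carrier R\<rparr>) (obj I l)"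
        using descend(1)[OF f] by (simp add: regular_module_carrier)
      from hom_exactD[OF ex F descend(2)[OF f] dF] obtain G
        where G: "G \<in> module_hom R (regular_module R) (obj I (l + 1))"
        and Ga: "\<And>b. b \<in> \<aa> \<Longrightarrow> G b = \<zero>\<^bsub>obj I (l + 1)\<^esub>" and dG:
            "\<And>r. r \<in> carrier R \<Longrightarrow> diff I (l + 1) (G r) = ?F r"
        unfolding regular_module_carrier by blast
      obtain g where g: "g \<in> carrier (obj ?H (l + 1))"
        and gG: "\<And>r. r \<in> carrier R \<Longrightarrow> g 0 (\<aa> +>\<^bsub>regular_module R\<^esub> r) = G r"
        using lift[OF G Ga] by blast
      have "diff ?H (l + 1) g \<in> carrier (obj ?H l)" using dHc[OF g] by simp
      then have "diff ?H (l + 1) g = f"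
        by (rule ext[OF _ f]) (use gG dG in \<open>auto simp: dH[OF g] Q.carrier_quot\<close>)
      then show "\<exists>g\<in>carrier (obj ?H (l + 1)). diff ?H (l + 1) g = f" using g by blast
    qed
  qed
qed

theorem Ext_vanishing_iff:
  fixes R :: "'r ring" and I :: "('r, 'e) chain_complex"
  assumes R: "cring R" and I: "K_injective R I" and xs: "set xs \<subseteq> carrier R"
  shows "(\<forall>l>t. \<not> nonzero_module (Ext_module R (- l) (quot_module (regular_module R)
      (Idl\<^bsub>R\<^esub> (set xs))) I)) \<longleftrightarrow>
    (\<forall>l>t + int (length xs). exact_at (kos R xs I) l)"
proof -
  interpret R: cring R by fact
  interpret I: cplx R I using I by unfold_locales (simp add: K_injective_def)
  have K: "K_inj_wrt TYPE('e + 'r list) R I" by (rule K_injective_K_inj_wrt[OF I])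
  let ?a = "Idl\<^bsub>R\<^esub> (set xs)"
  interpret a: ideal ?a R by (rule R.genideal_ideal[OF xs])
  have sub: "submodule ?a R (regular_module R)"
    using a.I_l_closed by (intro submodule_regularI[OF R]) (auto simp: a.Icarr)
  have sub_carrier: "submodule (carrier R) R (regular_module R)"
    and sub_zero: "submodule {\<zero>\<^bsub>R\<^esub>} R (regular_module R)"
    by (auto intro!: submodule_regularI[OF R])
  interpret kos: cplx R "kos R xs I" by (rule I.kos_cplx[OF xs])
  have gen: "set xs \<subseteq> ?a" by (rule R.genideal_self[OF xs])
  interpret Q: quotient_mod R "regular_module R" ?a
    using module_regular[OF R] sub by (rule quotient_mod.intro)
  interpret P: cplx_pair R "stalk_complex (quot_module (regular_module R) ?a)" I
    using stalk_complex_cplx[OF Q.module_quot] I.cplx_axioms by (rule cplx_pair.intro)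
  have "(\<not> nonzero_module (Ext_module R (- l) (quot_module (regular_module R) ?a) I)) \<longleftrightarrow>
      hom_exact R (carrier R) ?a I l" for l
    by (simp add: Ext_module_def P.nonzero_homology_hom_complex exact_at_hom_stalk_iff[OF I.cplx_axioms sub])
  moreover have "(\<forall>l>t. hom_exact R (carrier R) ?a I l) \<longleftrightarrow> (\<forall>l>t + int
      (length xs). exact_at (kos R xs I) l)"
  proof (intro iffI allI impI)
    fix l assume h: "\<forall>l>t. hom_exact R (carrier R) ?a I l" and l: "t + int (length xs) < l"
    have emb: "inj (\<lambda>r. Inr [r] :: 'e + 'r list)" by (simp add: inj_def)
    \<comment> \<open>The module \<open>R/0\<close> is where the removal of annihilation conditions
      ends: for it, exactness of Hom is exactness of the iterated cone itself.\<close>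
    have "hom_exact R (carrier R) {\<zero>\<^bsub>R\<^esub>} (kos R xs I) l"
    proof (rule hom_exact_above_kos[OF K I.cplx_axioms xs emb, where Y = "{}" and t = t])
      fix A B l
      assume AB: "submodule A R (regular_module R)" "submodule B R (regular_module R)" "B \<subseteq> A"
        "\<And>y a. y \<in> set xs \<union> {} \<Longrightarrow> a \<in> A \<Longrightarrow> y
            \<otimes>\<^bsub>R\<^esub> a \<in> B" and l: "t < l"
      note AD = submodule_regularD[OF R AB(1)] and BD = submodule_regularD[OF R AB(2)]
      \<comment> \<open>It is given that the generators move \<open>A\<close> into \<open>B\<close>,
        but all of \<open>?a\<close> has to do so. The elements with this property form an ideal, so
        the case of the generators is enough.\<close>
      have "ideal {r \<in> carrier R. \<forall>a\<in>A. r \<otimes>\<^bsub>R\<^esub> a \<in> B} R"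
      proof (rule idealI)
        show "ring R" by (rule R.ring_axioms)
        show "subgroup {r \<in> carrier R. \<forall>a\<in>A. r \<otimes>\<^bsub>R\<^esub> a \<in> B} (add_monoid R)"
        proof (rule R.add.subgroupI)
          fix r assume r: "r \<in> {r \<in> carrier R. \<forall>a\<in>A. r \<otimes>\<^bsub>R\<^esub> a \<in> B}"
          have "(\<ominus>\<^bsub>R\<^esub> r) \<otimes>\<^bsub>R\<^esub> a = (\<ominus>\<^bsub>R\<^esub>
              \<one>\<^bsub>R\<^esub>) \<otimes>\<^bsub>R\<^esub> (r \<otimes>\<^bsub>R\<^esub> a)" if "a \<in>
              A" for a
            using r that AD(1) by (auto simp: R.l_minus subset_iff)
          then show "\<ominus>\<^bsub>R\<^esub> r \<in> {r \<in> carrier R. \<forall>a\<in>A. r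
              \<otimes>\<^bsub>R\<^esub> a \<in> B}" using r BD(4) by simp
        next
          have "\<zero>\<^bsub>R\<^esub> \<in> {r \<in> carrier R. \<forall>a\<in>A. r
              \<otimes>\<^bsub>R\<^esub> a \<in> B}" using AD BD by (auto simp: subset_iff)
          then show "{r \<in> carrier R. \<forall>a\<in>A. r \<otimes>\<^bsub>R\<^esub> a \<in> B} \<noteq> {}"
              by blast
        qed (use AD BD in \<open>auto simp: R.l_distr subset_iff\<close>)
        fix r s assume r: "r \<in> {r \<in> carrier R. \<forall>a\<in>A. r \<otimes>\<^bsub>R\<^esub> a \<in>
            B}" and s: "s \<in> carrier R"
        have "(s \<otimes>\<^bsub>R\<^esub> r) \<otimes>\<^bsub>R\<^esub> a \<in> B" if "a \<in> A" for a
          using BD(4)[OF s, of "r \<otimes>\<^bsub>R\<^esub> a"] r s that AD(1) by (auto simp: R.m_assoc subset_iff)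
        then show "s \<otimes>\<^bsub>R\<^esub> r \<in> {r \<in> carrier R. \<forall>a\<in>A. r
            \<otimes>\<^bsub>R\<^esub> a \<in> B}" using r s by simp
        then show "r \<otimes>\<^bsub>R\<^esub> s \<in> {r \<in> carrier R. \<forall>a\<in>A. r
            \<otimes>\<^bsub>R\<^esub> a \<in> B}" using r s by (simp add: R.m_comm)
      qed
      moreover have "set xs \<subseteq> {r \<in> carrier R. \<forall>a\<in>A. r \<otimes>\<^bsub>R\<^esub> a
          \<in> B}" using AB(4) xs by auto
      ultimately have aA: "?a \<subseteq> {r \<in> carrier R. \<forall>a\<in>A. r \<otimes>\<^bsub>R\<^esub> a
          \<in> B}" by (rule R.genideal_minimal)
      show "hom_exact R A B I l"
      proof (rule hom_exact_above[OF K I.cplx_axioms _ _ _ AD(1) AB(3) _ l])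
        show "?a \<subseteq> carrier R" by (rule a.a_subset)
        show "inj_on Inl (carrier (obj I l))" for l by simp
        show "exact_at (annihilated ?a I) l" if "t < l" for l
          using I.exact_at_annihilated_of_hom_exact h that a.a_subset by blast
      qed (use aA in blast)
    qed (use sub_carrier sub_zero l in auto)
    then have "exact_at (annihilated {\<zero>\<^bsub>R\<^esub>} (kos R xs I)) l"
      by (rule kos.exact_at_annihilated_of_hom_exact) simp
    then show "exact_at (kos R xs I) l"
      by (simp add: exact_at_def Ball_def Bex_def cong: conj_cong)
  next
    fix l assume h: "\<forall>l>t + int (length xs). exact_at (kos R xs I) l" and l: "t < l"
    obtain e :: "'e tree \<Rightarrow> 'e + 'r list" where e: "\<And>l. inj_on e (carrier (obj (kos R xs I) l))"
      using kos_embedding by blast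
    \<comment> \<open>The iterated cone is K-injective with respect to the test type of
      \<open>I\<close>, and \<open>e\<close> embeds its terms there. Its truncation can therefore
      serve as a test complex, with \<open>S = {}\<close> since the cone itself is exact above the
      bound.\<close>
    have "hom_exact R (carrier R) ?a (kos R xs I) (l + int (length xs))"
    proof (rule hom_exact_above[OF K_inj_wrt_kos[OF K I.cplx_axioms xs] kos.cplx_axioms _ e, where S = "{}" and
        t = "t + int (length xs)"])
      show "exact_at (annihilated {} (kos R xs I)) l" if "t + int (length xs) < l" for l
        using h that by (simp add: annihilated_def subcomplex_def)
    qed (use l a.a_subset in auto)
    then show "hom_exact R (carrier R) ?a I l"
      by (rule hom_exact_of_kos[OF I.cplx_axioms xs]) (use gen xs a.I_r_closed in auto)
  qed
  ultimately show ?thesis by simp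
qed

section \<open>Tensor products\<close>

lemma free_module_sel [simp]:
  "carrier (free_module R S) =
    {u. (\<forall>a. u a \<in> carrier R) \<and> (\<forall>a. a \<notin> S \<longrightarrow> u a =
        \<zero>\<^bsub>R\<^esub>) \<and> finite {a. u a \<noteq> \<zero>\<^bsub>R\<^esub>}}"
  "\<zero>\<^bsub>free_module R S\<^esub> = (\<lambda>a. \<zero>\<^bsub>R\<^esub>)"
  "u \<oplus>\<^bsub>free_module R S\<^esub> v = (\<lambda>a. u a \<oplus>\<^bsub>R\<^esub> v a)"
  "r \<odot>\<^bsub>free_module R S\<^esub> u = (\<lambda>a. r \<otimes>\<^bsub>R\<^esub> u a)"
  by (simp_all add: free_module_def)

lemma module_free:
  assumes R: "cring R"
  shows "module R (free_module R S)"
proof -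
  interpret R: cring R by fact
  let ?F = "free_module R S"
  have fin: "finite {a. f a \<noteq> \<zero>\<^bsub>R\<^esub>}" if "finite {a. u a \<noteq>
      \<zero>\<^bsub>R\<^esub>}" "\<And>a. u a = \<zero>\<^bsub>R\<^esub> \<Longrightarrow> f a =
      \<zero>\<^bsub>R\<^esub>" for u f
    by (rule finite_subset[OF _ that(1)]) (use that(2) in auto)
  have fin2: "finite {a. u a \<oplus>\<^bsub>R\<^esub> v a \<noteq> \<zero>\<^bsub>R\<^esub>}"
    if "finite {a. u a \<noteq> \<zero>\<^bsub>R\<^esub>}" "finite {a. v a \<noteq> \<zero>\<^bsub>R\<^esub>}" for u v
    by (rule finite_subset[OF _ finite_UnI[OF that]]) auto
  show ?thesis
  proof (rule moduleI)
    show "abelian_group ?F"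
    proof (rule abelian_groupI)
      fix u assume u: "u \<in> carrier ?F"
      show "\<exists>v\<in>carrier ?F. v \<oplus>\<^bsub>?F\<^esub> u = \<zero>\<^bsub>?F\<^esub>"
        using u fin[of u "\<lambda>a. \<ominus>\<^bsub>R\<^esub> u a"] by (intro bexI[of _ "\<lambda>a.
            \<ominus>\<^bsub>R\<^esub> u a"]) (auto simp: R.l_neg)
    qed (auto simp: R.a_ac fin2 fun_eq_iff)
  next
    fix r u assume "r \<in> carrier R" "u \<in> carrier ?F"
    then show "r \<odot>\<^bsub>?F\<^esub> u \<in> carrier ?F" using fin[of u "\<lambda>a. r
        \<otimes>\<^bsub>R\<^esub> u a"] by auto
  qed (auto simp: R.l_distr R.r_distr R.m_assoc R fun_eq_iff)
qed

lemma free_gen_closed: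
  assumes "cring R" "a \<in> S"
  shows "free_gen R a \<in> carrier (free_module R S)"
proof -
  interpret cring R by fact
  have "finite {b. free_gen R a b \<noteq> \<zero>\<^bsub>R\<^esub>}"
    by (rule finite_subset[of _ "{a}"]) (auto simp: free_gen_def)
  then show ?thesis using assms(2) by (auto simp: free_gen_def)
qed

text \<open>Induction on a finite set containing the support of \<open>u\<close>, splitting off one
  coefficient at a time.\<close>

lemma free_hom_ext:
  assumes R: "cring R" and P: "module R P"
    and h: "h \<in> module_hom R (free_module R S) P" "h' \<in> module_hom R (free_module R S) P"
    and eq: "\<And>a. a \<in> S \<Longrightarrow> h (free_gen R a) = h' (free_gen R a)"
    and u: "u \<in> carrier (free_module R S)"
  shows "h u = h' u"
proof -
  interpret R: cring R by fact
  interpret F: module R "free_module R S" by (rule module_free[OF R])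
  have "h u = h' u" if "finite T" "{a. u a \<noteq> \<zero>\<^bsub>R\<^esub>} \<subseteq> T" "u \<in> carrier
      (free_module R S)" for T u
    using that
  proof (induction T arbitrary: u)
    case empty
    then have "u = \<zero>\<^bsub>free_module R S\<^esub>" by auto
    then show ?case using module_hom_zero[OF F.module_axioms P] h by metis
  next
    case (insert a T)
    define v where "v = u(a := \<zero>\<^bsub>R\<^esub>)"
    have v: "v \<in> carrier (free_module R S)"
    proof -
      have "finite {b. v b \<noteq> \<zero>\<^bsub>R\<^esub>}"
        by (rule finite_subset[of _ "{b. u b \<noteq> \<zero>\<^bsub>R\<^esub>}"]) (use insert.prems in
            \<open>auto simp: v_def\<close>)
      then show ?thesis using insert.prems(2) by (auto simp: v_def)
    qed
    have hv: "h v = h' v" using insert.prems v by (intro insert.IH) (auto simp: v_def)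
    show ?case
    proof (cases "u a = \<zero>\<^bsub>R\<^esub>")
      case True
      then have "v = u" by (auto simp: v_def)
      then show ?thesis using hv by simp
    next
      case False
      then have a: "a \<in> S" and ua: "u a \<in> carrier R" using insert.prems(2) by auto
      have e: "free_gen R a \<in> carrier (free_module R S)" by (rule free_gen_closed[OF R a])
      have "u = v \<oplus>\<^bsub>free_module R S\<^esub> u a \<odot>\<^bsub>free_module R S\<^esub> free_gen R a"
        using insert.prems(2) ua by (auto simp: v_def free_gen_def fun_eq_iff)
      then show ?thesis
        using v e ua hv eq[OF a] by (metis F.smult_closed module_homD(2,3)[OF h(1)] module_homD(2,3)[OF h(2)])
    qed
  qed
  then show ?thesis using u by auto
qed

lemma free_lift:
  assumes R: "cring R" and P: "module R P" and b: "\<And>a. a \<in> S \<Longrightarrow> b a \<in> carrier P"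
  obtains h where "h \<in> module_hom R (free_module R S) P" "\<And>a. a \<in> S \<Longrightarrow> h (free_gen
      R a) = b a"
proof -
  interpret R: cring R by fact
  interpret P: module R P by fact
  define h where "h u = finsum P (\<lambda>a. u a \<odot>\<^bsub>P\<^esub> b a) {a. u a \<noteq>
      \<zero>\<^bsub>R\<^esub>}" for u
  \<comment> \<open>The sum may be taken over any finite subset of \<open>S\<close> that contains
    the support. This gives \<open>u\<close>, \<open>v\<close> and their sum a common index
    set.\<close>
  have h: "h u = finsum P (\<lambda>a. u a \<odot>\<^bsub>P\<^esub> b a) T"
    if "u \<in> carrier (free_module R S)" "finite T" "{a. u a \<noteq> \<zero>\<^bsub>R\<^esub>} \<subseteq>
        T" "T \<subseteq> S" for u T
    unfolding h_def using that b by (intro P.M.add.finprod_mono_neutral_cong_left) auto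
  have supp: "{a. u a \<noteq> \<zero>\<^bsub>R\<^esub>} \<subseteq> S" "finite {a. u a \<noteq>
      \<zero>\<^bsub>R\<^esub>}" if "u \<in> carrier (free_module R S)" for u
    using that by auto
  have F: "module R (free_module R S)" by (rule module_free[OF R])
  interpret F: module R "free_module R S" by fact
  have "h \<in> module_hom R (free_module R S) P"
  proof (rule module_homI)
    fix u assume u: "u \<in> carrier (free_module R S)"
    show "h u \<in> carrier P" unfolding h_def using u b by (intro P.M.finsum_closed) auto
    show "h (r \<odot>\<^bsub>free_module R S\<^esub> u) = r \<odot>\<^bsub>P\<^esub> h u" if r: "r \<in>
        carrier R" for r
    proof -
      let ?T = "{a. u a \<noteq> \<zero>\<^bsub>R\<^esub>}"
      have "h (r \<odot>\<^bsub>free_module R S\<^esub> u) = finsum P (\<lambda>a. (r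
          \<otimes>\<^bsub>R\<^esub> u a) \<odot>\<^bsub>P\<^esub> b a) ?T"
      proof -
        have "{a. (r \<odot>\<^bsub>free_module R S\<^esub> u) a \<noteq> \<zero>\<^bsub>R\<^esub>} \<subseteq>
            ?T" using r by auto
        from h[OF F.smult_closed[OF r u] supp(2)[OF u] this supp(1)[OF u]] show ?thesis by simp
      qed
      also have "\<dots> = finsum P (\<lambda>a. r \<odot>\<^bsub>P\<^esub> (u a \<odot>\<^bsub>P\<^esub> b a)) ?T"
        using supp(1)[OF u] u r b by (intro P.M.finsum_cong') (auto simp: P.smult_assoc1 subset_iff)
      also have "\<dots> = r \<odot>\<^bsub>P\<^esub> h u"
        unfolding h_def using supp[OF u] u r b by (intro P.finsum_smult_ldistr[symmetric]) (auto simp: subset_iff)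
      finally show ?thesis .
    qed
    fix v assume v: "v \<in> carrier (free_module R S)"
    let ?T = "{a. u a \<noteq> \<zero>\<^bsub>R\<^esub>} \<union> {a. v a \<noteq> \<zero>\<^bsub>R\<^esub>}"
    have T: "finite ?T" "?T \<subseteq> S" using supp[OF u] supp[OF v] by auto
    have "h (u \<oplus>\<^bsub>free_module R S\<^esub> v) = finsum P (\<lambda>a. (u a
        \<oplus>\<^bsub>R\<^esub> v a) \<odot>\<^bsub>P\<^esub> b a) ?T"
    proof -
      have "{a. (u \<oplus>\<^bsub>free_module R S\<^esub> v) a \<noteq> \<zero>\<^bsub>R\<^esub>} \<subseteq>
          ?T" by auto
      from h[OF F.M.a_closed[OF u v] T(1) this T(2)] show ?thesis by simp
    qed
    also have "\<dots> = finsum P (\<lambda>a. u a \<odot>\<^bsub>P\<^esub> b a \<oplus>\<^bsub>P\<^esub> v a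
        \<odot>\<^bsub>P\<^esub> b a) ?T"
    proof (rule P.M.finsum_cong'[OF refl])
      have ub: "u a \<in> carrier R" "v a \<in> carrier R" "b a \<in> carrier P" if "a \<in> ?T" for a
        using T(2) u v b that by (simp, simp, blast)
      show "(\<lambda>a. u a \<odot>\<^bsub>P\<^esub> b a \<oplus>\<^bsub>P\<^esub> v a
          \<odot>\<^bsub>P\<^esub> b a) \<in> ?T \<rightarrow> carrier P"
        using ub by blast
      show "(u a \<oplus>\<^bsub>R\<^esub> v a) \<odot>\<^bsub>P\<^esub> b a = u a \<odot>\<^bsub>P\<^esub> b a
          \<oplus>\<^bsub>P\<^esub> v a \<odot>\<^bsub>P\<^esub> b a" if "a \<in> ?T" for a
        using ub[OF that] by (rule P.smult_l_distr)
    qed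
    also have "\<dots> = finsum P (\<lambda>a. u a \<odot>\<^bsub>P\<^esub> b a) ?T \<oplus>\<^bsub>P\<^esub>
        finsum P (\<lambda>a. v a \<odot>\<^bsub>P\<^esub> b a) ?T"
    proof (rule P.M.finsum_addf)
      show "(\<lambda>a. u a \<odot>\<^bsub>P\<^esub> b a) \<in> ?T \<rightarrow> carrier P" "(\<lambda>a. v a
          \<odot>\<^bsub>P\<^esub> b a) \<in> ?T \<rightarrow> carrier P"
        using T(2) u v b by (auto intro!: P.smult_closed)
    qed
    also have "\<dots> = h u \<oplus>\<^bsub>P\<^esub> h v" using h[OF u T(1) Un_upper1 T(2)] h[OF v T(1)
        Un_upper2 T(2)] by simp
    finally show "h (u \<oplus>\<^bsub>free_module R S\<^esub> v) = h u \<oplus>\<^bsub>P\<^esub> h v" .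
  qed
  moreover have "h (free_gen R a) = b a" if a: "a \<in> S" for a
  proof -
    have "h (free_gen R a) = finsum P (\<lambda>c. free_gen R a c \<odot>\<^bsub>P\<^esub> b c) {a}"
      using a by (intro h free_gen_closed[OF R]) (auto simp: free_gen_def)
    then show ?thesis using b[OF a] by (simp add: free_gen_def)
  qed
  ultimately show ?thesis using that by blast
qed

section \<open>Tensor products of modules and their universal property\<close>

locale tensor_pair = M: module R M + N: module R N
  for R :: "'r ring" and M :: "('r, 'a) module" and N :: "('r, 'b) module"
begin

abbreviation "F \<equiv> free_module R (carrier M \<times> carrier N)"

lemma cring: "cring R" by (rule M.R.cring_axioms)

sublocale F: module R F by (rule module_free[OF cring])

lemma gen_closed: "m \<in> carrier M \<Longrightarrow> n \<in> carrier N \<Longrightarrow> free_gen R (m, n)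
    \<in> carrier F"
  by (rule free_gen_closed[OF cring]) simp

lemma rels_closed: "tensor_rels R M N \<subseteq> carrier F"
  unfolding tensor_rels_def Let_def
  by (auto simp del: free_module_sel intro!: F.M.minus_closed F.M.a_closed F.smult_closed gen_closed)

lemma kernel_submodule: "submodule (tensor_kernel R M N) R F"
proof (rule F.submoduleI)
  have sub: "submodule (carrier F) R F" by (rule F.carrier_is_submodule)
  have mem: "u \<in> tensor_kernel R M N \<longleftrightarrow> (\<forall>N'. submodule N' R F \<and>
      tensor_rels R M N \<subseteq> N' \<longrightarrow> u \<in> N')" for u
    unfolding tensor_kernel_def submodule_span_def by blast
  show "tensor_kernel R M N \<subseteq> carrier F" using mem sub rels_closed by blast
  have "\<zero>\<^bsub>F\<^esub> \<in> N'" if "submodule N' R F" for N'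
    using subgroup.one_closed[OF submodule.axioms(1)[OF that]] by simp
  then show "\<zero>\<^bsub>F\<^esub> \<in> tensor_kernel R M N" unfolding mem by blast
  fix u assume u: "u \<in> tensor_kernel R M N"
  show "\<ominus>\<^bsub>F\<^esub> u \<in> tensor_kernel R M N" using u F.submoduleE(3) unfolding mem by blast
  show "r \<odot>\<^bsub>F\<^esub> u \<in> tensor_kernel R M N" if "r \<in> carrier R" for r
    using u F.submoduleE(4) that unfolding mem by blast
  fix v assume v: "v \<in> tensor_kernel R M N"
  show "u \<oplus>\<^bsub>F\<^esub> v \<in> tensor_kernel R M N" using u v F.submoduleE(5) unfolding mem by blast
qed

lemma rels_kernel: "tensor_rels R M N \<subseteq> tensor_kernel R M N"
  unfolding tensor_kernel_def submodule_span_def by blast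

sublocale Q: quotient_mod R F "tensor_kernel R M N"
  by (intro quotient_mod.intro F.module_axioms kernel_submodule)

lemma module_tensor: "module R (tensor_module R M N)"
  unfolding tensor_module_def by (rule Q.module_quot)

lemma pure_closed: "m \<in> carrier M \<Longrightarrow> n \<in> carrier N \<Longrightarrow> pure_tensor R M N m
    n \<in> carrier (tensor_module R M N)"
  unfolding tensor_module_def pure_tensor_def Q.carrier_quot using gen_closed by blast

lemma coset_eqI:
  assumes "u \<in> carrier F" "v \<in> carrier F" "u \<ominus>\<^bsub>F\<^esub> v \<in> tensor_rels R M N"
  shows "tensor_kernel R M N +>\<^bsub>F\<^esub> u = tensor_kernel R M N +>\<^bsub>F\<^esub> v"
  using Q.coset_eq_iff[OF assms(1,2)] assms(3) rels_kernel by (auto simp: a_minus_def)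

lemma pure_add_left:
  assumes "m \<in> carrier M" "m' \<in> carrier M" "n \<in> carrier N"
  shows "pure_tensor R M N (m \<oplus>\<^bsub>M\<^esub> m') n =
    pure_tensor R M N m n \<oplus>\<^bsub>tensor_module R M N\<^esub> pure_tensor R M N m' n"
proof -
  have "free_gen R (m \<oplus>\<^bsub>M\<^esub> m', n) \<ominus>\<^bsub>F\<^esub> (free_gen R (m, n)
      \<oplus>\<^bsub>F\<^esub> free_gen R (m', n)) \<in> tensor_rels R M N"
    unfolding tensor_rels_def Let_def using assms by blast
  then have "tensor_kernel R M N +>\<^bsub>F\<^esub> free_gen R (m \<oplus>\<^bsub>M\<^esub> m', n) =
      tensor_kernel R M N +>\<^bsub>F\<^esub> (free_gen R (m, n) \<oplus>\<^bsub>F\<^esub> free_gen R (m', n))"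
    using assms by (intro coset_eqI F.M.a_closed F.smult_closed gen_closed) simp_all
  then show ?thesis
    using assms unfolding pure_tensor_def tensor_module_def by (simp only: Q.add_quot gen_closed)
qed

lemma pure_add_right:
  assumes "m \<in> carrier M" "n \<in> carrier N" "n' \<in> carrier N"
  shows "pure_tensor R M N m (n \<oplus>\<^bsub>N\<^esub> n') =
    pure_tensor R M N m n \<oplus>\<^bsub>tensor_module R M N\<^esub> pure_tensor R M N m n'"
proof -
  have "free_gen R (m, n \<oplus>\<^bsub>N\<^esub> n') \<ominus>\<^bsub>F\<^esub> (free_gen R (m, n)
      \<oplus>\<^bsub>F\<^esub> free_gen R (m, n')) \<in> tensor_rels R M N"
    unfolding tensor_rels_def Let_def using assms by blast
  then have "tensor_kernel R M N +>\<^bsub>F\<^esub> free_gen R (m, n \<oplus>\<^bsub>N\<^esub> n') =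
      tensor_kernel R M N +>\<^bsub>F\<^esub> (free_gen R (m, n) \<oplus>\<^bsub>F\<^esub> free_gen R (m, n'))"
    using assms by (intro coset_eqI F.M.a_closed F.smult_closed gen_closed) simp_all
  then show ?thesis
    using assms unfolding pure_tensor_def tensor_module_def by (simp only: Q.add_quot gen_closed)
qed

lemma pure_smult_left:
  assumes "r \<in> carrier R" "m \<in> carrier M" "n \<in> carrier N"
  shows "pure_tensor R M N (r \<odot>\<^bsub>M\<^esub> m) n = r \<odot>\<^bsub>tensor_module R M N\<^esub>
      pure_tensor R M N m n"
proof -
  have "free_gen R (r \<odot>\<^bsub>M\<^esub> m, n) \<ominus>\<^bsub>F\<^esub> (r \<odot>\<^bsub>F\<^esub>
      free_gen R (m, n)) \<in> tensor_rels R M N"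
    unfolding tensor_rels_def Let_def using assms by blast
  then have "tensor_kernel R M N +>\<^bsub>F\<^esub> free_gen R (r \<odot>\<^bsub>M\<^esub> m, n) =
      tensor_kernel R M N +>\<^bsub>F\<^esub> (r \<odot>\<^bsub>F\<^esub> free_gen R (m, n))"
    using assms by (intro coset_eqI F.M.a_closed F.smult_closed gen_closed) simp_all
  then show ?thesis
    using assms unfolding pure_tensor_def tensor_module_def by (simp only: Q.smult_quot gen_closed)
qed

lemma pure_smult_right:
  assumes "r \<in> carrier R" "m \<in> carrier M" "n \<in> carrier N"
  shows "pure_tensor R M N m (r \<odot>\<^bsub>N\<^esub> n) = r \<odot>\<^bsub>tensor_module R M N\<^esub>
      pure_tensor R M N m n"
proof -
  have "free_gen R (m, r \<odot>\<^bsub>N\<^esub> n) \<ominus>\<^bsub>F\<^esub> (r \<odot>\<^bsub>F\<^esub>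
      free_gen R (m, n)) \<in> tensor_rels R M N"
    unfolding tensor_rels_def Let_def using assms by blast
  then have "tensor_kernel R M N +>\<^bsub>F\<^esub> free_gen R (m, r \<odot>\<^bsub>N\<^esub> n) =
      tensor_kernel R M N +>\<^bsub>F\<^esub> (r \<odot>\<^bsub>F\<^esub> free_gen R (m, n))"
    using assms by (intro coset_eqI F.M.a_closed F.smult_closed gen_closed) simp_all
  then show ?thesis
    using assms unfolding pure_tensor_def tensor_module_def by (simp only: Q.smult_quot gen_closed)
qed

lemma tensor_ext:
  assumes P: "module R P"
    and h: "h \<in> module_hom R (tensor_module R M N) P" "h' \<in> module_hom R (tensor_module R M N) P"
    and eq: "\<And>m n. m \<in> carrier M \<Longrightarrow> n \<in> carrier N \<Longrightarrow> h (pure_tensor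
        R M N m n) = h' (pure_tensor R M N m n)"
    and t: "t \<in> carrier (tensor_module R M N)"
  shows "h t = h' t"
proof -
  obtain u where u: "u \<in> carrier F" "t = tensor_kernel R M N +>\<^bsub>F\<^esub> u"
    using t unfolding tensor_module_def Q.carrier_quot by blast
  note proj = Q.proj_hom[folded tensor_module_def]
  show ?thesis
    unfolding u(2)
  proof (rule free_hom_ext[OF cring P module_hom_comp[OF proj h(1)] module_hom_comp[OF proj h(2)] _ u(1)])
    fix a assume "a \<in> carrier M \<times> carrier N"
    then show "h (tensor_kernel R M N +>\<^bsub>F\<^esub> free_gen R a) = h' (tensor_kernel R M N
        +>\<^bsub>F\<^esub> free_gen R a)"
      using eq[of "fst a" "snd a"] by (auto simp: pure_tensor_def)
  qed
qed

text \<open>The linear extension of \<open>b\<close> to the free module kills the relations. Since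
  the elements it kills form a submodule, it kills their span as well and descends to the
  quotient.\<close>

lemma tensor_lift:
  assumes P: "module R P"
    and b: "\<And>m n. m \<in> carrier M \<Longrightarrow> n \<in> carrier N \<Longrightarrow> b m n \<in> carrier P"
    and add_left: "\<And>m m' n. m \<in> carrier M \<Longrightarrow> m' \<in> carrier M \<Longrightarrow> n
        \<in> carrier N \<Longrightarrow>
      b (m \<oplus>\<^bsub>M\<^esub> m') n = b m n \<oplus>\<^bsub>P\<^esub> b m' n"
    and add_right: "\<And>m n n'. m \<in> carrier M \<Longrightarrow> n \<in> carrier N \<Longrightarrow> n'
        \<in> carrier N \<Longrightarrow>
      b m (n \<oplus>\<^bsub>N\<^esub> n') = b m n \<oplus>\<^bsub>P\<^esub> b m n'"
    and smult_left: "\<And>r m n. r \<in> carrier R \<Longrightarrow> m \<in> carrier M \<Longrightarrow> n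
        \<in> carrier N \<Longrightarrow> b (r \<odot>\<^bsub>M\<^esub> m) n = r \<odot>\<^bsub>P\<^esub> b m n"
    and smult_right: "\<And>r m n. r \<in> carrier R \<Longrightarrow> m \<in> carrier M \<Longrightarrow> n
        \<in> carrier N \<Longrightarrow> b m (r \<odot>\<^bsub>N\<^esub> n) = r \<odot>\<^bsub>P\<^esub> b m n"
  obtains h where "h \<in> module_hom R (tensor_module R M N) P"
    "\<And>m n. m \<in> carrier M \<Longrightarrow> n \<in> carrier N \<Longrightarrow> h (pure_tensor R M N m
        n) = b m n"
proof -
  interpret P: module R P by fact
  obtain f where f: "f \<in> module_hom R F P"
    and fv: "\<And>a. a \<in> carrier M \<times> carrier N \<Longrightarrow> f (free_gen R a) = (case a of (m,
        n) \<Rightarrow> b m n)"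
    by (rule free_lift[OF cring P, of "carrier M \<times> carrier N" "\<lambda>(m, n). b m n"]) (use b in auto)
  note fD = module_homD[OF f]
  have fe: "f (free_gen R (m, n)) = b m n" if "m \<in> carrier M" "n \<in> carrier N" for m n
    using fv[of "(m, n)"] that by simp
  have fminus: "f (u \<ominus>\<^bsub>F\<^esub> v) = f u \<oplus>\<^bsub>P\<^esub> \<ominus>\<^bsub>P\<^esub> f
      v" if "u \<in> carrier F" "v \<in> carrier F" for u v
    unfolding a_minus_def using that fD(2)[OF that(1) F.M.a_inv_closed[OF that(2)]]
      module_hom_neg[OF F.module_axioms P f that(2)] by simp
  have sub: "submodule {u \<in> carrier F. f u = \<zero>\<^bsub>P\<^esub>} R F"
    by (rule F.submoduleI)
      (auto simp del: free_module_sel simp: fD module_hom_neg[OF F.module_axioms P f] module_hom_zero[OF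
          F.module_axioms P f])
  have "tensor_rels R M N \<subseteq> {u \<in> carrier F. f u = \<zero>\<^bsub>P\<^esub>}"
  proof (intro subsetI CollectI conjI)
    fix u assume u: "u \<in> tensor_rels R M N"
    then show "u \<in> carrier F" using rels_closed by blast
    show "f u = \<zero>\<^bsub>P\<^esub>"
      using u unfolding tensor_rels_def Let_def
      by (auto simp del: free_module_sel simp: fminus fD fe gen_closed add_left add_right smult_left
          smult_right b P.M.r_neg)
  qed
  then have "tensor_kernel R M N \<subseteq> {u \<in> carrier F. f u = \<zero>\<^bsub>P\<^esub>}"
    using sub unfolding tensor_kernel_def submodule_span_def by blast
  then obtain h where "h \<in> module_hom R (tensor_module R M N) P"
    and "\<And>u. u \<in> carrier F \<Longrightarrow> h (tensor_kernel R M N +>\<^bsub>F\<^esub> u) = f u"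
    using Q.quot_lift[OF P f] unfolding tensor_module_def by blast
  then show ?thesis using that fe gen_closed unfolding pure_tensor_def by metis
qed

text \<open>The identity and the zero map agree on pure tensors, because the first factor can only
  be zero. Hence they agree everywhere.\<close>

lemma tensor_zero:
  assumes "carrier M = {\<zero>\<^bsub>M\<^esub>}" and t: "t \<in> carrier (tensor_module R M N)"
  shows "t = \<zero>\<^bsub>tensor_module R M N\<^esub>"
proof -
  interpret T: module R "tensor_module R M N" by (rule module_tensor)
  have "(\<lambda>t. t) t = (\<lambda>_. \<zero>\<^bsub>tensor_module R M N\<^esub>) t"
  proof (rule tensor_ext[OF module_tensor _ _ _ t])
    fix m n assume "m \<in> carrier M" and n: "n \<in> carrier N"
    then have "m = \<zero>\<^bsub>R\<^esub> \<odot>\<^bsub>M\<^esub> \<zero>\<^bsub>M\<^esub>" using assms(1) by auto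
    then show "pure_tensor R M N m n = \<zero>\<^bsub>tensor_module R M N\<^esub>"
      using pure_smult_left[of "\<zero>\<^bsub>R\<^esub>" "\<zero>\<^bsub>M\<^esub>" n] n pure_closed[of
          "\<zero>\<^bsub>M\<^esub>" n] by simp
  qed (auto intro!: module_homI)
  then show ?thesis .
qed

end

text \<open>This gives meaning to the definite description in \<open>tensor_map\<close>: existence
  is the universal property, and uniqueness follows from agreement on pure tensors inside the
  carrier and extensionality outside it.\<close>

lemma tensor_map_unique:
  assumes M: "module R M" "module R N" and M': "module R M'" "module R N'"
    and f: "f \<in> module_hom R M M'" and g: "g \<in> module_hom R N N'"
  shows "\<exists>!h. h \<in> module_hom R (tensor_module R M N) (tensor_module R M' N') \<and>
       h \<in> extensional (carrier (tensor_module R M N)) \<and>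
       (\<forall>m\<in>carrier M. \<forall>n\<in>carrier N. h (pure_tensor R M N m n) = pure_tensor R M' N' (f
           m) (g n))"
proof -
  interpret S: tensor_pair R M N by (intro tensor_pair.intro M)
  interpret T: tensor_pair R M' N' by (intro tensor_pair.intro M')
  obtain h where h: "h \<in> module_hom R (tensor_module R M N) (tensor_module R M' N')"
    and hv: "\<And>m n. m \<in> carrier M \<Longrightarrow> n \<in> carrier N \<Longrightarrow> h (pure_tensor
        R M N m n) = pure_tensor R M' N' (f m) (g n)"
    by (rule S.tensor_lift[OF T.module_tensor, of "\<lambda>m n. pure_tensor R M' N' (f m) (g n)"])
      (simp_all add: module_homD[OF f] module_homD[OF g] T.pure_closed T.pure_add_left T.pure_add_right
        T.pure_smult_left T.pure_smult_right)
  show ?thesis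
  proof (rule ex1I[of _ "restrict h (carrier (tensor_module R M N))"])
    show "restrict h (carrier (tensor_module R M N)) \<in> module_hom R (tensor_module R M N) (tensor_module R
        M' N') \<and>
       restrict h (carrier (tensor_module R M N)) \<in> extensional (carrier (tensor_module R M N)) \<and>
       (\<forall>m\<in>carrier M. \<forall>n\<in>carrier N.
          restrict h (carrier (tensor_module R M N)) (pure_tensor R M N m n) = pure_tensor R M' N' (f m) (g n))"
      using h hv S.pure_closed module_hom_restrict[OF S.module_tensor h] by simp
  next
    fix h' assume h': "h' \<in> module_hom R (tensor_module R M N) (tensor_module R M' N') \<and>
       h' \<in> extensional (carrier (tensor_module R M N)) \<and>
       (\<forall>m\<in>carrier M. \<forall>n\<in>carrier N. h' (pure_tensor R M N m n) = pure_tensor R M' N' (f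
           m) (g n))"
    show "h' = restrict h (carrier (tensor_module R M N))"
    proof (rule extensionalityI[of _ "carrier (tensor_module R M N)"])
      fix t assume "t \<in> carrier (tensor_module R M N)"
      then show "h' t = restrict h (carrier (tensor_module R M N)) t"
        using S.tensor_ext[OF T.module_tensor _ h, of h'] h' hv by simp
    qed (use h' in auto)
  qed
qed

lemmas tensor_map_props = theI'[OF tensor_map_unique, folded tensor_map_def]

lemma tensor_map_hom:
  assumes "module R M" "module R N" "module R M'" "module R N'"
    "f \<in> module_hom R M M'" "g \<in> module_hom R N N'"
  shows "tensor_map R M N M' N' f g \<in> module_hom R (tensor_module R M N) (tensor_module R M' N')"
  using tensor_map_props[OF assms] by blast

lemma tensor_map_pure:
  assumes "module R M" "module R N" "module R M'" "module R N'"
    "f \<in> module_hom R M M'" "g \<in> module_hom R N N'" "m \<in> carrier M" "n \<in> carrier N"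
  shows "tensor_map R M N M' N' f g (pure_tensor R M N m n) = pure_tensor R M' N' (f m) (g n)"
  using tensor_map_props[OF assms(1-6)] assms(7,8) by blast

context
  fixes R :: "'r ring" and M :: "('r, 'a) module" and N :: "('r, 'b) module"
    and M' :: "('r, 'c) module" and N' :: "('r, 'd) module"
  assumes mods: "module R M" "module R N" "module R M'" "module R N'"
begin

interpretation S: tensor_pair R M N by (intro tensor_pair.intro mods)
interpretation T: tensor_pair R M' N' by (intro tensor_pair.intro mods)
interpretation TT: module R "tensor_module R M' N'" by (rule T.module_tensor)

lemma tensor_map_add_left:
  assumes f: "f \<in> module_hom R M M'" "f1 \<in> module_hom R M M'" "f2 \<in> module_hom R M M'" and g: "g
      \<in> module_hom R N N'"
    and eq: "\<And>m. m \<in> carrier M \<Longrightarrow> f m = f1 m \<oplus>\<^bsub>M'\<^esub> f2 m" and t: "t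
        \<in> carrier (tensor_module R M N)"
  shows "tensor_map R M N M' N' f g t =
    tensor_map R M N M' N' f1 g t \<oplus>\<^bsub>tensor_module R M' N'\<^esub> tensor_map R M N M' N' f2 g t"
  using t
  by (rule S.tensor_ext[OF TT.module_axioms tensor_map_hom[OF mods f(1) g]
        module_hom_add[OF TT.module_axioms tensor_map_hom[OF mods f(2) g] tensor_map_hom[OF mods f(3) g]], rotated])
    (simp add: tensor_map_pure[OF mods _ g] f eq T.pure_add_left module_homD(1)[OF f(2)] module_homD(1)[OF
        f(3)] module_homD(1)[OF g])

lemma tensor_map_smult_left:
  assumes f: "f \<in> module_hom R M M'" "f1 \<in> module_hom R M M'" and g: "g \<in> module_hom R N N'" and r:
      "r \<in> carrier R"
    and eq: "\<And>m. m \<in> carrier M \<Longrightarrow> f m = r \<odot>\<^bsub>M'\<^esub> f1 m" and t: "t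
        \<in> carrier (tensor_module R M N)"
  shows "tensor_map R M N M' N' f g t = r \<odot>\<^bsub>tensor_module R M' N'\<^esub> tensor_map R M N M' N' f1 g t"
  using t
  by (rule S.tensor_ext[OF TT.module_axioms tensor_map_hom[OF mods f(1) g]
        module_hom_smult[OF TT.module_axioms tensor_map_hom[OF mods f(2) g] r], rotated])
    (simp add: tensor_map_pure[OF mods _ g] f eq T.pure_smult_left[OF r] module_homD(1)[OF f(2)] module_homD(1)[OF g])

lemma tensor_map_neg_left:
  assumes f: "f \<in> module_hom R M M'" "f1 \<in> module_hom R M M'" and g: "g \<in> module_hom R N N'"
    and eq: "\<And>m. m \<in> carrier M \<Longrightarrow> f m = \<ominus>\<^bsub>M'\<^esub> f1 m" and t: "t
        \<in> carrier (tensor_module R M N)"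
  shows "tensor_map R M N M' N' f g t = \<ominus>\<^bsub>tensor_module R M' N'\<^esub> tensor_map R M N M' N' f1 g t"
proof -
  have "tensor_map R M N M' N' f g t =
      (\<ominus>\<^bsub>R\<^esub> \<one>\<^bsub>R\<^esub>) \<odot>\<^bsub>tensor_module R M' N'\<^esub>
          tensor_map R M N M' N' f1 g t"
    by (rule tensor_map_smult_left[OF f g _ _ t])
      (simp_all add: eq T.M.smult_l_minus module_homD(1)[OF f(2)])
  then show ?thesis
    using module_homD(1)[OF tensor_map_hom[OF mods f(2) g] t] by (simp add: TT.smult_l_minus)
qed

lemma tensor_map_zero_left:
  assumes f: "f \<in> module_hom R M M'" and g: "g \<in> module_hom R N N'"
    and eq: "\<And>m. m \<in> carrier M \<Longrightarrow> f m = \<zero>\<^bsub>M'\<^esub>" and t: "t \<in>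
        carrier (tensor_module R M N)"
  shows "tensor_map R M N M' N' f g t = \<zero>\<^bsub>tensor_module R M' N'\<^esub>"
proof -
  have "tensor_map R M N M' N' f g t =
      \<zero>\<^bsub>R\<^esub> \<odot>\<^bsub>tensor_module R M' N'\<^esub> tensor_map R M N M' N' f g t"
    by (rule tensor_map_smult_left[OF f f g _ _ t]) (simp_all add: eq)
  then show ?thesis using module_homD(1)[OF tensor_map_hom[OF mods f g] t] by simp
qed

lemma tensor_map_zero_right:
  assumes f: "f \<in> module_hom R M M'" and g: "g \<in> module_hom R N N'"
    and eq: "\<And>n. n \<in> carrier N \<Longrightarrow> g n = \<zero>\<^bsub>N'\<^esub>" and t: "t \<in>
        carrier (tensor_module R M N)"
  shows "tensor_map R M N M' N' f g t = \<zero>\<^bsub>tensor_module R M' N'\<^esub>"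
  using t
proof (rule S.tensor_ext[OF TT.module_axioms tensor_map_hom[OF mods f g] module_hom_const_zero[OF
    TT.module_axioms], rotated])
  fix m n assume m: "m \<in> carrier M" and n: "n \<in> carrier N"
  have "pure_tensor R M' N' (f m) (\<zero>\<^bsub>R\<^esub> \<odot>\<^bsub>N'\<^esub>
      \<zero>\<^bsub>N'\<^esub>) = \<zero>\<^bsub>tensor_module R M' N'\<^esub>"
    using T.pure_smult_right[of "\<zero>\<^bsub>R\<^esub>" "f m" "\<zero>\<^bsub>N'\<^esub>"] T.pure_closed[of
        "f m" "\<zero>\<^bsub>N'\<^esub>"] module_homD(1)[OF f m] by simp
  then show "tensor_map R M N M' N' f g (pure_tensor R M N m n) = \<zero>\<^bsub>tensor_module R M' N'\<^esub>"
    using m n by (simp add: tensor_map_pure[OF mods f g] eq)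
qed

end

lemma tensor_map_id:
  assumes mods: "module R M" "module R N" and f: "f \<in> module_hom R M M" "g \<in> module_hom R N N"
    and eq: "\<And>m. m \<in> carrier M \<Longrightarrow> f m = m" "\<And>n. n \<in> carrier N
        \<Longrightarrow> g n = n"
    and t: "t \<in> carrier (tensor_module R M N)"
  shows "tensor_map R M N M N f g t = t"
proof -
  interpret S: tensor_pair R M N by (intro tensor_pair.intro mods)
  have "tensor_map R M N M N f g t = (\<lambda>t. t) t"
    by (rule S.tensor_ext[OF S.module_tensor tensor_map_hom[OF mods mods f] _ _ t])
      (auto simp: tensor_map_pure[OF mods mods f] eq intro: module_homI)
  then show ?thesis .
qed

lemma tensor_map_comp:
  assumes mods: "module R M" "module R N" "module R M'" "module R N'" "module R M''" "module R N''"
    and f: "f \<in> module_hom R M M'" "f' \<in> module_hom R M' M''" and g: "g \<in> module_hom R N N'" "g'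
        \<in> module_hom R N' N''"
    and t: "t \<in> carrier (tensor_module R M N)"
  shows "tensor_map R M' N' M'' N'' f' g' (tensor_map R M N M' N' f g t) =
    tensor_map R M N M'' N'' (\<lambda>m. f' (f m)) (\<lambda>n. g' (g n)) t"
proof -
  interpret S: tensor_pair R M N by (intro tensor_pair.intro mods)
  interpret T: tensor_pair R M'' N'' by (intro tensor_pair.intro mods)
  note fg = module_hom_comp[OF f] module_hom_comp[OF g]
  have "(\<lambda>t. tensor_map R M' N' M'' N'' f' g' (tensor_map R M N M' N' f g t)) t =
      tensor_map R M N M'' N'' (\<lambda>m. f' (f m)) (\<lambda>n. g' (g n)) t"
    by (rule S.tensor_ext[OF T.module_tensor
          module_hom_comp[OF tensor_map_hom[OF mods(1-4) f(1) g(1)] tensor_map_hom[OF mods(3-6) f(2) g(2)]]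
          tensor_map_hom[OF mods(1,2,5,6) fg] _ t])
      (simp add: tensor_map_pure[OF mods(1-4) f(1) g(1)] tensor_map_pure[OF mods(3-6) f(2) g(2)]
        tensor_map_pure[OF mods(1,2,5,6) fg] module_homD(1)[OF f(1)] module_homD(1)[OF g(1)])
  then show ?thesis .
qed

section \<open>Direct sums and tensor products of complexes\<close>

lemma direct_sum_module_sel [simp]:
  "carrier (direct_sum_module F) = {z. (\<forall>i. z i \<in> carrier (F i)) \<and> finite {i. z i \<noteq>
      \<zero>\<^bsub>F i\<^esub>}}"
  "\<zero>\<^bsub>direct_sum_module F\<^esub> = (\<lambda>i. \<zero>\<^bsub>F i\<^esub>)"
  "y \<oplus>\<^bsub>direct_sum_module F\<^esub> z = (\<lambda>i. y i \<oplus>\<^bsub>F i\<^esub> z i)"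
  "r \<odot>\<^bsub>direct_sum_module F\<^esub> z = (\<lambda>i. r \<odot>\<^bsub>F i\<^esub> z i)"
  by (simp_all add: direct_sum_module_def prod_module_def mk_module_def)

lemma finite_support_add:
  assumes "\<And>i. module R (F i)" "finite {i. y i \<noteq> \<zero>\<^bsub>F i\<^esub>}" "finite {i. z i
      \<noteq> \<zero>\<^bsub>F i\<^esub>}"
  shows "finite {i. y i \<oplus>\<^bsub>F i\<^esub> z i \<noteq> \<zero>\<^bsub>F i\<^esub>}"
proof (rule finite_subset)
  interpret F: module R "F i" for i by fact
  show "{i. y i \<oplus>\<^bsub>F i\<^esub> z i \<noteq> \<zero>\<^bsub>F i\<^esub>} \<subseteq> {i. y i
      \<noteq> \<zero>\<^bsub>F i\<^esub>} \<union> {i. z i \<noteq> \<zero>\<^bsub>F i\<^esub>}" by auto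
qed (use assms in simp)

lemma module_direct_sum:
  assumes "cring R" "\<And>i. module R (F i)"
  shows "module R (direct_sum_module F)"
proof -
  interpret F: module R "F i" for i by fact
  have fin: "finite {i. f i \<noteq> \<zero>\<^bsub>F i\<^esub>}" if "finite {i. z i \<noteq> \<zero>\<^bsub>F
      i\<^esub>}" "\<And>i. z i = \<zero>\<^bsub>F i\<^esub> \<Longrightarrow> f i = \<zero>\<^bsub>F
      i\<^esub>" for z f
    by (rule finite_subset[OF _ that(1)]) (use that(2) in auto)
  show ?thesis
  proof (rule moduleI)
    show "abelian_group (direct_sum_module F)"
    proof (rule abelian_groupI)
      fix z assume z: "z \<in> carrier (direct_sum_module F)"
      then show "\<exists>y\<in>carrier (direct_sum_module F). y \<oplus>\<^bsub>direct_sum_module F\<^esub> z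
          = \<zero>\<^bsub>direct_sum_module F\<^esub>"
        using fin[of z "\<lambda>i. \<ominus>\<^bsub>F i\<^esub> z i"] by (intro bexI[of _ "\<lambda>i.
            \<ominus>\<^bsub>F i\<^esub> z i"]) (auto simp: F.M.l_neg)
    qed (auto simp: F.M.a_ac finite_support_add[OF assms(2)])
  next
    fix r z assume "r \<in> carrier R" "z \<in> carrier (direct_sum_module F)"
    then show "r \<odot>\<^bsub>direct_sum_module F\<^esub> z \<in> carrier (direct_sum_module F)"
      using fin[of z "\<lambda>i. r \<odot>\<^bsub>F i\<^esub> z i"] by simp
  qed (auto simp: F.smult_l_distr F.smult_r_distr F.smult_assoc1 assms(1))
qed

context
  fixes R :: "'r ring" and M :: "('r, 'm) module"
  assumes M: "module R M"
begin

interpretation M: module R M by (rule M)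

lemma parity_sign_closed: "x \<in> carrier M \<Longrightarrow> parity_sign M i x \<in> carrier M"
  by (simp add: parity_sign_def)

lemma parity_sign_zero: "parity_sign M i \<zero>\<^bsub>M\<^esub> = \<zero>\<^bsub>M\<^esub>"
  by (simp add: parity_sign_def)

lemma parity_sign_add:
  "x \<in> carrier M \<Longrightarrow> y \<in> carrier M \<Longrightarrow>
    parity_sign M i (x \<oplus>\<^bsub>M\<^esub> y) = parity_sign M i x \<oplus>\<^bsub>M\<^esub> parity_sign M i y"
  by (simp add: parity_sign_def M.M.minus_add)

lemma parity_sign_smult:
  "r \<in> carrier R \<Longrightarrow> x \<in> carrier M \<Longrightarrow> parity_sign M i (r
      \<odot>\<^bsub>M\<^esub> x) = r \<odot>\<^bsub>M\<^esub> parity_sign M i x"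
  by (simp add: parity_sign_def M.smult_r_minus)

lemma parity_sign_Suc: "x \<in> carrier M \<Longrightarrow> parity_sign M (i + 1) x =
    \<ominus>\<^bsub>M\<^esub> parity_sign M i x"
  by (simp add: parity_sign_def)

end

lemma hom_parity_sign:
  assumes "module R M" "module R N" "f \<in> module_hom R M N" "x \<in> carrier M"
  shows "f (parity_sign M i x) = parity_sign N i (f x)"
  using module_hom_neg[OF assms] by (simp add: parity_sign_def)

locale tensor_cplx = K: cplx R K + D: cplx R D
  for R :: "'r ring" and K :: "('r, 'k) chain_complex" and D :: "('r, 'm) chain_complex"
begin

abbreviation "T p q \<equiv> tensor_module R (obj K p) (obj D q)"

sublocale tp: tensor_pair R "obj K p" "obj D q" for p q
  by (intro tensor_pair.intro K.module_obj D.module_obj)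

sublocale T: module R "T p q" for p q by (rule tp.module_tensor)

lemma T_module: "module R (T p q)" by (rule tp.module_tensor)

text \<open>Both parts of the differential are indexed by their target \<open>T p q\<close>: the
  component at \<open>p\<close> of a differential collects one contribution from
  \<open>p + 1\<close> and one from \<open>p\<close>.\<close>

definition dl where "dl p q = tensor_map R (obj K (p + 1)) (obj D q) (obj K p) (obj D q) (diff K (p + 1))
    (\<lambda>y. y)"
definition dr where "dr p q = tensor_map R (obj K p) (obj D (q + 1)) (obj K p) (obj D q) (\<lambda>x. x) (diff
    D (q + 1))"

lemma id_hom: "(\<lambda>x. x) \<in> module_hom R M M"
  by (auto intro: module_homI)

lemma diffK_hom: "diff K (p + 1) \<in> module_hom R (obj K (p + 1)) (obj K p)"
  using K.diff_hom[of "p + 1"] by simp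

lemma diffD_hom: "diff D (q + 1) \<in> module_hom R (obj D (q + 1)) (obj D q)"
  using D.diff_hom[of "q + 1"] by simp

lemma dl_hom: "dl p q \<in> module_hom R (T (p + 1) q) (T p q)"
  unfolding dl_def by (intro tensor_map_hom K.module_obj D.module_obj diffK_hom id_hom)

lemma dr_hom: "dr p q \<in> module_hom R (T p (q + 1)) (T p q)"
  unfolding dr_def by (intro tensor_map_hom K.module_obj D.module_obj diffD_hom id_hom)

lemma carrier_tensor_complex:
  "z \<in> carrier (obj (tensor_complex R K D) l) \<longleftrightarrow>
    (\<forall>p. z p \<in> carrier (T p (l - p))) \<and> finite {p. z p \<noteq> \<zero>\<^bsub>T p (l - p)\<^esub>}"
  by (simp add: tensor_complex_def)

lemma zero_tensor_complex: "\<zero>\<^bsub>obj (tensor_complex R K D) l\<^esub> = (\<lambda>p. \<zero>\<^bsub>T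
    p (l - p)\<^esub>)"
  and add_tensor_complex: "y \<oplus>\<^bsub>obj (tensor_complex R K D) l\<^esub> z = (\<lambda>p. y p
      \<oplus>\<^bsub>T p (l - p)\<^esub> z p)"
  and smult_tensor_complex: "r \<odot>\<^bsub>obj (tensor_complex R K D) l\<^esub> z = (\<lambda>p. r
      \<odot>\<^bsub>T p (l - p)\<^esub> z p)"
  by (simp_all add: tensor_complex_def)

lemma diff_tensor_complex:
  "diff (tensor_complex R K D) l z p =
    dl p (l - 1 - p) (z (p + 1)) \<oplus>\<^bsub>T p (l - 1 - p)\<^esub> parity_sign (T p (l - 1 - p)) p (dr p
        (l - 1 - p) (z p))"
proof -
  have "l - 1 - p + 1 = l - p" by simp
  then show ?thesis by (simp add: tensor_complex_def dl_def dr_def Let_def)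
qed

lemma comp_closed:
  assumes "z \<in> carrier (obj (tensor_complex R K D) l)"
  shows "z p \<in> carrier (T p (l - p))" "z p \<in> carrier (T p (l - 1 - p + 1))" "z (p + 1) \<in> carrier (T
      (p + 1) (l - 1 - p))"
proof -
  have "l - 1 - p + 1 = l - p" "l - 1 - p = l - (p + 1)" by simp_all
  then show "z p \<in> carrier (T p (l - p))" "z p \<in> carrier (T p (l - 1 - p + 1))" "z (p + 1) \<in>
      carrier (T (p + 1) (l - 1 - p))"
    using assms by (simp_all only: carrier_tensor_complex)
qed

lemma module_tensor_complex: "module R (obj (tensor_complex R K D) l)"
  by (simp add: tensor_complex_def module_direct_sum[OF K.cring] T_module)

lemma dl_dl: "t \<in> carrier (T (p + 1 + 1) q) \<Longrightarrow> dl p q (dl (p + 1) q t) = \<zero>\<^bsub>T p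
    q\<^esub>"
  unfolding dl_def
  by (subst tensor_map_comp[OF K.module_obj D.module_obj K.module_obj D.module_obj K.module_obj D.module_obj
        diffK_hom diffK_hom id_hom id_hom], assumption)
    (rule tensor_map_zero_left[OF K.module_obj D.module_obj K.module_obj D.module_obj module_hom_comp[OF
        diffK_hom diffK_hom] id_hom],
      use K.diff_diff_Suc[of _ "p + 1"] in simp_all)

lemma dr_dr: "t \<in> carrier (T p (q + 1 + 1)) \<Longrightarrow> dr p q (dr p (q + 1) t) = \<zero>\<^bsub>T p
    q\<^esub>"
  unfolding dr_def
  by (subst tensor_map_comp[OF K.module_obj D.module_obj K.module_obj D.module_obj K.module_obj D.module_obj
        id_hom id_hom diffD_hom diffD_hom], assumption)
    (rule tensor_map_zero_right[OF K.module_obj D.module_obj K.module_obj D.module_obj id_hom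
        module_hom_comp[OF diffD_hom diffD_hom]],
      use D.diff_diff_Suc[of _ "q + 1"] in simp_all)

lemma dl_dr: "t \<in> carrier (T (p + 1) (q + 1)) \<Longrightarrow> dr p q (dl p (q + 1) t) = dl p q (dr (p + 1) q t)"
  unfolding dl_def dr_def
  by (simp add: tensor_map_comp[OF K.module_obj D.module_obj K.module_obj D.module_obj K.module_obj D.module_obj]
      diffK_hom diffD_hom id_hom)

lemma tensor_complex_cplx: "cplx R (tensor_complex R K D)"
proof
  note dlD = module_homD[OF dl_hom] and drD = module_homD[OF dr_hom]
  note ps = parity_sign_closed[OF T_module] parity_sign_zero[OF T_module] parity_sign_add[OF T_module]
    parity_sign_smult[OF T_module] parity_sign_Suc[OF T_module]
  have dl0: "dl p q \<zero>\<^bsub>T (p + 1) q\<^esub> = \<zero>\<^bsub>T p q\<^esub>" and dr0: "dr p q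
      \<zero>\<^bsub>T p (q + 1)\<^esub> = \<zero>\<^bsub>T p q\<^esub>" for p q
    by (rule module_hom_zero[OF T_module T_module dl_hom], rule module_hom_zero[OF T_module T_module dr_hom])
  let ?C = "tensor_complex R K D"
  have closed: "diff ?C l z p \<in> carrier (T p (l - 1 - p))" if "z \<in> carrier (obj ?C l)" for l z p
    unfolding diff_tensor_complex using comp_closed[OF that, of p] by (intro T.M.a_closed ps(1) dlD(1) drD(1))
  have fin: "finite {p. diff ?C l z p \<noteq> \<zero>\<^bsub>T p (l - 1 - p)\<^esub>}" if z: "z \<in> carrier
      (obj ?C l)" for l z
  proof (rule finite_subset)
    \<comment> \<open>The component at \<open>p\<close> of the differential depends on the
      components of \<open>z\<close> at \<open>p\<close> and at \<open>p + 1\<close>. So its support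
      lies in the support of \<open>z\<close> together with its translate by -1.\<close>
    let ?S = "{p. z p \<noteq> \<zero>\<^bsub>T p (l - p)\<^esub>}"
    show "finite (?S \<union> (\<lambda>p. p - 1) ` ?S)" using z by (simp add: carrier_tensor_complex)
    have zero: "diff ?C l z p = \<zero>\<^bsub>T p (l - 1 - p)\<^esub>"
      if "z p = \<zero>\<^bsub>T p (l - p)\<^esub>" "z (p + 1) = \<zero>\<^bsub>T (p + 1) (l - (p + 1))\<^esub>" for p
    proof -
      have "z p = \<zero>\<^bsub>T p (l - 1 - p + 1)\<^esub>" "z (p + 1) = \<zero>\<^bsub>T (p + 1) (l - 1 -
          p)\<^esub>" using that by (simp_all add: algebra_simps)
      then show ?thesis
        unfolding diff_tensor_complex by (simp only: dl0 dr0 ps T.M.l_zero T.M.zero_closed)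
    qed
    show "{p. diff ?C l z p \<noteq> \<zero>\<^bsub>T p (l - 1 - p)\<^esub>} \<subseteq> ?S \<union>
        (\<lambda>p. p - 1) ` ?S"
    proof
      fix p assume "p \<in> {p. diff ?C l z p \<noteq> \<zero>\<^bsub>T p (l - 1 - p)\<^esub>}"
      then have "p \<in> ?S \<or> p + 1 \<in> ?S" using zero[of p] by blast
      then show "p \<in> ?S \<union> (\<lambda>p. p - 1) ` ?S"
      proof
        assume "p + 1 \<in> ?S"
        then have "p + 1 - 1 \<in> (\<lambda>p. p - 1) ` ?S" by (rule imageI)
        then show ?thesis by simp
      qed simp
    qed
  qed
  show "is_complex R ?C"
    unfolding is_complex_def
  proof (intro conjI allI ballI)
    fix l
    show "module R (obj ?C l)" by (rule module_tensor_complex)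
    show "diff ?C l \<in> module_hom R (obj ?C l) (obj ?C (l - 1))"
    proof (rule module_homI)
      fix z assume z: "z \<in> carrier (obj ?C l)"
      show "diff ?C l z \<in> carrier (obj ?C (l - 1))"
        unfolding carrier_tensor_complex using closed[OF z] fin[OF z] by simp
      note zc = comp_closed[OF z]
      show "diff ?C l (r \<odot>\<^bsub>obj ?C l\<^esub> z) = r \<odot>\<^bsub>obj ?C (l - 1)\<^esub> diff ?C l
          z" if r: "r \<in> carrier R" for r
      proof
        fix p
        have "(r \<odot>\<^bsub>obj ?C l\<^esub> z) p = r \<odot>\<^bsub>T p (l - 1 - p + 1)\<^esub> z p"
          "(r \<odot>\<^bsub>obj ?C l\<^esub> z) (p + 1) = r \<odot>\<^bsub>T (p + 1) (l - 1 - p)\<^esub> z (p + 1)"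
          by (simp_all add: smult_tensor_complex algebra_simps)
        then show "diff ?C l (r \<odot>\<^bsub>obj ?C l\<^esub> z) p = (r \<odot>\<^bsub>obj ?C (l - 1)\<^esub>
            diff ?C l z) p"
          using zc[of p] r by (simp only: diff_tensor_complex smult_tensor_complex dlD drD ps T.smult_r_distr)
      qed
      fix y assume y: "y \<in> carrier (obj ?C l)"
      note yc = comp_closed[OF y]
      show "diff ?C l (z \<oplus>\<^bsub>obj ?C l\<^esub> y) = diff ?C l z \<oplus>\<^bsub>obj ?C (l -
          1)\<^esub> diff ?C l y"
      proof
        fix p
        have "(z \<oplus>\<^bsub>obj ?C l\<^esub> y) p = z p \<oplus>\<^bsub>T p (l - 1 - p + 1)\<^esub> y p"
          "(z \<oplus>\<^bsub>obj ?C l\<^esub> y) (p + 1) = z (p + 1) \<oplus>\<^bsub>T (p + 1) (l - 1 -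
              p)\<^esub> y (p + 1)"
          by (simp_all add: add_tensor_complex algebra_simps)
        then show "diff ?C l (z \<oplus>\<^bsub>obj ?C l\<^esub> y) p = (diff ?C l z \<oplus>\<^bsub>obj ?C (l
            - 1)\<^esub> diff ?C l y) p"
          using zc[of p] yc[of p]
          by (simp only: diff_tensor_complex add_tensor_complex dlD drD ps T.M.a_ac T.M.a_closed)
      qed
    qed
    fix z assume z: "z \<in> carrier (obj ?C l)"
    show "diff ?C (l - 1) (diff ?C l z) = \<zero>\<^bsub>obj ?C (l - 1 - 1)\<^esub>"
    proof
      fix p
      \<comment> \<open>The three components of \<open>z\<close> that matter have bidegrees
        \<open>(p + 2, q)\<close>, \<open>(p + 1, q + 1)\<close> and \<open>(p, q + 2)\<close>. The
        first and the last drop out by \<open>dl_dl\<close> and \<open>dr_dr\<close>; the two images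
        of the middle one cancel because their signs belong to \<open>p + 1\<close> and to
        \<open>p\<close>.\<close>
      define q where "q = l - 1 - 1 - p"
      have q: "l - 1 - 1 - p = q" "l - 1 - p = q + 1" "l - 1 - (p + 1) = q" by (simp_all add: q_def)
      have a: "z (p + 1 + 1) \<in> carrier (T (p + 1 + 1) q)" and b: "z (p + 1) \<in> carrier (T (p + 1) (q + 1))"
        and c: "z p \<in> carrier (T p (q + 1 + 1))"
        using z unfolding carrier_tensor_complex q_def by (simp_all add: algebra_simps)
      have D1: "diff ?C l z (p + 1) = dl (p + 1) q (z (p + 1 + 1)) \<oplus>\<^bsub>T (p + 1) q\<^esub>
          parity_sign (T (p + 1) q) (p + 1) (dr (p + 1) q (z (p + 1)))"
        unfolding diff_tensor_complex q ..
      have D0: "diff ?C l z p = dl p (q + 1) (z (p + 1)) \<oplus>\<^bsub>T p (q + 1)\<^esub> parity_sign (T p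
          (q + 1)) p (dr p (q + 1) (z p))"
        unfolding diff_tensor_complex q ..
      have "diff ?C (l - 1) (diff ?C l z) p = dl p q (diff ?C l z (p + 1)) \<oplus>\<^bsub>T p q\<^esub>
          parity_sign (T p q) p (dr p q (diff ?C l z p))"
        unfolding diff_tensor_complex[of "l - 1"] q ..
      also have "dl p q (diff ?C l z (p + 1)) = parity_sign (T p q) (p + 1) (dl p q (dr (p + 1) q (z (p + 1))))"
        using a b unfolding D1
        by (simp add: dlD drD ps dl_dl hom_parity_sign[OF T_module T_module dl_hom]
            module_hom_neg[OF T_module T_module dl_hom] del: add.assoc)
      also have "dr p q (diff ?C l z p) = dl p q (dr (p + 1) q (z (p + 1)))"
        using b c unfolding D0
        by (simp add: dlD drD ps dr_dr dl_dr hom_parity_sign[OF T_module T_module dr_hom] del: add.assoc)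
      also have "parity_sign (T p q) (p + 1) (dl p q (dr (p + 1) q (z (p + 1)))) \<oplus>\<^bsub>T p q\<^esub>
          parity_sign (T p q) p (dl p q (dr (p + 1) q (z (p + 1)))) = \<zero>\<^bsub>T p q\<^esub>"
        using b by (simp add: ps dlD drD T.M.l_neg)
      finally show "diff ?C (l - 1) (diff ?C l z) p = \<zero>\<^bsub>obj ?C (l - 1 - 1)\<^esub> p"
        by (simp add: zero_tensor_complex q_def)
    qed
  qed
qed

end

section \<open>Isomorphisms of complexes\<close>

lemma isomorphic_complexesE:
  assumes "isomorphic_complexes R C D"
  obtains f g where "chain_map R C D f" "chain_map R D C g"
    "\<And>l x. x \<in> carrier (obj C l) \<Longrightarrow> g l (f l x) = x" "\<And>l y. y \<in> carrier (obj D
        l) \<Longrightarrow> f l (g l y) = y"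
proof -
  obtain f where f: "chain_map R C D f" and bij: "\<And>l. bij_betw (f l) (carrier (obj C l)) (carrier (obj D l))"
    using assms by (auto simp: isomorphic_complexes_def)
  interpret C: cplx R C by (rule chain_mapD[OF f])
  interpret D: cplx R D by (rule chain_mapD[OF f])
  note fD = chain_mapD(4-)[OF f]
  define g where "g l = inv_into (carrier (obj C l)) (f l)" for l
  have fg: "f l (g l y) = y" and gC: "g l y \<in> carrier (obj C l)" if "y \<in> carrier (obj D l)" for l y
    using that bij[of l] unfolding g_def bij_betw_def by (auto simp: f_inv_into_f inv_into_into)
  have gf: "g l (f l x) = x" if "x \<in> carrier (obj C l)" for l x
    using that bij[of l] unfolding g_def bij_betw_def by simp
  have "chain_map R D C g"
    unfolding chain_map_def
  proof (intro conjI allI ballI)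
    fix l
    show "g l \<in> module_hom R (obj D l) (obj C l)"
    proof (rule module_homI)
      fix y assume y: "y \<in> carrier (obj D l)"
      show "g l y \<in> carrier (obj C l)" by (rule gC[OF y])
      show "g l (r \<odot>\<^bsub>obj D l\<^esub> y) = r \<odot>\<^bsub>obj C l\<^esub> g l y" if "r \<in>
          carrier R" for r
        using gf[of "r \<odot>\<^bsub>obj C l\<^esub> g l y" l] that gC[OF y] by (simp add: fD fg[OF y])
      show "g l (y \<oplus>\<^bsub>obj D l\<^esub> y') = g l y \<oplus>\<^bsub>obj C l\<^esub> g l y'" if y':
          "y' \<in> carrier (obj D l)" for y'
        using gf[of "g l y \<oplus>\<^bsub>obj C l\<^esub> g l y'" l] gC[OF y] gC[OF y'] by (simp add: fD fg[OF
            y] fg[OF y'])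
    qed
    show "diff C l (g l y) = g (l - 1) (diff D l y)" if y: "y \<in> carrier (obj D l)" for y
      using gf[of "diff C l (g l y)" "l - 1"] gC[OF y] by (simp add: fD(6)[symmetric] fg[OF y])
  qed (use C.is_complex D.is_complex in auto)
  then show ?thesis using that f fg gf by blast
qed

lemma isomorphic_complexesI:
  assumes f: "chain_map R C D f" and gC: "\<And>l y. y \<in> carrier (obj D l) \<Longrightarrow> g l y \<in>
      carrier (obj C l)"
    and gf: "\<And>l x. x \<in> carrier (obj C l) \<Longrightarrow> g l (f l x) = x" and fg: "\<And>l y. y
        \<in> carrier (obj D l) \<Longrightarrow> f l (g l y) = y"
  shows "isomorphic_complexes R C D"
  unfolding isomorphic_complexes_def
  by (intro exI[of _ f] conjI f allI bij_betwI[where g = "g l" for l]) (use chain_mapD(4)[OF f] gC gf fg in auto)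

lemma chain_map_comp:
  assumes "chain_map R C D f" "chain_map R D E g"
  shows "chain_map R C E (\<lambda>l x. g l (f l x))"
  using assms chain_mapD(4,9)[OF assms(1)] chain_mapD(9)[OF assms(2)]
  unfolding chain_map_def by (auto intro: module_hom_comp)

lemma isomorphic_complexes_trans:
  assumes "isomorphic_complexes R C D" "isomorphic_complexes R D E"
  shows "isomorphic_complexes R C E"
proof -
  obtain f g where f: "chain_map R C D f" "chain_map R D C g"
    "\<And>l x. x \<in> carrier (obj C l) \<Longrightarrow> g l (f l x) = x" "\<And>l y. y \<in> carrier (obj D
        l) \<Longrightarrow> f l (g l y) = y"
    using isomorphic_complexesE[OF assms(1)] by metis
  obtain f' g' where f': "chain_map R D E f'" "chain_map R E D g'"
    "\<And>l x. x \<in> carrier (obj D l) \<Longrightarrow> g' l (f' l x) = x" "\<And>l y. y \<in> carrier (obj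
        E l) \<Longrightarrow> f' l (g' l y) = y"
    using isomorphic_complexesE[OF assms(2)] by metis
  show ?thesis
    by (rule isomorphic_complexesI[OF chain_map_comp[OF f(1) f'(1)], of "\<lambda>l y. g l (g' l y)"])
      (simp_all add: f f' chain_mapD(4)[OF f(1)] chain_mapD(4)[OF f(2)] chain_mapD(4)[OF f'(2)])
qed

lemma isomorphic_complexes_exact_at:
  assumes "isomorphic_complexes R C D"
  shows "exact_at C l \<longleftrightarrow> exact_at D l"
proof -
  obtain f g where f: "chain_map R C D f" and g: "chain_map R D C g"
    and gf: "\<And>l x. x \<in> carrier (obj C l) \<Longrightarrow> g l (f l x) = x" and fg: "\<And>l y. y
        \<in> carrier (obj D l) \<Longrightarrow> f l (g l y) = y"
    using isomorphic_complexesE[OF assms] by metis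
  have "exact_at C l" if D: "exact_at D l"
    unfolding exact_at_def
  proof (intro ballI impI)
    fix z assume z: "z \<in> carrier (obj C l)" and dz: "diff C l z = \<zero>\<^bsub>obj C (l - 1)\<^esub>"
    obtain w where w: "w \<in> carrier (obj D (l + 1))" "diff D (l + 1) w = f l z"
      using exact_atD[OF D, of "f l z"] chain_mapD(4,7,9)[OF f] z dz by auto
    then have "diff C (l + 1) (g (l + 1) w) = z" using chain_mapD(9)[OF g w(1)] gf[OF z] by simp
    then show "\<exists>w\<in>carrier (obj C (l + 1)). diff C (l + 1) w = z" using chain_mapD(4)[OF g w(1)] by blast
  qed
  moreover have "exact_at D l" if C: "exact_at C l"
    unfolding exact_at_def
  proof (intro ballI impI)
    fix z assume z: "z \<in> carrier (obj D l)" and dz: "diff D l z = \<zero>\<^bsub>obj D (l - 1)\<^esub>"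
    obtain w where w: "w \<in> carrier (obj C (l + 1))" "diff C (l + 1) w = g l z"
      using exact_atD[OF C, of "g l z"] chain_mapD(4,7,9)[OF g] z dz by auto
    then have "diff D (l + 1) (f (l + 1) w) = z" using chain_mapD(9)[OF f w(1)] fg[OF z] by simp
    then show "\<exists>w\<in>carrier (obj D (l + 1)). diff D (l + 1) w = z" using chain_mapD(4)[OF f w(1)] by blast
  qed
  ultimately show ?thesis by blast
qed

text \<open>A splitting of \<open>L\<close> into a copy of \<open>L'\<close> and a shifted copy, on
  which the differential is that of the cone of \<open>x\<close>: \<open>r0\<close> and
  \<open>r1\<close> are the projections, \<open>i0\<close> and \<open>i1\<close> the inclusions.
  Unlike an isomorphism with \<open>cone R x L'\<close> this makes sense for arbitrary element
  types, and it consists of linear maps with identities between them, which survive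
  tensoring.\<close>

locale cone_data = L: cplx R L + L': cplx R L'
  for R :: "'r ring" and L :: "('r, 'a) chain_complex" and L' :: "('r, 'b) chain_complex" +
  fixes x and r0 r1 i0 i1
  assumes x: "x \<in> carrier R"
    and r0: "r0 l \<in> module_hom R (obj L l) (obj L' l)" and r1: "r1 l \<in> module_hom R (obj L l) (obj L'
        (l - 1))"
    and i0: "i0 l \<in> module_hom R (obj L' l) (obj L l)" and i1: "i1 l \<in> module_hom R (obj L' (l - 1))
        (obj L l)"
    and r0_i0: "u \<in> carrier (obj L' l) \<Longrightarrow> r0 l (i0 l u) = u"
    and r1_i0: "u \<in> carrier (obj L' l) \<Longrightarrow> r1 l (i0 l u) = \<zero>\<^bsub>obj L' (l - 1)\<^esub>"
    and r0_i1: "v \<in> carrier (obj L' (l - 1)) \<Longrightarrow> r0 l (i1 l v) = \<zero>\<^bsub>obj L' l\<^esub>"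
    and r1_i1: "v \<in> carrier (obj L' (l - 1)) \<Longrightarrow> r1 l (i1 l v) = v"
    and i_r: "z \<in> carrier (obj L l) \<Longrightarrow> i0 l (r0 l z) \<oplus>\<^bsub>obj L l\<^esub> i1 l
        (r1 l z) = z"
    and r0_diff: "z \<in> carrier (obj L l) \<Longrightarrow>
      r0 (l - 1) (diff L l z) = diff L' l (r0 l z) \<oplus>\<^bsub>obj L' (l - 1)\<^esub> x \<odot>\<^bsub>obj
          L' (l - 1)\<^esub> r1 l z"
    and r1_diff: "z \<in> carrier (obj L l) \<Longrightarrow>
      r1 (l - 1) (diff L l z) = \<ominus>\<^bsub>obj L' (l - 1 - 1)\<^esub> diff L' (l - 1) (r1 l z)"

lemma cone_data_transfer:
  assumes "cone_data R L L' x r0 r1 i0 i1"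
    and A: "isomorphic_complexes R A L" and A': "isomorphic_complexes R L' A'"
  shows "\<exists>r0 r1 i0 i1. cone_data R A A' x r0 r1 i0 i1"
proof -
  interpret cone_data R L L' x r0 r1 i0 i1 by fact
  obtain f g where f: "chain_map R A L f" and g: "chain_map R L A g"
    and gf: "\<And>l x. x \<in> carrier (obj A l) \<Longrightarrow> g l (f l x) = x" and fg: "\<And>l y. y
        \<in> carrier (obj L l) \<Longrightarrow> f l (g l y) = y"
    using isomorphic_complexesE[OF A] by metis
  obtain f' g' where f': "chain_map R L' A' f'" and g': "chain_map R A' L' g'"
    and gf': "\<And>l x. x \<in> carrier (obj L' l) \<Longrightarrow> g' l (f' l x) = x" and fg': "\<And>l y. y
        \<in> carrier (obj A' l) \<Longrightarrow> f' l (g' l y) = y"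
    using isomorphic_complexesE[OF A'] by metis
  note D = chain_mapD[OF f] chain_mapD[OF f'] chain_mapD(3-)[OF g] chain_mapD(3-)[OF g']
  note cl = module_homD(1)[OF r0] module_homD(1)[OF r1] module_homD(1)[OF i0] module_homD(1)[OF i1]
  have "cone_data R A A' x (\<lambda>l z. f' l (r0 l (f l z))) (\<lambda>l z. f' (l - 1) (r1 l (f l z)))
      (\<lambda>l u. g l (i0 l (g' l u))) (\<lambda>l v. g l (i1 l (g' (l - 1) v)))"
  proof (intro cone_data.intro cone_data_axioms.intro D(1) chain_mapD(2)[OF f'] x)
    fix l
    show "(\<lambda>z. f' l (r0 l (f l z))) \<in> module_hom R (obj A l) (obj A' l)"
      "(\<lambda>z. f' (l - 1) (r1 l (f l z))) \<in> module_hom R (obj A l) (obj A' (l - 1))"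
      "(\<lambda>u. g l (i0 l (g' l u))) \<in> module_hom R (obj A' l) (obj A l)"
      "(\<lambda>v. g l (i1 l (g' (l - 1) v))) \<in> module_hom R (obj A' (l - 1)) (obj A l)"
      using module_hom_comp[OF module_hom_comp[OF chain_mapD(3)[OF f] r0] chain_mapD(3)[OF f']]
        module_hom_comp[OF module_hom_comp[OF chain_mapD(3)[OF f] r1] chain_mapD(3)[OF f']]
        module_hom_comp[OF module_hom_comp[OF chain_mapD(3)[OF g'] i0] chain_mapD(3)[OF g]]
        module_hom_comp[OF module_hom_comp[OF chain_mapD(3)[OF g'] i1] chain_mapD(3)[OF g]] by blast+
    show "f' l (r0 l (f l (g l (i0 l (g' l u))))) = u" "f' (l - 1) (r1 l (f l (g l (i0 l (g' l u))))) =
        \<zero>\<^bsub>obj A' (l - 1)\<^esub>"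
      if "u \<in> carrier (obj A' l)" for u
      using that by (simp_all add: fg cl chain_mapD(4)[OF g'] r0_i0 r1_i0 fg' chain_mapD(7)[OF f'])
    show "f' l (r0 l (f l (g l (i1 l (g' (l - 1) v))))) = \<zero>\<^bsub>obj A' l\<^esub>"
      "f' (l - 1) (r1 l (f l (g l (i1 l (g' (l - 1) v))))) = v"
      if "v \<in> carrier (obj A' (l - 1))" for v
      using that by (simp_all add: fg cl chain_mapD(4)[OF g'] r0_i1 r1_i1 fg' chain_mapD(7)[OF f'])
    fix z assume z: "z \<in> carrier (obj A l)"
    have fz: "f l z \<in> carrier (obj L l)" by (rule chain_mapD(4)[OF f z])
    show "g l (i0 l (g' l (f' l (r0 l (f l z))))) \<oplus>\<^bsub>obj A l\<^esub> g l (i1 l (g' (l - 1) (f' (l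
        - 1) (r1 l (f l z))))) = z"
      using fz z by (simp add: gf' cl i_r gf flip: chain_mapD(5)[OF g])
    have fd: "f (l - 1) (diff A l z) = diff L l (f l z)" by (rule chain_mapD(9)[OF f z, symmetric])
    show "f' (l - 1) (r0 (l - 1) (f (l - 1) (diff A l z))) =
        diff A' l (f' l (r0 l (f l z))) \<oplus>\<^bsub>obj A' (l - 1)\<^esub> x \<odot>\<^bsub>obj A' (l -
            1)\<^esub> f' (l - 1) (r1 l (f l z))"
      using fz x by (simp add: fd r0_diff cl chain_mapD(5,6,9)[OF f'])
    show "f' (l - 1 - 1) (r1 (l - 1) (f (l - 1) (diff A l z))) =
        \<ominus>\<^bsub>obj A' (l - 1 - 1)\<^esub> diff A' (l - 1) (f' (l - 1) (r1 l (f l z)))"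
      using fz chain_mapD(9)[OF f', of "r1 l (f l z)" "l - 1"] by (simp add: fd r1_diff cl chain_mapD(8)[OF f'])
  qed
  then show ?thesis by blast
qed

lemma cone_data_isomorphic_cone:
  assumes "cone_data R L C x r0 r1 i0 i1"
  shows "isomorphic_complexes R L (cone R x C)"
proof -
  interpret cone_data R L C x r0 r1 i0 i1 by fact
  interpret C: tree_cplx R C by (simp add: tree_cplx_def L'.cplx_axioms)
  note cl = module_homD(1)[OF r0] module_homD(1)[OF r1] module_homD(1)[OF i0] module_homD(1)[OF i1]
  have "chain_map R L (cone R x C) (\<lambda>l z. Node (r0 l z) (r1 l z))"
    unfolding chain_map_def
  proof (intro conjI allI ballI)
    show "is_complex R L" "is_complex R (cone R x C)" using L.is_complex C.cone_cplx[OF x] by (simp_all add: cplx_def)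
    fix l
    show "(\<lambda>z. Node (r0 l z) (r1 l z)) \<in> module_hom R (obj L l) (obj (cone R x C) l)"
      by (rule module_homI) (simp_all add: module_homD[OF r0] module_homD[OF r1])
    show "diff (cone R x C) l (Node (r0 l z) (r1 l z)) = Node (r0 (l - 1) (diff L l z)) (r1 (l - 1) (diff L l z))"
      if "z \<in> carrier (obj L l)" for z
      using that by (simp add: r0_diff r1_diff del: diff_diff_eq)
  qed
  then show ?thesis
  proof (rule isomorphic_complexesI[where g = "\<lambda>l a. i0 l (lft a) \<oplus>\<^bsub>obj L l\<^esub> i1 l
      (rgt a)"])
    fix l y assume "y \<in> carrier (obj (cone R x C) l)"
    then obtain u v where y: "y = Node u v" "u \<in> carrier (obj C l)" "v \<in> carrier (obj C (l - 1))" by auto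
    then show "i0 l (lft y) \<oplus>\<^bsub>obj L l\<^esub> i1 l (rgt y) \<in> carrier (obj L l)" by (simp add: cl)
    show "Node (r0 l (i0 l (lft y) \<oplus>\<^bsub>obj L l\<^esub> i1 l (rgt y))) (r1 l (i0 l (lft y)
        \<oplus>\<^bsub>obj L l\<^esub> i1 l (rgt y))) = y"
      using y by (simp add: cl module_homD(2)[OF r0] module_homD(2)[OF r1] r0_i0 r0_i1 r1_i0 r1_i1)
  qed (simp add: i_r)
qed

section \<open>Cone decompositions of tensor products\<close>

lemma direct_sum_map:
  fixes k :: int
  assumes mods: "\<And>p. module R (F p)" "\<And>p. module R (G p)" and h: "\<And>p. h p \<in> module_hom R (F
      (p + k)) (G p)"
  shows "(\<lambda>z p. h p (z (p + k))) \<in> module_hom R (direct_sum_module F) (direct_sum_module G)"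
proof (rule module_homI)
  fix z assume z: "z \<in> carrier (direct_sum_module F)"
  have "{p. h p (z (p + k)) \<noteq> \<zero>\<^bsub>G p\<^esub>} \<subseteq> (\<lambda>p. p - k) ` {p. z p
      \<noteq> \<zero>\<^bsub>F p\<^esub>}"
  proof
    fix p assume "p \<in> {p. h p (z (p + k)) \<noteq> \<zero>\<^bsub>G p\<^esub>}"
    then have "z (p + k) \<noteq> \<zero>\<^bsub>F (p + k)\<^esub>" using module_hom_zero[OF mods h] by auto
    then have "p + k - k \<in> (\<lambda>p. p - k) ` {p. z p \<noteq> \<zero>\<^bsub>F p\<^esub>}" by (intro
        imageI) simp
    then show "p \<in> (\<lambda>p. p - k) ` {p. z p \<noteq> \<zero>\<^bsub>F p\<^esub>}" by simp
  qed
  then have "finite {p. h p (z (p + k)) \<noteq> \<zero>\<^bsub>G p\<^esub>}" using z by (simp add: finite_subset)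
  then show "(\<lambda>p. h p (z (p + k))) \<in> carrier (direct_sum_module G)" using z by (simp add:
      module_homD(1)[OF h])
qed (simp_all add: module_homD[OF h])

lemma (in tensor_cplx) neg_tensor_complex:
  assumes z: "z \<in> carrier (obj (tensor_complex R K D) l)"
  shows "(\<ominus>\<^bsub>obj (tensor_complex R K D) l\<^esub> z) p = \<ominus>\<^bsub>T p (l - p)\<^esub> z p"
proof -
  interpret C: module R "obj (tensor_complex R K D) l" by (rule module_tensor_complex)
  have "(\<ominus>\<^bsub>obj (tensor_complex R K D) l\<^esub> z \<oplus>\<^bsub>obj (tensor_complex R K D)
      l\<^esub> z) p = \<zero>\<^bsub>T p (l - p)\<^esub>"
    using C.M.l_neg[OF z] by (simp add: zero_tensor_complex)
  then have "(\<ominus>\<^bsub>obj (tensor_complex R K D) l\<^esub> z) p \<oplus>\<^bsub>T p (l - p)\<^esub> z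
      p = \<zero>\<^bsub>T p (l - p)\<^esub>"
    by (simp add: add_tensor_complex)
  then show ?thesis
    using T.M.minus_equality comp_closed(1)[OF z] comp_closed(1)[OF C.M.a_inv_closed[OF z]] by metis
qed

lemma (in tensor_cplx) obj_tensor_complex:
  "obj (tensor_complex R K D) l = direct_sum_module (\<lambda>p. T p (l - p))"
  by (simp add: tensor_complex_def)

text \<open>This takes the place of associativity of the tensor product: if \<open>K\<close> is K(x)
  tensored with \<open>K'\<close>, then \<open>K \<otimes> D\<close> is K(x) tensored with
  \<open>K' \<otimes> D\<close>. The four maps are tensored with the identity of \<open>D\<close>;
  the identities between them persist because \<open>tensor_map\<close> is functorial, and additive
  in its left argument.\<close>

lemma cone_data_tensor:
  assumes "cone_data R K K' x r0 r1 i0 i1" and D: "cplx R D"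
  shows "\<exists>r0 r1 i0 i1. cone_data R (tensor_complex R K D) (tensor_complex R K' D) x r0 r1 i0 i1"
proof -
  interpret cone_data R K K' x r0 r1 i0 i1 by fact
  interpret D: cplx R D by fact
  interpret S: tensor_cplx R K D by (intro tensor_cplx.intro L.cplx_axioms D)
  interpret S': tensor_cplx R K' D by (intro tensor_cplx.intro L'.cplx_axioms D)
  note id = S.id_hom
  \<comment> \<open>\<open>r1\<close> and \<open>i1\<close> are reindexed so that \<open>p\<close>
    is the degree in \<open>K'\<close>; the corresponding degree in \<open>K\<close> is
    \<open>p + 1\<close>.\<close>
  have r1': "r1 (p + 1) \<in> module_hom R (obj K (p + 1)) (obj K' p)"
    and i1': "i1 (p + 1) \<in> module_hom R (obj K' p) (obj K (p + 1))" for p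
    using r1[of "p + 1"] i1[of "p + 1"] by simp_all
  note mods = L.module_obj L'.module_obj D.module_obj
  define a0 where "a0 p q = tensor_map R (obj K p) (obj D q) (obj K' p) (obj D q) (r0 p) (\<lambda>y. y)" for p q
  define a1 where "a1 p q = tensor_map R (obj K (p + 1)) (obj D q) (obj K' p) (obj D q) (r1 (p + 1))
      (\<lambda>y. y)" for p q
  define b0 where "b0 p q = tensor_map R (obj K' p) (obj D q) (obj K p) (obj D q) (i0 p) (\<lambda>y. y)" for p q
  define b1 where "b1 p q = tensor_map R (obj K' p) (obj D q) (obj K (p + 1)) (obj D q) (i1 (p + 1))
      (\<lambda>y. y)" for p q
  have a0: "a0 p q \<in> module_hom R (S.T p q) (S'.T p q)" and a1: "a1 p q \<in> module_hom R (S.T (p + 1) q)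
      (S'.T p q)"
    and b0: "b0 p q \<in> module_hom R (S'.T p q) (S.T p q)" and b1: "b1 p q \<in> module_hom R (S'.T p q) (S.T
        (p + 1) q)" for p q
    unfolding a0_def a1_def b0_def b1_def by (intro tensor_map_hom mods r0 r1' i0 i1' id)+
  note a0D = module_homD[OF a0] and a1D = module_homD[OF a1] and b0D = module_homD[OF b0] and b1D = module_homD[OF b1]
  have a0_b0: "a0 p q (b0 p q t) = t" if t: "t \<in> carrier (S'.T p q)" for p q t
    unfolding a0_def b0_def
    using tensor_map_comp[OF L'.module_obj D.module_obj L.module_obj D.module_obj L'.module_obj D.module_obj i0
        r0 id id t]
      tensor_map_id[OF L'.module_obj D.module_obj module_hom_comp[OF i0 r0] id _ _ t] r0_i0 by simp
  have a1_b0: "a1 p q (b0 (p + 1) q t) = \<zero>\<^bsub>S'.T p q\<^esub>" if t: "t \<in> carrier (S'.T (p + 1)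
      q)" for p q t
    unfolding a1_def b0_def
    using tensor_map_comp[OF L'.module_obj D.module_obj L.module_obj D.module_obj L'.module_obj D.module_obj i0
        r1' id id t]
      tensor_map_zero_left[OF L'.module_obj D.module_obj L'.module_obj D.module_obj module_hom_comp[OF i0 r1'] id _ t]
      r1_i0[of _ "p + 1"] by simp
  have a0_b1: "a0 (p + 1) q (b1 p q t) = \<zero>\<^bsub>S'.T (p + 1) q\<^esub>" if t: "t \<in> carrier (S'.T p
      q)" for p q t
    unfolding a0_def b1_def
    using tensor_map_comp[OF L'.module_obj D.module_obj L.module_obj D.module_obj L'.module_obj D.module_obj
        i1' r0 id id t]
      tensor_map_zero_left[OF L'.module_obj D.module_obj L'.module_obj D.module_obj module_hom_comp[OF i1' r0] id _ t]
      r0_i1[of _ "p + 1"] by simp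
  have a1_b1: "a1 p q (b1 p q t) = t" if t: "t \<in> carrier (S'.T p q)" for p q t
    unfolding a1_def b1_def
    using tensor_map_comp[OF L'.module_obj D.module_obj L.module_obj D.module_obj L'.module_obj D.module_obj
        i1' r1' id id t]
      tensor_map_id[OF L'.module_obj D.module_obj module_hom_comp[OF i1' r1'] id _ _ t] r1_i1[of _ "p + 1"] by simp
  have b_a: "b0 (p + 1) q (a0 (p + 1) q t) \<oplus>\<^bsub>S.T (p + 1) q\<^esub> b1 p q (a1 p q t) = t"
    if t: "t \<in> carrier (S.T (p + 1) q)" for p q t
  proof -
    have "b0 (p + 1) q (a0 (p + 1) q t) = tensor_map R (obj K (p + 1)) (obj D q) (obj K (p + 1)) (obj D q)
        (\<lambda>m. i0 (p + 1) (r0 (p + 1) m)) (\<lambda>y. y) t"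
      unfolding a0_def b0_def
      by (rule tensor_map_comp[OF L.module_obj D.module_obj L'.module_obj D.module_obj L.module_obj
          D.module_obj r0 i0 id id t])
    moreover have "b1 p q (a1 p q t) = tensor_map R (obj K (p + 1)) (obj D q) (obj K (p + 1)) (obj D q)
        (\<lambda>m. i1 (p + 1) (r1 (p + 1) m)) (\<lambda>y. y) t"
      unfolding a1_def b1_def
      by (rule tensor_map_comp[OF L.module_obj D.module_obj L'.module_obj D.module_obj L.module_obj
          D.module_obj r1' i1' id id t])
    moreover have "tensor_map R (obj K (p + 1)) (obj D q) (obj K (p + 1)) (obj D q) (\<lambda>m. m)
        (\<lambda>y. y) t =
        tensor_map R (obj K (p + 1)) (obj D q) (obj K (p + 1)) (obj D q) (\<lambda>m. i0 (p + 1) (r0 (p + 1)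
            m)) (\<lambda>y. y) t
        \<oplus>\<^bsub>S.T (p + 1) q\<^esub>
        tensor_map R (obj K (p + 1)) (obj D q) (obj K (p + 1)) (obj D q) (\<lambda>m. i1 (p + 1) (r1 (p + 1)
            m)) (\<lambda>y. y) t"
      by (rule tensor_map_add_left[OF L.module_obj D.module_obj L.module_obj D.module_obj id
            module_hom_comp[OF r0 i0] module_hom_comp[OF r1' i1'] id _ t]) (simp add: i_r)
    moreover have "tensor_map R (obj K (p + 1)) (obj D q) (obj K (p + 1)) (obj D q) (\<lambda>m. m)
        (\<lambda>y. y) t = t"
      by (rule tensor_map_id[OF L.module_obj D.module_obj id id _ _ t]) simp_all
    ultimately show ?thesis by simp
  qed
  have a0_dl: "a0 p q (S.dl p q t) = S'.dl p q (a0 (p + 1) q t) \<oplus>\<^bsub>S'.T p q\<^esub> x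
      \<odot>\<^bsub>S'.T p q\<^esub> a1 p q t"
    if t: "t \<in> carrier (S.T (p + 1) q)" for p q t
  proof -
    let ?tm = "\<lambda>f. tensor_map R (obj K (p + 1)) (obj D q) (obj K' p) (obj D q) f (\<lambda>y. y) t"
    have xr: "(\<lambda>m. x \<odot>\<^bsub>obj K' p\<^esub> r1 (p + 1) m) \<in> module_hom R (obj K (p + 1))
        (obj K' p)"
      by (rule module_hom_smult[OF L'.module_obj r1' x])
    have "a0 p q (S.dl p q t) = ?tm (\<lambda>m. r0 p (diff K (p + 1) m))"
      unfolding a0_def S.dl_def
      by (rule tensor_map_comp[OF L.module_obj D.module_obj L.module_obj D.module_obj L'.module_obj
          D.module_obj S.diffK_hom r0 id id t])
    also have "\<dots> = ?tm (\<lambda>m. diff K' (p + 1) (r0 (p + 1) m)) \<oplus>\<^bsub>S'.T p q\<^esub> ?tm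
        (\<lambda>m. x \<odot>\<^bsub>obj K' p\<^esub> r1 (p + 1) m)"
      by (rule tensor_map_add_left[OF L.module_obj D.module_obj L'.module_obj D.module_obj
            module_hom_comp[OF S.diffK_hom r0] module_hom_comp[OF r0 S'.diffK_hom] xr id _ t])
        (use r0_diff[of _ "p + 1"] in simp)
    also have "?tm (\<lambda>m. diff K' (p + 1) (r0 (p + 1) m)) = S'.dl p q (a0 (p + 1) q t)"
      unfolding a0_def S'.dl_def
      by (rule tensor_map_comp[OF L.module_obj D.module_obj L'.module_obj D.module_obj L'.module_obj
          D.module_obj r0 S'.diffK_hom id id t, symmetric])
    also have "?tm (\<lambda>m. x \<odot>\<^bsub>obj K' p\<^esub> r1 (p + 1) m) = x \<odot>\<^bsub>S'.T p
        q\<^esub> a1 p q t"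
      unfolding a1_def
      by (rule tensor_map_smult_left[OF L.module_obj D.module_obj L'.module_obj D.module_obj xr r1' id x _ t]) simp
    finally show ?thesis .
  qed
  have a1_dl: "a1 p q (S.dl (p + 1) q t) = \<ominus>\<^bsub>S'.T p q\<^esub> S'.dl p q (a1 (p + 1) q t)"
    if t: "t \<in> carrier (S.T (p + 1 + 1) q)" for p q t
  proof -
    let ?tm = "\<lambda>f. tensor_map R (obj K (p + 1 + 1)) (obj D q) (obj K' p) (obj D q) f (\<lambda>y. y) t"
    have "a1 p q (S.dl (p + 1) q t) = ?tm (\<lambda>m. r1 (p + 1) (diff K (p + 1 + 1) m))"
      unfolding a1_def S.dl_def
      by (rule tensor_map_comp[OF L.module_obj D.module_obj L.module_obj D.module_obj L'.module_obj
          D.module_obj S.diffK_hom r1' id id t])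
    also have "\<dots> = \<ominus>\<^bsub>S'.T p q\<^esub> ?tm (\<lambda>m. diff K' (p + 1) (r1 (p + 1 + 1) m))"
    proof (rule tensor_map_neg_left[OF L.module_obj D.module_obj L'.module_obj D.module_obj
            module_hom_comp[OF S.diffK_hom r1'] module_hom_comp[OF r1' S'.diffK_hom] id _ t])
      fix m assume "m \<in> carrier (obj K (p + 1 + 1))"
      from r1_diff[OF this] show "r1 (p + 1) (diff K (p + 1 + 1) m) = \<ominus>\<^bsub>obj K' p\<^esub> diff K'
          (p + 1) (r1 (p + 1 + 1) m)"
        by (simp only: add_diff_cancel_right')
    qed
    also have "?tm (\<lambda>m. diff K' (p + 1) (r1 (p + 1 + 1) m)) = S'.dl p q (a1 (p + 1) q t)"
      unfolding a1_def S'.dl_def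
      by (rule tensor_map_comp[OF L.module_obj D.module_obj L'.module_obj D.module_obj L'.module_obj
          D.module_obj r1' S'.diffK_hom id id t, symmetric])
    finally show ?thesis .
  qed
  have a0_dr: "a0 p q (S.dr p q t) = S'.dr p q (a0 p (q + 1) t)" if t: "t \<in> carrier (S.T p (q + 1))" for p q t
    unfolding a0_def S.dr_def S'.dr_def
    by (simp only: tensor_map_comp[OF L.module_obj D.module_obj L.module_obj D.module_obj L'.module_obj
        D.module_obj id r0 S.diffD_hom id t]
        tensor_map_comp[OF L.module_obj D.module_obj L'.module_obj D.module_obj L'.module_obj D.module_obj r0
            id id S.diffD_hom t])
  have a1_dr: "a1 p q (S.dr (p + 1) q t) = S'.dr p q (a1 p (q + 1) t)" if t: "t \<in> carrier (S.T (p + 1) (q +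
      1))" for p q t
    unfolding a1_def S.dr_def S'.dr_def
    by (simp only: tensor_map_comp[OF L.module_obj D.module_obj L.module_obj D.module_obj L'.module_obj
        D.module_obj id r1' S.diffD_hom id t]
        tensor_map_comp[OF L.module_obj D.module_obj L'.module_obj D.module_obj L'.module_obj D.module_obj r1'
            id id S.diffD_hom t])
  let ?C = "tensor_complex R K D" and ?C' = "tensor_complex R K' D"
  define R0 where "R0 l z = (\<lambda>p. a0 p (l - p) (z p))" for l z
  \<comment> \<open>The second summand sits one degree higher in \<open>K\<close> than in
    \<open>K'\<close>: the component at \<open>p\<close> of \<open>R1\<close> comes from the
    component at \<open>p + 1\<close>, and \<open>I1\<close> shifts back.\<close>
  define R1 where "R1 l z = (\<lambda>p. a1 p (l - 1 - p) (z (p + 1)))" for l z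
  define I0 where "I0 l u = (\<lambda>p. b0 p (l - p) (u p))" for l u
  define I1 where "I1 l v = (\<lambda>p. b1 (p - 1) (l - p) (v (p - 1)))" for l v
  have R0: "R0 l \<in> module_hom R (obj ?C l) (obj ?C' l)" for l
    using direct_sum_map[where F = "\<lambda>p. S.T p (l - p)" and G = "\<lambda>p. S'.T p (l - p)" and k = 0
        and h = "\<lambda>p. a0 p (l - p)", OF S.T_module S'.T_module] a0
    by (simp add: S.obj_tensor_complex S'.obj_tensor_complex R0_def[abs_def])
  have R1: "R1 l \<in> module_hom R (obj ?C l) (obj ?C' (l - 1))" for l
  proof -
    have "a1 p (l - 1 - p) \<in> module_hom R (S.T (p + 1) (l - (p + 1))) (S'.T p (l - 1 - p))" for p
    proof -
      have "l - (p + 1) = l - 1 - p" by simp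
      then show ?thesis using a1[of p "l - 1 - p"] by (simp only:)
    qed
    from direct_sum_map[where F = "\<lambda>p. S.T p (l - p)" and G = "\<lambda>p. S'.T p (l - 1 - p)" and k =
        1, OF S.T_module S'.T_module this]
    show ?thesis
      by (simp only: S.obj_tensor_complex S'.obj_tensor_complex R1_def[abs_def])
  qed
  have I0: "I0 l \<in> module_hom R (obj ?C' l) (obj ?C l)" for l
    using direct_sum_map[where F = "\<lambda>p. S'.T p (l - p)" and G = "\<lambda>p. S.T p (l - p)" and k = 0
        and h = "\<lambda>p. b0 p (l - p)", OF S'.T_module S.T_module] b0
    by (simp add: S.obj_tensor_complex S'.obj_tensor_complex I0_def[abs_def])
  have I1: "I1 l \<in> module_hom R (obj ?C' (l - 1)) (obj ?C l)" for l
  proof -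
    have "b1 (p - 1) (l - p) \<in> module_hom R (S'.T (p + - 1) (l - 1 - (p + - 1))) (S.T p (l - p))" for p
    proof -
      have "p + - 1 = p - 1" "l - 1 - (p - 1) = l - p" "p - 1 + 1 = p" by simp_all
      then show ?thesis using b1[of "p - 1" "l - p"] by (simp only:)
    qed
    from direct_sum_map[where F = "\<lambda>p. S'.T p (l - 1 - p)" and G = "\<lambda>p. S.T p (l - p)" and k =
        "- 1", OF S'.T_module S.T_module this]
    show ?thesis
      by (simp only: S.obj_tensor_complex S'.obj_tensor_complex I1_def[abs_def] add_uminus_conv_diff)
  qed
  note c = S.comp_closed and c' = S'.comp_closed
  have idx: "l - (p + 1) = l - 1 - p" "p - 1 + 1 = p" "p + 1 - 1 = p" "l - 1 - (p - 1) = l - p" for l p :: int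
      by simp_all
  have vc: "v (p - 1) \<in> carrier (S'.T (p - 1) (l - p))" if "v \<in> carrier (obj ?C' (l - 1))" for v l p
    using c'(1)[OF that, of "p - 1"] by (simp only: idx)
  have "cone_data R ?C ?C' x R0 R1 I0 I1"
  proof (intro cone_data.intro cone_data_axioms.intro S.tensor_complex_cplx S'.tensor_complex_cplx x R0 R1 I0 I1)
    fix l u assume u: "u \<in> carrier (obj ?C' l)"
    show "R0 l (I0 l u) = u"
      unfolding R0_def I0_def using a0_b0[OF c'(1)[OF u]] by simp
    show "R1 l (I0 l u) = \<zero>\<^bsub>obj ?C' (l - 1)\<^esub>"
      unfolding R1_def I0_def S'.zero_tensor_complex using a1_b0[OF c'(3)[OF u]] by (simp only: idx)
  next
    fix l v assume v: "v \<in> carrier (obj ?C' (l - 1))"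
    show "R0 l (I1 l v) = \<zero>\<^bsub>obj ?C' l\<^esub>"
      unfolding R0_def I1_def S'.zero_tensor_complex using a0_b1[OF vc[OF v]] by (simp only: idx)
    show "R1 l (I1 l v) = v"
      unfolding R1_def I1_def using a1_b1[OF c'(1)[OF v]] by (simp only: idx)
  next
    fix l z assume z: "z \<in> carrier (obj ?C l)"
    show "I0 l (R0 l z) \<oplus>\<^bsub>obj ?C l\<^esub> I1 l (R1 l z) = z"
    proof
      fix p
      show "(I0 l (R0 l z) \<oplus>\<^bsub>obj ?C l\<^esub> I1 l (R1 l z)) p = z p"
        unfolding S.add_tensor_complex I0_def R0_def I1_def R1_def
        using b_a[of "z p" "p - 1" "l - p"] c(1)[OF z, of p] by (simp only: idx)
    qed
    show "R0 (l - 1) (diff ?C l z) = diff ?C' l (R0 l z) \<oplus>\<^bsub>obj ?C' (l - 1)\<^esub> x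
        \<odot>\<^bsub>obj ?C' (l - 1)\<^esub> R1 l z"
    proof
      fix p
      define q where "q = l - 1 - p"
      have q: "l - 1 - p = q" "l - p = q + 1" "l - (p + 1) = q" by (simp_all add: q_def)
      have z1: "z (p + 1) \<in> carrier (S.T (p + 1) q)" and z0: "z p \<in> carrier (S.T p (q + 1))"
        using c(3)[OF z, of p] c(1)[OF z, of p] by (simp_all only: q)
      note cl = z0 z1 a0D(1) a1D(1) module_homD(1)[OF S.dl_hom] module_homD(1)[OF S.dr_hom]
        module_homD(1)[OF S'.dl_hom] module_homD(1)[OF S'.dr_hom] parity_sign_closed[OF S.T_module]
            parity_sign_closed[OF S'.T_module]
      have "a0 p q (diff ?C l z p) = (S'.dl p q (a0 (p + 1) q (z (p + 1))) \<oplus>\<^bsub>S'.T p q\<^esub> x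
          \<odot>\<^bsub>S'.T p q\<^esub> a1 p q (z (p + 1)))
          \<oplus>\<^bsub>S'.T p q\<^esub> parity_sign (S'.T p q) p (S'.dr p q (a0 p (q + 1) (z p)))"
        unfolding S.diff_tensor_complex q
        by (simp only: cl a0D(2) a0_dl a0_dr hom_parity_sign[OF S.T_module S'.T_module a0])
      also have "\<dots> = (S'.dl p q (a0 (p + 1) q (z (p + 1))) \<oplus>\<^bsub>S'.T p q\<^esub>
          parity_sign (S'.T p q) p (S'.dr p q (a0 p (q + 1) (z p)))) \<oplus>\<^bsub>S'.T p q\<^esub> x
              \<odot>\<^bsub>S'.T p q\<^esub> a1 p q (z (p + 1))"
        using x by (simp only: cl S'.T.M.a_ac S'.T.smult_closed S'.T.M.a_closed)
      finally show "R0 (l - 1) (diff ?C l z) p = (diff ?C' l (R0 l z) \<oplus>\<^bsub>obj ?C' (l - 1)\<^esub> x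
          \<odot>\<^bsub>obj ?C' (l - 1)\<^esub> R1 l z) p"
        unfolding S'.add_tensor_complex S'.smult_tensor_complex S'.diff_tensor_complex R0_def R1_def q .
    qed
    have R1z: "R1 l z \<in> carrier (obj ?C' (l - 1))" by (rule module_homD(1)[OF R1 z])
    have dR1z: "diff ?C' (l - 1) (R1 l z) \<in> carrier (obj ?C' (l - 1 - 1))"
      using cplx.diff_closed[OF S'.tensor_complex_cplx R1z] .
    show "R1 (l - 1) (diff ?C l z) = \<ominus>\<^bsub>obj ?C' (l - 1 - 1)\<^esub> diff ?C' (l - 1) (R1 l z)"
    proof
      fix p
      define q where "q = l - 1 - 1 - p"
      have q: "l - 1 - 1 - p = q" "l - 1 - p = q + 1" "l - 1 - (p + 1) = q" by (simp_all add: q_def)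
      have z2: "z (p + 1 + 1) \<in> carrier (S.T (p + 1 + 1) q)" and z1: "z (p + 1) \<in> carrier (S.T (p + 1)
          (q + 1))"
        using c(3)[OF z, of "p + 1"] c(3)[OF z, of p] by (simp_all only: q)
      note cl = z1 z2 a1D(1) module_homD(1)[OF S.dl_hom] module_homD(1)[OF S.dr_hom]
        module_homD(1)[OF S'.dl_hom] module_homD(1)[OF S'.dr_hom] parity_sign_closed[OF S.T_module]
            parity_sign_closed[OF S'.T_module]
      have "a1 p q (diff ?C l z (p + 1)) = \<ominus>\<^bsub>S'.T p q\<^esub> S'.dl p q (a1 (p + 1) q (z (p + 1 + 1)))
          \<oplus>\<^bsub>S'.T p q\<^esub> parity_sign (S'.T p q) (p + 1) (S'.dr p q (a1 p (q + 1) (z (p + 1))))"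
        unfolding S.diff_tensor_complex q
        by (simp only: cl a1D(2) a1_dl a1_dr hom_parity_sign[OF S.T_module S'.T_module a1])
      \<comment> \<open>The shift from \<open>p + 1\<close> to \<open>p\<close> changes the sign in
        front of \<open>dr\<close>. So both terms carry a minus sign, as the shifted summand of a
        cone demands.\<close>
      also have "\<dots> = \<ominus>\<^bsub>S'.T p q\<^esub> (S'.dl p q (a1 (p + 1) q (z (p + 1 + 1)))
          \<oplus>\<^bsub>S'.T p q\<^esub>
          parity_sign (S'.T p q) p (S'.dr p q (a1 p (q + 1) (z (p + 1)))))"
        by (simp only: cl parity_sign_Suc[OF S'.T_module] S'.T.M.minus_add)
      finally show "R1 (l - 1) (diff ?C l z) p = (\<ominus>\<^bsub>obj ?C' (l - 1 - 1)\<^esub> diff ?C' (l - 1)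
          (R1 l z)) p"
        unfolding S'.neg_tensor_complex[OF dR1z] unfolding S'.diff_tensor_complex R1_def q .
    qed
  qed
  then show ?thesis by blast
qed

text \<open>The isomorphism sends \<open>k \<otimes> m\<close> to \<open>f(k) m\<close>, and its
  inverse sends \<open>m\<close> to \<open>e \<otimes> m\<close>, where \<open>e\<close> corresponds
  to 1. It is stated for every complex isomorphic to the stalk complex of \<open>R\<close>, since
  \<open>is_koszul\<close> determines its base case up to isomorphism.\<close>

lemma tensor_unit:
  fixes R :: "'r ring" and K :: "('r, 'k) chain_complex" and D :: "('r, 'm) chain_complex"
  assumes K: "isomorphic_complexes R K (stalk_complex (regular_module R))" and D: "cplx R D"
  shows "isomorphic_complexes R (tensor_complex R K D) D"
proof -
  obtain f g where f: "chain_map R K (stalk_complex (regular_module R)) f"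
    and g: "chain_map R (stalk_complex (regular_module R)) K g"
    and gf: "\<And>l x. x \<in> carrier (obj K l) \<Longrightarrow> g l (f l x) = x"
    and fg: "\<And>l y. y \<in> carrier (obj (stalk_complex (regular_module R)) l) \<Longrightarrow> f l (g l y) = y"
    using isomorphic_complexesE[OF K] by metis
  interpret K: cplx R K by (rule chain_mapD[OF f])
  interpret D: cplx R D by fact
  interpret S: tensor_cplx R K D by (intro tensor_cplx.intro K.cplx_axioms D)
  note fD = chain_mapD(3-)[OF f] and gD = chain_mapD(3-)[OF g]
  \<comment> \<open>Outside degree 0 the terms of \<open>K\<close> vanish, hence so do the tensor
    products; an element of the tensor complex is its component at 0.\<close>
  have K0: "carrier (obj K p) = {\<zero>\<^bsub>obj K p\<^esub>}" if "p \<noteq> 0" for p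
  proof -
    have "k = \<zero>\<^bsub>obj K p\<^esub>" if "k \<in> carrier (obj K p)" for k
    proof -
      have "f p k = \<zero>\<^bsub>R\<^esub>" using fD(2)[OF that] \<open>p \<noteq> 0\<close> by simp
      then show ?thesis using gf[OF that] gD(5)[of p] by simp
    qed
    then show ?thesis by auto
  qed
  define e where "e = g 0 \<one>\<^bsub>R\<^esub>"
  have e: "e \<in> carrier (obj K 0)" unfolding e_def using gD(2)[of "\<one>\<^bsub>R\<^esub>" 0] by simp
  have fR: "f 0 k \<in> carrier R" if "k \<in> carrier (obj K 0)" for k using fD(2)[OF that] by simp
  have fe: "f 0 e = \<one>\<^bsub>R\<^esub>" using fg[of "\<one>\<^bsub>R\<^esub>" 0] by (simp add: e_def)
  have ek: "f 0 k \<odot>\<^bsub>obj K 0\<^esub> e = k" if k: "k \<in> carrier (obj K 0)" for k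
    using gD(4)[of "f 0 k" "\<one>\<^bsub>R\<^esub>" 0] fR[OF k] gf[OF k] by (simp add: e_def)
  have "\<exists>\<mu>. \<mu> \<in> module_hom R (S.T 0 q) (obj D q) \<and>
      (\<forall>k\<in>carrier (obj K 0). \<forall>m\<in>carrier (obj D q). \<mu> (pure_tensor R (obj K 0) (obj
          D q) k m) = f 0 k \<odot>\<^bsub>obj D q\<^esub> m)" for q
    by (rule S.tp.tensor_lift[OF D.module_obj, of 0 q "\<lambda>k m. f 0 k \<odot>\<^bsub>obj D q\<^esub> m"])
      (use fR fD(3,4) in \<open>auto simp: D.obj.smult_l_distr D.obj.smult_r_distr
          D.obj.smult_assoc1[symmetric] K.obj.R.m_comm\<close>)
  then obtain \<mu> where \<mu>: "\<And>q. \<mu> q \<in> module_hom R (S.T 0 q) (obj D q)"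
    and \<mu>p: "\<And>q k m. k \<in> carrier (obj K 0) \<Longrightarrow> m \<in> carrier (obj D q) \<Longrightarrow>
      \<mu> q (pure_tensor R (obj K 0) (obj D q) k m) = f 0 k \<odot>\<^bsub>obj D q\<^esub> m"
    by metis
  let ?C = "tensor_complex R K D" and ?\<nu> = "\<lambda>q m. pure_tensor R (obj K 0) (obj D q) e m"
  have \<nu>: "?\<nu> q \<in> module_hom R (obj D q) (S.T 0 q)" for q
    by (rule module_homI) (simp_all add: e S.tp.pure_closed S.tp.pure_add_right S.tp.pure_smult_right)
  have \<nu>\<mu>: "?\<nu> q (\<mu> q t) = t" if t: "t \<in> carrier (S.T 0 q)" for q t
  proof -
    have "(\<lambda>t. ?\<nu> q (\<mu> q t)) t = (\<lambda>t. t) t"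
    proof (rule S.tp.tensor_ext[OF S.T_module module_hom_comp[OF \<mu> \<nu>] S.id_hom _ t])
      fix k m assume k: "k \<in> carrier (obj K 0)" and m: "m \<in> carrier (obj D q)"
      have "?\<nu> q (f 0 k \<odot>\<^bsub>obj D q\<^esub> m) = pure_tensor R (obj K 0) (obj D q) (f 0 k
          \<odot>\<^bsub>obj K 0\<^esub> e) m"
        by (simp only: S.tp.pure_smult_right[OF fR[OF k] e m] S.tp.pure_smult_left[OF fR[OF k] e m])
      then show "?\<nu> q (\<mu> q (pure_tensor R (obj K 0) (obj D q) k m)) = pure_tensor R (obj K 0) (obj D q) k m"
        by (simp only: \<mu>p[OF k m] ek[OF k])
    qed
    then show ?thesis .
  qed
  have z_other: "z p = \<zero>\<^bsub>S.T p q\<^esub>" if "z p \<in> carrier (S.T p q)" "p \<noteq> 0" for z ::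
      "int \<Rightarrow> _" and p q
    using S.tp.tensor_zero[OF K0[OF that(2)] that(1)] .
  have \<mu>d: "diff D (q + 1) (\<mu> (q + 1) t) = \<mu> q (S.dr 0 q t)" if t: "t \<in> carrier (S.T 0 (q +
      1))" for q t
  proof (rule S.tp.tensor_ext[OF D.module_obj module_hom_comp[OF \<mu> S.diffD_hom] module_hom_comp[OF S.dr_hom
      \<mu>] _ t])
    fix k m assume k: "k \<in> carrier (obj K 0)" and m: "m \<in> carrier (obj D (q + 1))"
    show "diff D (q + 1) (\<mu> (q + 1) (pure_tensor R (obj K 0) (obj D (q + 1)) k m)) =
        \<mu> q (S.dr 0 q (pure_tensor R (obj K 0) (obj D (q + 1)) k m))"
      unfolding S.dr_def
      using k m fR[OF k] tensor_map_pure[OF K.module_obj D.module_obj K.module_obj D.module_obj S.id_hom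
          S.diffD_hom k m]
        D.diff_smult[of "f 0 k" m "q + 1"] by (simp add: \<mu>p)
  qed
  have "chain_map R ?C D (\<lambda>l z. \<mu> l (z 0))"
    unfolding chain_map_def
  proof (intro conjI allI ballI)
    fix l
    show "(\<lambda>z. \<mu> l (z 0)) \<in> module_hom R (obj ?C l) (obj D l)"
    proof (rule module_homI)
      fix z assume z: "z \<in> carrier (obj ?C l)"
      have z0: "z 0 \<in> carrier (S.T 0 l)" using S.comp_closed(1)[OF z, of 0] by simp
      show "\<mu> l (z 0) \<in> carrier (obj D l)" by (rule module_homD(1)[OF \<mu> z0])
      show "\<mu> l ((r \<odot>\<^bsub>obj ?C l\<^esub> z) 0) = r \<odot>\<^bsub>obj D l\<^esub> \<mu> l (z 0)"
          if "r \<in> carrier R" for r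
        using module_homD(3)[OF \<mu> that z0] by (simp add: S.smult_tensor_complex)
      fix y assume y: "y \<in> carrier (obj ?C l)"
      have y0: "y 0 \<in> carrier (S.T 0 l)" using S.comp_closed(1)[OF y, of 0] by simp
      show "\<mu> l ((z \<oplus>\<^bsub>obj ?C l\<^esub> y) 0) = \<mu> l (z 0) \<oplus>\<^bsub>obj D l\<^esub>
          \<mu> l (y 0)"
        using module_homD(2)[OF \<mu> z0 y0] by (simp add: S.add_tensor_complex)
    qed
    fix z assume z: "z \<in> carrier (obj ?C l)"
    have z0: "z 0 \<in> carrier (S.T 0 (l - 1 + 1))" using S.comp_closed(1)[OF z, of 0] by simp
    have "z (0 + 1) = \<zero>\<^bsub>S.T (0 + 1) (l - 1)\<^esub>"
      using S.comp_closed(3)[OF z, of 0] by (intro z_other) simp_all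
    then have "S.dl 0 (l - 1) (z (0 + 1)) = \<zero>\<^bsub>S.T 0 (l - 1)\<^esub>"
      using module_hom_zero[OF S.T_module S.T_module S.dl_hom, of 0 "l - 1"] by simp
    moreover have "diff ?C l z 0 = S.dl 0 (l - 1) (z (0 + 1)) \<oplus>\<^bsub>S.T 0 (l - 1)\<^esub> S.dr 0 (l -
        1) (z 0)"
      using S.diff_tensor_complex[of l z 0] by (simp add: parity_sign_def)
    ultimately have "diff ?C l z 0 = S.dr 0 (l - 1) (z 0)"
      using module_homD(1)[OF S.dr_hom z0] by simp
    then show "diff D l (\<mu> l (z 0)) = \<mu> (l - 1) (diff ?C l z 0)" using \<mu>d[OF z0] by simp
  qed (use cplx.is_complex[OF S.tensor_complex_cplx] D.is_complex in auto)
  then show ?thesis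
  proof (rule isomorphic_complexesI[where g = "\<lambda>l m p. if p = 0 then ?\<nu> l m else \<zero>\<^bsub>S.T
      p (l - p)\<^esub>"])
    fix l y assume y: "y \<in> carrier (obj D l)"
    have "finite {p. (if p = 0 then ?\<nu> l y else \<zero>\<^bsub>S.T p (l - p)\<^esub>) \<noteq>
        \<zero>\<^bsub>S.T p (l - p)\<^esub>}"
      by (rule finite_subset[of _ "{0}"]) auto
    then show "(\<lambda>p. if p = 0 then ?\<nu> l y else \<zero>\<^bsub>S.T p (l - p)\<^esub>) \<in> carrier
        (obj ?C l)"
      using S.tp.pure_closed[OF e y] by (simp add: S.carrier_tensor_complex)
    show "\<mu> l (if (0::int) = 0 then ?\<nu> l y else \<zero>\<^bsub>S.T 0 (l - 0)\<^esub>) = y" using y e by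
        (simp add: \<mu>p fe)
  next
    fix l z assume z: "z \<in> carrier (obj ?C l)"
    show "(\<lambda>p. if p = 0 then ?\<nu> l (\<mu> l (z 0)) else \<zero>\<^bsub>S.T p (l - p)\<^esub>) = z"
    proof
      fix p
      show "(if p = 0 then ?\<nu> l (\<mu> l (z 0)) else \<zero>\<^bsub>S.T p (l - p)\<^esub>) = z p"
      proof (cases "p = 0")
        case True
        then show ?thesis using \<nu>\<mu>[of "z 0" l] S.comp_closed(1)[OF z, of 0] by simp
      next
        case False
        then show ?thesis using z_other[of z p "l - p", OF S.comp_closed(1)[OF z] False] by simp
      qed
    qed
  qed
qed

text \<open>The copies of \<open>R\<close> in degrees 0 and 1 are the two summands, and each
  projection or inclusion is the identity in its degree and zero elsewhere.\<close>

lemma cone_data_koszul1: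
  assumes R: "cring R" and x: "x \<in> carrier R"
  shows "\<exists>r0 r1 i0 i1. cone_data R (koszul1 R x) (stalk_complex (regular_module R)) x r0 r1 i0 i1"
proof -
  interpret R: cring R by fact
  have K: "carrier (obj (koszul1 R x) l) = (if l = 0 \<or> l = 1 then carrier R else {\<zero>\<^bsub>R\<^esub>})"
    "zero (obj (koszul1 R x) l) = \<zero>\<^bsub>R\<^esub>" "add (obj (koszul1 R x) l) = add R" "smult (obj
        (koszul1 R x) l) = mult R"
    "diff (koszul1 R x) l = (\<lambda>r. if l = 1 then x \<otimes>\<^bsub>R\<^esub> r else
        \<zero>\<^bsub>R\<^esub>)" for l
    by (simp_all add: koszul1_def regular_module_def)
  have S: "carrier (obj (stalk_complex (regular_module R)) l) = (if l = 0 then carrier R else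
      {\<zero>\<^bsub>R\<^esub>})"
    "zero (obj (stalk_complex (regular_module R)) l) = \<zero>\<^bsub>R\<^esub>" "add (obj (stalk_complex
        (regular_module R)) l) = add R"
    "smult (obj (stalk_complex (regular_module R)) l) = mult R"
    "diff (stalk_complex (regular_module R)) l = (\<lambda>_. \<zero>\<^bsub>R\<^esub>)" for l
    by (simp_all add: regular_module_def)
  have "module R (obj (koszul1 R x) l)" for l
    using module_regular[OF R] module_zero_submodule[OF module_regular[OF R]] by (simp add: koszul1_def)
  then have cK: "cplx R (koszul1 R x)"
    using x by unfold_locales (auto simp: is_complex_def K R.r_distr R.m_lcomm intro!: module_homI split: if_splits)
  interpret S: cplx R "stalk_complex (regular_module R)" by (rule stalk_complex_cplx[OF module_regular[OF R]])
  have neg0: "\<ominus>\<^bsub>obj (stalk_complex (regular_module R)) l\<^esub> \<zero>\<^bsub>R\<^esub> =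
      \<zero>\<^bsub>R\<^esub>" for l
    using S.obj.M.neg_zero[of l] by (simp add: S)
  have "cone_data R (koszul1 R x) (stalk_complex (regular_module R)) x
      (\<lambda>l z. if l = 0 then z else \<zero>\<^bsub>R\<^esub>) (\<lambda>l z. if l = 1 then z else
          \<zero>\<^bsub>R\<^esub>)
      (\<lambda>l z. if l = 0 then z else \<zero>\<^bsub>R\<^esub>) (\<lambda>l z. if l = 1 then z else
          \<zero>\<^bsub>R\<^esub>)"
    by (intro cone_data.intro cone_data_axioms.intro cK S.cplx_axioms x)
      (use x in \<open>auto simp: K S neg0 intro!: module_homI split: if_splits\<close>)
  then show ?thesis by blast
qed

section \<open>Identification of the Koszul complex with iterated cones\<close>

lemma is_koszul_cplx:
  assumes "is_koszul R xs K"
  shows "cplx R K"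
  using assms by (cases xs) (auto simp: isomorphic_complexes_def chain_map_def cplx_def)

lemma leaf_isomorphic:
  assumes "cplx R C"
  shows "isomorphic_complexes R C (leaf_complex C)"
proof -
  interpret cplx R C by fact
  have "chain_map R C (leaf_complex C) (\<lambda>_. Leaf)"
    unfolding chain_map_def
    using is_complex transport_cplx[of "\<lambda>_. leaf_val" Leaf] by (auto simp: cplx_def intro!: module_homI)
  then show ?thesis by (rule isomorphic_complexesI[where g = "\<lambda>_. leaf_val"]) auto
qed

lemma isomorphic_complexes_refl: "cplx R C \<Longrightarrow> isomorphic_complexes R C C"
  by (rule isomorphic_complexesI[where f = "\<lambda>_ x. x" and g = "\<lambda>_ x. x"])
    (auto simp: chain_map_def cplx_def intro!: module_homI)

text \<open>Cone data are carried along the recursion of \<open>is_koszul\<close>. Those of K(x)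
  over \<open>R\<close>, tensored with \<open>K'\<close> and combined with
  \<open>R \<otimes> K' = K'\<close>, describe \<open>K\<close> over \<open>K'\<close>. Tensoring
  with \<open>D\<close> and replacing \<open>K' \<otimes> D\<close> by the iterated cone of the
  induction hypothesis describes \<open>K \<otimes> D\<close> as a cone over that.\<close>

theorem tensor_koszul_isomorphic:
  fixes K :: "('r, 'k) chain_complex" and D :: "('r, 'm) chain_complex"
  assumes "is_koszul R xs K" and D: "cplx R D" and "set xs \<subseteq> carrier R"
  shows "isomorphic_complexes R (tensor_complex R K D) (kos R xs D)"
  using assms(1,3)
proof (induction xs arbitrary: K)
  case Nil
  then show ?case
    using isomorphic_complexes_trans[OF tensor_unit[OF _ D] leaf_isomorphic[OF D]] by simp
next
  case (Cons x xs)
  have R: "cring R" by (rule cplx.cring[OF D])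
  have x: "x \<in> carrier R" and xs: "set xs \<subseteq> carrier R" using Cons.prems(2) by auto
  obtain K' :: "('r, 'k) chain_complex" where K': "is_koszul R xs K'"
    and K: "isomorphic_complexes R K (tensor_complex R (koszul1 R x) K')"
    using Cons.prems(1) by auto
  have stalk: "isomorphic_complexes R (stalk_complex (regular_module R)) (stalk_complex (regular_module R))"
    by (rule isomorphic_complexes_refl[OF stalk_complex_cplx[OF module_regular[OF R]]])
  obtain r0 r1 i0 i1 where "cone_data R (koszul1 R x) (stalk_complex (regular_module R)) x r0 r1 i0 i1"
    using cone_data_koszul1[OF R x] by blast
  from cone_data_tensor[OF this is_koszul_cplx[OF K']] obtain r0 r1 i0 i1
    where "cone_data R (tensor_complex R (koszul1 R x) K') (tensor_complex R (stalk_complex (regular_module R))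
        K') x r0 r1 i0 i1"
    by blast
  from cone_data_transfer[OF this K tensor_unit[OF stalk is_koszul_cplx[OF K']]]
  obtain r0 r1 i0 i1 where "cone_data R K K' x r0 r1 i0 i1" by blast
  from cone_data_tensor[OF this D] obtain r0 r1 i0 i1
    where c: "cone_data R (tensor_complex R K D) (tensor_complex R K' D) x r0 r1 i0 i1" by blast
  then have "isomorphic_complexes R (tensor_complex R K D) (tensor_complex R K D)"
    by (intro isomorphic_complexes_refl) (simp add: cone_data_def)
  from cone_data_transfer[OF c this Cons.IH[OF K' xs]]
  obtain r0 r1 i0 i1 where "cone_data R (tensor_complex R K D) (kos R xs D) x r0 r1 i0 i1" by blast
  then show ?case by (simp add: cone_data_isomorphic_cone)
qed

section \<open>The depth equalities\<close>

text \<open>A set of integers has the same infimum as any other with the same integral lower bounds.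
  The infinite values are included: every integer bounds the empty set, and none bounds a set that
  is unbounded below.\<close>

lemma Inf_ereal_int_eqI:
  assumes "\<And>t :: int. (\<forall>b\<in>B. t \<le> b) \<longleftrightarrow> (\<forall>c\<in>C. t \<le> c)"
  shows "Inf {ereal (real_of_int l) | l. l \<in> B} = Inf {ereal (real_of_int l) | l. l \<in> C}"
proof -
  have le: "Inf {ereal (real_of_int l) | l. l \<in> B} \<le> Inf {ereal (real_of_int l) | l. l \<in> C}"
    if eq: "\<And>t :: int. (\<forall>b\<in>B. t \<le> b) \<longleftrightarrow> (\<forall>c\<in>C. t \<le> c)" for B C
  proof (rule Inf_greatest, rule ccontr)
    fix y assume "y \<in> {ereal (real_of_int l) | l. l \<in> C}"
    then obtain c where c: "y = ereal (real_of_int c)" "c \<in> C" by blast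
    assume "\<not> Inf {ereal (real_of_int l) | l. l \<in> B} \<le> y"
    then have lt: "ereal (real_of_int c) < Inf {ereal (real_of_int l) | l. l \<in> B}" by (simp add: c)
    \<comment> \<open>If the infimum over \<open>B\<close> exceeded \<open>c\<close>, integrality
      would make \<open>c + 1\<close> a lower bound of \<open>B\<close> and therefore of
      \<open>C\<close>, which contains \<open>c\<close>.\<close>
    have "c + 1 \<le> b" if "b \<in> B" for b
    proof -
      have "Inf {ereal (real_of_int l) | l. l \<in> B} \<le> ereal (real_of_int b)" using that by (intro
          Inf_lower) blast
      then have "ereal (real_of_int c) < ereal (real_of_int b)" using lt by (rule less_le_trans[rotated])
      then show ?thesis by simp
    qed
    then have "c + 1 \<le> c" using eq[of "c + 1"] c(2) by blast
    then show False by simp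
  qed
  show ?thesis using le[of B C] le[of C B] assms by (intro antisym) auto
qed

lemma ereal_minus_Sup_int:
  "ereal (real n) - Sup {ereal (real_of_int l) | l. l \<in> A} =
    Inf {ereal (real_of_int l) | l. l \<in> (\<lambda>a. int n - a) ` A}"
proof (cases "A = {}")
  case True
  \<comment> \<open>Here the conventions for empty sets meet: subtracting
    \<open>-\<infinity>\<close> gives \<open>\<infinity>\<close>, which is also the infimum of the
    empty set.\<close>
  then show ?thesis by (simp add: bot_ereal_def top_ereal_def)
next
  case False
  have "Inf {ereal (real_of_int l) | l. l \<in> (\<lambda>a. int n - a) ` A} = (INF a\<in>A. ereal (real n) -
      ereal (real_of_int a))"
  proof -
    have "{ereal (real_of_int l) | l. l \<in> (\<lambda>a. int n - a) ` A} = (\<lambda>l. ereal (real_of_int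
        l)) ` (\<lambda>a. int n - a) ` A"
      by blast
    then show ?thesis by (simp add: image_image)
  qed
  also have "\<dots> = ereal (real n) - (SUP a\<in>A. ereal (real_of_int a))"
    using False by (intro INF_ereal_minus_right) auto
  also have "(SUP a\<in>A. ereal (real_of_int a)) = Sup {ereal (real_of_int l) | l. l \<in> A}"
    by (rule arg_cong[where f = Sup]) auto
  finally show ?thesis by simp
qed

theorem theoremI:
  fixes R :: "'r ring" and \<aa> :: "'r set" and xs :: "'r list"
    and K :: "('r, 'k) chain_complex" and M :: "('r, 'm) chain_complex"
    and I :: "('r, 'i) chain_complex" and J :: "('r, 'j) chain_complex"
  assumes "cring R" and "noetherian_ring R"
    and "ideal \<aa> R" and "set xs \<subseteq> carrier R" and "\<aa> = Idl\<^bsub>R\<^esub> (set xs)"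
    and "is_koszul R xs K"
    and "is_complex R M"
    and "K_injective_resolution R M I"
    and "K_injective_resolution R M J" and "\<forall>l. injective_module R (obj J l)"
  shows "ereal (real (length xs))
           - Sup {ereal (real_of_int l) | l. nonzero_module (homology (tensor_complex R K M) l)}
         = Inf {ereal (real_of_int l) | l.
                 nonzero_module (Ext_module R l (quot_module (regular_module R) \<aa>) I)}
       \<and> Inf {ereal (real_of_int l) | l.
                 nonzero_module (Ext_module R l (quot_module (regular_module R) \<aa>) I)}
         = Inf {ereal (real_of_int l) | l. nonzero_module (local_cohomology R \<aa> l J)}"
proof -
  let ?n = "length xs"
  define A where "A = {l. nonzero_module (homology (tensor_complex R K M) l)}"
  define B where "B = {l. nonzero_module (Ext_module R l (quot_module (regular_module R) \<aa>) I)}"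
  define C where "C = {l. nonzero_module (local_cohomology R \<aa> l J)}"
  have M: "cplx R M" using assms(7) by (simp add: cplx_def)
  have I: "K_injective R I" and J: "K_injective R J"
    using assms(8,9) by (simp_all add: K_injective_resolution_def)
  then have cJ: "cplx R J" by (simp add: K_injective_def cplx_def)
  obtain f g where f: "quasi_isomorphism R M I f" and g: "quasi_isomorphism R M J g"
    using assms(8,9) by (auto simp: K_injective_resolution_def)
  have MI: "exact_at (kos R xs I) l \<longleftrightarrow> exact_at (kos R xs M) l"
    and MJ: "exact_at (kos R xs J) l \<longleftrightarrow> exact_at (kos R xs M) l" for l
    using qis_kos[OF quasi_isomorphism_qis[OF f] assms(4)] qis_kos[OF quasi_isomorphism_qis[OF g] assms(4)]
      qis_exact_at_iff by blast+
  have A: "l \<in> A \<longleftrightarrow> \<not> exact_at (kos R xs M) l" for l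
  proof -
    have "tensor_cplx R K M" by (intro tensor_cplx.intro is_koszul_cplx[OF assms(6)] M)
    from cplx.nonzero_homology_iff[OF tensor_cplx.tensor_complex_cplx[OF this]] show ?thesis
      using isomorphic_complexes_exact_at[OF tensor_koszul_isomorphic[OF assms(6) M assms(4)]] by (simp add: A_def)
  qed
  have AB: "(\<forall>l>t. - l \<notin> B) \<longleftrightarrow> (\<forall>l>t + int ?n. l \<notin> A)" for t
    using Ext_vanishing_iff[OF assms(1) I assms(4), of t] by (simp add: B_def A MI assms(5))
  have AC: "(\<forall>l>t. - l \<notin> C) \<longleftrightarrow> (\<forall>l>t + int ?n. l \<notin> A)" for t
    using local_cohomology_vanishing_iff[OF assms(1,2) cJ assms(10,4), of t] by (simp add: C_def A MJ assms(5))
  \<comment> \<open>With the bound \<open>- t\<close> in homological degrees the vanishing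
    statements say that \<open>t\<close> is a lower bound of the cohomological degrees. In
    \<open>upper\<close> the shift by the number of generators becomes the passage from
    \<open>a\<close> to \<open>n - a\<close>.\<close>
  have lower: "(\<forall>l>- t. - l \<notin> S) \<longleftrightarrow> (\<forall>b\<in>S. t \<le> b)" for S ::
      "int set" and t
    by (metis linorder_not_less minus_less_iff add.inverse_inverse)
  have upper: "(\<forall>l>- t + int ?n. l \<notin> A) \<longleftrightarrow> (\<forall>b\<in>(\<lambda>a. int
      ?n - a) ` A. t \<le> b)" for t
    by (force simp: not_less[symmetric])
  have eqB: "(\<forall>b\<in>(\<lambda>a. int ?n - a) ` A. t \<le> b) \<longleftrightarrow> (\<forall>b\<in>B.
      t \<le> b)" for t
    using AB[of "- t"] unfolding lower upper by simp
  have eqC: "(\<forall>b\<in>B. t \<le> b) \<longleftrightarrow> (\<forall>c\<in>C. t \<le> c)" for t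
    using AB[of "- t"] AC[of "- t"] unfolding lower by simp
  show ?thesis
    using ereal_minus_Sup_int[of ?n A] Inf_ereal_int_eqI[OF eqB] Inf_ereal_int_eqI[OF eqC]
    by (simp add: A_def B_def C_def)
qed

end
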